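(* If $G$ is a residually finite, solvable, minimax group, then $G$ is in the class $\mathcal{G}$.
   Context: A group is minimax if it has a finite series $1=G_0\unlhd G_1\unlhd\cdots\unlhd G_k=G$ each of whose factors $G_{i+1}/G_i$ satisfies either the maximal condition or the minimal condition on subgroups. For an abstract group $H$, $\hat{H}$ denotes its profinite completion and $c_H:H\to\hat{H}$ the canonical completion map. The cohomology of an abstract group is ordinary group cohomology; the cohomology of a profinite group is continuous cohomology. A discrete $\hat{H}$-module is regarded as an $H$-module via $c_H$. The class $\mathcal{G}$ consists of all groups $H$ such that, for each $n\geq 0$ and each finite, discrete $\hat{H}$-module $A$: (i) the group $H^n(H,A)$ is finite; and (ii) the map $c_H:H\to\hat{H}$ induces an isomorphism $H^n(\hat{H},A)\to H^n(H,A)$. *)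

theory Defs
  imports
    "HOL-Algebra.Bij"
    "HOL-Algebra.FiniteProduct"
    "HOL-Algebra.Product_Groups"
    "HOL-Algebra.Solvable_Groups"
    "HOL-Analysis.Function_Topology"
    "HOL-Analysis.Product_Topology"
begin

section \<open>Minimax groups and residual finiteness\<close>

definition max_condition :: "('a, 'b) monoid_scheme \<Rightarrow> bool" where
  "max_condition G \<longleftrightarrow>
     (\<forall>\<S>. \<S> \<subseteq> {H. subgroup H G} \<and> \<S> \<noteq> {} \<longrightarrow> (\<exists>M\<in>\<S>. \<forall>H\<in>\<S>. M \<subseteq> H \<longrightarrow> H = M))"

definition min_condition :: "('a, 'b) monoid_scheme \<Rightarrow> bool" where
  "min_condition G \<longleftrightarrow>
     (\<forall>\<S>. \<S> \<subseteq> {H. subgroup H G} \<and> \<S> \<noteq> {} \<longrightarrow> (\<exists>M\<in>\<S>. \<forall>H\<in>\<S>. H \<subseteq> M \<longrightarrow> H = M))"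

definition minimax :: "('a, 'b) monoid_scheme \<Rightarrow> bool" where
  "minimax G \<longleftrightarrow>
     (\<exists>(k::nat) S. S 0 = {\<one>\<^bsub>G\<^esub>} \<and> S k = carrier G \<and>
        (\<forall>i\<le>k. subgroup (S i) G) \<and>
        (\<forall>i<k. S i \<lhd> G\<lparr>carrier := S (Suc i)\<rparr> \<and>
           (max_condition (G\<lparr>carrier := S (Suc i)\<rparr> Mod S i) \<or>
            min_condition (G\<lparr>carrier := S (Suc i)\<rparr> Mod S i))))"

definition finite_index_normal :: "('a, 'b) monoid_scheme \<Rightarrow> 'a set set" where
  "finite_index_normal G = {N. N \<lhd> G \<and> finite (rcosets\<^bsub>G\<^esub> N)}"

definition residually_finite :: "('a, 'b) monoid_scheme \<Rightarrow> bool" where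
  "residually_finite G \<longleftrightarrow>
     (\<forall>g\<in>carrier G. g \<noteq> \<one>\<^bsub>G\<^esub> \<longrightarrow> (\<exists>N\<in>finite_index_normal G. g \<notin> N))"


section \<open>Profinite completion\<close>

text \<open>The inverse limit of the finite quotients of \<open>G\<close>, as a subgroup of their product.
  For \<open>N \<subseteq> M\<close> the projection from \<open>G/N\<close> to \<open>G/M\<close> is \<open>X \<mapsto> M X\<close>, which sends
  \<open>N g\<close> to \<open>M g\<close>.\<close>

definition profinite_completion :: "('a, 'b) monoid_scheme \<Rightarrow> ('a set \<Rightarrow> 'a set) monoid" where
  "profinite_completion G =
     (let P = product_group (finite_index_normal G) (\<lambda>N. G Mod N) in
      P\<lparr>carrier := {x \<in> carrier P.
          \<forall>N\<in>finite_index_normal G. \<forall>M\<in>finite_index_normal G.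
            N \<subseteq> M \<longrightarrow> x M = M <#>\<^bsub>G\<^esub> x N}\<rparr>)"

definition profinite_topology :: "('a, 'b) monoid_scheme \<Rightarrow> ('a set \<Rightarrow> 'a set) topology" where
  "profinite_topology G =
     subtopology
       (product_topology (\<lambda>N. discrete_topology (carrier (G Mod N))) (finite_index_normal G))
       (carrier (profinite_completion G))"

definition completion_map :: "('a, 'b) monoid_scheme \<Rightarrow> 'a \<Rightarrow> 'a set \<Rightarrow> 'a set" where
  "completion_map G g = (\<lambda>N\<in>finite_index_normal G. N #>\<^bsub>G\<^esub> g)"


section \<open>Modules\<close>

text \<open>A \<open>G\<close>-module is an abelian group \<open>A\<close>, written multiplicatively,
  with an action of \<open>G\<close> by automorphisms.\<close>

definition group_module ::
  "('g, 'b) monoid_scheme \<Rightarrow> 'm monoid \<Rightarrow> ('g \<Rightarrow> 'm \<Rightarrow> 'm) \<Rightarrow> bool" where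
  "group_module G A \<phi> \<longleftrightarrow> comm_group A \<and> \<phi> \<in> hom G (AutoGroup A)"

definition discrete_module ::
  "'g topology \<Rightarrow> ('g, 'b) monoid_scheme \<Rightarrow> 'm monoid \<Rightarrow> ('g \<Rightarrow> 'm \<Rightarrow> 'm) \<Rightarrow> bool" where
  "discrete_module T G A \<phi> \<longleftrightarrow> group_module G A \<phi> \<and>
     continuous_map (prod_topology T (discrete_topology (carrier A)))
       (discrete_topology (carrier A)) (\<lambda>(g, a). \<phi> g a)"


section \<open>Cohomology\<close>

text \<open>Cohomology is defined by inhomogeneous cochains, i.e. functions from \<open>G\<^sup>n\<close> to \<open>A\<close>.
  An element of \<open>G\<^sup>n\<close> is an extensional function on \<open>{..<n}\<close>.\<close>

definition tuples :: "('g, 'b) monoid_scheme \<Rightarrow> nat \<Rightarrow> (nat \<Rightarrow> 'g) set" where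
  "tuples G n = (\<Pi>\<^sub>E i\<in>{..<n}. carrier G)"

definition cochain_group ::
  "('g, 'b) monoid_scheme \<Rightarrow> 'm monoid \<Rightarrow> nat \<Rightarrow> ((nat \<Rightarrow> 'g) \<Rightarrow> 'm) monoid" where
  "cochain_group G A n = product_group (tuples G n) (\<lambda>_. A)"

definition merge_entries ::
  "('g, 'b) monoid_scheme \<Rightarrow> nat \<Rightarrow> nat \<Rightarrow> (nat \<Rightarrow> 'g) \<Rightarrow> nat \<Rightarrow> 'g" where
  "merge_entries G n i x =
     (\<lambda>j\<in>{..<n}. if j < i then x j
                 else if j = i then x i \<otimes>\<^bsub>G\<^esub> x (Suc i)
                 else x (Suc j))"

text \<open>In additive notation,
  \<open>(\<delta> f)(x\<^sub>0, \<dots>, x\<^sub>n) = x\<^sub>0 f(x\<^sub>1, \<dots>, x\<^sub>n)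
     + (\<Sum>i<n. (-1)\<^sup>i\<^sup>+\<^sup>1 f(x\<^sub>0, \<dots>, x\<^sub>i x\<^sub>i\<^sub>+\<^sub>1, \<dots>, x\<^sub>n))
     + (-1)\<^sup>n\<^sup>+\<^sup>1 f(x\<^sub>0, \<dots>, x\<^sub>n\<^sub>-\<^sub>1)\<close>.\<close>

definition coboundary ::
  "('g, 'b) monoid_scheme \<Rightarrow> 'm monoid \<Rightarrow> ('g \<Rightarrow> 'm \<Rightarrow> 'm) \<Rightarrow> nat
     \<Rightarrow> ((nat \<Rightarrow> 'g) \<Rightarrow> 'm) \<Rightarrow> (nat \<Rightarrow> 'g) \<Rightarrow> 'm" where
  "coboundary G A \<phi> n f =
     (\<lambda>x\<in>tuples G (Suc n).
        \<phi> (x 0) (f (\<lambda>j\<in>{..<n}. x (Suc j)))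
        \<otimes>\<^bsub>A\<^esub> (\<Otimes>\<^bsub>A\<^esub>i\<in>{..<n}. f (merge_entries G n i x) [^]\<^bsub>A\<^esub> ((-1) ^ (i + 1) :: int))
        \<otimes>\<^bsub>A\<^esub> f (restrict x {..<n}) [^]\<^bsub>A\<^esub> ((-1) ^ (n + 1) :: int))"

text \<open>The argument \<open>K\<close> selects a subcomplex of the complex of all cochains; it is instantiated
  below with all cochains and with the continuous ones.\<close>

definition cocycles ::
  "('g, 'b) monoid_scheme \<Rightarrow> 'm monoid \<Rightarrow> ('g \<Rightarrow> 'm \<Rightarrow> 'm)
     \<Rightarrow> (nat \<Rightarrow> ((nat \<Rightarrow> 'g) \<Rightarrow> 'm) set) \<Rightarrow> nat \<Rightarrow> ((nat \<Rightarrow> 'g) \<Rightarrow> 'm) set" where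
  "cocycles G A \<phi> K n =
     {f \<in> K n. coboundary G A \<phi> n f = \<one>\<^bsub>cochain_group G A (Suc n)\<^esub>}"

definition coboundaries ::
  "('g, 'b) monoid_scheme \<Rightarrow> 'm monoid \<Rightarrow> ('g \<Rightarrow> 'm \<Rightarrow> 'm)
     \<Rightarrow> (nat \<Rightarrow> ((nat \<Rightarrow> 'g) \<Rightarrow> 'm) set) \<Rightarrow> nat \<Rightarrow> ((nat \<Rightarrow> 'g) \<Rightarrow> 'm) set" where
  "coboundaries G A \<phi> K n =
     (case n of 0 \<Rightarrow> {\<one>\<^bsub>cochain_group G A 0\<^esub>} | Suc m \<Rightarrow> coboundary G A \<phi> m ` K m)"

definition cohomology_of ::
  "('g, 'b) monoid_scheme \<Rightarrow> 'm monoid \<Rightarrow> ('g \<Rightarrow> 'm \<Rightarrow> 'm)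
     \<Rightarrow> (nat \<Rightarrow> ((nat \<Rightarrow> 'g) \<Rightarrow> 'm) set) \<Rightarrow> nat \<Rightarrow> ((nat \<Rightarrow> 'g) \<Rightarrow> 'm) set monoid" where
  "cohomology_of G A \<phi> K n =
     (cochain_group G A n)\<lparr>carrier := cocycles G A \<phi> K n\<rparr> Mod coboundaries G A \<phi> K n"

definition cochains ::
  "('g, 'b) monoid_scheme \<Rightarrow> 'm monoid \<Rightarrow> nat \<Rightarrow> ((nat \<Rightarrow> 'g) \<Rightarrow> 'm) set" where
  "cochains G A n = carrier (cochain_group G A n)"

definition continuous_cochains ::
  "'g topology \<Rightarrow> ('g, 'b) monoid_scheme \<Rightarrow> 'm monoid \<Rightarrow> nat \<Rightarrow> ((nat \<Rightarrow> 'g) \<Rightarrow> 'm) set" where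
  "continuous_cochains T G A n =
     {f \<in> cochains G A n.
        continuous_map (product_topology (\<lambda>_. T) {..<n}) (discrete_topology (carrier A)) f}"

definition group_cohomology ::
  "('g, 'b) monoid_scheme \<Rightarrow> 'm monoid \<Rightarrow> ('g \<Rightarrow> 'm \<Rightarrow> 'm) \<Rightarrow> nat
     \<Rightarrow> ((nat \<Rightarrow> 'g) \<Rightarrow> 'm) set monoid" where
  "group_cohomology G A \<phi> n = cohomology_of G A \<phi> (cochains G A) n"

definition continuous_cohomology ::
  "'g topology \<Rightarrow> ('g, 'b) monoid_scheme \<Rightarrow> 'm monoid \<Rightarrow> ('g \<Rightarrow> 'm \<Rightarrow> 'm) \<Rightarrow> nat
     \<Rightarrow> ((nat \<Rightarrow> 'g) \<Rightarrow> 'm) set monoid" where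
  "continuous_cohomology T G A \<phi> n = cohomology_of G A \<phi> (continuous_cochains T G A) n"

definition cochain_pullback ::
  "('h, 'b) monoid_scheme \<Rightarrow> ('h \<Rightarrow> 'g) \<Rightarrow> nat \<Rightarrow> ((nat \<Rightarrow> 'g) \<Rightarrow> 'm) \<Rightarrow> (nat \<Rightarrow> 'h) \<Rightarrow> 'm" where
  "cochain_pullback H c n f = (\<lambda>x\<in>tuples H n. f (\<lambda>j\<in>{..<n}. c (x j)))"

text \<open>The map from cohomology classes of a group \<open>G\<close> to those of \<open>H\<close> induced by \<open>c : H \<rightarrow> G\<close>,
  where \<open>H\<close> acts on \<open>A\<close> through \<open>c\<close>: the class of \<open>f\<close> is sent to the class of the
  pullback of \<open>f\<close>.  The latter does not depend on the choice of \<open>f\<close> in its class,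
  so \<open>the_elem\<close> is applied to a singleton.\<close>

definition cohomology_pullback ::
  "('h, 'b) monoid_scheme \<Rightarrow> 'm monoid \<Rightarrow> ('g \<Rightarrow> 'm \<Rightarrow> 'm) \<Rightarrow> ('h \<Rightarrow> 'g) \<Rightarrow> nat
     \<Rightarrow> ((nat \<Rightarrow> 'g) \<Rightarrow> 'm) set \<Rightarrow> ((nat \<Rightarrow> 'h) \<Rightarrow> 'm) set" where
  "cohomology_pullback H A \<phi> c n X =
     the_elem
       ((\<lambda>f. coboundaries H A (\<phi> \<circ> c) (cochains H A) n
               #>\<^bsub>cochain_group H A n\<^esub> cochain_pullback H c n f) ` X)"


section \<open>The class \<open>\<G>\<close>\<close>

text \<open>The type argument is the type over which the carriers of the modules range.\<close>

definition class_G :: "'m itself \<Rightarrow> ('a, 'b) monoid_scheme \<Rightarrow> bool" where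
  "class_G (_ :: 'm itself) H \<longleftrightarrow> group H \<and>
     (\<forall>(n::nat) (A :: 'm monoid) \<phi>.
        finite (carrier A) \<and>
        discrete_module (profinite_topology H) (profinite_completion H) A \<phi> \<longrightarrow>
          finite (carrier (group_cohomology H A (\<phi> \<circ> completion_map H) n)) \<and>
          cohomology_pullback H A \<phi> (completion_map H) n
            \<in> iso (continuous_cohomology (profinite_topology H) (profinite_completion H) A \<phi> n)
                  (group_cohomology H A (\<phi> \<circ> completion_map H) n))"

end

theory Submission
  imports Defs "HOL-Library.Function_Algebras" "HOL-Algebra.Multiplicative_Group"
begin

text \<open>A residually finite soluble minimax group has a subgroup \<open>H\<close> of finite index with a chain
  \<open>{1} = H\<^sub>0 \<subseteq> \<dots> \<subseteq> H\<^sub>k = H\<close> whose factors are abelian, torsion-free and of rank at most one: intersect \<open>H\<close>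
  with the closures of the derived subgroups in the profinite topology, and observe that the torsion of a
  residually finite abelian minimax group is finite.

  Along such a chain, the positive degree cohomology of every subgroup with finite coefficients is finite and
  vanishes on a subgroup of finite index.  For one step \<open>M \<subseteq> X\<close>, write \<open>X\<close> as a directed union of groups
  \<open>\<langle>M, t\<rangle>\<close>, use the Wang sequence of the extension of \<open>M\<close> by \<open>\<langle>t\<rangle>\<close>, and pass to the union by compactness
  of the space of cochains with finite values.

  Hence every finite index normal subgroup \<open>V\<close> contains a \<open>V'\<close> on which all classes of \<open>V\<close> of a given degree vanish.
  A double complex argument, a hands-on form of the Hochschild-Serre spectral sequence, turns this into an
  approximation statement: a cochain whose coboundary depends only on cosets of \<open>V\<close> differs by a coboundary
  from one which depends only on cosets of some \<open>V'\<close> determined by \<open>V\<close>.  By compactness the continuous cochains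
  of the completion are exactly the cochains of this kind, so the approximation gives injectivity and
  surjectivity of the comparison map.  It also gives finiteness, as there are only finitely many cochains for
  a fixed \<open>V'\<close>.\<close>

section \<open>Chains of rank one sections\<close>

text \<open>A section of the chain can be a group like Z[1/2], so one step is only a directed union
  of infinite cyclic extensions. Cohomology does not commute with such unions in general; a derived
  limit is the obstruction. Finite coefficients remove it, and a bound on the number of classes that
  is the same for all \<open>t\<close> survives the union. Rank one puts finitely many elements into
  a single \<langle>M, t\<rangle>; torsion-freeness keeps the nonzero powers of a \<open>t\<close>
  outside \<open>M\<close> out of \<open>M\<close>, as the Wang sequence demands.

  Vanishing on a finite index subgroup of \<open>M\<close> is of use only if one of finite index in
  \<open>X\<close> cuts out something smaller. That rests on finite rank: a subgroup of
  \<open>M\<close> containing all j-th powers of \<open>M\<close> has finite index. In degrees above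
  one two cuts are made, for the class itself and for the class one degree lower that measures the
  failure of \<open>t\<close>-equivariance, and the second concerns a subgroup of \<open>M\<close>.
  Hence the induction treats all subgroups at once.

  Columns of the double complex become exact only after shrinking \<open>V\<close>, so no quotient
  complex is formed; all is phrased as dependence on cosets.\<close>

lemma finite_maximal_separated:
  assumes bound: "\<And>F. finite F \<Longrightarrow> F \<subseteq> X \<Longrightarrow> (\<And>x y. x \<in> F \<Longrightarrow> y \<in> F \<Longrightarrow> x \<noteq> y \<Longrightarrow> \<not> R x y) \<Longrightarrow> card F \<le> (b::nat)"
    and refl: "\<And>x. x \<in> X \<Longrightarrow> R x x" and sym: "\<And>x y. x \<in> X \<Longrightarrow> y \<in> X \<Longrightarrow> R x y \<Longrightarrow> R y x"
  obtains F where "finite F" "F \<subseteq> X" "card F \<le> b" "\<And>x. x \<in> X \<Longrightarrow> \<exists>y\<in>F. R x y"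
proof -
  define sep where "sep F \<longleftrightarrow> finite F \<and> F \<subseteq> X \<and> (\<forall>x\<in>F. \<forall>y\<in>F. x \<noteq> y \<longrightarrow> \<not> R x y)" for F
  define P where "P k \<longleftrightarrow> (\<exists>F. sep F \<and> card F = k)" for k
  have le: "k \<le> b" if "P k" for k
    using that bound by (auto simp: P_def sep_def)
  have "P 0" unfolding P_def by (intro exI[of _ "{}"]) (auto simp: sep_def)
  then have "P (Greatest P)" using le by (rule GreatestI_nat)
  from this obtain F where F: "sep F" "card F = Greatest P" by (auto simp: P_def)
  have "\<exists>y\<in>F. R x y" if x: "x \<in> X" for x
  proof (rule ccontr)
    assume neg: "\<not> (\<exists>y\<in>F. R x y)"
    then have "x \<notin> F" using refl x by blast
    have "sep (insert x F)" using F(1) neg x sym unfolding sep_def by blast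
    moreover have "card (insert x F) = Suc (Greatest P)" using F \<open>x \<notin> F\<close> by (simp add: sep_def)
    ultimately have "P (Suc (Greatest P))" unfolding P_def by blast
    then have "Suc (Greatest P) \<le> Greatest P" using le by (rule Greatest_le_nat)
    then show False by simp
  qed
  moreover have "card F \<le> b" using le[OF \<open>P (Greatest P)\<close>] F(2) by simp
  ultimately show thesis using that[of F] F(1) by (auto simp: sep_def)
qed

context group
begin

lemma inv_cancel [simp]:
  assumes "x \<in> carrier G" "y \<in> carrier G"
  shows "inv x \<otimes> (x \<otimes> y) = y" "x \<otimes> (inv x \<otimes> y) = y"
  using assms by (simp_all flip: m_assoc)

lemma subgroup_nat_pow_closed: "subgroup H G \<Longrightarrow> x \<in> H \<Longrightarrow> x [^] (n::nat) \<in> H"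
  using subgroup_int_pow_closed[of H x "int n"] by (simp add: int_pow_int)

lemma int_pow_commute:
  assumes "x \<in> carrier G" "y \<in> carrier G" "x \<otimes> y = y \<otimes> x"
  shows "x [^] (k::int) \<otimes> y = y \<otimes> x [^] k"
proof -
  have "subgroup {z \<in> carrier G. z \<otimes> y = y \<otimes> z} G"
  proof (rule subgroupI)
    fix a assume "a \<in> {z \<in> carrier G. z \<otimes> y = y \<otimes> z}"
    then have a: "a \<in> carrier G" "a \<otimes> y = y \<otimes> a" by auto
    have "inv a \<otimes> (a \<otimes> y) \<otimes> inv a = inv a \<otimes> (y \<otimes> a) \<otimes> inv a" using a(2) by simp
    then have "y \<otimes> inv a = inv a \<otimes> y" using a(1) assms by (simp add: m_assoc)
    then show "inv a \<in> {z \<in> carrier G. z \<otimes> y = y \<otimes> z}" using a by simp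
  next
    fix a b assume "a \<in> {z \<in> carrier G. z \<otimes> y = y \<otimes> z}" "b \<in> {z \<in> carrier G. z \<otimes> y = y \<otimes> z}"
    then show "a \<otimes> b \<in> {z \<in> carrier G. z \<otimes> y = y \<otimes> z}"
      using assms by simp (metis m_assoc)
  qed (use assms in auto)
  from subgroup_int_pow_closed[OF this, of x k] assms show ?thesis by simp
qed

text \<open>For subgroups this says that the intersection of \<open>P\<close> and \<open>X\<close>
  has finite index in \<open>X\<close>, the left cosets \<open>rP\<close> covering \<open>X\<close>.
  Inclusion of \<open>P\<close> in \<open>X\<close> is not part of it, so that one \<open>P\<close>
  can be tested against every term of a chain.\<close>

definition fin_index :: "'a set \<Rightarrow> 'a set \<Rightarrow> bool" where
  "fin_index P X \<longleftrightarrow> (\<exists>R. finite R \<and> R \<subseteq> X \<and> (\<forall>x\<in>X. \<exists>r\<in>R. inv r \<otimes> x \<in> P))"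

definition commutators_in :: "'a set \<Rightarrow> 'a set \<Rightarrow> bool" where
  "commutators_in X P \<longleftrightarrow> (\<forall>x\<in>X. \<forall>y\<in>X. x \<otimes> y \<otimes> inv x \<otimes> inv y \<in> P)"

text \<open>Conjugating \<open>p\<close> by \<open>x\<close> multiplies it by the commutator of
  \<open>x\<close> and \<open>p\<close>; so normality in \<open>X\<close> is a consequence of
  containing the commutators.\<close>

lemma commutators_conj:
  assumes "commutators_in X P" "subgroup P G" "P \<subseteq> X" "X \<subseteq> carrier G" "x \<in> X" "p \<in> P"
  shows "x \<otimes> p \<otimes> inv x \<in> P"
proof -
  have "(x \<otimes> p \<otimes> inv x \<otimes> inv p) \<otimes> p \<in> P"
    by (rule subgroup.m_closed[OF assms(2)]) (use assms in \<open>auto simp: commutators_in_def\<close>)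
  then show ?thesis using assms by (auto simp: m_assoc subset_iff)
qed

text \<open>Hides the factor group of the record with changed carrier behind a group
  \<open>Q\<close> and a map on \<open>X\<close>. Later arguments modulo \<open>P\<close> compute
  with these equations alone.\<close>

lemma subgroup_quotient:
  assumes X: "subgroup X G" and P: "subgroup P G" "P \<subseteq> X"
    and conj: "\<And>x p. x \<in> X \<Longrightarrow> p \<in> P \<Longrightarrow> x \<otimes> p \<otimes> inv x \<in> P"
  obtains Q :: "'a set monoid" and \<pi> where "group Q" "\<pi> ` X = carrier Q"
    "\<And>x y. x \<in> X \<Longrightarrow> y \<in> X \<Longrightarrow> \<pi> (x \<otimes> y) = \<pi> x \<otimes>\<^bsub>Q\<^esub> \<pi> y"
    "\<And>x. x \<in> X \<Longrightarrow> \<pi> (inv x) = inv\<^bsub>Q\<^esub> \<pi> x"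
    "\<And>x k. x \<in> X \<Longrightarrow> \<pi> (x [^] (k::int)) = \<pi> x [^]\<^bsub>Q\<^esub> k"
    "\<And>x. x \<in> X \<Longrightarrow> \<pi> x = \<one>\<^bsub>Q\<^esub> \<longleftrightarrow> x \<in> P"
    "commutators_in X P \<Longrightarrow> comm_group Q"
proof -
  let ?X = "G\<lparr>carrier := X\<rparr>"
  define Q where "Q = ?X Mod P"
  define \<pi> where "\<pi> x = P #>\<^bsub>?X\<^esub> x" for x
  interpret X: group ?X by (rule subgroup.subgroup_is_group[OF X group_axioms])
  have PX: "subgroup P ?X" using P X by (simp add: subgroup_incl)
  have N: "P \<lhd> ?X"
    unfolding X.normal_inv_iff using conj PX by (auto simp: m_inv_consistent[OF X])
  interpret N: normal P ?X by (rule N)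
  interpret Q: group Q unfolding Q_def by (rule N.factorgroup_is_group)
  have "\<pi> \<in> hom ?X Q" unfolding Q_def \<pi>_def[abs_def] by (rule N.r_coset_hom_Mod)
  then interpret h: group_hom ?X Q \<pi>
    by (simp add: group_hom_def group_hom_axioms_def X.group_axioms Q.group_axioms)
  have one: "\<pi> x = \<one>\<^bsub>Q\<^esub> \<longleftrightarrow> x \<in> P" if "x \<in> X" for x
    using that X.coset_join1[OF _ _ PX] X.coset_join2[OF _ PX] unfolding Q_def \<pi>_def by auto
  have surj: "\<pi> ` X = carrier Q" by (auto simp: Q_def \<pi>_def carrier_FactGroup)
  have hm: "\<pi> (x \<otimes> y) = \<pi> x \<otimes>\<^bsub>Q\<^esub> \<pi> y" if "x \<in> X" "y \<in> X" for x y
    using h.hom_mult[of x y] that by simp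
  have hi: "\<pi> (inv x) = inv\<^bsub>Q\<^esub> \<pi> x" if "x \<in> X" for x
    using h.hom_inv[of x] that by (simp add: m_inv_consistent[OF X])
  show thesis
  proof
    show "group Q" by (rule Q.group_axioms)
    show "\<pi> ` X = carrier Q" by (rule surj)
    show "\<pi> (x \<otimes> y) = \<pi> x \<otimes>\<^bsub>Q\<^esub> \<pi> y" if "x \<in> X" "y \<in> X" for x y
      using that by (rule hm)
    show "\<pi> (inv x) = inv\<^bsub>Q\<^esub> \<pi> x" if "x \<in> X" for x
      using that by (rule hi)
    show "\<pi> (x [^] (k::int)) = \<pi> x [^]\<^bsub>Q\<^esub> k" if "x \<in> X" for x k
      using h.hom_int_pow[of x k] that int_pow_consistent[OF X that] by simp
    show "\<pi> x = \<one>\<^bsub>Q\<^esub> \<longleftrightarrow> x \<in> P" if "x \<in> X" for x by (rule one[OF that])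
    assume c: "commutators_in X P"
    show "comm_group Q"
    proof (rule Q.group_comm_groupI)
      fix u v assume "u \<in> carrier Q" "v \<in> carrier Q"
      then have "u \<in> \<pi> ` X" "v \<in> \<pi> ` X" unfolding surj .
      then obtain x y where xy: "x \<in> X" "y \<in> X" "u = \<pi> x" "v = \<pi> y" by blast
      have inP: "x \<otimes> y \<otimes> inv x \<otimes> inv y \<in> P"
        using c xy(1,2) unfolding commutators_in_def by blast
      then have "\<pi> (x \<otimes> y \<otimes> inv x \<otimes> inv y) = \<one>\<^bsub>Q\<^esub>"
        using one P(2) by blast
      moreover have "\<pi> (x \<otimes> y \<otimes> inv x \<otimes> inv y) = u \<otimes>\<^bsub>Q\<^esub> v \<otimes>\<^bsub>Q\<^esub> inv\<^bsub>Q\<^esub> u \<otimes>\<^bsub>Q\<^esub> inv\<^bsub>Q\<^esub> v"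
        using xy by (simp add: hm hi subgroup.m_closed[OF X] subgroup.m_inv_closed[OF X])
      ultimately have "u \<otimes>\<^bsub>Q\<^esub> v \<otimes>\<^bsub>Q\<^esub> inv\<^bsub>Q\<^esub> u \<otimes>\<^bsub>Q\<^esub> inv\<^bsub>Q\<^esub> v \<otimes>\<^bsub>Q\<^esub> v \<otimes>\<^bsub>Q\<^esub> u = v \<otimes>\<^bsub>Q\<^esub> u"
        using \<open>u \<in> carrier Q\<close> \<open>v \<in> carrier Q\<close> by simp
      then show "u \<otimes>\<^bsub>Q\<^esub> v = v \<otimes>\<^bsub>Q\<^esub> u"
        using \<open>u \<in> carrier Q\<close> \<open>v \<in> carrier Q\<close> by (simp add: Q.m_assoc)
    qed
  qed
qed

text \<open>\<open>X / M\<close> is abelian, torsion-free and of rank at most one.\<close>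

definition rank1 :: "'a set \<Rightarrow> 'a set \<Rightarrow> bool" where
  "rank1 X M \<longleftrightarrow> subgroup X G \<and> subgroup M G \<and> M \<subseteq> X \<and> commutators_in X M \<and>
     (\<forall>x\<in>X. \<forall>k>0. x [^] (k::nat) \<in> M \<longrightarrow> x \<in> M) \<and>
     (\<forall>x\<in>X. \<forall>y\<in>X. \<exists>(a::int) (b::int). (a \<noteq> 0 \<or> b \<noteq> 0) \<and> x [^] a \<otimes> y [^] b \<in> M)"

lemma rank1_Int:
  assumes "rank1 X M" "subgroup H G"
  shows "rank1 (X \<inter> H) (M \<inter> H)"
proof -
  interpret H: subgroup H G by (rule assms)
  have "subgroup (X \<inter> H) G" "subgroup (M \<inter> H) G"
    using assms by (auto simp: rank1_def intro: subgroups_Inter_pair)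
  moreover have "commutators_in (X \<inter> H) (M \<inter> H)"
    using assms(1) by (auto simp: rank1_def commutators_in_def)
  moreover have "x [^] a \<otimes> y [^] b \<in> H" if "x \<in> H" "y \<in> H" for x y and a b :: int
    using that subgroup_int_pow_closed[OF assms(2)] by simp
  ultimately show ?thesis
    using assms(1) unfolding rank1_def by simp (meson Int_iff subset_iff)
qed

lemma rank1_int_pow:
  assumes "rank1 X M" "x \<in> X" "k \<noteq> 0" "x [^] (k::int) \<in> M"
  shows "x \<in> M"
proof -
  have xc: "x \<in> carrier G" "subgroup M G" using assms by (auto simp: rank1_def subgroup_def)
  have "x [^] nat \<bar>k\<bar> \<in> M"
  proof (cases "k > 0")
    case True
    then show ?thesis using assms(4) int_pow_int[of G x "nat k"] by simp
  next
    case False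
    then have "x [^] nat \<bar>k\<bar> = x [^] (- k)" using int_pow_int[of G x "nat (- k)"] by simp
    also have "\<dots> = inv (x [^] k)" using xc by (simp add: int_pow_neg)
    finally show ?thesis using assms(4) xc(2) by (simp add: subgroup.m_inv_closed)
  qed
  moreover have "nat \<bar>k\<bar> > 0" using assms(3) by simp
  ultimately show ?thesis using assms(1,2) unfolding rank1_def by blast
qed

end

lemma (in comm_group) torsion_free_rank_one_cyclic:
  assumes xy: "x \<in> carrier G" "y \<in> carrier G"
    and tf: "\<And>z k. z \<in> carrier G \<Longrightarrow> (k::int) \<noteq> 0 \<Longrightarrow> z [^] k = \<one> \<Longrightarrow> z = \<one>"
    and dep: "a \<noteq> 0 \<or> b \<noteq> 0" "x [^] (a::int) \<otimes> y [^] (b::int) = \<one>"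
  obtains z i j where "z \<in> carrier G" "z = x [^] (i::int) \<otimes> y [^] (j::int)"
    "\<exists>k::int. x = z [^] k" "\<exists>k::int. y = z [^] k"
proof -
  define g where "g = gcd a b"
  have g0: "g \<noteq> 0" using dep(1) by (simp add: g_def)
  define a' b' where "a' = a div g" and "b' = b div g"
  have ab: "a = a' * g" "b = b' * g" by (simp_all add: a'_def b'_def g_def)
  have "coprime a' b'" unfolding a'_def b'_def g_def using dep(1) by (intro div_gcd_coprime) auto
  then obtain u v where uv: "u * a' + v * b' = 1"
    using bezout_int[of a' b'] by (auto simp: coprime_iff_gcd_eq_1)
  \<comment> \<open>Torsion-freeness removes the common factor \<open>g\<close> from the relation,
    so its exponents become coprime.\<close>
  have "(x [^] a' \<otimes> y [^] b') [^] g = \<one>"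
    using dep(2) xy by (simp add: int_pow_distrib int_pow_pow ab)
  then have rel: "x [^] a' \<otimes> y [^] b' = \<one>" using tf[OF _ g0] xy by simp
  \<comment> \<open>The Bezout coefficients give the generator: multiplying its power
    \<open>b'\<close> by the \<open>u\<close>-th power of the relation gives \<open>x\<close>, and
    multiplying its power \<open>- a'\<close> by the \<open>v\<close>-th power of the relation gives
    \<open>y\<close>.\<close>
  define z where "z = x [^] v \<otimes> y [^] (- u)"
  have zc: "z \<in> carrier G" using xy by (simp add: z_def)
  have "z [^] b' = x [^] (v * b') \<otimes> y [^] (- u * b')"
    using xy by (simp add: z_def int_pow_distrib int_pow_pow)
  also have "\<dots> = x [^] (v * b') \<otimes> y [^] (- u * b') \<otimes> (x [^] a' \<otimes> y [^] b') [^] u"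
    using rel xy by simp
  also have "\<dots> = x [^] (v * b') \<otimes> y [^] (- u * b') \<otimes> (x [^] (a' * u) \<otimes> y [^] (b' * u))"
    using xy by (simp only: int_pow_distrib int_pow_pow int_pow_closed)
  also have "\<dots> = (x [^] (v * b') \<otimes> x [^] (a' * u)) \<otimes> (y [^] (- u * b') \<otimes> y [^] (b' * u))"
    using xy by (simp add: m_ac)
  also have "\<dots> = x [^] (v * b' + a' * u) \<otimes> y [^] (- u * b' + b' * u)"
    using xy by (simp only: int_pow_mult)
  also have "\<dots> = x" using uv xy by (simp add: algebra_simps)
  finally have zx: "z [^] b' = x" .
  have "z [^] (- a') = x [^] (- v * a') \<otimes> y [^] (u * a')"
    using xy by (simp add: z_def int_pow_distrib int_pow_pow)
  also have "\<dots> = x [^] (- v * a') \<otimes> y [^] (u * a') \<otimes> (x [^] a' \<otimes> y [^] b') [^] v"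
    using rel xy by simp
  also have "\<dots> = x [^] (- v * a') \<otimes> y [^] (u * a') \<otimes> (x [^] (a' * v) \<otimes> y [^] (b' * v))"
    using xy by (simp only: int_pow_distrib int_pow_pow int_pow_closed)
  also have "\<dots> = (x [^] (- v * a') \<otimes> x [^] (a' * v)) \<otimes> (y [^] (u * a') \<otimes> y [^] (b' * v))"
    using xy by (simp add: m_ac)
  also have "\<dots> = x [^] (- v * a' + a' * v) \<otimes> y [^] (u * a' + b' * v)"
    using xy by (simp only: int_pow_mult)
  also have "\<dots> = y" using uv xy by (simp add: algebra_simps)
  finally have "z [^] (- a') = y" .
  with zx zc z_def show thesis using that by metis
qed

context group
begin

text \<open>Two dependent elements of the torsion-free abelian group \<open>X / M\<close> generate a
  cyclic group, and \<open>t\<close> lifts a generator of it.\<close>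

lemma rank1_pair:
  assumes r: "rank1 X M" and xy: "x \<in> X" "y \<in> X"
  obtains t where "t \<in> X" "\<exists>m\<in>M. \<exists>k::int. x = m \<otimes> t [^] k" "\<exists>m\<in>M. \<exists>k::int. y = m \<otimes> t [^] k"
proof -
  have X: "subgroup X G" and M: "subgroup M G" "M \<subseteq> X" and c: "commutators_in X M"
    using r by (auto simp: rank1_def)
  note Xc = subgroup.subset[OF X]
  obtain Q :: "'a set monoid" and \<pi> where Q: "group Q" "\<pi> ` X = carrier Q"
    "\<And>x y. x \<in> X \<Longrightarrow> y \<in> X \<Longrightarrow> \<pi> (x \<otimes> y) = \<pi> x \<otimes>\<^bsub>Q\<^esub> \<pi> y"
    "\<And>x. x \<in> X \<Longrightarrow> \<pi> (inv x) = inv\<^bsub>Q\<^esub> \<pi> x"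
    "\<And>x k. x \<in> X \<Longrightarrow> \<pi> (x [^] (k::int)) = \<pi> x [^]\<^bsub>Q\<^esub> k"
    "\<And>x. x \<in> X \<Longrightarrow> \<pi> x = \<one>\<^bsub>Q\<^esub> \<longleftrightarrow> x \<in> M"
    "commutators_in X M \<Longrightarrow> comm_group Q"
    using subgroup_quotient[OF X M commutators_conj[OF c M Xc]] by blast
  interpret Q: comm_group Q using Q(7)[OF c] .
  have pw: "x [^] (k::int) \<in> X" if "x \<in> X" for x k by (rule subgroup_int_pow_closed[OF X that])
  obtain a b :: int where ab: "a \<noteq> 0 \<or> b \<noteq> 0" "x [^] a \<otimes> y [^] b \<in> M"
    using r xy unfolding rank1_def by blast
  have "\<pi> x [^]\<^bsub>Q\<^esub> a \<otimes>\<^bsub>Q\<^esub> \<pi> y [^]\<^bsub>Q\<^esub> b = \<one>\<^bsub>Q\<^esub>"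
    using ab(2) xy pw Q(3,5,6) subgroup.m_closed[OF X] by metis
  moreover have "z = \<one>\<^bsub>Q\<^esub>" if "z \<in> carrier Q" "k \<noteq> 0" "z [^]\<^bsub>Q\<^esub> k = \<one>\<^bsub>Q\<^esub>" for z and k :: int
    using that rank1_int_pow[OF r _ that(2)] Q(2,5,6) pw by (metis imageE)
  moreover have "\<pi> x \<in> carrier Q" "\<pi> y \<in> carrier Q" using xy Q(2) by auto
  ultimately obtain z i j where z: "z \<in> carrier Q" "z = \<pi> x [^]\<^bsub>Q\<^esub> (i::int) \<otimes>\<^bsub>Q\<^esub> \<pi> y [^]\<^bsub>Q\<^esub> (j::int)"
    "\<exists>k::int. \<pi> x = z [^]\<^bsub>Q\<^esub> k" "\<exists>k::int. \<pi> y = z [^]\<^bsub>Q\<^esub> k"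
    using Q.torsion_free_rank_one_cyclic[of "\<pi> x" "\<pi> y" a b] ab(1) by metis
  obtain t where t: "t \<in> X" "z = \<pi> t" using z(1) Q(2) by auto
  have lift: "\<exists>m\<in>M. \<exists>k::int. w = m \<otimes> t [^] k" if w: "w \<in> X" "\<pi> w = z [^]\<^bsub>Q\<^esub> (k::int)" for w k
  proof -
    have "\<pi> (w \<otimes> inv (t [^] k)) = \<pi> w \<otimes>\<^bsub>Q\<^esub> inv\<^bsub>Q\<^esub> \<pi> (t [^] k)"
      using w t pw subgroup.m_inv_closed[OF X] by (simp add: Q(3,4))
    also have "\<dots> = \<one>\<^bsub>Q\<^esub>" using w t Q(2,5) pw z(1) by simp
    finally have "w \<otimes> inv (t [^] k) \<in> M"
      using Q(6)[of "w \<otimes> inv (t [^] k)"] w t pw X by (simp add: subgroup.m_closed subgroup.m_inv_closed)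
    moreover have "w = w \<otimes> inv (t [^] k) \<otimes> t [^] k"
      using w t Xc by (simp add: m_assoc subset_iff)
    ultimately show ?thesis by blast
  qed
  show thesis
    using z(3,4) lift xy t(1) that by metis
qed

lemma rank1_normal:
  assumes "rank1 X M" "x \<in> X" "m \<in> M"
  shows "x \<otimes> m \<otimes> inv x \<in> M" "inv x \<otimes> m \<otimes> x \<in> M"
proof -
  have *: "x \<otimes> m \<otimes> inv x \<in> M" if "x \<in> X" for x
    using assms that by (intro commutators_conj[of X M]) (auto simp: rank1_def subgroup_def)
  show "x \<otimes> m \<otimes> inv x \<in> M" by (rule *[OF assms(2)])
  have "inv x \<in> X" "x \<in> carrier G" using assms by (auto simp: rank1_def subgroup_def)
  then show "inv x \<otimes> m \<otimes> x \<in> M" using *[of "inv x"] by simp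
qed

text \<open>\<open>X / M\<close> is locally cyclic: generators are merged two at a time. This
  presents \<open>X\<close> as the directed union of the groups \<langle>M, t\<rangle>.\<close>

lemma rank1_finite:
  assumes r: "rank1 X M" and S: "finite S" "S \<subseteq> X"
  shows "\<exists>t\<in>X. \<forall>s\<in>S. \<exists>m\<in>M. \<exists>k::int. s = m \<otimes> t [^] k"
  using S
proof (induction S rule: finite_induct)
  case empty
  show ?case using r by (auto simp: rank1_def subgroup_def)
next
  case (insert s S)
  have X: "subgroup X G" and M: "subgroup M G" "M \<subseteq> X" using r by (auto simp: rank1_def)
  note Xc = subgroup.subset[OF X]
  obtain t where t: "t \<in> X" "\<And>s. s \<in> S \<Longrightarrow> \<exists>m\<in>M. \<exists>k::int. s = m \<otimes> t [^] k" using insert by auto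
  obtain z where z: "z \<in> X" "\<exists>m\<in>M. \<exists>k::int. s = m \<otimes> z [^] k" "\<exists>m\<in>M. \<exists>k::int. t = m \<otimes> z [^] k"
    using rank1_pair[OF r, of s t] insert.prems t(1) by (metis insert_subset)
  then obtain m k where t': "m \<in> M" "t = m \<otimes> z [^] (k::int)" by blast
  obtain Q :: "'a set monoid" and \<pi> where Q: "group Q" "\<pi> ` X = carrier Q"
    "\<And>x y. x \<in> X \<Longrightarrow> y \<in> X \<Longrightarrow> \<pi> (x \<otimes> y) = \<pi> x \<otimes>\<^bsub>Q\<^esub> \<pi> y"
    "\<And>x. x \<in> X \<Longrightarrow> \<pi> (inv x) = inv\<^bsub>Q\<^esub> \<pi> x"
    "\<And>x k. x \<in> X \<Longrightarrow> \<pi> (x [^] (k::int)) = \<pi> x [^]\<^bsub>Q\<^esub> k"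
    "\<And>x. x \<in> X \<Longrightarrow> \<pi> x = \<one>\<^bsub>Q\<^esub> \<longleftrightarrow> x \<in> M"
    "commutators_in X M \<Longrightarrow> comm_group Q"
    using subgroup_quotient[OF X M rank1_normal(1)[OF r]] by blast
  interpret Q: group Q by (rule Q(1))
  have pw: "x [^] (k::int) \<in> X" if "x \<in> X" for x k by (rule subgroup_int_pow_closed[OF X that])
  have \<pi>c: "\<pi> x \<in> carrier Q" if "x \<in> X" for x using that Q(2) by auto
  have "\<pi> t = \<pi> z [^]\<^bsub>Q\<^esub> k"
    using t' M(2) z(1) pw \<pi>c Q(5) Q(6)[of m] by (auto simp: Q(3))
  have "\<exists>m\<in>M. \<exists>k::int. w = m \<otimes> z [^] k" if w: "w \<in> S" for w
  proof -
    obtain m' l where w': "m' \<in> M" "w = m' \<otimes> t [^] (l::int)" using t(2) w by blast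
    have wX: "w \<in> X" using w insert.prems by auto
    have "\<pi> w = \<pi> z [^]\<^bsub>Q\<^esub> (k * l)"
      using w' M(2) t(1) z(1) pw \<pi>c Q(5) Q(6)[of m'] \<open>\<pi> t = \<pi> z [^]\<^bsub>Q\<^esub> k\<close>
      by (auto simp: Q(3) Q.int_pow_pow)
    then have "\<pi> (w \<otimes> inv (z [^] (k * l))) = \<one>\<^bsub>Q\<^esub>"
      using wX z(1) pw \<pi>c X by (simp add: Q(3,4,5) subgroup.m_inv_closed)
    then have "w \<otimes> inv (z [^] (k * l)) \<in> M"
      using Q(6)[of "w \<otimes> inv (z [^] (k * l))"] wX z(1) pw X by (simp add: subgroup.m_closed subgroup.m_inv_closed)
    moreover have "w = w \<otimes> inv (z [^] (k * l)) \<otimes> z [^] (k * l)"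
      using wX z(1) Xc by (simp add: m_assoc subset_iff)
    ultimately show ?thesis by blast
  qed
  with z show ?case by auto
qed

text \<open>The chain grows at its top while the bottom \<open>N\<close> stays a parameter. Chains
  can then be concatenated, and a chain in a quotient pulls back to one that ends at the
  kernel.\<close>

inductive r1chain :: "'a set \<Rightarrow> 'a set \<Rightarrow> bool" for N where
  base: "subgroup N G \<Longrightarrow> r1chain N N"
| step: "r1chain N M \<Longrightarrow> rank1 X M \<Longrightarrow> r1chain N X"

lemma r1chain_subgroup: "r1chain N X \<Longrightarrow> subgroup X G \<and> subgroup N G"
  by (induction rule: r1chain.induct) (auto simp: rank1_def)

lemma r1chain_trans: "r1chain M X \<Longrightarrow> r1chain N M \<Longrightarrow> r1chain N X"
  by (induction rule: r1chain.induct) (auto intro: r1chain.step)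

lemma r1chain_Int: "r1chain N X \<Longrightarrow> subgroup H G \<Longrightarrow> r1chain (N \<inter> H) (X \<inter> H)"
  by (induction rule: r1chain.induct)
    (auto intro: r1chain.intros subgroups_Inter_pair rank1_Int)

text \<open>Each rank one section contributes a factor of at most \<open>j\<close>: finitely many
  elements of \<open>X\<close> lie in some \<langle>M, t\<rangle>, and j-th powers fall into
  \<open>P\<close>, so at most \<open>j\<close> of them are pairwise incongruent modulo
  \<open>M\<close> and \<open>P\<close>. Since \<open>P\<close> may fail to be normal, congruence is
  the relation \<open>rel\<close>, whose symmetry uses normality of \<open>M\<close>.\<close>

lemma fin_index_powers:
  assumes "r1chain {\<one>} X" "subgroup P G" "(j::nat) > 0" "\<And>x. x \<in> X \<Longrightarrow> x [^] j \<in> P"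
  shows "fin_index P X"
  using assms
proof (induction rule: r1chain.induct)
  case base
  then show ?case by (auto simp: fin_index_def subgroup_def intro!: exI[of _ "{\<one>}"])
next
  case (step M X)
  have X: "subgroup X G" and M: "subgroup M G" "M \<subseteq> X" using step.hyps by (auto simp: rank1_def)
  note Xc = subgroup.subset[OF X]
  interpret P: subgroup P G by (rule step.prems)
  interpret M: subgroup M G by (rule M)
  interpret X: subgroup X G by (rule X)
  obtain R1 where R1: "finite R1" "R1 \<subseteq> M" "\<And>x. x \<in> M \<Longrightarrow> \<exists>r\<in>R1. inv r \<otimes> x \<in> P"
  proof -
    have "fin_index P M"
    proof (rule step.IH[OF step.prems(1,2)])
      fix x assume "x \<in> M"
      then show "x [^] j \<in> P" using M(2) by (intro step.prems(3)) auto
    qed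
    then show thesis unfolding fin_index_def using that by blast
  qed
  define rel where "rel x y \<longleftrightarrow> (\<exists>m\<in>M. \<exists>p\<in>P. inv y \<otimes> x = m \<otimes> p)" for x y
  have pigeon: "\<exists>x\<in>F. \<exists>y\<in>F. x \<noteq> y \<and> rel x y" if F: "finite F" "F \<subseteq> X" "card F > j" for F
  proof -
    obtain t where t: "t \<in> X" "\<And>s. s \<in> F \<Longrightarrow> \<exists>m\<in>M. \<exists>k::int. s = m \<otimes> t [^] k"
      using rank1_finite[OF step.hyps(2) F(1,2)] by blast
    then obtain \<mu> \<kappa> where \<mu>: "\<And>s. s \<in> F \<Longrightarrow> \<mu> s \<in> M" "\<And>s. s \<in> F \<Longrightarrow> s = \<mu> s \<otimes> t [^] (\<kappa> s :: int)"
      by metis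
    \<comment> \<open>More than \<open>j\<close> elements force two exponents of \<open>t\<close> to
      agree modulo \<open>j\<close>; the two elements then differ by an element of \<open>M\<close>
      and a j-th power.\<close>
    have "\<not> inj_on (\<lambda>s. \<kappa> s mod int j) F"
    proof
      assume "inj_on (\<lambda>s. \<kappa> s mod int j) F"
      moreover have "(\<lambda>s. \<kappa> s mod int j) ` F \<subseteq> {0..<int j}" using step.prems(2) by auto
      ultimately have "card F \<le> card {0..<int j}" by (intro card_inj_on_le) auto
      then show False using F(3) by simp
    qed
    then obtain x y where xy: "x \<in> F" "y \<in> F" "x \<noteq> y" "\<kappa> x mod int j = \<kappa> y mod int j"
      by (auto simp: inj_on_def)
    define l where "l = (\<kappa> x - \<kappa> y) div int j"
    have l: "\<kappa> x = \<kappa> y + l * int j"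
    proof -
      have "int j dvd \<kappa> x - \<kappa> y" using xy(4) by (simp add: mod_eq_dvd_iff)
      then show ?thesis by (simp add: l_def)
    qed
    have tc: "t \<in> carrier G" using t(1) Xc by auto
    let ?s = "t [^] \<kappa> y"
    have sX: "?s \<in> X" by (rule subgroup_int_pow_closed[OF X t(1)])
    have "inv y \<otimes> x = inv (\<mu> y \<otimes> ?s) \<otimes> (\<mu> x \<otimes> t [^] \<kappa> x)"
      using \<mu>(2)[OF xy(1)] \<mu>(2)[OF xy(2)] by simp
    also have "\<dots> = (inv ?s \<otimes> (inv (\<mu> y) \<otimes> \<mu> x) \<otimes> ?s) \<otimes> (t [^] l) [^] j"
      using \<mu>(1)[OF xy(1)] \<mu>(1)[OF xy(2)] tc
      by (simp add: inv_mult_group m_assoc l int_pow_mult int_pow_pow flip: int_pow_int)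
    finally have "inv y \<otimes> x = (inv ?s \<otimes> (inv (\<mu> y) \<otimes> \<mu> x) \<otimes> ?s) \<otimes> (t [^] l) [^] j" .
    moreover have "inv ?s \<otimes> (inv (\<mu> y) \<otimes> \<mu> x) \<otimes> ?s \<in> M"
      using \<mu>(1)[OF xy(1)] \<mu>(1)[OF xy(2)] by (intro rank1_normal(2)[OF step.hyps(2) sX]) auto
    moreover have "(t [^] l) [^] j \<in> P"
      using step.prems(3) subgroup_int_pow_closed[OF X t(1)] by blast
    ultimately show ?thesis using xy unfolding rel_def by blast
  qed
  have relsym: "rel y x" if xy: "x \<in> X" "y \<in> X" "rel x y" for x y
  proof -
    obtain m p where mp: "m \<in> M" "p \<in> P" "inv y \<otimes> x = m \<otimes> p" using xy(3) by (auto simp: rel_def)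
    have xyc: "x \<in> carrier G" "y \<in> carrier G" using xy by auto
    have "inv m \<otimes> (inv y \<otimes> x) \<in> X" using mp(1) xy(1,2) M(2) by auto
    then have pX: "p \<in> X" unfolding mp(3) using mp(1,2) by simp
    have "inv x \<otimes> y = inv (inv y \<otimes> x)" using xyc by (simp add: inv_mult_group)
    also have "\<dots> = (inv p \<otimes> inv m \<otimes> p) \<otimes> inv p"
      using mp by (simp add: inv_mult_group m_assoc)
    finally have "inv x \<otimes> y = (inv p \<otimes> inv m \<otimes> p) \<otimes> inv p" .
    moreover have "inv p \<otimes> inv m \<otimes> p \<in> M"
      using mp by (intro rank1_normal(2)[OF step.hyps(2) pX]) auto
    ultimately show ?thesis using mp(2) unfolding rel_def by blast
  qed
  have relrefl: "rel x x" if "x \<in> X" for x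
    unfolding rel_def using that by (intro bexI[of _ \<one>]) auto
  obtain R2 where R2: "finite R2" "R2 \<subseteq> X" "\<And>x. x \<in> X \<Longrightarrow> \<exists>y\<in>R2. rel x y"
  proof (rule finite_maximal_separated[of X rel j])
    fix F assume "finite F" "F \<subseteq> X" "\<And>x y. x \<in> F \<Longrightarrow> y \<in> F \<Longrightarrow> x \<noteq> y \<Longrightarrow> \<not> rel x y"
    then show "card F \<le> j" using pigeon[of F] by (meson not_le)
  qed (use relsym relrefl in auto)
  show ?case
    unfolding fin_index_def
  \<comment> \<open>Representatives for \<open>rel\<close>, refined by representatives of
    \<open>M\<close> modulo \<open>P\<close>.\<close>
  proof (intro exI[of _ "(\<lambda>(r, s). r \<otimes> s) ` (R2 \<times> R1)"] conjI ballI)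
    show "(\<lambda>(r, s). r \<otimes> s) ` (R2 \<times> R1) \<subseteq> X" using R1(2) R2(2) M(2) by auto
  next
    fix x assume x: "x \<in> X"
    obtain r m p where r: "r \<in> R2" "m \<in> M" "p \<in> P" "inv r \<otimes> x = m \<otimes> p"
      using R2(3)[OF x] by (auto simp: rel_def)
    obtain s where s: "s \<in> R1" "inv s \<otimes> m \<in> P" using R1(3)[OF r(2)] by blast
    have c: "r \<in> carrier G" "s \<in> carrier G" "x \<in> carrier G"
      using r(1) s(1) R2(2) R1(2) x by auto
    have "inv (r \<otimes> s) \<otimes> x = inv s \<otimes> (inv r \<otimes> x)" using c by (simp add: inv_mult_group m_assoc)
    also have "\<dots> = (inv s \<otimes> m) \<otimes> p" using c r by (simp add: m_assoc)
    finally have "inv (r \<otimes> s) \<otimes> x \<in> P" using s(2) r(3) by simp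
    then show "\<exists>q\<in>(\<lambda>(r, s). r \<otimes> s) ` (R2 \<times> R1). inv q \<otimes> x \<in> P"
      using r(1) s(1) by force
  qed (use R1(1) R2(1) in auto)
qed

end

section \<open>Cutting out finite index subgroups of a section\<close>

context group
begin

text \<open>Conjugations by powers of \<open>q\<close> induce at most \<open>b\<close> maps on the
  finite set \<open>N\<close>, so two of the powers with exponents 0 to \<open>b\<close> induce the
  same map and a power with exponent \<open>k \<le> b\<close> commutes with \<open>N\<close>. The
  factorial of \<open>b\<close> is a multiple of every such \<open>k\<close> and serves all
  \<open>q\<close> at once.\<close>

lemma power_centralizes:
  assumes N: "finite N" "N \<subseteq> carrier G"
    and conj: "\<And>q n. q \<in> carrier G \<Longrightarrow> n \<in> N \<Longrightarrow> q \<otimes> n \<otimes> inv q \<in> N"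
  obtains e :: nat where "e > 0" "\<And>q n. q \<in> carrier G \<Longrightarrow> n \<in> N \<Longrightarrow> q [^] e \<otimes> n = n \<otimes> q [^] e"
proof
  define b where "b = card (N \<rightarrow>\<^sub>E N)"
  show "fact b > (0::nat)" by simp
  fix q n assume q: "q \<in> carrier G" and n: "n \<in> N"
  have nc: "n \<in> carrier G" using n N(2) by auto
  define c where "c i = (\<lambda>n\<in>N. q [^] i \<otimes> n \<otimes> inv (q [^] i))" for i :: nat
  have "\<not> inj_on c {0..b}"
  proof
    assume "inj_on c {0..b}"
    moreover have "c ` {0..b} \<subseteq> N \<rightarrow>\<^sub>E N" using conj q by (auto simp: c_def)
    ultimately have "card {0..b} \<le> b" unfolding b_def
      using N(1) by (intro card_inj_on_le[of c]) (auto intro: finite_PiE)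
    then show False by simp
  qed
  then obtain i i' where ii: "i \<le> b" "i' \<le> b" "i < i'" "c i = c i'"
    unfolding inj_on_def by (metis atLeastAtMost_iff linorder_neqE_nat)
  define k where "k = i' - i"
  have i': "i' = i + k" "0 < k" "k \<le> b" using ii by (auto simp: k_def)
  have "c i n = c i' n" using ii(4) by simp
  then have "q [^] i \<otimes> n \<otimes> inv (q [^] i) = q [^] i \<otimes> (q [^] k \<otimes> n \<otimes> inv (q [^] k)) \<otimes> inv (q [^] i)"
    using n q nc unfolding c_def i'(1) by (simp add: inv_mult_group m_assoc flip: nat_pow_mult)
  then have "n = q [^] k \<otimes> n \<otimes> inv (q [^] k)"
    using q nc by simp
  then have "n \<otimes> q [^] k = q [^] k \<otimes> n \<otimes> inv (q [^] k) \<otimes> q [^] k" by simp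
  then have comm: "q [^] k \<otimes> n = n \<otimes> q [^] k" using q nc by (simp add: m_assoc)
  have "k dvd fact b" using i' by (intro dvd_fact) auto
  then obtain l where l: "fact b = k * l" by blast
  have "(q [^] k) [^] int l \<otimes> n = n \<otimes> (q [^] k) [^] int l"
    using comm q nc by (intro int_pow_commute) auto
  then show "q [^] (fact b :: nat) \<otimes> n = n \<otimes> q [^] (fact b :: nat)"
    using q by (simp add: l int_pow_int nat_pow_pow)
qed

text \<open>The same pigeonhole for the cosets of the powers of \<open>m\<close>, again with a
  factorial as exponent common to all \<open>m\<close>. It covers subgroups \<open>K\<close> that
  are not normal.\<close>

lemma fin_index_exponent:
  assumes K: "subgroup K G" and M: "subgroup M G" and fi: "fin_index K M"
  obtains j :: nat where "j > 0" "\<And>m. m \<in> M \<Longrightarrow> m [^] j \<in> K"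
proof -
  obtain R where R: "finite R" "R \<subseteq> M" "\<And>x. x \<in> M \<Longrightarrow> \<exists>r\<in>R. inv r \<otimes> x \<in> K"
    using fi by (auto simp: fin_index_def)
  then obtain \<rho> where \<rho>: "\<And>x. x \<in> M \<Longrightarrow> \<rho> x \<in> R" "\<And>x. x \<in> M \<Longrightarrow> inv (\<rho> x) \<otimes> x \<in> K" by metis
  note Mc = subgroup.subset[OF M]
  show thesis
  proof
    show "fact (card R) > (0::nat)" by simp
    fix m assume m: "m \<in> M"
    have mc: "m \<in> carrier G" and pw: "m [^] (i::nat) \<in> M" for i
      using m Mc by (auto intro: subgroup_nat_pow_closed[OF M])
    have "\<not> inj_on (\<lambda>i::nat. \<rho> (m [^] i)) {0..card R}"
    proof
      assume "inj_on (\<lambda>i::nat. \<rho> (m [^] i)) {0..card R}"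
      moreover have "(\<lambda>i::nat. \<rho> (m [^] i)) ` {0..card R} \<subseteq> R" using \<rho>(1) pw by auto
      ultimately have "card {0..card R} \<le> card R" using R(1) by (rule card_inj_on_le)
      then show False by simp
    qed
    then obtain i i' where ii: "i \<le> card R" "i' \<le> card R" "i < i'" "\<rho> (m [^] i) = \<rho> (m [^] i')"
      unfolding inj_on_def by (metis atLeastAtMost_iff linorder_neqE_nat)
    define k where "k = i' - i"
    have i': "i' = i + k" "0 < k" "k \<le> card R" using ii by (auto simp: k_def)
    let ?r = "\<rho> (m [^] i)"
    have rc: "?r \<in> carrier G" using \<rho>(1) pw R(2) Mc by blast
    have "inv (inv ?r \<otimes> m [^] i) \<otimes> (inv ?r \<otimes> m [^] i') \<in> K"
      using \<rho>(2)[OF pw, of i] \<rho>(2)[OF pw, of i'] ii(4) K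
      by (simp add: subgroup.m_closed subgroup.m_inv_closed)
    also have "inv (inv ?r \<otimes> m [^] i) \<otimes> (inv ?r \<otimes> m [^] i') = m [^] k"
      using rc mc unfolding i'(1) by (simp add: inv_mult_group m_assoc flip: nat_pow_mult)
    finally have mk: "m [^] k \<in> K" .
    have "k dvd fact (card R)" using i' by (intro dvd_fact) auto
    then obtain l where l: "fact (card R) = k * l" by blast
    have "(m [^] k) [^] l \<in> K" using K mk by (rule subgroup_nat_pow_closed)
    then show "m [^] (fact (card R) :: nat) \<in> K" using mc by (simp add: l nat_pow_pow)
  qed
qed

text \<open>The profinite topology of \<open>X\<close> induces that of \<open>M\<close>.\<close>

lemma rank1_avoid:
  assumes r: "rank1 X M" and chX: "r1chain {\<one>} X" and chM: "r1chain {\<one>} M"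
    and K: "subgroup K G" and fi: "fin_index K M"
  obtains H where "subgroup H G" "H \<subseteq> X" "fin_index H X" "H \<inter> M \<subseteq> K"
proof -
  have X: "subgroup X G" and M: "subgroup M G" "M \<subseteq> X" using r by (auto simp: rank1_def)
  interpret X: subgroup X G by (rule X)
  interpret M: subgroup M G by (rule M)
  interpret K: subgroup K G by (rule K)
  obtain j :: nat where j: "j > 0" "\<And>m. m \<in> M \<Longrightarrow> m [^] j \<in> K"
    using fin_index_exponent[OF K M(1) fi] by blast
  \<comment> \<open>The largest subgroup of \<open>M\<close> all of whose conjugates under
    \<open>X\<close> lie in \<open>K\<close>. The j-th powers of elements of \<open>M\<close> are
    permuted by these conjugations and lie in \<open>K\<close>, hence in \<open>P\<close>; so
    \<open>P\<close> has finite index in \<open>M\<close> and is normal in \<open>X\<close>.\<close>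
  define P where "P = {p \<in> M. \<forall>y\<in>X. y \<otimes> p \<otimes> inv y \<in> K}"
  have powP: "m [^] j \<in> P" if m: "m \<in> M" for m
  proof -
    have "y \<otimes> m [^] j \<otimes> inv y \<in> K" if y: "y \<in> X" for y
    proof -
      have e: "(y \<otimes> m \<otimes> inv y) [^] (i::nat) = y \<otimes> m [^] i \<otimes> inv y" for i
        by (induction i) (use m y X.subset M.subset in \<open>auto simp: m_assoc subset_iff\<close>)
      show ?thesis using j(2)[OF rank1_normal(1)[OF r y m]] by (simp add: e)
    qed
    then show ?thesis using subgroup_nat_pow_closed[OF M(1) m] by (simp add: P_def)
  qed
  have P: "subgroup P G"
  proof (rule subgroupI)
    show "P \<subseteq> carrier G" by (auto simp: P_def)
    show "P \<noteq> {}" using powP[OF M.one_closed] by auto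
  next
    fix a assume a: "a \<in> P"
    have "y \<otimes> inv a \<otimes> inv y \<in> K" if y: "y \<in> X" for y
    proof -
      have "inv (y \<otimes> a \<otimes> inv y) \<in> K" using a y by (auto simp: P_def)
      then show ?thesis using a y by (auto simp: P_def inv_mult_group m_assoc)
    qed
    then show "inv a \<in> P" using a by (auto simp: P_def)
  next
    fix a b assume ab: "a \<in> P" "b \<in> P"
    have "y \<otimes> (a \<otimes> b) \<otimes> inv y \<in> K" if y: "y \<in> X" for y
    proof -
      have "(y \<otimes> a \<otimes> inv y) \<otimes> (y \<otimes> b \<otimes> inv y) \<in> K" using ab y by (auto simp: P_def)
      then show ?thesis using ab y by (auto simp: P_def m_assoc)
    qed
    then show "a \<otimes> b \<in> P" using ab by (auto simp: P_def)
  qed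
  have PK: "P \<subseteq> K"
  proof
    fix p assume p: "p \<in> P"
    then have "\<one> \<otimes> p \<otimes> inv \<one> \<in> K" unfolding P_def using X.one_closed by blast
    then show "p \<in> K" using p by (auto simp: P_def)
  qed
  have PM: "P \<subseteq> M" by (auto simp: P_def)
  have conjP: "x \<otimes> p \<otimes> inv x \<in> P" if x: "x \<in> X" and p: "p \<in> P" for x p
  proof -
    have "y \<otimes> (x \<otimes> p \<otimes> inv x) \<otimes> inv y \<in> K" if y: "y \<in> X" for y
    proof -
      have "(y \<otimes> x) \<otimes> p \<otimes> inv (y \<otimes> x) \<in> K" using x y p by (auto simp: P_def)
      then show ?thesis using x y p by (auto simp: P_def inv_mult_group m_assoc)
    qed
    then show ?thesis using rank1_normal(1)[OF r x] p by (auto simp: P_def)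
  qed
  obtain Q :: "'a set monoid" and \<pi> where Q: "group Q" "\<pi> ` X = carrier Q"
    "\<And>x y. x \<in> X \<Longrightarrow> y \<in> X \<Longrightarrow> \<pi> (x \<otimes> y) = \<pi> x \<otimes>\<^bsub>Q\<^esub> \<pi> y"
    "\<And>x. x \<in> X \<Longrightarrow> \<pi> (inv x) = inv\<^bsub>Q\<^esub> \<pi> x"
    "\<And>x k. x \<in> X \<Longrightarrow> \<pi> (x [^] (k::int)) = \<pi> x [^]\<^bsub>Q\<^esub> k"
    "\<And>x. x \<in> X \<Longrightarrow> \<pi> x = \<one>\<^bsub>Q\<^esub> \<longleftrightarrow> x \<in> P"
    "commutators_in X P \<Longrightarrow> comm_group Q"
    using subgroup_quotient[OF X P subset_trans[OF PM M(2)] conjP] by blast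
  interpret Q: group Q by (rule Q(1))
  have \<pi>c: "\<pi> x \<in> carrier Q" if "x \<in> X" for x using that Q(2) by auto
  have \<pi>n: "\<pi> (x [^] (k::nat)) = \<pi> x [^]\<^bsub>Q\<^esub> k" if "x \<in> X" for x k
    using Q(5)[OF that, of "int k"] by (simp add: int_pow_int)
  have MX: "m \<in> X" if "m \<in> M" for m using that M(2) by auto
  obtain R where R: "finite R" "R \<subseteq> M" "\<And>x. x \<in> M \<Longrightarrow> \<exists>r\<in>R. inv r \<otimes> x \<in> P"
    using fin_index_powers[OF chM P j(1) powP] unfolding fin_index_def by blast
  have "\<pi> ` M \<subseteq> \<pi> ` R"
  proof
    fix u assume "u \<in> \<pi> ` M"
    then obtain m s where m: "m \<in> M" "u = \<pi> m" "s \<in> R" "inv s \<otimes> m \<in> P" using R(3) by blast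
    have sX: "s \<in> X" "m \<in> X" using m R(2) MX by auto
    have "\<pi> (s \<otimes> (inv s \<otimes> m)) = \<pi> s \<otimes>\<^bsub>Q\<^esub> \<pi> (inv s \<otimes> m)"
      using sX by (intro Q(3)) auto
    also have "\<pi> (inv s \<otimes> m) = \<one>\<^bsub>Q\<^esub>" using Q(6) m(4) sX by auto
    finally have "\<pi> m = \<pi> s" using sX \<pi>c by simp
    then show "u \<in> \<pi> ` R" using m by auto
  qed
  then have finM: "finite (\<pi> ` M)" using R(1) finite_subset by blast
  \<comment> \<open>The image of \<open>M\<close> in \<open>Q\<close> is finite and normal, so a
    fixed power of every element centralizes it.\<close>
  obtain e :: nat where e: "e > 0"
    "\<And>q n. q \<in> carrier Q \<Longrightarrow> n \<in> \<pi> ` M \<Longrightarrow> q [^]\<^bsub>Q\<^esub> e \<otimes>\<^bsub>Q\<^esub> n = n \<otimes>\<^bsub>Q\<^esub> q [^]\<^bsub>Q\<^esub> e"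
  proof (rule Q.power_centralizes[OF finM])
    show "\<pi> ` M \<subseteq> carrier Q" using \<pi>c MX by auto
    fix q n assume "q \<in> carrier Q" "n \<in> \<pi> ` M"
    then have "q \<in> \<pi> ` X" "n \<in> \<pi> ` M" unfolding Q(2) .
    then obtain x m where x: "x \<in> X" "q = \<pi> x" "m \<in> M" "n = \<pi> m" by blast
    have "\<pi> (x \<otimes> m \<otimes> inv x) = q \<otimes>\<^bsub>Q\<^esub> n \<otimes>\<^bsub>Q\<^esub> inv\<^bsub>Q\<^esub> q"
      using x MX by (simp add: Q(3,4))
    then show "q \<otimes>\<^bsub>Q\<^esub> n \<otimes>\<^bsub>Q\<^esub> inv\<^bsub>Q\<^esub> q \<in> \<pi> ` M"
      using rank1_normal(1)[OF r x(1,3)] by (metis imageI)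
  qed (use that in blast)
  \<comment> \<open>The elements of \<open>X\<close> that centralize the image of \<open>M\<close>;
    it contains all e-th powers.\<close>
  define X1 where "X1 = {x \<in> X. \<forall>m\<in>M. \<pi> x \<otimes>\<^bsub>Q\<^esub> \<pi> m = \<pi> m \<otimes>\<^bsub>Q\<^esub> \<pi> x}"
  have X1X: "x \<in> X" if "x \<in> X1" for x using that by (simp add: X1_def)
  have X1c: "\<pi> x \<otimes>\<^bsub>Q\<^esub> \<pi> m = \<pi> m \<otimes>\<^bsub>Q\<^esub> \<pi> x" if "x \<in> X1" "m \<in> M" for x m
    using that unfolding X1_def by blast
  have X1: "subgroup X1 G"
  proof (rule subgroupI)
    show "X1 \<subseteq> carrier G" by (auto simp: X1_def)
    have "\<pi> \<one> = \<one>\<^bsub>Q\<^esub>" using Q(6) subgroup.one_closed[OF P] by auto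
    then show "X1 \<noteq> {}" using \<pi>c MX unfolding X1_def by (intro ex_in_conv[THEN iffD1] exI[of _ \<one>]) auto
  next
    fix a assume a: "a \<in> X1"
    have "inv\<^bsub>Q\<^esub> \<pi> a \<otimes>\<^bsub>Q\<^esub> \<pi> m = \<pi> m \<otimes>\<^bsub>Q\<^esub> inv\<^bsub>Q\<^esub> \<pi> a" if m: "m \<in> M" for m
      using Q.int_pow_commute[of "\<pi> a" "\<pi> m" "- 1"] a m \<pi>c MX by (simp add: X1_def Q.int_pow_neg)
    then show "inv a \<in> X1" using a by (simp add: X1_def Q(4))
  next
    fix a b assume ab: "a \<in> X1" "b \<in> X1"
    have "\<pi> a \<otimes>\<^bsub>Q\<^esub> \<pi> b \<otimes>\<^bsub>Q\<^esub> \<pi> m = \<pi> m \<otimes>\<^bsub>Q\<^esub> (\<pi> a \<otimes>\<^bsub>Q\<^esub> \<pi> b)" if m: "m \<in> M" for m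
    proof -
      have c: "\<pi> a \<in> carrier Q" "\<pi> b \<in> carrier Q" "\<pi> m \<in> carrier Q" using ab m \<pi>c MX X1X by auto
      have "\<pi> a \<otimes>\<^bsub>Q\<^esub> \<pi> b \<otimes>\<^bsub>Q\<^esub> \<pi> m = \<pi> a \<otimes>\<^bsub>Q\<^esub> (\<pi> m \<otimes>\<^bsub>Q\<^esub> \<pi> b)"
        using ab m c by (simp add: X1_def Q.m_assoc)
      also have "\<dots> = \<pi> a \<otimes>\<^bsub>Q\<^esub> \<pi> m \<otimes>\<^bsub>Q\<^esub> \<pi> b" using c by (simp add: Q.m_assoc)
      also have "\<dots> = \<pi> m \<otimes>\<^bsub>Q\<^esub> \<pi> a \<otimes>\<^bsub>Q\<^esub> \<pi> b" using ab m by (simp add: X1_def)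
      finally show ?thesis using c by (simp add: Q.m_assoc)
    qed
    then show "a \<otimes> b \<in> X1" using ab by (simp add: X1_def Q(3))
  qed
  have r1: "rank1 (X \<inter> X1) (M \<inter> X1)" using r X1 by (rule rank1_Int)
  \<comment> \<open>The image of \<open>X1\<close> is abelian: the part coming from \<open>M\<close>
    is central, and modulo that part the group is locally cyclic.\<close>
  have comm: "\<pi> x \<otimes>\<^bsub>Q\<^esub> \<pi> y = \<pi> y \<otimes>\<^bsub>Q\<^esub> \<pi> x" if xy: "x \<in> X1" "y \<in> X1" for x y
  proof -
    obtain t where t: "t \<in> X \<inter> X1" "\<exists>m\<in>M \<inter> X1. \<exists>k::int. x = m \<otimes> t [^] k"
      "\<exists>m\<in>M \<inter> X1. \<exists>k::int. y = m \<otimes> t [^] k"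
      by (rule rank1_pair[OF r1, of x y]) (use xy X1X in auto)
    then obtain m m' and k l :: int where mk: "m \<in> M" "m \<in> X1" "x = m \<otimes> t [^] k"
      "m' \<in> M" "m' \<in> X1" "y = m' \<otimes> t [^] l" by blast
    define T A A' where "T = \<pi> t" and "A = \<pi> m" and "A' = \<pi> m'"
    have c: "T \<in> carrier Q" "A \<in> carrier Q" "A' \<in> carrier Q"
      using t(1) mk \<pi>c MX by (auto simp: T_def A_def A'_def)
    have tX: "t [^] (i::int) \<in> X" for i using t(1) subgroup_int_pow_closed[OF X] by auto
    have px: "\<pi> x = A \<otimes>\<^bsub>Q\<^esub> T [^]\<^bsub>Q\<^esub> k" "\<pi> y = A' \<otimes>\<^bsub>Q\<^esub> T [^]\<^bsub>Q\<^esub> l"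
      using mk t(1) MX tX by (auto simp: T_def A_def A'_def Q(3,5))
    have TA0: "T \<otimes>\<^bsub>Q\<^esub> A = A \<otimes>\<^bsub>Q\<^esub> T" "T \<otimes>\<^bsub>Q\<^esub> A' = A' \<otimes>\<^bsub>Q\<^esub> T" and AA: "A \<otimes>\<^bsub>Q\<^esub> A' = A' \<otimes>\<^bsub>Q\<^esub> A"
      unfolding T_def A_def A'_def using t(1) mk by (intro X1c; blast)+
    have TA: "T [^]\<^bsub>Q\<^esub> i \<otimes>\<^bsub>Q\<^esub> A = A \<otimes>\<^bsub>Q\<^esub> T [^]\<^bsub>Q\<^esub> i" "T [^]\<^bsub>Q\<^esub> i \<otimes>\<^bsub>Q\<^esub> A' = A' \<otimes>\<^bsub>Q\<^esub> T [^]\<^bsub>Q\<^esub> i" for i :: int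
      by (rule Q.int_pow_commute[OF c(1,2) TA0(1)], rule Q.int_pow_commute[OF c(1,3) TA0(2)])
    have mv: "(U \<otimes>\<^bsub>Q\<^esub> T [^]\<^bsub>Q\<^esub> i) \<otimes>\<^bsub>Q\<^esub> (V \<otimes>\<^bsub>Q\<^esub> T [^]\<^bsub>Q\<^esub> i') = (U \<otimes>\<^bsub>Q\<^esub> V) \<otimes>\<^bsub>Q\<^esub> T [^]\<^bsub>Q\<^esub> (i + i')"
      if "U \<in> carrier Q" "V \<in> carrier Q" "T [^]\<^bsub>Q\<^esub> i \<otimes>\<^bsub>Q\<^esub> V = V \<otimes>\<^bsub>Q\<^esub> T [^]\<^bsub>Q\<^esub> i" for U V and i i' :: int
    proof -
      have "(U \<otimes>\<^bsub>Q\<^esub> T [^]\<^bsub>Q\<^esub> i) \<otimes>\<^bsub>Q\<^esub> (V \<otimes>\<^bsub>Q\<^esub> T [^]\<^bsub>Q\<^esub> i')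
          = U \<otimes>\<^bsub>Q\<^esub> ((T [^]\<^bsub>Q\<^esub> i \<otimes>\<^bsub>Q\<^esub> V) \<otimes>\<^bsub>Q\<^esub> T [^]\<^bsub>Q\<^esub> i')"
        using that(1,2) c by (simp add: Q.m_assoc)
      then show ?thesis using that c by (simp add: Q.m_assoc Q.int_pow_mult)
    qed
    show ?thesis unfolding px using c TA AA by (simp add: mv add.commute)
  qed
  \<comment> \<open>The j-th powers modulo \<open>P\<close>, a subgroup because the image of
    \<open>X1\<close> is abelian, of finite index because it contains all powers with exponent
    \<open>e * j\<close>. If such an element lies in \<open>M\<close>, then so does its j-th root,
    since \<open>X / M\<close> is torsion-free; the j-th power of that root is in \<open>P\<close>,
    and hence the element is in \<open>P\<close>, inside \<open>K\<close>.\<close>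
  define H where "H = {x \<in> X1. \<exists>y\<in>X1. \<pi> x = \<pi> y [^]\<^bsub>Q\<^esub> j}"
  interpret X1: subgroup X1 G by (rule X1)
  have H: "subgroup H G"
  proof (rule subgroupI)
    show "H \<subseteq> carrier G" by (auto simp: H_def)
    have "\<pi> \<one> = \<one>\<^bsub>Q\<^esub>" using Q(6) subgroup.one_closed[OF P] by auto
    then have "\<one> \<in> H" 
      unfolding H_def by (intro CollectI conjI bexI[of _ \<one>]) simp_all
    then show "H \<noteq> {}" by blast
  next
    fix a assume "a \<in> H"
    then obtain y where y: "a \<in> X1" "y \<in> X1" "\<pi> a = \<pi> y [^]\<^bsub>Q\<^esub> j" by (auto simp: H_def)
    have "\<pi> (inv a) = \<pi> (inv y) [^]\<^bsub>Q\<^esub> j"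
      using y X1X \<pi>c by (simp add: Q(4) Q.nat_pow_inv)
    then show "inv a \<in> H" using y by (auto simp: H_def)
  next
    fix a b assume "a \<in> H" "b \<in> H"
    then obtain y z where y: "a \<in> X1" "y \<in> X1" "\<pi> a = \<pi> y [^]\<^bsub>Q\<^esub> j"
      "b \<in> X1" "z \<in> X1" "\<pi> b = \<pi> z [^]\<^bsub>Q\<^esub> j" by (auto simp: H_def)
    have "(\<pi> y \<otimes>\<^bsub>Q\<^esub> \<pi> z) [^]\<^bsub>Q\<^esub> j = \<pi> y [^]\<^bsub>Q\<^esub> j \<otimes>\<^bsub>Q\<^esub> \<pi> z [^]\<^bsub>Q\<^esub> j"
      using y X1X \<pi>c by (intro Q.pow_mult_distrib comm) auto
    then have "\<pi> (a \<otimes> b) = \<pi> (y \<otimes> z) [^]\<^bsub>Q\<^esub> j"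
      using y X1X by (simp add: Q(3))
    then show "a \<otimes> b \<in> H" using y by (auto simp: H_def)
  qed
  have HX: "H \<subseteq> X" by (auto simp: H_def X1_def)
  have "fin_index H X"
  proof (rule fin_index_powers[OF chX H])
    show "e * j > 0" using e(1) j(1) by simp
    fix x assume x: "x \<in> X"
    have xe: "x [^] e \<in> X1"
      unfolding X1_def using x e(2)[OF \<pi>c[OF x]] subgroup_nat_pow_closed[OF X x] by (simp add: \<pi>n)
    have "\<pi> ((x [^] e) [^] j) = \<pi> (x [^] e) [^]\<^bsub>Q\<^esub> j"
      using subgroup_nat_pow_closed[OF X x] by (intro \<pi>n) auto
    then have "(x [^] e) [^] j \<in> H"
      unfolding H_def using xe subgroup_nat_pow_closed[OF X1 xe] by auto
    then show "x [^] (e * j) \<in> H" using x by (simp add: nat_pow_pow)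
  qed
  moreover have "H \<inter> M \<subseteq> K"
  proof
    fix x assume "x \<in> H \<inter> M"
    then obtain y where xy: "x \<in> M" "y \<in> X1" "\<pi> x = \<pi> y [^]\<^bsub>Q\<^esub> j" by (auto simp: H_def)
    have yX: "y \<in> X" "y [^] j \<in> X" "x \<in> X" using xy X1X MX subgroup_nat_pow_closed[OF X] by auto
    have "\<pi> (inv x \<otimes> y [^] j) = \<one>\<^bsub>Q\<^esub>"
      using yX \<pi>c xy(3) by (simp add: Q(3,4) \<pi>n)
    then have p: "inv x \<otimes> y [^] j \<in> P" using Q(6)[of "inv x \<otimes> y [^] j"] yX by auto
    have "x \<otimes> (inv x \<otimes> y [^] j) \<in> M"
      by (rule M.m_closed) (use p PM xy(1) in auto)
    then have "y [^] j \<in> M" using yX by simp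
    then have "y \<in> M" using r yX(1) j(1) unfolding rank1_def by blast
    then have "y [^] j \<in> P" by (rule powP)
    then have "y [^] j \<otimes> inv (inv x \<otimes> y [^] j) \<in> P"
      using p P by (simp add: subgroup.m_closed subgroup.m_inv_closed)
    then have "x \<in> P" using yX by (simp add: inv_mult_group)
    then show "x \<in> K" using PK by auto
  qed
  ultimately show thesis using that H HX by blast
qed

end

section \<open>Finite index subgroups and normal cores\<close>

context group
begin

text \<open>A finite colouring that separates the left cosets of \<open>P\<close> replaces the
  counting of cosets. Colours combine into pairs and functions, which settles intersections, cores
  and kernels.\<close>

lemma fin_index_colour:
  assumes "finite C" "\<And>x. x \<in> X \<Longrightarrow> c x \<in> C"
    and "\<And>x y. x \<in> X \<Longrightarrow> y \<in> X \<Longrightarrow> c x = c y \<Longrightarrow> inv x \<otimes> y \<in> P"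
  shows "fin_index P X"
  unfolding fin_index_def
proof (intro exI conjI ballI)
  define r where "r u = (SOME x. x \<in> X \<and> c x = u)" for u
  have r: "r (c x) \<in> X \<and> c (r (c x)) = c x" if "x \<in> X" for x
    unfolding r_def by (rule someI[of _ x]) (use that in simp)
  show "finite (r ` c ` X)" using assms(1,2) by (auto intro: finite_subset)
  show "r ` c ` X \<subseteq> X" using r by auto
  fix x assume "x \<in> X"
  then show "\<exists>q\<in>r ` c ` X. inv q \<otimes> x \<in> P" using r assms(3) by blast
qed

lemma fin_index_colouring:
  assumes P: "subgroup P G" and X: "X \<subseteq> carrier G" and fi: "fin_index P X"
  obtains C :: "'a set" and c where "finite C" "\<And>x. x \<in> X \<Longrightarrow> c x \<in> C"
    "\<And>x y. x \<in> X \<Longrightarrow> y \<in> X \<Longrightarrow> c x = c y \<Longrightarrow> inv x \<otimes> y \<in> P"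
proof -
  obtain R where R: "finite R" "R \<subseteq> X" "\<And>x. x \<in> X \<Longrightarrow> \<exists>r\<in>R. inv r \<otimes> x \<in> P"
    using fi by (auto simp: fin_index_def)
  then obtain c where c: "\<And>x. x \<in> X \<Longrightarrow> c x \<in> R" "\<And>x. x \<in> X \<Longrightarrow> inv (c x) \<otimes> x \<in> P" by metis
  show thesis
  proof (rule that[OF R(1) c(1)])
    fix x y assume xy: "x \<in> X" "y \<in> X" "c x = c y"
    have cc: "c x \<in> carrier G" "x \<in> carrier G" "y \<in> carrier G" using c(1) R(2) X xy by auto
    have "inv (inv (c x) \<otimes> x) \<otimes> (inv (c x) \<otimes> y) \<in> P"
      using c(2)[OF xy(1)] c(2)[OF xy(2)] xy(3) P by (simp add: subgroup.m_closed subgroup.m_inv_closed)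
    then show "inv x \<otimes> y \<in> P" using cc by (simp add: inv_mult_group m_assoc)
  qed
qed

lemma fin_index_Int:
  assumes "subgroup P G" "subgroup P' G" "X \<subseteq> carrier G" "fin_index P X" "fin_index P' X"
  shows "fin_index (P \<inter> P') X"
proof -
  obtain C :: "'a set" and c where c: "finite C" "\<And>x. x \<in> X \<Longrightarrow> c x \<in> C"
    "\<And>x y. x \<in> X \<Longrightarrow> y \<in> X \<Longrightarrow> c x = c y \<Longrightarrow> inv x \<otimes> y \<in> P"
    using fin_index_colouring[OF assms(1,3,4)] by blast
  obtain C' :: "'a set" and c' where c': "finite C'" "\<And>x. x \<in> X \<Longrightarrow> c' x \<in> C'"
    "\<And>x y. x \<in> X \<Longrightarrow> y \<in> X \<Longrightarrow> c' x = c' y \<Longrightarrow> inv x \<otimes> y \<in> P'"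
    using fin_index_colouring[OF assms(2,3,5)] by blast
  show ?thesis
    by (rule fin_index_colour[of "C \<times> C'" X "\<lambda>x. (c x, c' x)"]) (use c c' in auto)
qed

lemma fin_index_Inter:
  assumes "finite I" "X \<subseteq> carrier G" "\<And>i. i \<in> I \<Longrightarrow> subgroup (P i) G" "\<And>i. i \<in> I \<Longrightarrow> fin_index (P i) X"
  shows "subgroup (carrier G \<inter> (\<Inter>i\<in>I. P i)) G \<and> fin_index (carrier G \<inter> (\<Inter>i\<in>I. P i)) X"
  using assms(1,3,4)
proof (induction I rule: finite_induct)
  case empty
  show ?case
    using assms(2) fin_index_colour[of "{()}" X "\<lambda>_. ()" "carrier G"] subgroup_self by (auto simp: subset_iff)
next
  case (insert i I)
  have "carrier G \<inter> (\<Inter>i\<in>insert i I. P i) = P i \<inter> (carrier G \<inter> (\<Inter>i\<in>I. P i))" by auto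
  moreover have "subgroup (P i) G" "subgroup (carrier G \<inter> (\<Inter>i\<in>I. P i)) G"
      "fin_index (P i) X" "fin_index (carrier G \<inter> (\<Inter>i\<in>I. P i)) X"
    using insert by auto
  ultimately show ?case
    using fin_index_Int[OF _ _ assms(2)] subgroups_Inter_pair by simp
qed

lemma fin_index_mono: "fin_index P X \<Longrightarrow> P \<subseteq> P' \<Longrightarrow> fin_index P' X"
  unfolding fin_index_def by (metis subsetD)

lemma fin_index_trans:
  assumes "subgroup K G" "subgroup H G" "X \<subseteq> carrier G" "H \<subseteq> X" "subgroup X G"
    and "fin_index K H" "fin_index H X"
  shows "fin_index K X"
proof -
  obtain R where R: "finite R" "R \<subseteq> X" "\<And>x. x \<in> X \<Longrightarrow> \<exists>r\<in>R. inv r \<otimes> x \<in> H"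
    using assms(7) by (auto simp: fin_index_def)
  obtain S where S: "finite S" "S \<subseteq> H" "\<And>x. x \<in> H \<Longrightarrow> \<exists>r\<in>S. inv r \<otimes> x \<in> K"
    using assms(6) by (auto simp: fin_index_def)
  show ?thesis
    unfolding fin_index_def
  proof (intro exI[of _ "(\<lambda>(r, s). r \<otimes> s) ` (R \<times> S)"] conjI ballI)
    have "r \<otimes> s \<in> X" if "r \<in> R" "s \<in> S" for r s
      by (rule subgroup.m_closed[OF assms(5)]) (use that R(2) S(2) assms(4) in blast)+
    then show "(\<lambda>(r, s). r \<otimes> s) ` (R \<times> S) \<subseteq> X" by auto
    fix x assume x: "x \<in> X"
    obtain r where r: "r \<in> R" "inv r \<otimes> x \<in> H" using R(3)[OF x] by blast
    obtain s where s: "s \<in> S" "inv s \<otimes> (inv r \<otimes> x) \<in> K" using S(3)[OF r(2)] by blast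
    have "r \<in> carrier G" "s \<in> carrier G" "x \<in> carrier G" using r s x R(2) S(2) assms(3,4) by auto
    then have "inv (r \<otimes> s) \<otimes> x \<in> K" using s(2) by (simp add: inv_mult_group m_assoc)
    then show "\<exists>q\<in>(\<lambda>(r, s). r \<otimes> s) ` (R \<times> S). inv q \<otimes> x \<in> K" using r(1) s(1) by force
  qed (use R(1) S(1) in auto)
qed

lemma finite_index_normalI:
  assumes norm: "N \<lhd> G" and fi: "fin_index N (carrier G)"
  shows "N \<in> finite_index_normal G"
proof -
  have N: "subgroup N G" using norm by (rule normal_imp_subgroup)
  obtain S where S: "finite S" "S \<subseteq> carrier G" "\<And>x. x \<in> carrier G \<Longrightarrow> \<exists>r\<in>S. inv r \<otimes> x \<in> N"
    using fi unfolding fin_index_def by blast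
  have "rcosets N \<subseteq> (\<lambda>s. N #> s) ` S"
  proof
    fix D assume "D \<in> rcosets N"
    then obtain x where x: "x \<in> carrier G" "D = N #> x" by (auto simp: RCOSETS_def)
    obtain s where s: "s \<in> S" "inv s \<otimes> x \<in> N" using S(3)[OF x(1)] by blast
    have sc: "s \<in> carrier G" using s S(2) by auto
    \<comment> \<open>\<open>fin_index\<close> speaks of left cosets and \<open>rcosets\<close> of
      right ones; normality exchanges them.\<close>
    have "s \<otimes> (inv s \<otimes> x) \<otimes> inv s \<in> N" using norm s(2) sc unfolding normal_inv_iff by blast
    then have "x \<otimes> inv s \<in> N" using sc x(1) by simp
    then have "N #> s = D"
      using x sc N by (metis repr_independence subgroup.rcos_module_rev group_axioms)
    then show "D \<in> (\<lambda>s. N #> s) ` S" using s(1) by blast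
  qed
  then have "finite (rcosets N)" using S(1) finite_subset by blast
  then show ?thesis using norm by (simp add: finite_index_normal_def)
qed

lemma finite_index_normal_core:
  assumes P: "subgroup P G" and fi: "fin_index P (carrier G)"
  obtains N where "N \<in> finite_index_normal G" "N \<subseteq> P"
proof -
  interpret P: subgroup P G by (rule P)
  obtain C :: "'a set" and c where c: "finite C" "\<And>x. x \<in> carrier G \<Longrightarrow> c x \<in> C"
    "\<And>x y. x \<in> carrier G \<Longrightarrow> y \<in> carrier G \<Longrightarrow> c x = c y \<Longrightarrow> inv x \<otimes> y \<in> P"
    using fin_index_colouring[OF P order_refl fi] by blast
  obtain R where R: "finite R" "R \<subseteq> carrier G" "\<And>x. x \<in> carrier G \<Longrightarrow> \<exists>r\<in>R. inv r \<otimes> x \<in> P"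
    using fi unfolding fin_index_def by blast
  define N where "N = {x \<in> carrier G. \<forall>g\<in>carrier G. inv g \<otimes> x \<otimes> g \<in> P}"
  have N: "subgroup N G"
  proof (rule subgroupI)
    have "\<one> \<in> N" by (simp add: N_def)
    then show "N \<noteq> {}" by blast
  next
    fix a assume a: "a \<in> N"
    have "inv g \<otimes> inv a \<otimes> g \<in> P" if g: "g \<in> carrier G" for g
    proof -
      have "inv (inv g \<otimes> a \<otimes> g) \<in> P" using a g by (simp add: N_def)
      then show ?thesis using a g by (simp add: N_def inv_mult_group m_assoc)
    qed
    then show "inv a \<in> N" using a by (simp add: N_def)
  next
    fix a b assume ab: "a \<in> N" "b \<in> N"
    have "inv g \<otimes> (a \<otimes> b) \<otimes> g \<in> P" if g: "g \<in> carrier G" for g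
    proof -
      have "(inv g \<otimes> a \<otimes> g) \<otimes> (inv g \<otimes> b \<otimes> g) \<in> P" using ab g by (simp add: N_def)
      then show ?thesis using ab g by (simp add: N_def m_assoc)
    qed
    then show "a \<otimes> b \<in> N" using ab by (simp add: N_def)
  qed (auto simp: N_def)
  have norm: "N \<lhd> G"
    unfolding normal_inv_iff
  proof (intro conjI ballI)
    fix x h assume x: "x \<in> carrier G" and h: "h \<in> N"
    have "inv g \<otimes> (x \<otimes> h \<otimes> inv x) \<otimes> g \<in> P" if g: "g \<in> carrier G" for g
    proof -
      have "inv (inv x \<otimes> g) \<otimes> h \<otimes> (inv x \<otimes> g) \<in> P" using h g x unfolding N_def by blast
      then show ?thesis using h x g by (simp add: N_def inv_mult_group m_assoc)
    qed
    then show "x \<otimes> h \<otimes> inv x \<in> N" using x h by (simp add: N_def)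
  qed (rule N)
  \<comment> \<open>The colour of \<open>x\<close> lists the cosets of \<open>x \<otimes> r\<close>
    over all representatives \<open>r\<close>, that is, the permutation of the cosets of
    \<open>P\<close> induced by \<open>x\<close>. Equal colours mean that the quotient of the two
    elements fixes every coset.\<close>
  have "fin_index N (carrier G)"
  proof (rule fin_index_colour[where C = "R \<rightarrow>\<^sub>E C" and c = "\<lambda>x. \<lambda>r\<in>R. c (x \<otimes> r)"])
    show "finite (R \<rightarrow>\<^sub>E C)" using R(1) c(1) by (simp add: finite_PiE)
    show "(\<lambda>r\<in>R. c (x \<otimes> r)) \<in> R \<rightarrow>\<^sub>E C" if "x \<in> carrier G" for x using that R(2) c(2) by auto
    fix x y assume xy: "x \<in> carrier G" "y \<in> carrier G" "(\<lambda>r\<in>R. c (x \<otimes> r)) = (\<lambda>r\<in>R. c (y \<otimes> r))"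
    have "inv g \<otimes> (inv x \<otimes> y) \<otimes> g \<in> P" if g: "g \<in> carrier G" for g
    proof -
      obtain r where r: "r \<in> R" "inv r \<otimes> g \<in> P" using R(3)[OF g] by blast
      have rc: "r \<in> carrier G" using r R(2) by auto
      have "c (x \<otimes> r) = c (y \<otimes> r)" using xy(3) r(1) by (metis restrict_apply')
      then have "inv (x \<otimes> r) \<otimes> (y \<otimes> r) \<in> P" using c(3) xy rc by simp
      then have "inv (inv r \<otimes> g) \<otimes> (inv (x \<otimes> r) \<otimes> (y \<otimes> r)) \<otimes> (inv r \<otimes> g) \<in> P" using r(2) by simp
      then show ?thesis using xy rc g by (simp add: inv_mult_group m_assoc)
    qed
    then show "inv x \<otimes> y \<in> N" using xy by (simp add: N_def)
  qed
  with norm have "N \<in> finite_index_normal G" by (rule finite_index_normalI)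
  moreover have "N \<subseteq> P"
  proof
    fix x assume x: "x \<in> N"
    then have "inv \<one> \<otimes> x \<otimes> \<one> \<in> P" unfolding N_def by blast
    then show "x \<in> P" using x by (simp add: N_def)
  qed
  ultimately show thesis by (rule that)
qed

lemma finite_index_normalD:
  assumes "N \<in> finite_index_normal G"
  shows "N \<lhd> G" "subgroup N G" "fin_index N (carrier G)" "N \<subseteq> carrier G"
    "\<And>x n. x \<in> carrier G \<Longrightarrow> n \<in> N \<Longrightarrow> x \<otimes> n \<otimes> inv x \<in> N"
    "\<And>x n. x \<in> carrier G \<Longrightarrow> n \<in> N \<Longrightarrow> inv x \<otimes> n \<otimes> x \<in> N"
proof -
  show N: "N \<lhd> G" using assms by (simp add: finite_index_normal_def)
  then show N1: "subgroup N G" by (rule normal_imp_subgroup)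
  then show "N \<subseteq> carrier G" by (rule subgroup.subset)
  show "\<And>x n. x \<in> carrier G \<Longrightarrow> n \<in> N \<Longrightarrow> x \<otimes> n \<otimes> inv x \<in> N"
    using N by (rule normal.inv_op_closed2)
  show "\<And>x n. x \<in> carrier G \<Longrightarrow> n \<in> N \<Longrightarrow> inv x \<otimes> n \<otimes> x \<in> N"
    using N by (rule normal.inv_op_closed1)
  show "fin_index N (carrier G)"
  \<comment> \<open>The inverse turns right cosets into left ones.\<close>
  proof (rule fin_index_colour[where C = "rcosets N" and c = "\<lambda>x. N #> inv x"])
    show "finite (rcosets N)" using assms by (simp add: finite_index_normal_def)
    show "N #> inv x \<in> rcosets N" if "x \<in> carrier G" for x
      using that N1 by (simp add: rcosetsI subgroup.subset)
    fix x y assume xy: "x \<in> carrier G" "y \<in> carrier G" "N #> inv x = N #> inv y"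
    then have "inv x \<in> N #> inv y" using rcos_self[OF _ N1, of "inv x"] by simp
    then have "inv x \<otimes> inv (inv y) \<in> N" using xy subgroup.rcos_module_imp[OF N1 group_axioms, of "inv y" "inv x"] by simp
    then show "inv x \<otimes> y \<in> N" using xy by simp
  qed
qed

end

section \<open>Homogeneous cochains\<close>

text \<open>The alternating sum over the deletions of one entry, unfolded along the first entry so
  that its identities follow by induction on the list. A list with one entry yields
  \<open>f []\<close>, hence the complex is augmented.\<close>

fun cob :: "('b list \<Rightarrow> 'v::ab_group_add) \<Rightarrow> 'b list \<Rightarrow> 'v" where
  "cob f [] = 0"
| "cob f (z # zs) = f zs - cob (\<lambda>w. f (z # w)) zs"

lemma cob_zero [simp]: "cob (\<lambda>_. 0) xs = 0"
  by (induction xs) auto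

lemma cob_add: "cob (\<lambda>w. f w + g w) xs = cob f xs + cob g xs"
  by (induction xs arbitrary: f g) (auto simp: algebra_simps)

lemma cob_minus: "cob (\<lambda>w. - f w) xs = - cob f xs"
  by (induction xs arbitrary: f) (auto simp: algebra_simps)

lemma cob_diff: "cob (\<lambda>w. f w - g w) xs = cob f xs - cob g xs"
  using cob_add[of f "\<lambda>w. - g w" xs] by (simp add: cob_minus)

lemma cob_cob [simp]: "cob (cob f) xs = 0"
  by (induction xs arbitrary: f) (auto simp: cob_diff)

lemma cob_map: "cob f (map g xs) = cob (\<lambda>w. f (map g w)) xs"
  by (induction xs arbitrary: f) auto

lemma additive_zero_diff:
  fixes T :: "'v::ab_group_add \<Rightarrow> 'u::ab_group_add"
  assumes "\<And>u v. T (u + v) = T u + T v"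
  shows "T 0 = 0" "T (u - v) = T u - T v"
proof -
  show z: "T 0 = 0" using assms[of 0 0] by simp
  show "T (u - v) = T u - T v" using assms[of "u - v" v] by simp
qed

lemma cob_additive:
  assumes "\<And>u v. T (u + v) = T u + T v"
  shows "T (cob f xs) = cob (\<lambda>w. T (f w)) xs"
  by (induction xs arbitrary: f) (auto simp: additive_zero_diff[OF assms])

text \<open>Differentials in separate blocks of variables commute without a sign; the double complex
  built from them is a commuting one.\<close>

lemma cob_commute:
  "cob (\<lambda>w. cob (f w) ys) xs = cob (\<lambda>v. cob (\<lambda>w. f w v) xs) ys"
  by (induction xs arbitrary: f) (auto simp: cob_diff)

text \<open>Only finitely many values of \<open>f\<close> enter into \<open>cob f xs\<close>. This
  makes an equation between coboundaries a closed condition in the compactness argument.\<close>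

lemma cob_cong_len:
  assumes "\<And>w. length w + 1 = length xs \<Longrightarrow> set w \<subseteq> set xs \<Longrightarrow> f w = g w"
  shows "cob f xs = cob g xs"
  using assms
proof (induction xs arbitrary: f g)
  case (Cons z zs)
  have "cob (\<lambda>w. f (z # w)) zs = cob (\<lambda>w. g (z # w)) zs"
    by (rule Cons.IH, rule Cons.prems) auto
  moreover have "f zs = g zs" by (rule Cons.prems) auto
  ultimately show ?case by simp
qed simp

text \<open>The values lie in a type with addition on which \<open>act g\<close> is additive for
  every \<open>g\<close>, so \<open>act\<close> passes through \<open>cob\<close> without side
  conditions. The finite module itself is the invariant set \<open>B\<close>.\<close>

locale finite_gmodule = group G for G (structure) +
  fixes act :: "'a \<Rightarrow> 'v::ab_group_add \<Rightarrow> 'v" and B :: "'v set"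
  assumes act_add: "act g (u + v) = act g u + act g v"
    and act_one [simp]: "act \<one> u = u"
    and act_mult: "g \<in> carrier G \<Longrightarrow> h \<in> carrier G \<Longrightarrow> act (g \<otimes> h) u = act g (act h u)"
    and finite_B: "finite B"
    and zero_B [simp]: "0 \<in> B"
    and diff_B: "u \<in> B \<Longrightarrow> v \<in> B \<Longrightarrow> u - v \<in> B"
    and act_B: "g \<in> carrier G \<Longrightarrow> u \<in> B \<Longrightarrow> act g u \<in> B"
begin

lemma act_zero [simp]: "act g 0 = 0"
  by (rule additive_zero_diff) (rule act_add)

lemma act_diff: "act g (u - v) = act g u - act g v"
  by (rule additive_zero_diff) (rule act_add)

lemma act_minus: "act g (- v) = - act g v"
  using act_diff[of g 0 v] by simp

lemma minus_B: "u \<in> B \<Longrightarrow> - u \<in> B"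
  using diff_B[of 0 u] by simp

lemma add_B: "u \<in> B \<Longrightarrow> v \<in> B \<Longrightarrow> u + v \<in> B"
  using diff_B[of u "- v"] minus_B by simp

lemma act_inv_cancel [simp]:
  assumes "g \<in> carrier G"
  shows "act g (act (inv g) u) = u" "act (inv g) (act g u) = u"
  using assms by (simp_all flip: act_mult)

declare map_map [simp del]

definition lists_n :: "nat \<Rightarrow> 'a list set" where
  "lists_n n = {xs. length xs = n \<and> set xs \<subseteq> carrier G}"

abbreviation lmul :: "'a \<Rightarrow> 'a list \<Rightarrow> 'a list" where
  "lmul g xs \<equiv> map (\<lambda>x. g \<otimes> x) xs"

lemma lists_0 [simp]: "lists_n 0 = {[]}"
  by (auto simp: lists_n_def)

lemma lists_Cons [simp]: "x # xs \<in> lists_n (Suc n) \<longleftrightarrow> x \<in> carrier G \<and> xs \<in> lists_n n"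
  by (auto simp: lists_n_def)

lemma lists_SucE:
  assumes "xs \<in> lists_n (Suc n)"
  obtains y ys where "xs = y # ys" "y \<in> carrier G" "ys \<in> lists_n n"
  using assms by (cases xs) (auto simp: lists_n_def)

lemma lists_lmul [simp]: "g \<in> carrier G \<Longrightarrow> xs \<in> lists_n n \<Longrightarrow> lmul g xs \<in> lists_n n"
  by (auto simp: lists_n_def)

lemma lmul_lmul:
  "g \<in> carrier G \<Longrightarrow> h \<in> carrier G \<Longrightarrow> xs \<in> lists_n n \<Longrightarrow> lmul g (lmul h xs) = lmul (g \<otimes> h) xs"
  by (auto simp: lists_n_def m_assoc map_map)

lemma lmul_one: "xs \<in> lists_n n \<Longrightarrow> lmul \<one> xs = xs"
  by (auto simp: lists_n_def intro!: map_idI)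

lemma lmul_inv [simp]:
  assumes "g \<in> carrier G" "xs \<in> lists_n n"
  shows "lmul g (lmul (inv g) xs) = xs" "lmul (inv g) (lmul g xs) = xs"
  using assms by (simp_all add: lmul_lmul[of _ _ _ n] lmul_one)

lemma cob_cong:
  assumes "\<And>w. w \<in> lists_n n \<Longrightarrow> f w = g w" "xs \<in> lists_n (Suc n)"
  shows "cob f xs = cob g xs"
  by (rule cob_cong_len, rule assms(1)) (use assms(2) in \<open>auto simp: lists_n_def\<close>)

lemma cob_B:
  assumes "\<And>w. w \<in> lists_n n \<Longrightarrow> f w \<in> B" "xs \<in> lists_n (Suc n)"
  shows "cob f xs \<in> B"
  using assms
proof (induction n arbitrary: f xs)
  case 0
  then show ?case by (auto elim!: lists_SucE)
next
  case (Suc n)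
  from Suc.prems(2) obtain y ys where xs: "xs = y # ys" "y \<in> carrier G" "ys \<in> lists_n (Suc n)"
    by (rule lists_SucE)
  have "cob (\<lambda>w. f (y # w)) ys \<in> B"
    by (rule Suc.IH) (use Suc.prems xs in auto)
  then show ?case using xs Suc.prems by (auto intro: diff_B)
qed

text \<open>The index counts the entries of the lists, which come from the whole group \<open>G\<close> and form a free
  \<open>H\<close>-set: for \<open>n > 0\<close>, \<open>H\<^sup>n(H, B)\<close> is \<open>cocycle H (Suc n)\<close> modulo \<open>cobound H n\<close>.  All subgroups thus
  share the same domain of cochains, and restriction is inclusion.\<close>

definition cochain :: "'a set \<Rightarrow> nat \<Rightarrow> ('a list \<Rightarrow> 'v) set" where
  "cochain H n = {f. (\<forall>xs\<in>lists_n n. f xs \<in> B) \<and>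
     (\<forall>h\<in>H. \<forall>xs\<in>lists_n n. f (lmul h xs) = act h (f xs))}"

definition cocycle :: "'a set \<Rightarrow> nat \<Rightarrow> ('a list \<Rightarrow> 'v) set" where
  "cocycle H n = {f \<in> cochain H n. \<forall>xs\<in>lists_n (Suc n). cob f xs = 0}"

definition cobound :: "'a set \<Rightarrow> nat \<Rightarrow> ('a list \<Rightarrow> 'v) set" where
  "cobound H n = {f. \<exists>h\<in>cochain H n. \<forall>xs\<in>lists_n (Suc n). f xs = cob h xs}"

lemma cochain_B: "f \<in> cochain H n \<Longrightarrow> xs \<in> lists_n n \<Longrightarrow> f xs \<in> B"
  by (auto simp: cochain_def)

lemma cochain_act: "f \<in> cochain H n \<Longrightarrow> h \<in> H \<Longrightarrow> xs \<in> lists_n n \<Longrightarrow> f (lmul h xs) = act h (f xs)"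
  by (auto simp: cochain_def)

lemma cochain_anti: "K \<subseteq> H \<Longrightarrow> cochain H n \<subseteq> cochain K n"
  by (auto simp: cochain_def)

lemma cocycle_anti: "K \<subseteq> H \<Longrightarrow> cocycle H n \<subseteq> cocycle K n"
  using cochain_anti[of K H n] by (auto simp: cocycle_def)

lemma cobound_anti: "K \<subseteq> H \<Longrightarrow> cobound H n \<subseteq> cobound K n"
  using cochain_anti[of K H n] by (auto simp: cobound_def)

lemma cochain_zero: "(\<lambda>_. 0) \<in> cochain H n"
  by (auto simp: cochain_def)

lemma cochain_diff: "f \<in> cochain H n \<Longrightarrow> g \<in> cochain H n \<Longrightarrow> (\<lambda>x. f x - g x) \<in> cochain H n"
  by (auto simp: cochain_def act_diff diff_B)

lemma cochain_add: "f \<in> cochain H n \<Longrightarrow> g \<in> cochain H n \<Longrightarrow> (\<lambda>x. f x + g x) \<in> cochain H n"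
  by (auto simp: cochain_def act_add add_B)

lemma cocycle_diff: "f \<in> cocycle H n \<Longrightarrow> g \<in> cocycle H n \<Longrightarrow> (\<lambda>x. f x - g x) \<in> cocycle H n"
  by (auto simp: cocycle_def cob_diff cochain_diff)

lemma cobound_diff: 
  assumes "f \<in> cobound H n" "g \<in> cobound H n" shows "(\<lambda>x. f x - g x) \<in> cobound H n"
proof -
  obtain h k where "h\<in>cochain H n" "\<forall>xs\<in>lists_n (Suc n). f xs = cob h xs"
     "k\<in>cochain H n" "\<forall>xs\<in>lists_n (Suc n). g xs = cob k xs"
    using assms by (auto simp: cobound_def)
  then show ?thesis
    by (auto simp: cobound_def cob_diff intro!: bexI[of _ "\<lambda>x. h x - k x"] cochain_diff)
qed

lemma cobound_add: 
  assumes "f \<in> cobound H n" "g \<in> cobound H n" shows "(\<lambda>x. f x + g x) \<in> cobound H n"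
proof -
  obtain h k where "h\<in>cochain H n" "\<forall>xs\<in>lists_n (Suc n). f xs = cob h xs"
     "k\<in>cochain H n" "\<forall>xs\<in>lists_n (Suc n). g xs = cob k xs"
    using assms by (auto simp: cobound_def)
  then show ?thesis
    by (auto simp: cobound_def cob_add intro!: bexI[of _ "\<lambda>x. h x + k x"] cochain_add)
qed

lemma cob_cochain:
  assumes H: "H \<subseteq> carrier G" and f: "f \<in> cochain H n"
  shows "cob f \<in> cochain H (Suc n)"
proof -
  have "cob f (lmul h xs) = act h (cob f xs)" if "h \<in> H" "xs \<in> lists_n (Suc n)" for h xs
  proof -
    have "cob f (lmul h xs) = cob (\<lambda>w. f (lmul h w)) xs" by (rule cob_map)
    also have "\<dots> = cob (\<lambda>w. act h (f w)) xs"
      by (rule cob_cong[OF _ that(2)]) (use f that in \<open>auto simp: cochain_act\<close>)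
    also have "\<dots> = act h (cob f xs)" by (rule cob_additive[symmetric]) (rule act_add)
    finally show ?thesis .
  qed
  moreover have "cob f xs \<in> B" if "xs \<in> lists_n (Suc n)" for xs
    by (rule cob_B[OF _ that]) (rule cochain_B[OF f])
  ultimately show ?thesis by (auto simp: cochain_def)
qed

text \<open>A cocycle of one variable is constant and its value is fixed by \<open>H\<close>;
  \<open>cochain H 0\<close> consists of such values at the empty list. So the augmented complex has
  no cohomology in degree zero and nothing has to be shrunk there.\<close>

lemma cocycle_1_cobound:
  assumes H: "H \<subseteq> carrier G"
  shows "cocycle H (Suc 0) \<subseteq> cobound H 0"
proof
  fix f assume f: "f \<in> cocycle H (Suc 0)"
  have c: "f [x] = f [\<one>]" if "x \<in> carrier G" for x
  proof -
    have "[\<one>, x] \<in> lists_n (Suc (Suc 0))" using that by simp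
    then have "cob f [\<one>, x] = 0" using f unfolding cocycle_def by blast
    then show ?thesis by simp
  qed
  have "f [\<one>] = act h (f [\<one>])" if "h \<in> H" for h
  proof -
    have "f (lmul h [\<one>]) = act h (f [\<one>])"
      by (rule cochain_act) (use f that in \<open>auto simp: cocycle_def\<close>)
    then show ?thesis using c[of h] that H by auto
  qed
  moreover have "f [\<one>] \<in> B" using f by (auto simp: cocycle_def cochain_def)
  ultimately have h: "(\<lambda>_. f [\<one>]) \<in> cochain H 0" by (simp add: cochain_def)
  have "f xs = cob (\<lambda>_. f [\<one>]) xs" if xs: "xs \<in> lists_n (Suc 0)" for xs
  proof -
    obtain x ys where x: "xs = x # ys" "x \<in> carrier G" "ys \<in> lists_n 0"
      using xs by (rule lists_SucE)
    show ?thesis using c[OF x(2)] x by simp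
  qed
  then have "\<forall>xs\<in>lists_n (Suc 0). f xs = cob (\<lambda>_. f [\<one>]) xs" by blast
  with h show "f \<in> cobound H 0"
    unfolding cobound_def by blast
qed

text \<open>Both inclusions are demanded because for infinite \<open>M\<close> a conjugate can be
  properly contained in \<open>M\<close>.\<close>

definition normalizes :: "'a \<Rightarrow> 'a set \<Rightarrow> bool" where
  "normalizes t M \<longleftrightarrow> (\<forall>m\<in>M. t \<otimes> m \<otimes> inv t \<in> M \<and> inv t \<otimes> m \<otimes> t \<in> M)"

lemma normalizes_int_pow:
  assumes M: "M \<subseteq> carrier G" and t: "t \<in> carrier G" "normalizes t M"
  shows "normalizes (t [^] (k::int)) M"
proof -
  have "subgroup {t \<in> carrier G. normalizes t M} G"
  proof (rule subgroupI)
    have "normalizes \<one> M" using M by (auto simp: normalizes_def)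
    then show "{t \<in> carrier G. normalizes t M} \<noteq> {}" by auto
  next
    fix a b
    assume ab: "a \<in> {t \<in> carrier G. normalizes t M}" "b \<in> {t \<in> carrier G. normalizes t M}"
    have "a \<otimes> b \<otimes> m \<otimes> inv (a \<otimes> b) \<in> M \<and> inv (a \<otimes> b) \<otimes> m \<otimes> (a \<otimes> b) \<in> M" if m: "m \<in> M" for m
    proof -
      have "a \<otimes> (b \<otimes> m \<otimes> inv b) \<otimes> inv a \<in> M" "inv b \<otimes> (inv a \<otimes> m \<otimes> a) \<otimes> b \<in> M"
        using ab m by (auto simp: normalizes_def)
      then show ?thesis
        using ab m M by (auto simp: inv_mult_group m_assoc subset_iff)
    qed
    then show "a \<otimes> b \<in> {t \<in> carrier G. normalizes t M}"
      using ab by (auto simp: normalizes_def)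
  qed (auto simp: normalizes_def)
  from subgroup_int_pow_closed[OF this, of t k] t show ?thesis by simp
qed

text \<open>A function on \<open>G\<close> which is constant on the cosets \<open>M x\<close> and counts powers of \<open>t\<close>:
  this is where freeness of the left action of \<open>\<langle>M, t\<rangle>\<close> on \<open>G\<close> is used.\<close>

lemma power_counter:
  assumes M: "subgroup M G" and t: "t \<in> carrier G" "normalizes t M"
    and free: "\<And>k::int. k \<noteq> 0 \<Longrightarrow> t [^] k \<notin> M"
  obtains \<kappa> :: "'a \<Rightarrow> int" where "\<And>m x. m \<in> M \<Longrightarrow> x \<in> carrier G \<Longrightarrow> \<kappa> (m \<otimes> x) = \<kappa> x"
    and "\<And>x. x \<in> carrier G \<Longrightarrow> \<kappa> (t \<otimes> x) = \<kappa> x + 1"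
proof -
  interpret M: subgroup M G by (rule M)
  note Mc = M.subset
  \<comment> \<open>The orbit of \<open>x\<close> under \<langle>M, t\<rangle>. Relative to a chosen
    base point \<open>\<rho> x\<close> of the orbit the exponent of \<open>t\<close> is well
    defined, since no nonzero power of \<open>t\<close> lies in \<open>M\<close>.\<close>
  define Y where "Y x = {m \<otimes> t [^] k \<otimes> x | m (k::int). m \<in> M}" for x
  have norm: "t [^] (k::int) \<otimes> m \<otimes> inv (t [^] k) \<in> M" if "m \<in> M" for m k
    using normalizes_int_pow[OF Mc t, of k] that by (auto simp: normalizes_def)
  have Ysub: "Y (m \<otimes> t [^] (k::int) \<otimes> x) \<subseteq> Y x" if "m \<in> M" "x \<in> carrier G" for m k x
  proof
    fix z assume "z \<in> Y (m \<otimes> t [^] k \<otimes> x)"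
    then obtain m' k' where z: "m' \<in> M" "z = m' \<otimes> t [^] (k'::int) \<otimes> (m \<otimes> t [^] k \<otimes> x)"
      by (auto simp: Y_def)
    have "z = (m' \<otimes> (t [^] k' \<otimes> m \<otimes> inv (t [^] k'))) \<otimes> t [^] (k' + k) \<otimes> x"
      using z that t(1) by (simp add: m_assoc int_pow_mult)
    then show "z \<in> Y x" using norm[OF that(1), of k'] z(1) unfolding Y_def by blast
  qed
  have Yeq: "Y (m \<otimes> t [^] (k::int) \<otimes> x) = Y x" if "m \<in> M" "x \<in> carrier G" for m k x
  proof
    let ?y = "m \<otimes> t [^] k \<otimes> x"
    let ?m = "t [^] (- k) \<otimes> inv m \<otimes> inv (t [^] (- k))"
    have m': "?m \<in> M" using norm[of "inv m" "- k"] that by simp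
    have "?m \<otimes> t [^] (- k) \<otimes> ?y = x"
      using that t(1) by (simp add: m_assoc int_pow_neg)
    then have "Y x \<subseteq> Y ?y" using Ysub[OF m', of ?y "- k"] that t(1) by simp
    then show "Y x \<subseteq> Y ?y" .
  qed (rule Ysub[OF that])
  define \<rho> where "\<rho> x = (SOME y. y \<in> Y x)" for x
  have self: "x \<in> Y x" if "x \<in> carrier G" for x
    unfolding Y_def using that M.one_closed by (intro CollectI exI[of _ \<one>] exI[of _ "0::int"]) auto
  have \<rho>Y: "\<rho> x \<in> Y x" if "x \<in> carrier G" for x
    unfolding \<rho>_def using self[OF that] by (rule someI)
  have \<rho>c: "\<rho> x \<in> carrier G" if "x \<in> carrier G" for x
    using \<rho>Y[OF that] t(1) that by (auto simp: Y_def)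
  have uniq: "k = k'" if "x \<in> carrier G" "m \<in> M" "m' \<in> M" "m \<otimes> t [^] (k::int) \<otimes> x = m' \<otimes> t [^] (k'::int) \<otimes> x" for m m' k k' x
  proof (rule ccontr)
    assume "k \<noteq> k'"
    have "m \<otimes> t [^] k = m' \<otimes> t [^] k'" using that t(1) by simp
    then have "inv m' \<otimes> (m \<otimes> t [^] k) \<otimes> inv (t [^] k') = inv m' \<otimes> (m' \<otimes> t [^] k') \<otimes> inv (t [^] k')" by simp
    then have "(inv m' \<otimes> m) \<otimes> t [^] (k - k') = \<one>"
      using that t(1) by (simp add: m_assoc int_pow_diff)
    then have "t [^] (k - k') = inv (inv m' \<otimes> m)"
      using that t(1) by (metis M.mem_carrier M.m_closed M.m_inv_closed int_pow_closed inv_equality inv_inv)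
    then have "t [^] (k - k') \<in> M" using that by simp
    then show False using free[of "k - k'"] \<open>k \<noteq> k'\<close> by simp
  qed
  define \<kappa> where "\<kappa> x = (THE k::int. \<exists>m\<in>M. x = m \<otimes> t [^] k \<otimes> \<rho> x)" for x
  have \<kappa>I: "\<kappa> x = k" if "x \<in> carrier G" "m \<in> M" "x = m \<otimes> t [^] k \<otimes> \<rho> x" for x m k
    unfolding \<kappa>_def using that uniq[OF \<rho>c[OF that(1)]] by (intro the_equality) (blast, metis)
  have \<kappa>E: "\<exists>m\<in>M. x = m \<otimes> t [^] \<kappa> x \<otimes> \<rho> x" if x: "x \<in> carrier G" for x
  proof -
    obtain m k where mk: "m \<in> M" "\<rho> x = m \<otimes> t [^] (k::int) \<otimes> x"
      using \<rho>Y[OF x] by (auto simp: Y_def)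
    have "Y (\<rho> x) = Y x" using Yeq[OF mk(1) x] mk(2) by simp
    then have "x \<in> Y (\<rho> x)" using self[OF x] by simp
    then obtain m' k' where "m' \<in> M" "x = m' \<otimes> t [^] (k'::int) \<otimes> \<rho> x"
      by (auto simp: Y_def)
    with \<kappa>I[OF x this] show ?thesis by blast
  qed
  show thesis
  proof
    fix m x assume mx: "m \<in> M" "x \<in> carrier G"
    obtain m' where m': "m' \<in> M" "x = m' \<otimes> t [^] \<kappa> x \<otimes> \<rho> x" using \<kappa>E[OF mx(2)] by blast
    have "Y (m \<otimes> x) = Y x" using Yeq[OF mx, of 0] mx by simp
    then have \<rho>eq: "\<rho> (m \<otimes> x) = \<rho> x" by (simp add: \<rho>_def)
    have "m \<otimes> x = m \<otimes> (m' \<otimes> t [^] \<kappa> x \<otimes> \<rho> x)" using m' by simp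
    also have "\<dots> = (m \<otimes> m') \<otimes> t [^] \<kappa> x \<otimes> \<rho> (m \<otimes> x)"
      using m'(1) mx t(1) \<rho>c by (simp add: \<rho>eq m_assoc)
    finally show "\<kappa> (m \<otimes> x) = \<kappa> x" using mx m'(1) by (intro \<kappa>I) auto
  next
    fix x assume x: "x \<in> carrier G"
    obtain m' where m': "m' \<in> M" "x = m' \<otimes> t [^] \<kappa> x \<otimes> \<rho> x" using \<kappa>E[OF x] by blast
    have "Y (t \<otimes> x) = Y x" using Yeq[OF M.one_closed x, of 1] x t(1) by (simp add: int_pow_1)
    then have \<rho>eq: "\<rho> (t \<otimes> x) = \<rho> x" by (simp add: \<rho>_def)
    have "t \<otimes> x = t \<otimes> (m' \<otimes> t [^] \<kappa> x \<otimes> \<rho> x)" using m' by simp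
    also have "\<dots> = (t \<otimes> m' \<otimes> inv t) \<otimes> t [^] (1 + \<kappa> x) \<otimes> \<rho> (t \<otimes> x)"
      using m'(1) x t(1) \<rho>c by (simp add: \<rho>eq m_assoc int_pow_mult int_pow_1)
    finally have "\<kappa> (t \<otimes> x) = 1 + \<kappa> x"
      using x t m'(1) by (intro \<kappa>I) (auto simp: normalizes_def)
    then show "\<kappa> (t \<otimes> x) = \<kappa> x + 1" by simp
  qed
qed

end

section \<open>The Wang sequence of an infinite cyclic extension\<close>

context finite_gmodule
begin

text \<open>Cochains with at least one variable form a coinduced module for the infinite cyclic
  group generated by \<open>t\<close> modulo \<open>M\<close>, and on such a module
  \<open>t - 1\<close> is onto: along each orbit the equation is solved by summing translates of
  \<open>l\<close>, starting where \<open>\<kappa>\<close> is zero. The Wang sequence results from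
  this surjectivity.\<close>

lemma shift_surj:
  assumes M: "subgroup M G" and t: "t \<in> carrier G" "normalizes t M"
    and free: "\<And>k::int. k \<noteq> 0 \<Longrightarrow> t [^] k \<notin> M"
    and l: "l \<in> cochain M (Suc n)"
  obtains p where "p \<in> cochain M (Suc n)"
    and "\<And>xs. xs \<in> lists_n (Suc n) \<Longrightarrow> act t (p (lmul (inv t) xs)) - p xs = l xs"
proof -
  interpret M: subgroup M G by (rule M)
  obtain \<kappa> :: "'a \<Rightarrow> int" where \<kappa>M: "\<And>m x. m \<in> M \<Longrightarrow> x \<in> carrier G \<Longrightarrow> \<kappa> (m \<otimes> x) = \<kappa> x"
    and \<kappa>t: "\<And>x. x \<in> carrier G \<Longrightarrow> \<kappa> (t \<otimes> x) = \<kappa> x + 1"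
    using power_counter[OF M t free] by blast
  define T where "T i xs = act (t [^] i) (l (lmul (inv (t [^] i)) xs))" for i :: int and xs
  \<comment> \<open>The sum of the translates \<open>T i\<close> for \<open>0 \<le> i < k\<close>,
    continued to negative \<open>k\<close> so that consecutive values of \<open>q\<close> always
    differ by \<open>T k\<close>.\<close>
  define q where "q k xs = (\<Sum>i\<in>{0..<k}. T i xs) - (\<Sum>i\<in>{k..<0}. T i xs)" for k :: int and xs
  have q0: "q 0 xs = 0" for xs by (simp add: q_def)
  have qS: "q (k + 1) xs = q k xs + T k xs" for k xs
  proof (cases "k \<ge> 0")
    case True
    then have "{0..<k + 1} = insert k {0..<k}" by auto
    with True show ?thesis by (simp add: q_def algebra_simps)
  next
    case False
    then have "{k..<0} = insert k {k + 1..<0}" by auto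
    with False show ?thesis by (simp add: q_def algebra_simps)
  qed
  have TM: "T i \<in> cochain M (Suc n)" for i
    unfolding cochain_def
  proof (intro CollectI conjI ballI)
    fix xs assume "xs \<in> lists_n (Suc n)"
    then show "T i xs \<in> B"
      using l t(1) unfolding T_def by (intro act_B cochain_B[of l M "Suc n"]) auto
  next
    fix m xs assume m: "m \<in> M" and xs: "xs \<in> lists_n (Suc n)"
    let ?s = "t [^] i"
    let ?m = "inv ?s \<otimes> m \<otimes> ?s"
    have s: "?s \<in> carrier G" using t by simp
    have m': "?m \<in> M"
      using normalizes_int_pow[OF M.subset t, of i] m by (auto simp: normalizes_def)
    have "lmul (inv ?s) (lmul m xs) = lmul ?m (lmul (inv ?s) xs)"
      using xs m s by (subst (1 2) lmul_lmul[where n = "Suc n"]) (auto simp: m_assoc)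
    then have "T i (lmul m xs) = act ?s (act ?m (l (lmul (inv ?s) xs)))"
      unfolding T_def using cochain_act[OF l m', of "lmul (inv ?s) xs"] xs s by simp
    also have "\<dots> = act (m \<otimes> ?s) (l (lmul (inv ?s) xs))"
      using m s M.mem_carrier by (simp flip: act_mult add: m_assoc)
    also have "\<dots> = act m (T i xs)"
      unfolding T_def using m s by (simp add: act_mult)
    finally show "T i (lmul m xs) = act m (T i xs)" .
  qed
  have Tt: "act t (T i (lmul (inv t) xs)) = T (i + 1) xs" if "xs \<in> lists_n (Suc n)" for i xs
  proof -
    have e: "t [^] (i + 1) = t \<otimes> t [^] i" using t by (simp add: add.commute int_pow_mult)
    show ?thesis
      unfolding T_def e using that t(1)
      by (subst lmul_lmul[where n = "Suc n"]) (auto simp: act_mult inv_mult_group)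
  qed
  have T0: "T 0 xs = l xs" if "xs \<in> lists_n (Suc n)" for xs
    using that by (simp add: T_def lmul_one)
  have qt: "act t (q (k - 1) (lmul (inv t) xs)) = q k xs - l xs" if xs: "xs \<in> lists_n (Suc n)" for k xs
  proof (induction k rule: int_induct[where k = 1])
    case base
    show ?case using qS[of 0 xs] T0[OF xs] by (simp add: q0)
  next
    case (step1 i)
    then show ?case
      using qS[of "i - 1" "lmul (inv t) xs"] qS[of i xs] Tt[OF xs, of "i - 1"]
      by (simp add: act_add)
  next
    case (step2 i)
    have "q (i - 1 - 1) (lmul (inv t) xs) = q (i - 1) (lmul (inv t) xs) - T (i - 1 - 1) (lmul (inv t) xs)"
      using qS[of "i - 1 - 1" "lmul (inv t) xs"] by simp
    then show ?case
      using step2 qS[of "i - 1" xs] Tt[OF xs, of "i - 1 - 1"]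
      by (simp add: act_diff)
  qed
  have qM: "q k \<in> cochain M (Suc n)" for k
  proof (induction k rule: int_induct[where k = 0])
    case base
    show ?case using cochain_zero by (simp add: q_def)
  next
    case (step1 i)
    have "q (i + 1) = (\<lambda>x. q i x + T i x)" using qS[of i] by (simp add: fun_eq_iff)
    then show ?case using cochain_add[OF step1(2) TM[of i]] by simp
  next
    case (step2 i)
    have "q (i - 1) = (\<lambda>x. q i x - T (i - 1) x)" using qS[of "i - 1"] by (simp add: fun_eq_iff)
    then show ?case using cochain_diff[OF step2(2) TM[of "i - 1"]] by simp
  qed
  \<comment> \<open>Translation by \<open>t\<close> raises \<open>\<kappa>\<close> of the head by
    one, so the translate of \<open>q\<close> and \<open>q\<close> itself telescope and leave
    \<open>l\<close>. Only the head is consulted, which is why one variable is required.\<close>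
  define p where "p xs = - q (\<kappa> (hd xs)) xs" for xs
  show thesis
  proof
    show "p \<in> cochain M (Suc n)"
      unfolding cochain_def
    proof (intro CollectI conjI ballI)
      fix xs assume "xs \<in> lists_n (Suc n)"
      then show "p xs \<in> B" unfolding p_def by (intro minus_B cochain_B[OF qM])
    next
      fix m xs assume m: "m \<in> M" and xs: "xs \<in> lists_n (Suc n)"
      have "\<kappa> (hd (lmul m xs)) = \<kappa> (hd xs)"
        using xs m \<kappa>M by (auto elim!: lists_SucE)
      then show "p (lmul m xs) = act m (p xs)"
        unfolding p_def using cochain_act[OF qM m xs] by (simp add: act_minus)
    qed
  next
    fix xs assume xs: "xs \<in> lists_n (Suc n)"
    have "\<kappa> (hd (lmul (inv t) xs)) = \<kappa> (hd xs) - 1"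
      using xs t(1) \<kappa>t[of "inv t \<otimes> hd xs"] by (auto elim!: lists_SucE)
    then show "act t (p (lmul (inv t) xs)) - p xs = l xs"
      unfolding p_def using qt[OF xs] by (simp add: act_minus)
  qed
qed

text \<open>The operator \<open>t - 1\<close> for the natural action on functions of lists.\<close>

definition shift :: "'a \<Rightarrow> ('a list \<Rightarrow> 'v) \<Rightarrow> 'a list \<Rightarrow> 'v" where
  "shift t f xs = act t (f (lmul (inv t) xs)) - f xs"

lemma shift_diff: "shift t (\<lambda>x. f x - g x) xs = shift t f xs - shift t g xs"
  by (simp add: shift_def act_diff)

lemma shift_cob:
  "cob (shift t f) xs = shift t (cob f) xs"
proof -
  have "cob (shift t f) xs = cob (\<lambda>w. act t (f (lmul (inv t) w))) xs - cob f xs"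
    unfolding cob_diff[symmetric] by (simp add: shift_def[abs_def])
  also have "cob (\<lambda>w. act t (f (lmul (inv t) w))) xs = act t (cob (\<lambda>w. f (lmul (inv t) w)) xs)"
    by (rule cob_additive[symmetric]) (rule act_add)
  also have "cob (\<lambda>w. f (lmul (inv t) w)) xs = cob f (lmul (inv t) xs)"
    by (rule cob_map[symmetric])
  finally show ?thesis unfolding shift_def[of t "cob f"] .
qed

lemma shift_cong:
  assumes "t \<in> carrier G" "xs \<in> lists_n n" "\<And>ys. ys \<in> lists_n n \<Longrightarrow> f ys = g ys"
  shows "shift t f xs = shift t g xs"
  using assms by (simp add: shift_def)

text \<open>Equivariance is demanded only for members of the given set, so \<open>insert t M\<close>
  stands for the group it generates. The part of the condition that concerns \<open>t\<close> is the
  vanishing of the defect \<open>shift t f\<close>.\<close>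

lemma cochain_insert_iff:
  assumes "t \<in> carrier G"
  shows "f \<in> cochain (insert t M) n \<longleftrightarrow> f \<in> cochain M n \<and> (\<forall>xs\<in>lists_n n. shift t f xs = 0)"
proof -
  have "(\<forall>xs\<in>lists_n n. f (lmul t xs) = act t (f xs)) \<longleftrightarrow> (\<forall>xs\<in>lists_n n. shift t f xs = 0)"
  proof safe
    fix xs assume *: "\<forall>xs\<in>lists_n n. f (lmul t xs) = act t (f xs)" and xs: "xs \<in> lists_n n"
    have "f (lmul t (lmul (inv t) xs)) = act t (f (lmul (inv t) xs))"
      by (rule bspec[OF *]) (use xs assms in simp)
    then show "shift t f xs = 0" using xs assms by (simp add: shift_def)
  next
    fix xs assume *: "\<forall>xs\<in>lists_n n. shift t f xs = 0" and xs: "xs \<in> lists_n n"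
    have "shift t f (lmul t xs) = 0"
      by (rule bspec[OF *]) (use xs assms in simp)
    then show "f (lmul t xs) = act t (f xs)" using xs assms by (simp add: shift_def)
  qed
  then show ?thesis by (auto simp: cochain_def)
qed

lemma shift_cochain:
  assumes M: "M \<subseteq> carrier G" and t: "t \<in> carrier G" "normalizes t M" and f: "f \<in> cochain M n"
  shows "shift t f \<in> cochain M n"
  unfolding cochain_def
proof (intro CollectI conjI ballI)
  fix xs assume "xs \<in> lists_n n"
  then show "shift t f xs \<in> B"
    using f t(1) unfolding shift_def by (intro diff_B act_B cochain_B[of f M n]) auto
next
  fix m xs assume m: "m \<in> M" and xs: "xs \<in> lists_n n"
  let ?m = "inv t \<otimes> m \<otimes> t"
  have m': "?m \<in> M" using t m by (auto simp: normalizes_def)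
  have mc: "m \<in> carrier G" using m M by auto
  have "lmul (inv t) (lmul m xs) = lmul ?m (lmul (inv t) xs)"
    using xs mc t by (subst (1 2) lmul_lmul[where n = n]) (auto simp: m_assoc)
  then have "act t (f (lmul (inv t) (lmul m xs))) = act t (act ?m (f (lmul (inv t) xs)))"
    using cochain_act[OF f m', of "lmul (inv t) xs"] xs t by simp
  also have "\<dots> = act (m \<otimes> t) (f (lmul (inv t) xs))"
    using mc t by (simp flip: act_mult add: m_assoc)
  also have "\<dots> = act m (act t (f (lmul (inv t) xs)))"
    using mc t by (simp add: act_mult)
  finally show "shift t f (lmul m xs) = act m (shift t f xs)"
    unfolding shift_def using cochain_act[OF f m xs] by (simp add: act_diff)
qed

text \<open>Let \<open>h\<close> be a primitive of \<open>f\<close> over \<open>M\<close>. Since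
  \<open>f\<close> is \<open>t\<close>-equivariant, the defect \<open>shift t h\<close> is a cocycle
  of \<open>M\<close> one degree lower. Once it bounds over \<open>M'\<close>, its primitive is
  itself of the form \<open>shift t p\<close>, and \<open>h\<close> minus the coboundary of
  \<open>p\<close> is \<open>t\<close>-equivariant. Vanishing in two adjacent degrees is
  consumed.\<close>

lemma wang_kill:
  assumes M: "M \<subseteq> carrier G" and M': "subgroup M' G" "M' \<subseteq> M"
    and t: "t \<in> carrier G" "normalizes t M" "normalizes t M'"
    and free: "\<And>k::int. k \<noteq> 0 \<Longrightarrow> t [^] k \<notin> M'"
    and f: "f \<in> cocycle (insert t M) (Suc (Suc (Suc n)))" "f \<in> cobound M (Suc (Suc n))"
    and kill: "cocycle M (Suc (Suc n)) \<subseteq> cobound M' (Suc n)"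
  shows "f \<in> cobound (insert t M') (Suc (Suc n))"
proof -
  obtain h where h: "h \<in> cochain M (Suc (Suc n))" "\<And>xs. xs \<in> lists_n (Suc (Suc (Suc n))) \<Longrightarrow> f xs = cob h xs"
    using f(2) by (auto simp: cobound_def)
  have "cob (shift t h) xs = 0" if xs: "xs \<in> lists_n (Suc (Suc (Suc n)))" for xs
  proof -
    have "cob (shift t h) xs = shift t f xs"
      unfolding shift_cob using h(2) by (intro shift_cong[OF t(1) xs]) simp
    also have "\<dots> = 0"
      using f(1) xs cochain_insert_iff[OF t(1)] by (auto simp: cocycle_def)
    finally show ?thesis .
  qed
  then have "shift t h \<in> cocycle M (Suc (Suc n))"
    using shift_cochain[OF M t(1,2) h(1)] by (auto simp: cocycle_def)
  with kill obtain l where l: "l \<in> cochain M' (Suc n)"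
    "\<And>xs. xs \<in> lists_n (Suc (Suc n)) \<Longrightarrow> shift t h xs = cob l xs"
    by (auto simp: cobound_def)
  obtain p where p: "p \<in> cochain M' (Suc n)" "\<And>xs. xs \<in> lists_n (Suc n) \<Longrightarrow> shift t p xs = l xs"
    using shift_surj[OF M'(1) t(1,3) free l(1)] unfolding shift_def by metis
  define h' where "h' = (\<lambda>xs. h xs - cob p xs)"
  have "h \<in> cochain M' (Suc (Suc n))" using h(1) cochain_anti[OF M'(2)] by blast
  then have h'M: "h' \<in> cochain M' (Suc (Suc n))"
    unfolding h'_def using cob_cochain[OF subgroup.subset[OF M'(1)] p(1)] by (rule cochain_diff)
  have "shift t h' xs = 0" if xs: "xs \<in> lists_n (Suc (Suc n))" for xs
  proof -
    have "shift t h' xs = shift t h xs - cob (shift t p) xs"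
      unfolding h'_def by (simp add: shift_diff shift_cob)
    also have "cob (shift t p) xs = cob l xs" using p(2) xs by (rule cob_cong)
    finally show ?thesis using l(2)[OF xs] by simp
  qed
  then have "h' \<in> cochain (insert t M') (Suc (Suc n))"
    using h'M cochain_insert_iff[OF t(1)] by blast
  moreover have "f xs = cob h' xs" if "xs \<in> lists_n (Suc (Suc (Suc n)))" for xs
    unfolding h'_def using h(2)[OF that] by (simp add: cob_diff)
  ultimately show ?thesis by (auto simp: cobound_def)
qed

end

section \<open>Compactness of cochain spaces and counting of classes\<close>

text \<open>Its hypothesis, that failure of membership shows in finitely many coordinates, fits
  conditions such as equivariance at one element, a coboundary equation at one list, or
  compatibility of two coordinates of the completion.\<close>

lemma closedin_product_discrete:
  assumes "C \<subseteq> Pi\<^sub>E I A"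
    and "\<And>x. x \<in> Pi\<^sub>E I A \<Longrightarrow> x \<notin> C \<Longrightarrow>
      \<exists>S. finite S \<and> S \<subseteq> I \<and> (\<forall>y\<in>Pi\<^sub>E I A. (\<forall>i\<in>S. y i = x i) \<longrightarrow> y \<notin> C)"
  shows "closedin (product_topology (\<lambda>i. discrete_topology (A i)) I) C"
proof -
  have "openin (product_topology (\<lambda>i. discrete_topology (A i)) I) (Pi\<^sub>E I A - C)"
    unfolding openin_product_topology_alt
  proof
    fix x assume x: "x \<in> Pi\<^sub>E I A - C"
    then obtain S where S: "finite S" "S \<subseteq> I" "\<And>y. y \<in> Pi\<^sub>E I A \<Longrightarrow> (\<forall>i\<in>S. y i = x i) \<Longrightarrow> y \<notin> C"
      using assms(2)[of x] by blast
    define U where "U i = (if i \<in> S then {x i} else A i)" for i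
    have "{i \<in> I. U i \<noteq> topspace (discrete_topology (A i))} \<subseteq> S" by (auto simp: U_def)
    then have "finite {i \<in> I. U i \<noteq> topspace (discrete_topology (A i))}"
      using S(1) finite_subset by blast
    moreover have "\<forall>i\<in>I. openin (discrete_topology (A i)) (U i)" "x \<in> Pi\<^sub>E I U"
      using x by (auto simp: U_def PiE_iff)
    moreover have "Pi\<^sub>E I U \<subseteq> Pi\<^sub>E I A - C"
    proof
      fix y assume y: "y \<in> Pi\<^sub>E I U"
      have "y i \<in> A i" if "i \<in> I" for i using y that x by (cases "i \<in> S") (auto simp: U_def PiE_iff)
      then have "y \<in> Pi\<^sub>E I A" using y by (auto simp: PiE_iff)
      moreover have "\<forall>i\<in>S. y i = x i"
      proof
        fix i assume "i \<in> S"
        then show "y i = x i" using PiE_mem[OF y, of i] S(2) by (auto simp: U_def)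
      qed
      ultimately show "y \<in> Pi\<^sub>E I A - C" using S(3) by blast
    qed
    ultimately show "\<exists>U. finite {i \<in> I. U i \<noteq> topspace (discrete_topology (A i))} \<and>
        (\<forall>i\<in>I. openin (discrete_topology (A i)) (U i)) \<and> x \<in> Pi\<^sub>E I U \<and> Pi\<^sub>E I U \<subseteq> Pi\<^sub>E I A - C"
      by blast
  qed
  then show ?thesis using assms(1) by (simp add: closedin_def)
qed

lemma compact_space_product_discrete:
  assumes "\<And>i. i \<in> I \<Longrightarrow> finite (A i)"
  shows "compact_space (product_topology (\<lambda>i. discrete_topology (A i)) I)"
  using assms by (auto simp: compact_space_product_topology compact_space_discrete_topology)

definition separated :: "('x \<Rightarrow> 'v::ab_group_add) set \<Rightarrow> ('x \<Rightarrow> 'v) set \<Rightarrow> bool" where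
  "separated W F \<longleftrightarrow> (\<forall>f\<in>F. \<forall>g\<in>F. f \<noteq> g \<longrightarrow> (\<lambda>x. f x - g x) \<notin> W)"

text \<open>Counts classes of \<open>Y\<close> modulo \<open>W\<close> without forming a quotient.
  Only finite incongruent sets occur, and such a set remains incongruent over a suitable finitely
  generated piece, so a uniform bound passes to directed unions.\<close>

definition classes_le :: "nat \<Rightarrow> ('x \<Rightarrow> 'v::ab_group_add) set \<Rightarrow> ('x \<Rightarrow> 'v) set \<Rightarrow> bool" where
  "classes_le b Y W \<longleftrightarrow> (\<forall>F. finite F \<and> F \<subseteq> Y \<and> separated W F \<longrightarrow> card F \<le> b)"

lemma classes_le_colour:
  assumes "finite C" "card C \<le> b" "\<And>f. f \<in> Y \<Longrightarrow> c f \<in> C"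
    and "\<And>f g. f \<in> Y \<Longrightarrow> g \<in> Y \<Longrightarrow> c f = c g \<Longrightarrow> (\<lambda>x. f x - g x) \<in> W"
  shows "classes_le b Y W"
  unfolding classes_le_def
proof (intro allI impI; elim conjE)
  fix F assume F: "finite F" "F \<subseteq> Y" "separated W F"
  have "inj_on c F"
    unfolding inj_on_def using F assms(4) unfolding separated_def by (metis subsetD)
  then have "card F \<le> card C"
    using F assms by (intro card_inj_on_le[of c]) auto
  then show "card F \<le> b" using assms(2) by simp
qed

lemma classes_le_reps:
  fixes Y W :: "('x \<Rightarrow> 'v::ab_group_add) set"
  assumes "classes_le b Y W" and "(\<lambda>_. 0) \<in> W"
    and "\<And>f g. f \<in> W \<Longrightarrow> g \<in> W \<Longrightarrow> (\<lambda>x. f x - g x) \<in> W"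
  obtains R where "finite R" "R \<subseteq> Y" "card R \<le> b" "\<And>f. f \<in> Y \<Longrightarrow> \<exists>r\<in>R. (\<lambda>x. f x - r x) \<in> W"
proof (rule finite_maximal_separated[of Y "\<lambda>f g. (\<lambda>x. f x - g x) \<in> W" b])
  fix f g assume "(\<lambda>x. f x - g x) \<in> W"
  from assms(3)[OF assms(2) this] show "(\<lambda>x. g x - f x) \<in> W" by simp
next
  fix F assume "finite F" "F \<subseteq> Y" "\<And>f g. f \<in> F \<Longrightarrow> g \<in> F \<Longrightarrow> f \<noteq> g \<Longrightarrow> (\<lambda>x. f x - g x) \<notin> W"
  then show "card F \<le> b" using assms(1) unfolding classes_le_def separated_def by blast
qed (use assms(2) that in auto)

context finite_gmodule
begin

lemma zero_cobound: "(\<lambda>_. 0) \<in> cobound H n"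
  by (auto simp: cobound_def intro!: bexI[of _ "\<lambda>_. 0"] cochain_zero)

text \<open>For finite \<open>F\<close> the primitives of \<open>f\<close> that are equivariant
  under \<open>F\<close> form a closed set in a product of copies of the finite set
  \<open>B\<close>. Finitely many of these sets meet, by the hypothesis for the union of the
  \<open>F\<close>, so all of them meet, and a common point is equivariant under
  \<open>X\<close>.\<close>

lemma cobound_compact:
  assumes X: "X \<subseteq> carrier G"
    and f: "\<And>F. finite F \<Longrightarrow> F \<subseteq> X \<Longrightarrow> f \<in> cobound F n"
  shows "f \<in> cobound X n"
proof -
  define T where "T = product_topology (\<lambda>_. discrete_topology B) (lists_n n)"
  define C where "C F = {h \<in> lists_n n \<rightarrow>\<^sub>E B. h \<in> cochain F n \<and> (\<forall>xs\<in>lists_n (Suc n). f xs = cob h xs)}" for F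
  have "compact_space T"
    unfolding T_def by (rule compact_space_product_discrete) (rule finite_B)
  have cl: "closedin T (C F)" if F: "F \<subseteq> X" for F
    unfolding T_def
  proof (rule closedin_product_discrete)
    fix h assume h: "h \<in> lists_n n \<rightarrow>\<^sub>E B" "h \<notin> C F"
    then consider t xs where "t \<in> F" "xs \<in> lists_n n" "h (lmul t xs) \<noteq> act t (h xs)"
      | xs where "xs \<in> lists_n (Suc n)" "f xs \<noteq> cob h xs"
      by (auto simp: C_def cochain_def)
    then show "\<exists>S. finite S \<and> S \<subseteq> lists_n n \<and>
      (\<forall>y\<in>lists_n n \<rightarrow>\<^sub>E B. (\<forall>i\<in>S. y i = h i) \<longrightarrow> y \<notin> C F)"
    proof cases
      case 1
      then have "lmul t xs \<in> lists_n n" using F X by auto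
      with 1 show ?thesis
        by (intro exI[of _ "{lmul t xs, xs}"]) (auto simp: C_def cochain_def)
    next
      case 2
      let ?S = "{w. set w \<subseteq> set xs \<and> length w = n}"
      show ?thesis
      proof (intro exI[of _ ?S] conjI ballI impI)
        show "finite ?S" by (rule finite_lists_length_eq) simp
        show "?S \<subseteq> lists_n n" using 2 by (auto simp: lists_n_def)
      next
        fix y assume y: "\<forall>i\<in>?S. y i = h i"
        have "cob y xs = cob h xs"
          using y 2(1) by (intro cob_cong_len) (auto simp: lists_n_def)
        moreover have "f xs = cob y xs" if "y \<in> C F" using that 2(1) unfolding C_def by blast
        ultimately show "y \<notin> C F" using 2(2) by auto
      qed
    qed
  qed (auto simp: C_def)
  have "\<Inter>(C ` {F. finite F \<and> F \<subseteq> X}) \<noteq> {}"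
  proof -
    have "\<Inter>\<F> \<noteq> {}" if \<F>: "finite \<F>" "\<F> \<subseteq> C ` {F. finite F \<and> F \<subseteq> X}" for \<F>
    proof -
      obtain \<A> where A: "finite \<A>" "\<A> \<subseteq> {F. finite F \<and> F \<subseteq> X}" "\<F> = C ` \<A>"
        using finite_subset_image[OF \<F>] by blast
      have "f \<in> cobound (\<Union>\<A>) n" using A by (intro f) auto
      then obtain h where h: "h \<in> cochain (\<Union>\<A>) n" "\<forall>xs\<in>lists_n (Suc n). f xs = cob h xs"
        by (auto simp: cobound_def)
      have "restrict h (lists_n n) \<in> C F" if "F \<in> \<A>" for F
      proof -
        have FX: "F \<subseteq> carrier G" using A that X by auto
        have "restrict h (lists_n n) \<in> cochain F n"
          unfolding cochain_def
        proof (intro CollectI conjI ballI)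
          fix t xs assume "t \<in> F" "xs \<in> lists_n n"
          then show "restrict h (lists_n n) (lmul t xs) = act t (restrict h (lists_n n) xs)"
            using h(1) that FX by (auto simp: cochain_def subset_iff)
        qed (use h(1) in \<open>auto simp: cochain_def\<close>)
        moreover have "cob (restrict h (lists_n n)) xs = cob h xs" if "xs \<in> lists_n (Suc n)" for xs
          using that by (intro cob_cong[of n]) auto
        moreover have "restrict h (lists_n n) \<in> lists_n n \<rightarrow>\<^sub>E B"
          using h(1) by (auto simp: cochain_def)
        ultimately show ?thesis using h(2) by (auto simp: C_def)
      qed
      then show ?thesis using A(3) by blast
    qed
    moreover have "\<forall>D\<in>C ` {F. finite F \<and> F \<subseteq> X}. closedin T D" using cl by blast
    ultimately show ?thesis
      by (intro \<open>compact_space T\<close>[unfolded compact_space_fip, rule_format]) auto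
  qed
  then obtain h where h: "\<And>F. finite F \<Longrightarrow> F \<subseteq> X \<Longrightarrow> h \<in> C F" by blast
  have "h \<in> cochain X n"
    unfolding cochain_def
  proof (intro CollectI conjI ballI)
    fix xs assume "xs \<in> lists_n n"
    then show "h xs \<in> B" using h[of "{}"] by (auto simp: C_def)
  next
    fix t xs assume "t \<in> X" "xs \<in> lists_n n"
    then show "h (lmul t xs) = act t (h xs)" using h[of "{t}"] by (auto simp: C_def cochain_def)
  qed
  then show ?thesis using h[of "{}"] by (auto simp: C_def cobound_def)
qed

text \<open>Subtracting \<open>cob p\<close> does not change the coboundary of \<open>h\<close> and
  cancels its failure to be \<open>t\<close>-equivariant.\<close>

lemma wang_lift:
  assumes M: "subgroup M G" and t: "t \<in> carrier G"
    and h: "h \<in> cochain M (Suc n)" "\<And>xs. xs \<in> lists_n (Suc (Suc n)) \<Longrightarrow> f xs = cob h xs"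
    and p: "cob p \<in> cochain M (Suc n)" "\<And>xs. xs \<in> lists_n (Suc n) \<Longrightarrow> shift t h xs = shift t (cob p) xs"
  shows "f \<in> cobound (insert t M) (Suc n)"
proof -
  define h' where "h' = (\<lambda>xs. h xs - cob p xs)"
  have "h' \<in> cochain M (Suc n)" unfolding h'_def using h(1) p(1) by (rule cochain_diff)
  moreover have "shift t h' xs = 0" if xs: "xs \<in> lists_n (Suc n)" for xs
    using p(2)[OF xs] unfolding h'_def by (simp add: shift_diff)
  ultimately have "h' \<in> cochain (insert t M) (Suc n)"
    using cochain_insert_iff[OF t] by blast
  moreover have "f xs = cob h' xs" if "xs \<in> lists_n (Suc (Suc n))" for xs
    unfolding h'_def using h(2)[OF that] by (simp add: cob_diff)
  ultimately show ?thesis by (auto simp: cobound_def)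
qed

text \<open>Reduced coboundaries in degree zero vanish, so that the case \<open>n = 0\<close> speaks about
  unreduced cohomology.\<close>

definition bound_or_zero :: "'a set \<Rightarrow> nat \<Rightarrow> ('a list \<Rightarrow> 'v) set" where
  "bound_or_zero M n = (case n of 0 \<Rightarrow> {f. \<forall>xs\<in>lists_n (Suc 0). f xs = 0} | Suc _ \<Rightarrow> cobound M n)"

text \<open>Cocycles of one variable are constant, so the value at \<open>\<one>\<close> is a colour
  that separates them.\<close>

lemma classes_degree_zero: "classes_le (card B) (cocycle M (Suc 0)) (bound_or_zero M 0)"
proof (rule classes_le_colour[where c = "\<lambda>f. f [\<one>]" and C = B])
  fix f g assume fg: "f \<in> cocycle M (Suc 0)" "g \<in> cocycle M (Suc 0)" "f [\<one>] = g [\<one>]"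
  have c: "f [x] = f [\<one>]" if "x \<in> carrier G" "f \<in> cocycle M (Suc 0)" for x f
  proof -
    have "[\<one>, x] \<in> lists_n (Suc (Suc 0))" using that by simp
    then have "cob f [\<one>, x] = 0" using that unfolding cocycle_def by blast
    then show ?thesis by simp
  qed
  have "f xs - g xs = 0" if xs: "xs \<in> lists_n (Suc 0)" for xs
  proof -
    obtain x ys where x: "xs = x # ys" "x \<in> carrier G" "ys \<in> lists_n 0"
      using xs by (rule lists_SucE)
    show ?thesis using c[OF x(2) fg(1)] c[OF x(2) fg(2)] fg(3) x by simp
  qed
  then show "(\<lambda>x. f x - g x) \<in> bound_or_zero M 0" by (simp add: bound_or_zero_def)
qed (auto simp: finite_B cocycle_def cochain_def)

text \<open>A class over \<langle>M, t\<rangle> is determined by its restriction to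
  \<open>M\<close>, with at most \<open>b1\<close> possibilities, and among classes with equal
  restriction by the class of the defect \<open>shift t h\<close> one degree lower, with at most
  \<open>b2\<close> possibilities.\<close>

lemma wang_classes:
  assumes M: "subgroup M G" and t: "t \<in> carrier G" "normalizes t M"
    and free: "\<And>k::int. k \<noteq> 0 \<Longrightarrow> t [^] k \<notin> M"
    and b1: "classes_le b1 (cocycle M (Suc (Suc n))) (cobound M (Suc n))"
    and b2: "classes_le b2 (cocycle M (Suc n)) (bound_or_zero M n)"
  shows "classes_le (b1 * b2) (cocycle (insert t M) (Suc (Suc n))) (cobound (insert t M) (Suc n))"
proof -
  note Mc = subgroup.subset[OF M]
  obtain R1 where R1: "finite R1" "R1 \<subseteq> cocycle M (Suc (Suc n))" "card R1 \<le> b1"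
    "\<And>f. f \<in> cocycle M (Suc (Suc n)) \<Longrightarrow> \<exists>r\<in>R1. (\<lambda>x. f x - r x) \<in> cobound M (Suc n)"
    by (rule classes_le_reps[OF b1 zero_cobound cobound_diff]) (assumption | rule that)+
  have bz: "(\<lambda>_. 0) \<in> bound_or_zero M n"
    "\<And>f g. f \<in> bound_or_zero M n \<Longrightarrow> g \<in> bound_or_zero M n \<Longrightarrow> (\<lambda>x. f x - g x) \<in> bound_or_zero M n"
    by (auto simp: bound_or_zero_def zero_cobound cobound_diff split: nat.splits)
  obtain R2 where R2: "finite R2" "card R2 \<le> b2"
    "\<And>f. f \<in> cocycle M (Suc n) \<Longrightarrow> \<exists>r\<in>R2. (\<lambda>x. f x - r x) \<in> bound_or_zero M n"
    by (rule classes_le_reps[OF b2 bz]) (assumption | rule that)+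
  let ?Y = "cocycle (insert t M) (Suc (Suc n))"
  have YM: "?Y \<subseteq> cocycle M (Suc (Suc n))" by (rule cocycle_anti) auto
  obtain c1 where c1: "\<And>f. f \<in> ?Y \<Longrightarrow> c1 f \<in> R1" "\<And>f. f \<in> ?Y \<Longrightarrow> (\<lambda>x. f x - c1 f x) \<in> cobound M (Suc n)"
    using R1(4) YM by (metis subset_iff)
  \<comment> \<open>One cocycle for each restriction class serves as origin; \<open>h f\<close> will
    be a primitive over \<open>M\<close> of the difference between \<open>f\<close> and its
    origin.\<close>
  define base where "base r = (SOME f. f \<in> ?Y \<and> c1 f = r)" for r
  have base: "base (c1 f) \<in> ?Y \<and> c1 (base (c1 f)) = c1 f" if "f \<in> ?Y" for f
    unfolding base_def by (rule someI[of _ f]) (use that in simp)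
  have "\<exists>h. h \<in> cochain M (Suc n) \<and> (\<forall>xs\<in>lists_n (Suc (Suc n)). f xs - base (c1 f) xs = cob h xs)"
    if f: "f \<in> ?Y" for f
  proof -
    have "(\<lambda>x. (f x - c1 f x) - (base (c1 f) x - c1 f x)) \<in> cobound M (Suc n)"
      by (rule cobound_diff) (use c1(2)[OF f] c1(2)[of "base (c1 f)"] base[OF f] in auto)
    then show ?thesis by (auto simp: cobound_def)
  qed
  then obtain h where h: "\<And>f. f \<in> ?Y \<Longrightarrow> h f \<in> cochain M (Suc n)"
    "\<And>f xs. f \<in> ?Y \<Longrightarrow> xs \<in> lists_n (Suc (Suc n)) \<Longrightarrow> f xs - base (c1 f) xs = cob (h f) xs"
    by metis
  have k: "shift t (h f) \<in> cocycle M (Suc n)" if f: "f \<in> ?Y" for f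
  proof -
    have "cob (shift t (h f)) xs = 0" if xs: "xs \<in> lists_n (Suc (Suc n))" for xs
    proof -
      have "cob (shift t (h f)) xs = shift t (\<lambda>x. f x - base (c1 f) x) xs"
        unfolding shift_cob using h(2)[OF f] by (intro shift_cong[OF t(1) xs]) simp
      also have "\<dots> = 0"
        unfolding shift_diff using f base[OF f] xs cochain_insert_iff[OF t(1)] by (auto simp: cocycle_def)
      finally show ?thesis .
    qed
    then show ?thesis using shift_cochain[OF Mc t h(1)[OF f]] by (auto simp: cocycle_def)
  qed
  obtain c2 where c2: "\<And>f. f \<in> ?Y \<Longrightarrow> c2 f \<in> R2"
    "\<And>f. f \<in> ?Y \<Longrightarrow> (\<lambda>x. shift t (h f) x - c2 f x) \<in> bound_or_zero M n"
    using R2(3)[OF k] by metis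
  show ?thesis
  proof (rule classes_le_colour[where c = "\<lambda>f. (c1 f, c2 f)" and C = "R1 \<times> R2"])
    show "card (R1 \<times> R2) \<le> b1 * b2"
      using R1(3) R2(2) by (simp add: card_cartesian_product mult_le_mono)
  next
    fix f g assume f: "f \<in> ?Y" and g: "g \<in> ?Y" and "(c1 f, c2 f) = (c1 g, c2 g)"
    then have e: "c1 f = c1 g" "c2 f = c2 g" by auto
    define h' where "h' = (\<lambda>x. h f x - h g x)"
    have h'M: "h' \<in> cochain M (Suc n)" unfolding h'_def using h(1)[OF f] h(1)[OF g] by (rule cochain_diff)
    have h'f: "f xs - g xs = cob h' xs" if "xs \<in> lists_n (Suc (Suc n))" for xs
      using h(2)[OF f that] h(2)[OF g that] e unfolding h'_def cob_diff by (simp add: algebra_simps)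
    have "(\<lambda>x. (shift t (h f) x - c2 f x) - (shift t (h g) x - c2 f x)) \<in> bound_or_zero M n"
      by (rule bz(2)) (use c2(2)[OF f] c2(2)[OF g] e in auto)
    then have k': "(\<lambda>x. shift t h' x) \<in> bound_or_zero M n"
      unfolding h'_def by (simp add: shift_diff)
    show "(\<lambda>x. f x - g x) \<in> cobound (insert t M) (Suc n)"
    \<comment> \<open>In the lowest degree the defect vanishes outright. Otherwise it bounds some
      \<open>l\<close>, and \<open>l\<close> is a shift.\<close>
    proof (cases n)
      case 0
      show ?thesis
        by (rule wang_lift[OF M t(1) h'M h'f, of "\<lambda>_. 0"])
          (use k' 0 in \<open>auto simp: bound_or_zero_def shift_def cob_zero[abs_def] cochain_zero\<close>)
    next
      case (Suc m)
      then obtain l where l: "l \<in> cochain M (Suc m)" "\<And>xs. xs \<in> lists_n (Suc (Suc m)) \<Longrightarrow> shift t h' xs = cob l xs"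
        using k' by (auto simp: bound_or_zero_def cobound_def)
      obtain p where p: "p \<in> cochain M (Suc m)" "\<And>xs. xs \<in> lists_n (Suc m) \<Longrightarrow> shift t p xs = l xs"
        using shift_surj[OF M t free l(1)] unfolding shift_def by metis
      show ?thesis
      proof (rule wang_lift[OF M t(1) h'M h'f, of p])
        show "cob p \<in> cochain M (Suc n)" using cob_cochain[OF Mc p(1)] Suc by simp
      next
        fix xs assume "xs \<in> lists_n (Suc n)"
        then have xs: "xs \<in> lists_n (Suc (Suc m))" using Suc by simp
        have "shift t (cob p) xs = cob (shift t p) xs" by (rule shift_cob[symmetric])
        also have "\<dots> = cob l xs" using p(2) xs by (rule cob_cong)
        finally show "shift t h' xs = shift t (cob p) xs" using l(2)[OF xs] by simp
      qed
    qed
  qed (use R1 R2 c1 c2 in auto)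
qed

end

section \<open>Finiteness and virtual vanishing along a chain\<close>

context finite_gmodule
begin

lemma equivariance_subgroup:
  "subgroup {g \<in> carrier G. \<forall>xs\<in>lists_n n. f (lmul g xs) = act g (f xs)} G" (is "subgroup ?E G")
proof (rule subgroupI)
  have "\<one> \<in> ?E" by (simp add: lmul_one)
  then show "?E \<noteq> {}" by blast
next
  fix a assume a: "a \<in> ?E"
  have "f (lmul (inv a) xs) = act (inv a) (f xs)" if xs: "xs \<in> lists_n n" for xs
  proof -
    have "lmul (inv a) xs \<in> lists_n n" using a xs by simp
    then have "f (lmul a (lmul (inv a) xs)) = act a (f (lmul (inv a) xs))" using a by blast
    moreover have "lmul a (lmul (inv a) xs) = xs" using a xs by simp
    ultimately have "f xs = act a (f (lmul (inv a) xs))" by simp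
    then show ?thesis using a by simp
  qed
  then show "inv a \<in> ?E" using a by simp
next
  fix a b assume ab: "a \<in> ?E" "b \<in> ?E"
  have "f (lmul (a \<otimes> b) xs) = act (a \<otimes> b) (f xs)" if xs: "xs \<in> lists_n n" for xs
  proof -
    have "lmul b xs \<in> lists_n n" using ab xs by simp
    then have "f (lmul a (lmul b xs)) = act a (f (lmul b xs))" using ab by blast
    also have "f (lmul b xs) = act b (f xs)" using ab xs by blast
    finally show ?thesis using ab xs by (simp add: lmul_lmul[of _ _ _ n] act_mult)
  qed
  then show "a \<otimes> b \<in> ?E" using ab by simp
qed auto

text \<open>The elements under which a function is equivariant form a subgroup, so equivariance
  under \<open>N\<close> and \<open>t\<close> extends to all products
  \<open>m \<otimes> t [^] k\<close>.\<close>

lemma cochain_insert_generates: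
  assumes N: "N \<subseteq> carrier G" and t: "t \<in> carrier G"
    and S: "\<And>s. s \<in> S \<Longrightarrow> \<exists>m\<in>N. \<exists>k::int. s = m \<otimes> t [^] k"
  shows "cochain (insert t N) n \<subseteq> cochain S n"
proof
  fix f assume f: "f \<in> cochain (insert t N) n"
  let ?E = "{g \<in> carrier G. \<forall>xs\<in>lists_n n. f (lmul g xs) = act g (f xs)}"
  have "N \<subseteq> ?E" "t \<in> ?E" using f N t by (auto simp: cochain_def)
  then have "S \<subseteq> ?E"
    using S subgroup_int_pow_closed[OF equivariance_subgroup, of t n f]
      subgroup.m_closed[OF equivariance_subgroup[of n f]] by blast
  then show "f \<in> cochain S n" using f by (auto simp: cochain_def)
qed

lemma cobound_insert_generates:
  assumes "N \<subseteq> carrier G" "t \<in> carrier G"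
    and "\<And>s. s \<in> S \<Longrightarrow> \<exists>m\<in>N. \<exists>k::int. s = m \<otimes> t [^] k"
  shows "cobound (insert t N) n \<subseteq> cobound S n"
  using cochain_insert_generates[OF assms, of S n] unfolding cobound_def by blast

text \<open>Prepending \<open>\<one>\<close> is a contracting homotopy; over the trivial group it
  respects equivariance.\<close>

lemma cocycle_trivial_group: "cocycle {\<one>} (Suc n) \<subseteq> cobound {\<one>} n"
proof
  fix f assume f: "f \<in> cocycle {\<one>} (Suc n)"
  define h where "h = (\<lambda>xs. f (\<one> # xs))"
  have "h \<in> cochain {\<one>} n"
    using f by (auto simp: h_def cochain_def cocycle_def lmul_one)
  moreover have "f xs = cob h xs" if "xs \<in> lists_n (Suc n)" for xs
  proof -
    have "\<one> # xs \<in> lists_n (Suc (Suc n))" using that by simp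
    then have "cob f (\<one> # xs) = 0" using f unfolding cocycle_def by blast
    then show ?thesis by (simp add: h_def)
  qed
  ultimately show "f \<in> cobound {\<one>} n" by (auto simp: cobound_def)
qed

text \<open>\<open>d\<close> is the crossed homomorphism belonging to \<open>f\<close>. On the
  elements that act trivially it is a homomorphism into the finite group \<open>B\<close>, so its
  kernel \<open>H\<close> there has finite index, and over \<open>H\<close> the function
  \<open>d\<close> itself is a primitive of \<open>f\<close>. The subgroup depends on
  \<open>f\<close>; finiteness of the number of classes makes it uniform.\<close>

lemma degree_one_kill:
  assumes Y: "subgroup Y G" and f: "f \<in> cocycle Y (Suc (Suc 0))"
  obtains H where "subgroup H G" "H \<subseteq> Y" "fin_index H Y" "f \<in> cobound H (Suc 0)"
proof -
  interpret Y: subgroup Y G by (rule Y)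
  define d where "d x = f [\<one>, x]" for x
  have fB: "f [x, y] \<in> B" if "x \<in> carrier G" "y \<in> carrier G" for x y
    using f that by (auto simp: cocycle_def intro: cochain_B)
  have cyc: "f [x, y] = d y - d x" if "x \<in> carrier G" "y \<in> carrier G" for x y
  proof -
    have "[\<one>, x, y] \<in> lists_n (Suc (Suc (Suc 0)))" using that by simp
    then have "cob f [\<one>, x, y] = 0" using f unfolding cocycle_def by blast
    then show ?thesis by (simp add: d_def algebra_simps)
  qed
  have tr: "f [u \<otimes> x, u \<otimes> y] = act u (f [x, y])" if "u \<in> Y" "x \<in> carrier G" "y \<in> carrier G" for u x y
  proof -
    have "f (lmul u [x, y]) = act u (f [x, y])"
      by (rule cochain_act) (use f that in \<open>auto simp: cocycle_def\<close>)
    then show ?thesis by simp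
  qed
  have dm: "d (u \<otimes> x) = d u + act u (d x)" if "u \<in> Y" "x \<in> carrier G" for u x
  proof -
    have "f [u \<otimes> \<one>, u \<otimes> x] = act u (d x)" unfolding d_def by (rule tr) (use that in auto)
    moreover have "f [u \<otimes> \<one>, u \<otimes> x] = d (u \<otimes> x) - d (u \<otimes> \<one>)" by (rule cyc) (use that in auto)
    ultimately show ?thesis using that by (simp add: algebra_simps)
  qed
  have d1: "d \<one> = 0" using dm[OF Y.one_closed, of \<one>] by simp
  define H where "H = {u \<in> Y. (\<forall>b\<in>B. act u b = b) \<and> d u = 0}"
  have H: "subgroup H G"
  proof (rule subgroupI)
    have "\<one> \<in> H" by (simp add: H_def d1)
    then show "H \<noteq> {}" by blast
  next
    fix u assume u: "u \<in> H"
    have "act (inv u) b = b" if "b \<in> B" for b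
      using u that act_inv_cancel(2)[of u b] by (simp add: H_def)
    moreover have "d (inv u) = 0"
      using dm[of "inv u" u] u d1 by (simp add: H_def)
    ultimately show "inv u \<in> H" using u by (simp add: H_def)
  next
    fix u v assume "u \<in> H" "v \<in> H"
    then show "u \<otimes> v \<in> H" by (simp add: H_def dm act_mult)
  qed (auto simp: H_def)
  moreover have "fin_index H Y"
  proof (rule fin_index_colour[where C = "(B \<rightarrow>\<^sub>E B) \<times> B" and c = "\<lambda>u. (restrict (act u) B, d u)"])
    show "finite ((B \<rightarrow>\<^sub>E B) \<times> B)" using finite_B by (simp add: finite_PiE)
    show "(restrict (act x) B, d x) \<in> (B \<rightarrow>\<^sub>E B) \<times> B" if "x \<in> Y" for x
      using that act_B fB by (auto simp: d_def)
    fix x y assume xy: "x \<in> Y" "y \<in> Y" "(restrict (act x) B, d x) = (restrict (act y) B, d y)"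
    have a: "act x b = act y b" if "b \<in> B" for b
      using xy(3) that by (metis prod.inject restrict_apply')
    have "act (inv x \<otimes> y) b = b" if "b \<in> B" for b
      using xy that by (simp add: act_mult flip: a)
    moreover have "d (inv x \<otimes> y) = 0"
    proof -
      have "d y = d x + act x (d (inv x \<otimes> y))" using dm[of x "inv x \<otimes> y"] xy by simp
      then have "act x (d (inv x \<otimes> y)) = 0" using xy(3) by simp
      then show ?thesis using act_inv_cancel(2)[of x "d (inv x \<otimes> y)"] xy(1) by simp
    qed
    ultimately show "inv x \<otimes> y \<in> H" using xy by (simp add: H_def)
  qed
  moreover have "f \<in> cobound H (Suc 0)"
  proof -
    define h where "h xs = d (hd xs)" for xs
    have "h \<in> cochain H (Suc 0)"
      unfolding cochain_def
    proof (intro CollectI conjI ballI)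
      fix xs assume "xs \<in> lists_n (Suc 0)"
      then show "h xs \<in> B" by (auto simp: h_def d_def intro: fB elim!: lists_SucE)
    next
      fix u xs assume u: "u \<in> H" and "xs \<in> lists_n (Suc 0)"
      then obtain x where "xs = [x]" "x \<in> carrier G" by (auto elim!: lists_SucE)
      then show "h (lmul u xs) = act u (h xs)" using u dm by (simp add: h_def H_def)
    qed
    moreover have "f xs = cob h xs" if xs: "xs \<in> lists_n (Suc (Suc 0))" for xs
    proof -
      obtain x ys where x: "xs = x # ys" "x \<in> carrier G" "ys \<in> lists_n (Suc 0)" using xs by (rule lists_SucE)
      obtain y zs where y: "ys = y # zs" "y \<in> carrier G" "zs \<in> lists_n 0" using x(3) by (rule lists_SucE)
      show ?thesis using x y cyc[of x y] by (simp add: h_def)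
    qed
    ultimately show ?thesis by (auto simp: cobound_def)
  qed
  ultimately show thesis using that[of H] by (auto simp: H_def)
qed

text \<open>For positive \<open>n\<close> this is finiteness of the cohomology in degree
  \<open>n\<close>, whose homogeneous cocycles have \<open>n + 1\<close> arguments.\<close>

definition classes_finite :: "'a set \<Rightarrow> nat \<Rightarrow> bool" where
  "classes_finite X n \<longleftrightarrow> (\<exists>b. classes_le b (cocycle X (Suc n)) (cobound X n))"

definition virtually_killed :: "'a set \<Rightarrow> nat \<Rightarrow> bool" where
  "virtually_killed X n \<longleftrightarrow>
     (\<exists>H. subgroup H G \<and> H \<subseteq> X \<and> fin_index H X \<and> cocycle X (Suc n) \<subseteq> cobound H n)"

text \<open>Finitely many representatives suffice, each with its own subgroup; over the intersection
  they all bound, and coboundaries stay coboundaries under restriction.\<close>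

lemma virtually_killed_uniform:
  assumes X: "subgroup X G" and fin: "classes_finite X n"
    and kill: "\<And>f. f \<in> cocycle X (Suc n) \<Longrightarrow> \<exists>H. subgroup H G \<and> H \<subseteq> X \<and> fin_index H X \<and> f \<in> cobound H n"
  shows "virtually_killed X n"
proof -
  obtain b where "classes_le b (cocycle X (Suc n)) (cobound X n)"
    using fin by (auto simp: classes_finite_def)
  then obtain R where R: "finite R" "R \<subseteq> cocycle X (Suc n)" 
    "\<And>f. f \<in> cocycle X (Suc n) \<Longrightarrow> \<exists>r\<in>R. (\<lambda>x. f x - r x) \<in> cobound X n"
    by (rule classes_le_reps[OF _ zero_cobound cobound_diff]) (assumption | rule that)+
  obtain K where K: "\<And>f. f \<in> R \<Longrightarrow> subgroup (K f) G \<and> fin_index (K f) X \<and> f \<in> cobound (K f) n"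
    using kill R(2) by (metis subset_iff)
  define H where "H = X \<inter> (carrier G \<inter> (\<Inter>f\<in>R. K f))"
  have KH: "subgroup (carrier G \<inter> (\<Inter>f\<in>R. K f)) G" "fin_index (carrier G \<inter> (\<Inter>f\<in>R. K f)) X"
    using fin_index_Inter[OF R(1) subgroup.subset[OF X], of K] K by blast+
  have XX: "fin_index X X"
    using fin_index_colour[of "{()}" X "\<lambda>_. ()" X] X by (auto simp: subgroup_def)
  have "subgroup H G" unfolding H_def using X KH(1) by (rule subgroups_Inter_pair)
  moreover have "fin_index H X"
    unfolding H_def using X KH(1) subgroup.subset[OF X] XX KH(2) by (rule fin_index_Int)
  moreover have "cocycle X (Suc n) \<subseteq> cobound H n"
  proof
    fix f assume "f \<in> cocycle X (Suc n)"
    then obtain r where r: "r \<in> R" "(\<lambda>x. f x - r x) \<in> cobound X n" using R(3) by blast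
    have "r \<in> cobound H n" using K[OF r(1)] cobound_anti[of H "K r" n] r(1) by (auto simp: H_def)
    moreover have "(\<lambda>x. f x - r x) \<in> cobound H n" using r(2) cobound_anti[of H X n] by (auto simp: H_def)
    ultimately show "f \<in> cobound H n" using cobound_add[of "\<lambda>x. f x - r x" H n r] by simp
  qed
  ultimately show ?thesis unfolding virtually_killed_def H_def by blast
qed

lemma rank1_normalizes: "rank1 X M \<Longrightarrow> t \<in> X \<Longrightarrow> normalizes t M"
  using rank1_normal by (auto simp: normalizes_def)

text \<open>Compactness separates each pair of incongruent cocycles by finitely many elements of
  \<open>Y\<close>. For a finite set of cocycles all these elements lie in one \<langle>N,
  t\<rangle>, over which the set is still incongruent, and the Wang bound there does not depend on
  \<open>t\<close>.\<close>

lemma rank1_classes_finite: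
  assumes r: "rank1 Y N" and fin: "\<And>k. classes_finite N (Suc k)"
  shows "classes_finite Y (Suc n)"
proof -
  have Y: "subgroup Y G" and N: "subgroup N G" "N \<subseteq> Y" using r by (auto simp: rank1_def)
  note Yc = subgroup.subset[OF Y]
  obtain b1 where b1: "classes_le b1 (cocycle N (Suc (Suc n))) (cobound N (Suc n))"
    using fin by (auto simp: classes_finite_def)
  obtain b2 where b2: "classes_le b2 (cocycle N (Suc n)) (bound_or_zero N n)"
  proof (cases n)
    case 0
    then show thesis using that classes_degree_zero by blast
  next
    case (Suc m)
    then show thesis using that fin[of m] by (auto simp: classes_finite_def bound_or_zero_def)
  qed
  have "classes_le (max b1 (b1 * b2)) (cocycle Y (Suc (Suc n))) (cobound Y (Suc n))"
    unfolding classes_le_def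
  proof (intro allI impI; elim conjE)
    fix F assume F: "finite F" "F \<subseteq> cocycle Y (Suc (Suc n))" "separated (cobound Y (Suc n)) F"
    have "\<exists>S. finite S \<and> S \<subseteq> Y \<and> (\<lambda>x. f x - g x) \<notin> cobound S (Suc n)"
      if "f \<in> F" "g \<in> F" "f \<noteq> g" for f g
      using cobound_compact[OF Yc, of "\<lambda>x. f x - g x" "Suc n"] F(3) that unfolding separated_def by blast
    then obtain S where S: "\<And>f g. f \<in> F \<Longrightarrow> g \<in> F \<Longrightarrow> f \<noteq> g \<Longrightarrow>
        finite (S f g) \<and> S f g \<subseteq> Y \<and> (\<lambda>x. f x - g x) \<notin> cobound (S f g) (Suc n)"
      by metis
    define U where "U = (\<Union>f\<in>F. \<Union>g\<in>F - {f}. S f g)"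
    have "finite U" "U \<subseteq> Y" unfolding U_def using S F(1) by (auto; blast)+
    then obtain t where t: "t \<in> Y" "\<And>s. s \<in> U \<Longrightarrow> \<exists>m\<in>N. \<exists>k::int. s = m \<otimes> t [^] k"
      using rank1_finite[OF r] by metis
    have tc: "t \<in> carrier G" using t(1) Yc by auto
    have Nc: "N \<subseteq> carrier G" using N(2) Yc by auto
    have sep: "separated (cobound (insert t N) (Suc n)) F"
      unfolding separated_def
    proof (intro ballI impI)
      fix f g assume fg: "f \<in> F" "g \<in> F" "f \<noteq> g"
      have "S f g \<subseteq> U" unfolding U_def using fg by blast
      then have "cobound (insert t N) (Suc n) \<subseteq> cobound (S f g) (Suc n)"
        using t(2) by (intro cobound_insert_generates[OF Nc tc]) blast
      then show "(\<lambda>x. f x - g x) \<notin> cobound (insert t N) (Suc n)" using S[OF fg] by blast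
    qed
    have FZ: "F \<subseteq> cocycle (insert t N) (Suc (Suc n))"
      using F(2) cocycle_anti[of "insert t N" Y "Suc (Suc n)"] t(1) N(2) by auto
    \<comment> \<open>If \<open>t\<close> lies in \<open>N\<close>, there is no extension and
      \<open>b1\<close> alone is the bound; hence the maximum.\<close>
    show "card F \<le> max b1 (b1 * b2)"
    proof (cases "t \<in> N")
      case True
      then have "insert t N = N" by auto
      then have "card F \<le> b1" using b1 F(1) FZ sep unfolding classes_le_def by metis
      then show ?thesis by simp
    next
      case False
      have free: "t [^] k \<notin> N" if "k \<noteq> 0" for k :: int
        using rank1_int_pow[OF r t(1) that] False by blast
      have "card F \<le> b1 * b2"
        using wang_classes[OF N(1) tc rank1_normalizes[OF r t(1)] free b1 b2] F(1) FZ sep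
        unfolding classes_le_def by blast
      then show ?thesis by simp
    qed
  qed
  then show ?thesis unfolding classes_finite_def by blast
qed

text \<open>In degree \<open>m + 2\<close>, passing to \<open>H1\<close> makes the restrictions to
  \<open>N1\<close> bound, and passing to \<open>H2\<close> makes the classes of \<open>N1\<close>
  in degree \<open>m + 1\<close> bound over \<open>N2\<close>; with both, \<open>wang_kill\<close>
  applies to each \<langle>N2, t\<rangle>. The lemma \<open>rank1_avoid\<close> produces
  \<open>H1\<close> and \<open>H2\<close> from subgroups of \<open>N\<close>. The second cut starts
  from \<open>N1\<close>, hence \<open>kill\<close> speaks of all subgroups of \<open>N\<close>.
  Degree one is separate because classes of degree zero cannot be made to vanish by
  restriction.\<close>

lemma rank1_virtually_killed:
  assumes r: "rank1 Y N" and chY: "r1chain {\<one>} Y" and chN: "r1chain {\<one>} N"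
    and fin: "\<And>k. classes_finite N (Suc k)"
    and kill: "\<And>N' k. subgroup N' G \<Longrightarrow> N' \<subseteq> N \<Longrightarrow> virtually_killed N' (Suc k)"
  shows "virtually_killed Y (Suc n)"
proof -
  have Y: "subgroup Y G" and N: "subgroup N G" "N \<subseteq> Y" using r by (auto simp: rank1_def)
  note Yc = subgroup.subset[OF Y]
  show ?thesis
  proof (cases n)
    case 0
    show ?thesis
    proof (rule virtually_killed_uniform[OF Y rank1_classes_finite[OF r fin]])
      fix f assume "f \<in> cocycle Y (Suc (Suc n))"
      then show "\<exists>H. subgroup H G \<and> H \<subseteq> Y \<and> fin_index H Y \<and> f \<in> cobound H (Suc n)"
        using degree_one_kill[OF Y] 0 by metis
    qed
  next
    case (Suc m)
    obtain K1 where K1: "subgroup K1 G" "K1 \<subseteq> N" "fin_index K1 N"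
      "cocycle N (Suc (Suc (Suc m))) \<subseteq> cobound K1 (Suc (Suc m))"
      using kill[OF N(1) order_refl, of "Suc m"] by (auto simp: virtually_killed_def)
    obtain H1 where H1: "subgroup H1 G" "H1 \<subseteq> Y" "fin_index H1 Y" "H1 \<inter> N \<subseteq> K1"
      using rank1_avoid[OF r chY chN K1(1,3)] by blast
    define N1 where "N1 = N \<inter> H1"
    have N1: "subgroup N1 G" "N1 \<subseteq> N" unfolding N1_def using N(1) H1(1) by (auto intro: subgroups_Inter_pair)
    have YH1: "Y \<inter> H1 = H1" using H1(2) by auto
    have r1: "rank1 H1 N1" using rank1_Int[OF r H1(1)] by (simp add: YH1 N1_def)
    have ch1: "r1chain {\<one>} H1" "r1chain {\<one>} N1"
      using r1chain_Int[OF chY H1(1)] r1chain_Int[OF chN H1(1)] subgroup.one_closed[OF H1(1)]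
      by (simp_all add: YH1 N1_def)
    obtain K2 where K2: "subgroup K2 G" "K2 \<subseteq> N1" "fin_index K2 N1"
      "cocycle N1 (Suc (Suc m)) \<subseteq> cobound K2 (Suc m)"
      using kill[OF N1, of m] by (auto simp: virtually_killed_def)
    obtain H2 where H2: "subgroup H2 G" "H2 \<subseteq> H1" "fin_index H2 H1" "H2 \<inter> N1 \<subseteq> K2"
      using rank1_avoid[OF r1 ch1 K2(1,3)] by blast
    define N2 where "N2 = N1 \<inter> H2"
    have "H1 \<inter> H2 = H2" using H2(2) by auto
    then have r2: "rank1 H2 N2" using rank1_Int[OF r1 H2(1)] by (simp add: N2_def)
    have N2: "subgroup N2 G" "N2 \<subseteq> N1" using r2 by (auto simp: rank1_def N2_def)
    have H2c: "H2 \<subseteq> carrier G" by (rule subgroup.subset[OF H2(1)])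
    have N1c: "N1 \<subseteq> carrier G" by (rule subgroup.subset[OF N1(1)])
    have "f \<in> cobound H2 (Suc (Suc m))" if f: "f \<in> cocycle Y (Suc (Suc (Suc m)))" for f
    \<comment> \<open>\<open>H2\<close> was chosen before \<open>t\<close>, so primitives over all
      \<langle>N2, t\<rangle> combine to one over \<open>H2\<close>.\<close>
    proof (rule cobound_compact[OF H2c])
      fix F assume F: "finite F" "F \<subseteq> H2"
      obtain t where t: "t \<in> H2" "\<And>s. s \<in> F \<Longrightarrow> \<exists>m\<in>N2. \<exists>k::int. s = m \<otimes> t [^] k"
        using rank1_finite[OF r2 F] by blast
      have tc: "t \<in> carrier G" using t(1) H2c by auto
      have fN: "f \<in> cocycle N (Suc (Suc (Suc m)))" using f cocycle_anti[OF N(2)] by blast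
      have fN1: "f \<in> cobound N1 (Suc (Suc m))"
        using fN K1(4) cobound_anti[of N1 K1 "Suc (Suc m)"] H1(4) by (auto simp: N1_def)
      have "f \<in> cobound (insert t N2) (Suc (Suc m))"
      proof (cases "t \<in> N2")
        case True
        then have "insert t N2 = N2" by auto
        then show ?thesis using fN1 cobound_anti[OF N2(2), of "Suc (Suc m)"] by auto
      next
        case False
        have free: "t [^] k \<notin> N2" if "k \<noteq> 0" for k :: int
          using rank1_int_pow[OF r2 t(1) that] False by blast
        have fi: "f \<in> cocycle (insert t N1) (Suc (Suc (Suc m)))"
          using f cocycle_anti[of "insert t N1" Y "Suc (Suc (Suc m))"] t(1) H1(2) H2(2) N1(2) N(2) by blast
        have "t \<in> H1" using t(1) H2(2) by auto
        have "cocycle N1 (Suc (Suc m)) \<subseteq> cobound N2 (Suc m)"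
          using K2(4) cobound_anti[of N2 K2 "Suc m"] H2(4) by (auto simp: N2_def)
        then show ?thesis
          using wang_kill[OF N1c N2 tc rank1_normalizes[OF r1 \<open>t \<in> H1\<close>] rank1_normalizes[OF r2 t(1)] free fi fN1]
          by blast
      qed
      moreover have "cobound (insert t N2) (Suc (Suc m)) \<subseteq> cobound F (Suc (Suc m))"
        using N2(2) N1c t(2) by (intro cobound_insert_generates tc) auto
      ultimately show "f \<in> cobound F (Suc (Suc m))" by blast
    qed
    moreover have "fin_index H2 Y"
      using H2(1) H1(1) Yc H1(2) Y H2(3) H1(3) by (rule fin_index_trans)
    ultimately show ?thesis
      unfolding virtually_killed_def Suc using H2(1,2) H1(2) by blast
  qed
qed

text \<open>Intersecting a chain of \<open>X\<close> with \<open>Y\<close> gives a chain of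
  \<open>Y\<close>. Quantifying over all subgroups is what lets the induction hypothesis reach those
  that arise from the cuts in the step.\<close>

theorem chain_cohomology:
  assumes "r1chain {\<one>} X" "subgroup Y G" "Y \<subseteq> X"
  shows "classes_finite Y (Suc n)" "virtually_killed Y (Suc n)"
proof -
  have "\<forall>Y n. subgroup Y G \<longrightarrow> Y \<subseteq> X \<longrightarrow> classes_finite Y (Suc n) \<and> virtually_killed Y (Suc n)"
    using assms(1)
  proof (induction rule: r1chain.induct)
    case base
    show ?case
    proof (intro allI impI)
      fix Y n assume "subgroup Y G" "Y \<subseteq> {\<one>}"
      then have Y: "Y = {\<one>}" "subgroup {\<one>} G"
        using subgroup.one_closed[of Y G] triv_subgroup by auto
      have fin: "classes_finite Y (Suc n)"
        unfolding classes_finite_def Y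
      proof (intro exI[of _ 1] classes_le_colour[where C = "{()}" and c = "\<lambda>_. ()"])
        fix f g assume "f \<in> cocycle {\<one>} (Suc (Suc n))" "g \<in> cocycle {\<one>} (Suc (Suc n))"
        then show "(\<lambda>x. f x - g x) \<in> cobound {\<one>} (Suc n)"
          by (intro subsetD[OF cocycle_trivial_group] cocycle_diff)
      qed auto
      moreover have "virtually_killed Y (Suc n)"
        using Y cocycle_trivial_group[of "Suc n"] unfolding virtually_killed_def
        by (intro exI[of _ "{\<one>}"]) (auto simp: fin_index_def intro!: exI[of _ "{\<one>}"])
      ultimately show "classes_finite Y (Suc n) \<and> virtually_killed Y (Suc n)" by blast
    qed
  next
    case (step M X)
    show ?case
    proof (intro allI impI)
      fix Y n assume Y: "subgroup Y G" "Y \<subseteq> X"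
      define N where "N = M \<inter> Y"
      have XY: "X \<inter> Y = Y" using Y(2) by auto
      have r: "rank1 Y N" using rank1_Int[OF step.hyps(2) Y(1)] by (simp add: N_def XY)
      have chX: "r1chain {\<one>} X" using step.hyps by (rule r1chain.step)
      have ch: "r1chain {\<one>} Y" "r1chain {\<one>} N"
        using r1chain_Int[OF chX Y(1)] r1chain_Int[OF step.hyps(1) Y(1)] subgroup.one_closed[OF Y(1)]
        by (simp_all add: N_def XY)
      have IH: "classes_finite N' (Suc k)" "virtually_killed N' (Suc k)" if "subgroup N' G" "N' \<subseteq> N" for N' k
        using step.IH that by (auto simp: N_def)
      have N: "subgroup N G" using r by (simp add: rank1_def)
      show "classes_finite Y (Suc n) \<and> virtually_killed Y (Suc n)"
        using rank1_classes_finite[OF r] rank1_virtually_killed[OF r ch] IH N by blast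
    qed
  qed
  then show "classes_finite Y (Suc n)" "virtually_killed Y (Suc n)" using assms(2,3) by auto
qed

end

section \<open>Uniform vanishing for finite index normal subgroups\<close>

context finite_gmodule
begin

text \<open>Classes of \<open>V\<close> are first restricted to the intersection with
  \<open>H\<close>, a subgroup of a group with a chain, and made to vanish there; the normal core
  restores normality in \<open>G\<close>. In degree zero the augmented complex is exact
  already.\<close>

lemma uniform_kill:
  assumes ch: "r1chain {\<one>} H" and fiH: "fin_index H (carrier G)" and V: "V \<in> finite_index_normal G"
  obtains V' where "V' \<in> finite_index_normal G" "V' \<subseteq> V" "cocycle V (Suc n) \<subseteq> cobound V' n"
proof (cases n)
  case 0
  then show thesis using that[OF V order_refl] cocycle_1_cobound[OF finite_index_normalD(4)[OF V]] by simp
next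
  case (Suc m)
  note VD = finite_index_normalD[OF V]
  have H: "subgroup H G" using r1chain_subgroup[OF ch] by simp
  define X where "X = V \<inter> H"
  have X: "subgroup X G" "X \<subseteq> H" using VD(2) H by (auto simp: X_def intro: subgroups_Inter_pair)
  have fX: "fin_index X (carrier G)" unfolding X_def using VD(2) H order_refl VD(3) fiH by (rule fin_index_Int)
  obtain K where K: "subgroup K G" "K \<subseteq> X" "fin_index K X" "cocycle X (Suc (Suc m)) \<subseteq> cobound K (Suc m)"
    using chain_cohomology(2)[OF ch X, of m] by (auto simp: virtually_killed_def)
  have "fin_index K (carrier G)"
    using K(1) X(1) order_refl subgroup.subset[OF X(1)] subgroup_self K(3) fX by (rule fin_index_trans)
  then obtain N where N: "N \<in> finite_index_normal G" "N \<subseteq> K"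
    using finite_index_normal_core[OF K(1)] by blast
  have "cocycle V (Suc n) \<subseteq> cobound N n"
    using cocycle_anti[of X V "Suc n"] K(4) cobound_anti[OF N(2), of n] Suc by (auto simp: X_def)
  then show thesis using that[OF N(1)] N(2) K(2) by (auto simp: X_def)
qed

section \<open>The double complex\<close>

text \<open>Left cosets are used because the group translates lists from the left: the relation is
  then stable under \<open>lmul\<close>.\<close>

definition lev :: "'a set \<Rightarrow> 'a list \<Rightarrow> 'a list \<Rightarrow> bool" where
  "lev V = list_all2 (\<lambda>x y. inv x \<otimes> y \<in> V)"

lemma lev_mono: "lev V' xs ys \<Longrightarrow> V' \<subseteq> V \<Longrightarrow> lev V xs ys"
  unfolding lev_def by (erule list_all2_mono) auto

lemma lev_Cons [simp]: "lev V (x # xs) (y # ys) \<longleftrightarrow> inv x \<otimes> y \<in> V \<and> lev V xs ys"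
  by (simp add: lev_def)

lemma lev_refl:
  assumes "subgroup V G" "xs \<in> lists_n n"
  shows "lev V xs xs"
  using assms by (auto simp: lev_def lists_n_def list_all2_same subgroup.one_closed)

lemma cob_rel:
  assumes "\<And>w w'. w \<in> lists_n n \<Longrightarrow> w' \<in> lists_n n \<Longrightarrow> lev V w w' \<Longrightarrow> f w = g w'"
    and "xs \<in> lists_n (Suc n)" "ys \<in> lists_n (Suc n)" "lev V xs ys"
  shows "cob f xs = cob g ys"
  using assms
proof (induction n arbitrary: f g xs ys)
  case 0
  then show ?case by (auto elim!: lists_SucE)
next
  case (Suc n)
  obtain x xs' where x: "xs = x # xs'" "x \<in> carrier G" "xs' \<in> lists_n (Suc n)"
    using Suc.prems(2) by (rule lists_SucE)
  obtain y ys' where y: "ys = y # ys'" "y \<in> carrier G" "ys' \<in> lists_n (Suc n)"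
    using Suc.prems(3) by (rule lists_SucE)
  have "cob (\<lambda>w. f (x # w)) xs' = cob (\<lambda>w. g (y # w)) ys'"
    by (rule Suc.IH) (use Suc.prems x y in auto)
  moreover have "f xs' = g ys'" using Suc.prems x y by auto
  ultimately show ?case using x y by simp
qed

text \<open>For \<open>j > 0\<close> the column \<open>bich V j\<close> is a finite product of complexes computing the cohomology
  of \<open>V\<close>, so it becomes exact on passing to a smaller \<open>V\<close>; \<open>fich\<close> is the finite part of it.\<close>

definition bich :: "'a set \<Rightarrow> nat \<Rightarrow> nat \<Rightarrow> ('a list \<Rightarrow> 'a list \<Rightarrow> 'v) set" where
  "bich V j k = {f. (\<forall>xs\<in>lists_n j. \<forall>ys\<in>lists_n k. f xs ys \<in> B \<and>
       (\<forall>g\<in>carrier G. f (lmul g xs) (lmul g ys) = act g (f xs ys)) \<and>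
       (\<forall>xs'\<in>lists_n j. lev V xs xs' \<longrightarrow> f xs ys = f xs' ys))}"

definition fich :: "'a set \<Rightarrow> nat \<Rightarrow> nat \<Rightarrow> ('a list \<Rightarrow> 'a list \<Rightarrow> 'v) set" where
  "fich V j k = {f \<in> bich V j k. \<forall>xs\<in>lists_n j. \<forall>ys\<in>lists_n k. \<forall>ys'\<in>lists_n k.
       lev V ys ys' \<longrightarrow> f xs ys = f xs ys'}"

definition dv :: "('a list \<Rightarrow> 'a list \<Rightarrow> 'v) \<Rightarrow> 'a list \<Rightarrow> 'a list \<Rightarrow> 'v" where
  "dv f = (\<lambda>xs ys. cob (f xs) ys)"

definition dh :: "('a list \<Rightarrow> 'a list \<Rightarrow> 'v) \<Rightarrow> 'a list \<Rightarrow> 'a list \<Rightarrow> 'v" where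
  "dh f = (\<lambda>xs ys. cob (\<lambda>w. f w ys) xs)"

lemma bichI:
  assumes "\<And>xs ys. xs \<in> lists_n j \<Longrightarrow> ys \<in> lists_n k \<Longrightarrow> f xs ys \<in> B"
    and "\<And>g xs ys. g \<in> carrier G \<Longrightarrow> xs \<in> lists_n j \<Longrightarrow> ys \<in> lists_n k \<Longrightarrow> f (lmul g xs) (lmul g ys) = act g (f xs ys)"
    and "\<And>xs xs' ys. xs \<in> lists_n j \<Longrightarrow> xs' \<in> lists_n j \<Longrightarrow> ys \<in> lists_n k \<Longrightarrow> lev V xs xs' \<Longrightarrow> f xs ys = f xs' ys"
  shows "f \<in> bich V j k"
  using assms unfolding bich_def by blast

lemma bichD:
  assumes "f \<in> bich V j k" "xs \<in> lists_n j" "ys \<in> lists_n k"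
  shows "f xs ys \<in> B" "\<And>g. g \<in> carrier G \<Longrightarrow> f (lmul g xs) (lmul g ys) = act g (f xs ys)"
    "\<And>xs'. xs' \<in> lists_n j \<Longrightarrow> lev V xs xs' \<Longrightarrow> f xs ys = f xs' ys"
  using assms unfolding bich_def by blast+

lemma fichI:
  assumes "f \<in> bich V j k"
    and "\<And>xs ys ys'. xs \<in> lists_n j \<Longrightarrow> ys \<in> lists_n k \<Longrightarrow> ys' \<in> lists_n k \<Longrightarrow> lev V ys ys' \<Longrightarrow> f xs ys = f xs ys'"
  shows "f \<in> fich V j k"
  using assms unfolding fich_def by blast

lemma fich_bich: "f \<in> fich V j k \<Longrightarrow> f \<in> bich V j k"
  unfolding fich_def by blast

lemma fichD:
  assumes "f \<in> fich V j k" "xs \<in> lists_n j" "ys \<in> lists_n k" "ys' \<in> lists_n k" "lev V ys ys'"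
  shows "f xs ys = f xs ys'"
  using assms unfolding fich_def by blast

lemma bich_mono: "V' \<subseteq> V \<Longrightarrow> f \<in> bich V j k \<Longrightarrow> f \<in> bich V' j k"
  by (rule bichI) (auto intro: bichD lev_mono)

lemma fich_mono: "V' \<subseteq> V \<Longrightarrow> f \<in> fich V j k \<Longrightarrow> f \<in> fich V' j k"
  by (rule fichI) (auto intro: bich_mono fich_bich fichD lev_mono)

lemma bich_zero: "(\<lambda>_ _. 0) \<in> bich V j k"
  by (rule bichI) auto

lemma bich_diff:
  assumes "f \<in> bich V j k" "g \<in> bich V j k" shows "(\<lambda>xs ys. f xs ys - g xs ys) \<in> bich V j k"
proof (rule bichI)
  fix xs ys assume xy: "xs \<in> lists_n j" "ys \<in> lists_n k"
  note f = bichD[OF assms(1) xy] and g = bichD[OF assms(2) xy]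
  show "f xs ys - g xs ys \<in> B" using f(1) g(1) by (rule diff_B)
  show "f (lmul h xs) (lmul h ys) - g (lmul h xs) (lmul h ys) = act h (f xs ys - g xs ys)"
    if "h \<in> carrier G" for h using f(2)[OF that] g(2)[OF that] by (simp add: act_diff)
  show "f xs ys - g xs ys = f xs' ys - g xs' ys" if "xs' \<in> lists_n j" "lev V xs xs'" for xs'
    using f(3)[OF that] g(3)[OF that] by simp
qed

lemma fich_diff:
  assumes "f \<in> fich V j k" "g \<in> fich V j k" shows "(\<lambda>xs ys. f xs ys - g xs ys) \<in> fich V j k"
proof (rule fichI)
  fix xs ys ys' assume "xs \<in> lists_n j" "ys \<in> lists_n k" "ys' \<in> lists_n k" "lev V ys ys'"
  from fichD[OF assms(1) this] fichD[OF assms(2) this] show "f xs ys - g xs ys = f xs ys' - g xs ys'" by simp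
qed (intro bich_diff fich_bich assms)

lemma fich_zero: "(\<lambda>_ _. 0) \<in> fich V j k"
  by (rule fichI) (auto intro: bich_zero)

lemma fich_add:
  assumes "f \<in> fich V j k" "g \<in> fich V j k" shows "(\<lambda>xs ys. f xs ys + g xs ys) \<in> fich V j k"
  using fich_diff[OF assms(1) fich_diff[OF fich_zero assms(2)]] by simp

lemma bich_cong:
  assumes "f \<in> bich V j k" "\<And>xs ys. xs \<in> lists_n j \<Longrightarrow> ys \<in> lists_n k \<Longrightarrow> f xs ys = g xs ys"
  shows "g \<in> bich V j k"
proof (rule bichI)
  fix xs ys assume xy: "xs \<in> lists_n j" "ys \<in> lists_n k"
  note f = bichD[OF assms(1) xy]
  show "g xs ys \<in> B" using f(1) assms(2)[OF xy] by simp
  show "g (lmul h xs) (lmul h ys) = act h (g xs ys)" if "h \<in> carrier G" for h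
    using f(2)[OF that] xy that assms(2) by simp
  show "g xs ys = g xs' ys" if "xs' \<in> lists_n j" "lev V xs xs'" for xs'
    using f(3)[OF that] xy that assms(2) by simp
qed

lemma fich_cong:
  assumes "f \<in> fich V j k" "\<And>xs ys. xs \<in> lists_n j \<Longrightarrow> ys \<in> lists_n k \<Longrightarrow> f xs ys = g xs ys"
  shows "g \<in> fich V j k"
proof (rule fichI)
  show "g \<in> bich V j k" by (rule bich_cong[OF fich_bich[OF assms(1)] assms(2)])
  fix xs ys ys' assume *: "xs \<in> lists_n j" "ys \<in> lists_n k" "ys' \<in> lists_n k" "lev V ys ys'"
  then show "g xs ys = g xs ys'" using fichD[OF assms(1) *] assms(2) by simp
qed

lemma dv_bich:
  assumes "f \<in> bich V j k" shows "dv f \<in> bich V j (Suc k)"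
proof (rule bichI)
  fix xs ys assume xy: "xs \<in> lists_n j" "ys \<in> lists_n (Suc k)"
  show "dv f xs ys \<in> B" unfolding dv_def using xy(2) by (rule cob_B[rotated]) (rule bichD(1)[OF assms xy(1)])
  show "dv f (lmul h xs) (lmul h ys) = act h (dv f xs ys)" if h: "h \<in> carrier G" for h
  proof -
    have "dv f (lmul h xs) (lmul h ys) = cob (\<lambda>w. f (lmul h xs) (lmul h w)) ys"
      unfolding dv_def by (rule cob_map)
    also have "\<dots> = cob (\<lambda>w. act h (f xs w)) ys"
      using xy(2) by (rule cob_cong[rotated]) (rule bichD(2)[OF assms xy(1) _ h])
    also have "\<dots> = act h (dv f xs ys)"
      unfolding dv_def by (rule cob_additive[symmetric]) (rule act_add)
    finally show ?thesis .
  qed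
  show "dv f xs ys = dv f xs' ys" if "xs' \<in> lists_n j" "lev V xs xs'" for xs'
    unfolding dv_def using xy(2) by (rule cob_cong[rotated]) (rule bichD(3)[OF assms xy(1) _ that])
qed

lemma dh_bich:
  assumes "f \<in> bich V j k" shows "dh f \<in> bich V (Suc j) k"
proof (rule bichI)
  fix xs ys assume xy: "xs \<in> lists_n (Suc j)" "ys \<in> lists_n k"
  show "dh f xs ys \<in> B" unfolding dh_def using xy(1) by (rule cob_B[rotated]) (rule bichD(1)[OF assms _ xy(2)])
  show "dh f (lmul h xs) (lmul h ys) = act h (dh f xs ys)" if h: "h \<in> carrier G" for h
  proof -
    have "dh f (lmul h xs) (lmul h ys) = cob (\<lambda>w. f (lmul h w) (lmul h ys)) xs"
      unfolding dh_def by (rule cob_map)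
    also have "\<dots> = cob (\<lambda>w. act h (f w ys)) xs"
      using xy(1) by (rule cob_cong[rotated]) (rule bichD(2)[OF assms _ xy(2) h])
    also have "\<dots> = act h (dh f xs ys)"
      unfolding dh_def by (rule cob_additive[symmetric]) (rule act_add)
    finally show ?thesis .
  qed
  show "dh f xs ys = dh f xs' ys" if "xs' \<in> lists_n (Suc j)" "lev V xs xs'" for xs'
    unfolding dh_def using _ xy(1) that by (rule cob_rel) (rule bichD(3)[OF assms _ xy(2)])
qed

lemma dv_fich:
  assumes "f \<in> fich V j k" shows "dv f \<in> fich V j (Suc k)"
proof (rule fichI)
  fix xs ys ys' assume *: "xs \<in> lists_n j" "ys \<in> lists_n (Suc k)" "ys' \<in> lists_n (Suc k)" "lev V ys ys'"
  show "dv f xs ys = dv f xs ys'"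
    unfolding dv_def using _ *(2-4) by (rule cob_rel) (rule fichD[OF assms *(1)])
qed (intro dv_bich fich_bich assms)

lemma dh_fich:
  assumes "f \<in> fich V j k" shows "dh f \<in> fich V (Suc j) k"
proof (rule fichI)
  fix xs ys ys' assume *: "xs \<in> lists_n (Suc j)" "ys \<in> lists_n k" "ys' \<in> lists_n k" "lev V ys ys'"
  show "dh f xs ys = dh f xs ys'"
    unfolding dh_def using *(1) by (rule cob_cong[rotated]) (rule fichD[OF assms _ *(2-4)])
qed (intro dh_bich fich_bich assms)

lemma dv_dh: "dv (dh f) = dh (dv f)"
  unfolding dv_def dh_def by (intro ext) (rule cob_commute[symmetric])

lemma dv_dv: "dv (dv f) = (\<lambda>_ _. 0)"
  by (simp add: dv_def fun_eq_iff)

lemma dh_dh: "dh (dh f) = (\<lambda>_ _. 0)"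
proof -
  have "cob (\<lambda>w. cob (\<lambda>v. f v ys) w) xs = 0" for xs ys using cob_cob[of "\<lambda>v. f v ys" xs] .
  then show ?thesis by (simp add: dh_def fun_eq_iff)
qed

lemma dv_diff: "dv (\<lambda>xs ys. f xs ys - g xs ys) = (\<lambda>xs ys. dv f xs ys - dv g xs ys)"
  by (simp add: dv_def fun_eq_iff cob_diff)

lemma dh_diff: "dh (\<lambda>xs ys. f xs ys - g xs ys) = (\<lambda>xs ys. dh f xs ys - dh g xs ys)"
  by (simp add: dh_def fun_eq_iff cob_diff)

text \<open>Prepending \<open>hd xs\<close> to the second block contracts the columns, and
  \<open>cob_cob\<close> gives the formula. When \<open>dv f\<close> is of finite level, so is its
  contraction, which thus has the same vertical coboundary as \<open>f\<close>.\<close>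

lemma dv_hd: "dv (\<lambda>xs ys. dv f xs (hd xs # ys)) = dv f"
proof -
  have "cob (\<lambda>ys. cob (f xs) (hd xs # ys)) ys = cob (f xs) ys" for xs ys
    using cob_cob[of "f xs" "hd xs # ys"] by (simp add: cob_diff)
  then show ?thesis by (simp add: dv_def fun_eq_iff)
qed

lemma hd_lists:
  assumes "ys \<in> lists_n (Suc k)"
  shows "hd ys \<in> carrier G" "hd (lmul a ys) = a \<otimes> hd ys"
  using assms by (auto elim!: lists_SucE)

lemma lev_hd:
  assumes "lev V xs ys" "xs \<in> lists_n (Suc k)"
  shows "inv hd xs \<otimes> hd ys \<in> V"
  using assms by (cases xs; cases ys) (auto simp: lev_def lists_n_def)

text \<open>Prepending the first variable of the other block is an equivariant contraction.\<close>

lemma bich_hd_row: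
  assumes V: "subgroup V G" and g: "g \<in> bich V (Suc j) (Suc k)"
  shows "(\<lambda>xs ys. g (hd ys # xs) ys) \<in> bich V j (Suc k)"
proof (rule bichI)
  fix xs ys assume xy: "xs \<in> lists_n j" "ys \<in> lists_n (Suc k)"
  have c: "hd ys # xs \<in> lists_n (Suc j)" using xy hd_lists by simp
  note g' = bichD[OF g c xy(2)]
  show "g (hd ys # xs) ys \<in> B" by (rule g'(1))
  show "g (hd (lmul h ys) # lmul h xs) (lmul h ys) = act h (g (hd ys # xs) ys)" if "h \<in> carrier G" for h
    using g'(2)[OF that] by (simp add: hd_lists(2)[OF xy(2)])
  show "g (hd ys # xs) ys = g (hd ys # xs') ys" if "xs' \<in> lists_n j" "lev V xs xs'" for xs'
    using that xy hd_lists(1)[OF xy(2)] V by (intro g'(3)) (auto simp: subgroup.one_closed)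
qed

lemma fich_hd_row:
  assumes V: "subgroup V G" and g: "g \<in> fich V (Suc j) (Suc k)"
  shows "(\<lambda>xs ys. g (hd ys # xs) ys) \<in> fich V j (Suc k)"
proof (rule fichI)
  fix xs ys ys' assume *: "xs \<in> lists_n j" "ys \<in> lists_n (Suc k)" "ys' \<in> lists_n (Suc k)" "lev V ys ys'"
  have c: "hd ys # xs \<in> lists_n (Suc j)" "hd ys' # xs \<in> lists_n (Suc j)" using * hd_lists by simp_all
  have "g (hd ys # xs) ys = g (hd ys' # xs) ys"
    using lev_hd[OF *(4,2)] lev_refl[OF V *(1)] by (intro bichD(3)[OF fich_bich[OF g] c(1) *(2) c(2)]) simp
  also have "\<dots> = g (hd ys' # xs) ys'" by (rule fichD[OF g c(2) *(2-4)])
  finally show "g (hd ys # xs) ys = g (hd ys' # xs) ys'" .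
qed (intro bich_hd_row V fich_bich g)

lemma fich_hd_column:
  assumes V: "subgroup V G" and e: "e \<in> fich V (Suc j) (Suc k)"
  shows "(\<lambda>xs ys. e xs (hd xs # ys)) \<in> fich V (Suc j) k"
proof (rule fichI[OF bichI])
  fix xs ys assume xy: "xs \<in> lists_n (Suc j)" "ys \<in> lists_n k"
  have c: "hd xs # ys \<in> lists_n (Suc k)" using xy hd_lists by simp
  note e' = bichD[OF fich_bich[OF e] xy(1) c]
  show "e xs (hd xs # ys) \<in> B" by (rule e'(1))
  show "e (lmul h xs) (hd (lmul h xs) # lmul h ys) = act h (e xs (hd xs # ys))" if "h \<in> carrier G" for h
    using e'(2)[OF that] by (simp add: hd_lists(2)[OF xy(1)])
  show "e xs (hd xs # ys) = e xs' (hd xs' # ys)" if xs': "xs' \<in> lists_n (Suc j)" "lev V xs xs'" for xs'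
  proof -
    have c': "hd xs' # ys \<in> lists_n (Suc k)" using xy xs' hd_lists by simp
    have "e xs (hd xs # ys) = e xs (hd xs' # ys)"
      using lev_hd[OF xs'(2) xy(1)] lev_refl[OF V xy(2)] by (intro fichD[OF e xy(1) c c']) simp
    also have "\<dots> = e xs' (hd xs' # ys)" by (rule bichD(3)[OF fich_bich[OF e] xy(1) c' xs'])
    finally show ?thesis .
  qed
  show "e xs (hd xs # ys) = e xs (hd xs # ys')" if "ys' \<in> lists_n k" "lev V ys ys'" for ys'
    using that xy hd_lists(1)[OF xy(1)] V by (intro fichD[OF e xy(1)]) (auto simp: subgroup.one_closed)
qed

text \<open>The homotopy formula \<open>s dh + dh s = id\<close> for the operator \<open>s\<close>
  that prepends \<open>hd ys\<close> to the first block. As \<open>s\<close> preserves finite level,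
  rows are exact modulo their finite part without shrinking \<open>V\<close>.\<close>

lemma dh_hd_row: "g xs ys - dh (\<lambda>xs ys. g (hd ys # xs) ys) xs ys = dh g (hd ys # xs) ys"
  by (simp add: dh_def)

lemma row_exact:
  assumes V: "subgroup V G" and g: "g \<in> bich V (Suc j) (Suc k)" and dg: "dh g \<in> fich V (Suc (Suc j)) (Suc k)"
  obtains h where "h \<in> bich V j (Suc k)" "(\<lambda>xs ys. g xs ys - dh h xs ys) \<in> fich V (Suc j) (Suc k)"
proof
  show "(\<lambda>xs ys. g (hd ys # xs) ys) \<in> bich V j (Suc k)" by (rule bich_hd_row[OF V g])
  show "(\<lambda>xs ys. g xs ys - dh (\<lambda>xs ys. g (hd ys # xs) ys) xs ys) \<in> fich V (Suc j) (Suc k)"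
    unfolding dh_hd_row using fich_hd_row[OF V dg] .
qed

text \<open>With an empty first block \<open>s\<close> is a left inverse of \<open>dh\<close>, and
  it preserves finite level.\<close>

lemma row_injective:
  assumes V: "subgroup V G" and dg: "dh g \<in> fich V (Suc 0) (Suc k)"
  shows "g \<in> fich V 0 (Suc k)"
proof (rule fich_cong[OF fich_hd_row[OF V dg]])
  show "dh g (hd ys # xs) ys = g xs ys" if "xs \<in> lists_n 0" for xs ys
    using that by (simp add: dh_def)
qed

lemma normal_coset_rep:
  assumes V: "V \<in> finite_index_normal G"
  obtains r where "\<And>x. x \<in> carrier G \<Longrightarrow> r x \<in> carrier G \<and> inv x \<otimes> r x \<in> V"
    "\<And>x y. x \<in> carrier G \<Longrightarrow> y \<in> carrier G \<Longrightarrow> inv x \<otimes> y \<in> V \<Longrightarrow> r x = r y"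
proof -
  interpret V: subgroup V G by (rule finite_index_normalD[OF V])
  define D where "D x = {y \<in> carrier G. inv x \<otimes> y \<in> V}" for x
  define r where "r x = (SOME y. y \<in> D x)" for x
  have r: "r x \<in> D x" if "x \<in> carrier G" for x
    unfolding r_def by (rule someI[of _ x]) (use that in \<open>simp add: D_def\<close>)
  have "D x \<subseteq> D y" if xy: "x \<in> carrier G" "y \<in> carrier G" "inv y \<otimes> x \<in> V" for x y
  proof
    fix z assume z: "z \<in> D x"
    have "(inv y \<otimes> x) \<otimes> (inv x \<otimes> z) \<in> V" using xy(3) z by (auto simp: D_def)
    then show "z \<in> D y" using z xy by (simp add: D_def m_assoc)
  qed
  moreover have "inv y \<otimes> x \<in> V" if "x \<in> carrier G" "y \<in> carrier G" "inv x \<otimes> y \<in> V" for x y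
    using V.m_inv_closed[OF that(3)] that(1,2) by (simp add: inv_mult_group)
  ultimately have Deq: "D x = D y" if "x \<in> carrier G" "y \<in> carrier G" "inv x \<otimes> y \<in> V" for x y
    using that by blast
  have "r x = r y" if "x \<in> carrier G" "y \<in> carrier G" "inv x \<otimes> y \<in> V" for x y
    unfolding r_def Deq[OF that] ..
  then show thesis using that[of r] r unfolding D_def by blast
qed

text \<open>Subtracting the finite level cochain \<open>g0\<close>, which has the same
  \<open>dv\<close>, leaves a vertically closed \<open>f\<close>. For a fixed first block this is a
  cocycle of \<open>V\<close>, so it bounds over \<open>V1\<close>. Primitives are taken only at
  first blocks in normal form and carried to the others by the action.\<close>

lemma column_exact:
  assumes V: "V \<in> finite_index_normal G" and V1: "V1 \<in> finite_index_normal G" "V1 \<subseteq> V"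
    and kill: "cocycle V (Suc k) \<subseteq> cobound V1 k"
    and g: "g \<in> bich V (Suc j) (Suc k)" and dg: "dv g \<in> fich V (Suc j) (Suc (Suc k))"
  obtains g' where "g' \<in> bich V1 (Suc j) k" "(\<lambda>xs ys. g xs ys - dv g' xs ys) \<in> fich V1 (Suc j) (Suc k)"
proof -
  note VD = finite_index_normalD[OF V] and V1D = finite_index_normalD[OF V1(1)]
  interpret V: subgroup V G by (rule VD)
  interpret V1: subgroup V1 G by (rule V1D)
  define g0 where "g0 = (\<lambda>xs ys. dv g xs (hd xs # ys))"
  have g0: "g0 \<in> fich V (Suc j) (Suc k)" unfolding g0_def using VD(2) dg by (rule fich_hd_column)
  have dvg0: "dv g0 = dv g" unfolding g0_def by (rule dv_hd)
  define f where "f = (\<lambda>xs ys. g xs ys - g0 xs ys)"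
  have f: "f \<in> bich V (Suc j) (Suc k)" unfolding f_def using g fich_bich[OF g0] by (rule bich_diff)
  have dvf: "dv f = (\<lambda>_ _. 0)" unfolding f_def dv_diff dvg0 by simp
  have fz: "f \<rho> \<in> cocycle V (Suc k)" if \<rho>: "\<rho> \<in> lists_n (Suc j)" for \<rho>
    unfolding cocycle_def cochain_def
  proof (intro CollectI conjI ballI)
    fix ys assume "ys \<in> lists_n (Suc k)"
    then show "f \<rho> ys \<in> B" using bichD(1)[OF f \<rho>] by blast
  next
    \<comment> \<open>Since \<open>V\<close> is normal, translating \<open>\<rho>\<close> by an
      element of \<open>V\<close> changes none of its left cosets. Diagonal equivariance under
      \<open>V\<close> therefore becomes equivariance in the second block alone.\<close>
    fix v ys assume v: "v \<in> V" and ys: "ys \<in> lists_n (Suc k)"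
    have vc: "v \<in> carrier G" using v VD(4) by auto
    have c: "lmul (inv v) \<rho> \<in> lists_n (Suc j)" using vc \<rho> by simp
    have "lev V (lmul (inv v) \<rho>) \<rho>"
      unfolding lev_def list_all2_conv_all_nth
    proof (intro conjI allI impI)
      fix i assume i: "i < length (lmul (inv v) \<rho>)"
      have xc: "\<rho> ! i \<in> carrier G" using \<rho> i by (auto simp: lists_n_def)
      have "inv (\<rho> ! i) \<otimes> v \<otimes> \<rho> ! i \<in> V" using VD(6)[OF xc v] .
      then show "inv (lmul (inv v) \<rho> ! i) \<otimes> \<rho> ! i \<in> V" using i xc vc by (simp add: inv_mult_group)
    qed simp
    then have "f (lmul (inv v) \<rho>) ys = f \<rho> ys" by (rule bichD(3)[OF f c ys \<rho>])
    moreover have "f (lmul v (lmul (inv v) \<rho>)) (lmul v ys) = act v (f (lmul (inv v) \<rho>) ys)"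
      by (rule bichD(2)[OF f c ys vc])
    ultimately show "f \<rho> (lmul v ys) = act v (f \<rho> ys)" using vc \<rho> by simp
  next
    fix ys show "cob (f \<rho>) ys = 0" using fun_cong[OF fun_cong[OF dvf], of \<rho> ys] by (simp add: dv_def)
  qed
  have "\<exists>u. u \<in> cochain V1 k \<and> (\<forall>ys\<in>lists_n (Suc k). f \<rho> ys = cob u ys)" if "\<rho> \<in> lists_n (Suc j)" for \<rho>
    using fz[OF that] kill unfolding cobound_def by blast
  then obtain u where u: "\<And>\<rho>. \<rho> \<in> lists_n (Suc j) \<Longrightarrow> u \<rho> \<in> cochain V1 k"
    "\<And>\<rho> ys. \<rho> \<in> lists_n (Suc j) \<Longrightarrow> ys \<in> lists_n (Suc k) \<Longrightarrow> f \<rho> ys = cob (u \<rho>) ys"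
    by metis
  obtain r where r: "\<And>x. x \<in> carrier G \<Longrightarrow> r x \<in> carrier G \<and> inv x \<otimes> r x \<in> V"
    "\<And>x y. x \<in> carrier G \<Longrightarrow> y \<in> carrier G \<Longrightarrow> inv x \<otimes> y \<in> V \<Longrightarrow> r x = r y"
    using normal_coset_rep[OF V] by blast
  \<comment> \<open>The normal form: the head is moved to \<open>\<one>\<close> by translation and
    all entries are replaced by coset representatives. It is invariant under translation and, by
    normality of \<open>V\<close>, depends only on the cosets of the entries.\<close>
  define \<rho> where "\<rho> xs = map r (lmul (inv (hd xs)) xs)" for xs
  have \<rho>c: "\<rho> xs \<in> lists_n (Suc j)" if "xs \<in> lists_n (Suc j)" for xs
  proof -
    have "lmul (inv (hd xs)) xs \<in> lists_n (Suc j)" using that hd_lists(1)[OF that] by simp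
    then show ?thesis unfolding \<rho>_def using r(1) by (auto simp: lists_n_def)
  qed
  \<comment> \<open>The primitives \<open>u\<close> are equivariant under \<open>V1\<close>. This
    absorbs a change of \<open>hd xs\<close> within its coset of \<open>V1\<close>, which is why the
    result has level \<open>V1\<close> in the first block.\<close>
  define g' where "g' = (\<lambda>xs ys. act (hd xs) (u (\<rho> xs) (lmul (inv (hd xs)) ys)))"
  have g'b: "g' \<in> bich V1 (Suc j) k"
  proof (rule bichI)
    fix xs ys assume xs: "xs \<in> lists_n (Suc j)" and ys: "ys \<in> lists_n k"
    note hc = hd_lists(1)[OF xs]
    have ys': "lmul (inv (hd xs)) ys \<in> lists_n k" using hc ys by simp
    show "g' xs ys \<in> B"
      unfolding g'_def by (rule act_B[OF hc cochain_B[OF u(1)[OF \<rho>c[OF xs]] ys']])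
    show "g' (lmul h xs) (lmul h ys) = act h (g' xs ys)" if h: "h \<in> carrier G" for h
    proof -
      have e: "lmul (inv (hd (lmul h xs))) (lmul h zs) = lmul (inv (hd xs)) zs" if "zs \<in> lists_n i" for zs i
        using that h hc by (simp add: hd_lists(2)[OF xs] lmul_lmul[of _ _ _ i] inv_mult_group m_assoc)
      show ?thesis
        unfolding g'_def \<rho>_def e[OF xs] e[OF ys] using h hc by (simp add: hd_lists(2)[OF xs] act_mult)
    qed
    show "g' xs ys = g' xs' ys" if xs': "xs' \<in> lists_n (Suc j)" "lev V1 xs xs'" for xs'
    proof -
      note hc' = hd_lists(1)[OF xs'(1)]
      define w where "w = inv (hd xs) \<otimes> hd xs'"
      have w: "w \<in> V1" unfolding w_def by (rule lev_hd[OF xs'(2) xs])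
      have wc: "w \<in> carrier G" "w \<in> V" using w V1(2) V1D(4) by auto
      have h': "hd xs' = hd xs \<otimes> w" unfolding w_def using hc hc' by simp
      have "\<rho> xs = \<rho> xs'"
        unfolding \<rho>_def
      proof (rule nth_equalityI)
        show "length (map r (lmul (inv hd xs) xs)) = length (map r (lmul (inv hd xs') xs'))"
          using xs xs' by (simp add: lists_n_def)
        fix i assume "i < length (map r (lmul (inv hd xs) xs))"
        then have i: "i < length xs" "i < length xs'" using xs xs' by (auto simp: lists_n_def)
        have xc: "xs ! i \<in> carrier G" "xs' ! i \<in> carrier G" using i xs xs' by (auto simp: lists_n_def)
        define wi where "wi = inv (xs ! i) \<otimes> xs' ! i"
        have wi: "wi \<in> V1" using xs'(2) i unfolding lev_def list_all2_conv_all_nth wi_def by blast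
        then have wic: "wi \<in> V" "wi \<in> carrier G" using V1(2) V1D(4) by auto
        have x': "xs' ! i = xs ! i \<otimes> wi" unfolding wi_def using xc by simp
        define a where "a = inv (hd xs) \<otimes> xs ! i"
        have ac: "a \<in> carrier G" unfolding a_def using hc xc by simp
        have "(inv a \<otimes> inv w \<otimes> a) \<otimes> wi \<in> V"
          using VD(6)[OF ac V.m_inv_closed[OF wc(2)]] wic(1) by (rule V.m_closed)
        also have "(inv a \<otimes> inv w \<otimes> a) \<otimes> wi = inv a \<otimes> (inv (hd xs') \<otimes> xs' ! i)"
          unfolding h' x' a_def using hc xc wc wic by (simp add: inv_mult_group m_assoc)
        finally have "r a = r (inv (hd xs') \<otimes> xs' ! i)" using ac hc' xc by (intro r(2)) auto
        then show "map r (lmul (inv hd xs) xs) ! i = map r (lmul (inv hd xs') xs') ! i"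
          using i by (simp add: a_def)
      qed
      moreover have "act (hd xs') (u (\<rho> xs') (lmul (inv (hd xs')) ys)) = act (hd xs) (u (\<rho> xs') (lmul (inv (hd xs)) ys))"
      proof -
        have "lmul (inv (hd xs')) ys = lmul (inv w) (lmul (inv (hd xs)) ys)"
          unfolding h' using hc wc ys by (simp add: lmul_lmul[of _ _ _ k] inv_mult_group)
        moreover have "u (\<rho> xs') (lmul (inv w) (lmul (inv (hd xs)) ys)) = act (inv w) (u (\<rho> xs') (lmul (inv (hd xs)) ys))"
          by (rule cochain_act[OF u(1)[OF \<rho>c[OF xs'(1)]] V1.m_inv_closed[OF w] ys'])
        ultimately show ?thesis unfolding h' using hc wc by (simp add: act_mult)
      qed
      ultimately show ?thesis unfolding g'_def by simp
    qed
  qed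
  have dvg': "dv g' xs ys = f xs ys" if xs: "xs \<in> lists_n (Suc j)" and ys: "ys \<in> lists_n (Suc k)" for xs ys
  proof -
    note hc = hd_lists(1)[OF xs]
    let ?x = "inv (hd xs)"
    have xs': "lmul ?x xs \<in> lists_n (Suc j)" and ys': "lmul ?x ys \<in> lists_n (Suc k)" using hc xs ys by simp_all
    have "dv g' xs ys = act (hd xs) (cob (\<lambda>w. u (\<rho> xs) (lmul ?x w)) ys)"
      unfolding dv_def g'_def by (rule cob_additive[symmetric]) (rule act_add)
    also have "cob (\<lambda>w. u (\<rho> xs) (lmul ?x w)) ys = cob (u (\<rho> xs)) (lmul ?x ys)"
      by (rule cob_map[symmetric])
    also have "\<dots> = f (\<rho> xs) (lmul ?x ys)" by (rule u(2)[OF \<rho>c[OF xs] ys', symmetric])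
    also have "\<dots> = f (lmul ?x xs) (lmul ?x ys)"
    proof (rule bichD(3)[OF f xs' ys' \<rho>c[OF xs], symmetric])
      show "lev V (lmul ?x xs) (\<rho> xs)"
        unfolding lev_def list_all2_conv_all_nth
      proof (intro conjI allI impI)
        show "length (lmul ?x xs) = length (\<rho> xs)" by (simp add: \<rho>_def)
        fix i assume i: "i < length (lmul ?x xs)"
        then have "xs ! i \<in> carrier G" using xs nth_mem[of i xs] by (auto simp: lists_n_def)
        then have "?x \<otimes> xs ! i \<in> carrier G" using hc by simp
        from r(1)[OF this] show "inv (lmul ?x xs ! i) \<otimes> \<rho> xs ! i \<in> V" using i by (simp add: \<rho>_def)
      qed
    qed
    also have "act (hd xs) \<dots> = f (lmul (hd xs) (lmul ?x xs)) (lmul (hd xs) (lmul ?x ys))"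
      by (rule bichD(2)[OF f xs' ys' hc, symmetric])
    finally show ?thesis using hc xs ys by simp
  qed
  show thesis
  proof (rule that[OF g'b])
    have "(\<lambda>xs ys. g0 xs ys) \<in> fich V1 (Suc j) (Suc k)" using fich_mono[OF V1(2) g0] by simp
    then show "(\<lambda>xs ys. g xs ys - dv g' xs ys) \<in> fich V1 (Suc j) (Suc k)"
      by (rule fich_cong) (simp add: dvg' f_def)
  qed
qed

text \<open>Induction along an antidiagonal: the column step applied to \<open>dh g\<close> produces
  a \<open>g'\<close> with \<open>j\<close> raised and \<open>k\<close> lowered, the induction
  hypothesis corrects \<open>g'\<close>, and the row step returns to \<open>g\<close>. Hence
  \<open>j\<close> and \<open>V\<close> are arbitrary. At \<open>k = 0\<close> the second block is
  empty and every cochain has finite level. The subgroup found depends on \<open>V\<close>,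
  \<open>j\<close>, \<open>k\<close> but not on \<open>g\<close>.\<close>

lemma zigzag:
  assumes unif: "\<And>V n. V \<in> finite_index_normal G \<Longrightarrow>
      \<exists>V'\<in>finite_index_normal G. V' \<subseteq> V \<and> cocycle V (Suc n) \<subseteq> cobound V' n"
    and V: "V \<in> finite_index_normal G"
  shows "\<exists>V'\<in>finite_index_normal G. V' \<subseteq> V \<and> (\<forall>g\<in>bich V (Suc j) k.
      dh (dv g) \<in> fich V (Suc (Suc j)) (Suc k) \<longrightarrow>
      (\<exists>h\<in>bich V' j k. dv (\<lambda>xs ys. g xs ys - dh h xs ys) \<in> fich V' (Suc j) (Suc k)))"
  using V
proof (induction k arbitrary: j V)
  case 0
  have "\<exists>h\<in>bich V j 0. dv (\<lambda>xs ys. g xs ys - dh h xs ys) \<in> fich V (Suc j) (Suc 0)"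
    if g: "g \<in> bich V (Suc j) 0" for g
  proof (intro bexI[OF _ bich_zero])
    have "g \<in> fich V (Suc j) 0" using g by (rule fichI) auto
    then have "dv g \<in> fich V (Suc j) (Suc 0)" by (rule dv_fich)
    then show "dv (\<lambda>xs ys. g xs ys - dh (\<lambda>_ _. 0) xs ys) \<in> fich V (Suc j) (Suc 0)"
      by (simp add: dh_def)
  qed
  then show ?case using 0 by blast
next
  case (Suc k)
  obtain V1 where V1: "V1 \<in> finite_index_normal G" "V1 \<subseteq> V" "cocycle V (Suc k) \<subseteq> cobound V1 k"
    using unif[OF Suc.prems] by blast
  obtain V2 where V2: "V2 \<in> finite_index_normal G" "V2 \<subseteq> V1"
    "\<And>g. g \<in> bich V1 (Suc (Suc j)) k \<Longrightarrow> dh (dv g) \<in> fich V1 (Suc (Suc (Suc j))) (Suc k) \<Longrightarrow>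
      \<exists>h\<in>bich V2 (Suc j) k. dv (\<lambda>xs ys. g xs ys - dh h xs ys) \<in> fich V2 (Suc (Suc j)) (Suc k)"
    using Suc.IH[OF V1(1), of "Suc j"] by blast
  note V2s = finite_index_normalD(2)[OF V2(1)]
  have "\<exists>h\<in>bich V2 j (Suc k). dv (\<lambda>xs ys. g xs ys - dh h xs ys) \<in> fich V2 (Suc j) (Suc (Suc k))"
    if g: "g \<in> bich V (Suc j) (Suc k)" and dg: "dh (dv g) \<in> fich V (Suc (Suc j)) (Suc (Suc k))" for g
  proof -
    obtain g' where g': "g' \<in> bich V1 (Suc (Suc j)) k"
      "(\<lambda>xs ys. dh g xs ys - dv g' xs ys) \<in> fich V1 (Suc (Suc j)) (Suc k)"
      by (rule column_exact[OF Suc.prems V1 dh_bich[OF g]]) (use dg dv_dh[of g] in auto)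
    have "dh (\<lambda>xs ys. dh g xs ys - dv g' xs ys) \<in> fich V1 (Suc (Suc (Suc j))) (Suc k)"
      using g'(2) by (rule dh_fich)
    then have "(\<lambda>xs ys. 0 - dh (dv g') xs ys) \<in> fich V1 (Suc (Suc (Suc j))) (Suc k)"
      unfolding dh_diff dh_dh .
    from fich_diff[OF fich_zero this] have "dh (dv g') \<in> fich V1 (Suc (Suc (Suc j))) (Suc k)" by simp
    then obtain h' where h': "h' \<in> bich V2 (Suc j) k"
      "dv (\<lambda>xs ys. g' xs ys - dh h' xs ys) \<in> fich V2 (Suc (Suc j)) (Suc k)"
      using V2(3)[OF g'(1)] by blast
    \<comment> \<open>Subtracting \<open>dv h'\<close> leaves \<open>dv g\<close> unchanged and
      brings \<open>dh g\<close> to finite level, so the row step becomes available.\<close>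
    have g2: "(\<lambda>xs ys. g xs ys - dv h' xs ys) \<in> bich V2 (Suc j) (Suc k)"
      using bich_mono[OF subset_trans[OF V2(2) V1(2)] g] dv_bich[OF h'(1)] by (rule bich_diff)
    have "(\<lambda>xs ys. (dh g xs ys - dv g' xs ys) + dv (\<lambda>xs ys. g' xs ys - dh h' xs ys) xs ys)
        \<in> fich V2 (Suc (Suc j)) (Suc k)"
      using fich_mono[OF V2(2) g'(2)] h'(2) by (rule fich_add)
    then have "dh (\<lambda>xs ys. g xs ys - dv h' xs ys) \<in> fich V2 (Suc (Suc j)) (Suc k)"
      unfolding dh_diff dv_diff dv_dh by simp
    then obtain h where h: "h \<in> bich V2 j (Suc k)"
      "(\<lambda>xs ys. (g xs ys - dv h' xs ys) - dh h xs ys) \<in> fich V2 (Suc j) (Suc k)"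
      by (rule row_exact[OF V2s g2])
    have "dv (\<lambda>xs ys. (g xs ys - dv h' xs ys) - dh h xs ys) \<in> fich V2 (Suc j) (Suc (Suc k))"
      using h(2) by (rule dv_fich)
    then have "dv (\<lambda>xs ys. g xs ys - dh h xs ys) \<in> fich V2 (Suc j) (Suc (Suc k))"
      unfolding dv_diff dv_dv by simp
    then show ?thesis using h(1) by blast
  qed
  then show ?case using V2(1,2) V1(2) by blast
qed

text \<open>For \<open>f\<close> a cocycle this yields both finiteness and surjectivity,
  for \<open>cob f\<close> of finite level injectivity.\<close>

theorem finite_level_approximation:
  assumes unif: "\<And>V n. V \<in> finite_index_normal G \<Longrightarrow>
      \<exists>V'\<in>finite_index_normal G. V' \<subseteq> V \<and> cocycle V (Suc n) \<subseteq> cobound V' n"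
    and V: "V \<in> finite_index_normal G"
  shows "\<exists>V'\<in>finite_index_normal G. \<forall>f\<in>cochain (carrier G) (Suc k).
      (\<forall>ys\<in>lists_n (Suc (Suc k)). \<forall>ys'\<in>lists_n (Suc (Suc k)). lev V ys ys' \<longrightarrow> cob f ys = cob f ys') \<longrightarrow>
      (\<exists>h\<in>cochain (carrier G) k. \<forall>ys\<in>lists_n (Suc k). \<forall>ys'\<in>lists_n (Suc k). lev V' ys ys' \<longrightarrow>
         f ys - cob h ys = f ys' - cob h ys')"
proof -
  obtain V1 where V1: "V1 \<in> finite_index_normal G" "V1 \<subseteq> V" "cocycle V (Suc k) \<subseteq> cobound V1 k"
    using unif[OF V] by blast
  obtain V2 where V2: "V2 \<in> finite_index_normal G" "V2 \<subseteq> V1"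
    "\<And>g. g \<in> bich V1 (Suc 0) k \<Longrightarrow> dh (dv g) \<in> fich V1 (Suc (Suc 0)) (Suc k) \<Longrightarrow>
      \<exists>h\<in>bich V2 0 k. dv (\<lambda>xs ys. g xs ys - dh h xs ys) \<in> fich V2 (Suc 0) (Suc k)"
    using zigzag[OF unif V1(1), where j = 0 and k = k] by blast
  note V2s = finite_index_normalD(2)[OF V2(1)]
  show ?thesis
  proof (intro bexI[OF _ V2(1)] ballI impI)
    fix f assume f: "f \<in> cochain (carrier G) (Suc k)"
      and "\<forall>ys\<in>lists_n (Suc (Suc k)). \<forall>ys'\<in>lists_n (Suc (Suc k)). lev V ys ys' \<longrightarrow> cob f ys = cob f ys'"
    then have lf: "cob f ys = cob f ys'"
      if "ys \<in> lists_n (Suc (Suc k))" "ys' \<in> lists_n (Suc (Suc k))" "lev V ys ys'" for ys ys'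
      using that by blast
    \<comment> \<open>\<open>f\<close> is placed in column zero, where the first block is empty.
      There \<open>dh\<close> is the augmentation of the rows, and \<open>h []\<close> at the end is
      a cochain for all of \<open>G\<close>.\<close>
    define F where "F = (\<lambda>xs :: 'a list. f)"
    have F: "F \<in> bich V 0 (Suc k)"
      using f by (intro bichI) (auto simp: F_def intro: cochain_B cochain_act)
    have "dv F \<in> fich V 0 (Suc (Suc k))"
      by (rule fichI[OF dv_bich[OF F]]) (auto simp: dv_def F_def intro: lf)
    then have "dv (dh F) \<in> fich V (Suc 0) (Suc (Suc k))" unfolding dv_dh by (rule dh_fich)
    then obtain g where g: "g \<in> bich V1 (Suc 0) k"
      "(\<lambda>xs ys. dh F xs ys - dv g xs ys) \<in> fich V1 (Suc 0) (Suc k)"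
      by (rule column_exact[OF V V1 dh_bich[OF F]])
    have "dh (\<lambda>xs ys. dh F xs ys - dv g xs ys) \<in> fich V1 (Suc (Suc 0)) (Suc k)"
      using g(2) by (rule dh_fich)
    then have "(\<lambda>xs ys. 0 - dh (dv g) xs ys) \<in> fich V1 (Suc (Suc 0)) (Suc k)"
      unfolding dh_diff dh_dh .
    from fich_diff[OF fich_zero this] have "dh (dv g) \<in> fich V1 (Suc (Suc 0)) (Suc k)" by simp
    then obtain h where h: "h \<in> bich V2 0 k"
      "dv (\<lambda>xs ys. g xs ys - dh h xs ys) \<in> fich V2 (Suc 0) (Suc k)"
      using V2(3)[OF g(1)] by blast
    have "(\<lambda>xs ys. (dh F xs ys - dv g xs ys) + dv (\<lambda>xs ys. g xs ys - dh h xs ys) xs ys)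
        \<in> fich V2 (Suc 0) (Suc k)"
      using fich_mono[OF V2(2) g(2)] h(2) by (rule fich_add)
    then have "dh (\<lambda>xs ys. F xs ys - dv h xs ys) \<in> fich V2 (Suc 0) (Suc k)"
      unfolding dh_diff dv_diff dv_dh by simp
    then have fin: "(\<lambda>xs ys. F xs ys - dv h xs ys) \<in> fich V2 0 (Suc k)"
      by (rule row_injective[OF V2s])
    have "h [] \<in> cochain (carrier G) k"
      using bichD(1,2)[OF h(1), of "[]"] by (simp add: cochain_def)
    moreover have "f ys - cob (h []) ys = f ys' - cob (h []) ys'"
      if "ys \<in> lists_n (Suc k)" "ys' \<in> lists_n (Suc k)" "lev V2 ys ys'" for ys ys'
      using fichD[OF fin _ that, of "[]"] by (simp add: F_def dv_def)
    ultimately show "\<exists>h\<in>cochain (carrier G) k. \<forall>ys\<in>lists_n (Suc k). \<forall>ys'\<in>lists_n (Suc k).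
        lev V2 ys ys' \<longrightarrow> f ys - cob h ys = f ys' - cob h ys'" by blast
  qed
qed

end

section \<open>Residually finite soluble minimax groups\<close>

context group
begin

text \<open>The maximal condition for \<open>X / Y\<close> in terms of subgroups of
  \<open>X\<close>: larger members of the family lie in \<open>YU\<close>. No quotient group is
  mentioned, so the condition passes to the image of a homomorphism that is defined on a subgroup
  only.\<close>

definition max_mod :: "'a set \<Rightarrow> 'a set \<Rightarrow> bool" where
  "max_mod Y X \<longleftrightarrow> (\<forall>\<U>. \<U> \<noteq> {} \<longrightarrow> (\<forall>U\<in>\<U>. subgroup U G \<and> U \<subseteq> X) \<longrightarrow>
     (\<exists>U\<in>\<U>. \<forall>U'\<in>\<U>. U \<subseteq> U' \<longrightarrow> (\<forall>u'\<in>U'. \<exists>u\<in>U. u' \<otimes> inv u \<in> Y)))"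

definition min_mod :: "'a set \<Rightarrow> 'a set \<Rightarrow> bool" where
  "min_mod Y X \<longleftrightarrow> (\<forall>\<U>. \<U> \<noteq> {} \<longrightarrow> (\<forall>U\<in>\<U>. subgroup U G \<and> U \<subseteq> X) \<longrightarrow>
     (\<exists>U\<in>\<U>. \<forall>U'\<in>\<U>. U' \<subseteq> U \<longrightarrow> (\<forall>u\<in>U. \<exists>u'\<in>U'. u \<otimes> inv u' \<in> Y)))"

lemma max_modE:
  assumes "max_mod Y X" "\<U> \<noteq> {}" "\<And>U. U \<in> \<U> \<Longrightarrow> subgroup U G \<and> U \<subseteq> X"
  obtains U where "U \<in> \<U>" "\<And>U' u'. U' \<in> \<U> \<Longrightarrow> U \<subseteq> U' \<Longrightarrow> u' \<in> U' \<Longrightarrow> \<exists>u\<in>U. u' \<otimes> inv u \<in> Y"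
proof -
  have "\<exists>U\<in>\<U>. \<forall>U'\<in>\<U>. U \<subseteq> U' \<longrightarrow> (\<forall>u'\<in>U'. \<exists>u\<in>U. u' \<otimes> inv u \<in> Y)"
    using assms(1)[unfolded max_mod_def, rule_format, OF assms(2)] assms(3) by simp
  then obtain U where U: "U \<in> \<U>" "\<forall>U'\<in>\<U>. U \<subseteq> U' \<longrightarrow> (\<forall>u'\<in>U'. \<exists>u\<in>U. u' \<otimes> inv u \<in> Y)" ..
  show thesis by (rule that[OF U(1) U(2)[rule_format]])
qed

lemma min_modE:
  assumes "min_mod Y X" "\<U> \<noteq> {}" "\<And>U. U \<in> \<U> \<Longrightarrow> subgroup U G \<and> U \<subseteq> X"
  obtains U where "U \<in> \<U>" "\<And>U' u. U' \<in> \<U> \<Longrightarrow> U' \<subseteq> U \<Longrightarrow> u \<in> U \<Longrightarrow> \<exists>u'\<in>U'. u \<otimes> inv u' \<in> Y"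
proof -
  have "\<exists>U\<in>\<U>. \<forall>U'\<in>\<U>. U' \<subseteq> U \<longrightarrow> (\<forall>u\<in>U. \<exists>u'\<in>U'. u \<otimes> inv u' \<in> Y)"
    using assms(1)[unfolded min_mod_def, rule_format, OF assms(2)] assms(3) by simp
  then obtain U where U: "U \<in> \<U>" "\<forall>U'\<in>\<U>. U' \<subseteq> U \<longrightarrow> (\<forall>u\<in>U. \<exists>u'\<in>U'. u \<otimes> inv u' \<in> Y)" ..
  show thesis by (rule that[OF U(1) U(2)[rule_format]])
qed

lemma factor_conditions_mod:
  assumes X: "subgroup X G" and Y: "Y \<lhd> G\<lparr>carrier := X\<rparr>"
  shows "max_condition (G\<lparr>carrier := X\<rparr> Mod Y) \<Longrightarrow> max_mod Y X"
    and "min_condition (G\<lparr>carrier := X\<rparr> Mod Y) \<Longrightarrow> min_mod Y X"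
proof -
  let ?X = "G\<lparr>carrier := X\<rparr>"
  let ?Q = "?X Mod Y"
  interpret X: group ?X by (rule subgroup.subgroup_is_group[OF X group_axioms])
  interpret N: normal Y ?X by (rule Y)
  define \<pi> where "\<pi> x = Y #>\<^bsub>?X\<^esub> x" for x
  have hom: "\<pi> \<in> hom ?X ?Q" unfolding \<pi>_def[abs_def] by (rule N.r_coset_hom_Mod)
  interpret h: group_hom ?X ?Q \<pi>
    using hom N.factorgroup_is_group by (simp add: group_hom_def group_hom_axioms_def X.group_axioms)
  have img: "subgroup (\<pi> ` U) ?Q" if "subgroup U G" "U \<subseteq> X" for U
    using that X by (intro h.subgroup_img_is_subgroup) (simp add: subgroup_incl)
  have eq: "x \<otimes> inv y \<in> Y" if "x \<in> X" "y \<in> X" "\<pi> x = \<pi> y" for x y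
  proof -
    have "x \<in> Y #>\<^bsub>?X\<^esub> y"
      using that X.rcos_self[of x Y] N.subgroup_axioms by (simp add: \<pi>_def)
    then show ?thesis
      using N.rcos_module_imp[OF X.group_axioms, of y x] that by (simp add: m_inv_consistent[OF X])
  qed
  show "max_condition ?Q \<Longrightarrow> max_mod Y X"
    unfolding max_mod_def
  proof (intro allI impI)
    fix \<U> assume mx: "max_condition ?Q" and U: "\<U> \<noteq> {}" "\<forall>U\<in>\<U>. subgroup U G \<and> U \<subseteq> X"
    have "(`) \<pi> ` \<U> \<subseteq> {H. subgroup H ?Q} \<and> (`) \<pi> ` \<U> \<noteq> {}" using U img by blast
    from mx[unfolded max_condition_def, THEN spec, THEN mp, OF this]
    obtain M where "M \<in> (`) \<pi> ` \<U>" and M: "\<forall>H\<in>(`) \<pi> ` \<U>. M \<subseteq> H \<longrightarrow> H = M" ..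
    then obtain U where U': "U \<in> \<U>" "M = \<pi> ` U" by blast
    have "\<exists>u\<in>U. u' \<otimes> inv u \<in> Y" if h: "U' \<in> \<U>" "U \<subseteq> U'" "u' \<in> U'" for U' u'
    proof -
      have "\<pi> ` U' = \<pi> ` U" using M U' h by (simp add: image_mono)
      then obtain u where "u \<in> U" "\<pi> u' = \<pi> u" using h(3) by (metis imageE imageI)
      moreover have "u' \<in> X" "u \<in> X" using \<open>u \<in> U\<close> h U(2) U'(1) by blast+
      ultimately show ?thesis using eq by blast
    qed
    then show "\<exists>U\<in>\<U>. \<forall>U'\<in>\<U>. U \<subseteq> U' \<longrightarrow> (\<forall>u'\<in>U'. \<exists>u\<in>U. u' \<otimes> inv u \<in> Y)" using U'(1) by blast
  qed
  show "min_condition ?Q \<Longrightarrow> min_mod Y X"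
    unfolding min_mod_def
  proof (intro allI impI)
    fix \<U> assume mn: "min_condition ?Q" and U: "\<U> \<noteq> {}" "\<forall>U\<in>\<U>. subgroup U G \<and> U \<subseteq> X"
    have "(`) \<pi> ` \<U> \<subseteq> {H. subgroup H ?Q} \<and> (`) \<pi> ` \<U> \<noteq> {}" using U img by blast
    from mn[unfolded min_condition_def, THEN spec, THEN mp, OF this]
    obtain M where "M \<in> (`) \<pi> ` \<U>" and M: "\<forall>H\<in>(`) \<pi> ` \<U>. H \<subseteq> M \<longrightarrow> H = M" ..
    then obtain U where U': "U \<in> \<U>" "M = \<pi> ` U" by blast
    have "\<exists>u'\<in>U'. u \<otimes> inv u' \<in> Y" if h: "U' \<in> \<U>" "U' \<subseteq> U" "u \<in> U" for U' u
    proof -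
      have "\<pi> ` U' = \<pi> ` U" using M U' h by (simp add: image_mono)
      then obtain u' where "u' \<in> U'" "\<pi> u' = \<pi> u" using h(3) by (metis imageE imageI)
      moreover have "u' \<in> X" "u \<in> X" using \<open>u' \<in> U'\<close> h U(2) U'(1) by blast+
      ultimately show ?thesis using eq[of u u'] by metis
    qed
    then show "\<exists>U\<in>\<U>. \<forall>U'\<in>\<U>. U' \<subseteq> U \<longrightarrow> (\<forall>u\<in>U. \<exists>u'\<in>U'. u \<otimes> inv u' \<in> Y)" using U'(1) by blast
  qed
qed

definition mod_series :: "nat \<Rightarrow> (nat \<Rightarrow> 'a set) \<Rightarrow> bool" where
  "mod_series k S \<longleftrightarrow> S 0 = {\<one>} \<and> (\<forall>i\<le>k. subgroup (S i) G) \<and>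
     (\<forall>i<k. S i \<subseteq> S (Suc i) \<and> (max_mod (S i) (S (Suc i)) \<or> min_mod (S i) (S (Suc i))))"

lemma minimax_mod_series:
  assumes "minimax G"
  obtains k S where "mod_series k S" "S k = carrier G"
proof -
  obtain k S where S: "S 0 = {\<one>}" "S k = carrier G" "\<forall>i\<le>k. subgroup (S i) G"
    "\<forall>i<k. S i \<lhd> G\<lparr>carrier := S (Suc i)\<rparr> \<and>
           (max_condition (G\<lparr>carrier := S (Suc i)\<rparr> Mod S i) \<or>
            min_condition (G\<lparr>carrier := S (Suc i)\<rparr> Mod S i))"
    using assms unfolding minimax_def by blast
  have "mod_series k S"
    unfolding mod_series_def
  proof (intro conjI S(1,3) allI impI)
    fix i assume i: "i < k"
    have X: "subgroup (S (Suc i)) G" using S(3) i by simp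
    have N: "S i \<lhd> G\<lparr>carrier := S (Suc i)\<rparr>" using S(4) i by blast
    show "S i \<subseteq> S (Suc i)" using normal_imp_subgroup[OF N] subgroup.subset by fastforce
    show "max_mod (S i) (S (Suc i)) \<or> min_mod (S i) (S (Suc i))"
      using S(4) i factor_conditions_mod[OF X N] by blast
  qed
  then show thesis using S(2) that by blast
qed

end

section \<open>Homomorphisms defined on a subgroup\<close>

locale partial_hom = G: group G + Q: group Q for G (structure) and Q (structure) +
  fixes N :: "'a set" and \<pi> :: "'a \<Rightarrow> 'c"
  assumes N: "subgroup N G"
    and closed: "x \<in> N \<Longrightarrow> \<pi> x \<in> carrier Q"
    and mult: "x \<in> N \<Longrightarrow> y \<in> N \<Longrightarrow> \<pi> (x \<otimes>\<^bsub>G\<^esub> y) = \<pi> x \<otimes>\<^bsub>Q\<^esub> \<pi> y"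
begin

lemma hom: "\<pi> \<in> hom (G\<lparr>carrier := N\<rparr>) Q"
  using closed mult by (auto simp: hom_def)

sublocale h: group_hom "G\<lparr>carrier := N\<rparr>" Q \<pi>
  using hom subgroup.subgroup_is_group[OF N G.group_axioms]
  by (simp add: group_hom_def group_hom_axioms_def Q.group_axioms)

lemma inv: "x \<in> N \<Longrightarrow> \<pi> (inv\<^bsub>G\<^esub> x) = inv\<^bsub>Q\<^esub> \<pi> x"
  using h.hom_inv[of x] by (simp add: G.m_inv_consistent[OF N])

lemma one: "\<pi> \<one>\<^bsub>G\<^esub> = \<one>\<^bsub>Q\<^esub>"
  using h.hom_one by simp

lemma int_pow: "x \<in> N \<Longrightarrow> \<pi> (x [^]\<^bsub>G\<^esub> (k::int)) = \<pi> x [^]\<^bsub>Q\<^esub> k"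
  using h.hom_int_pow[of x k] by (simp add: G.int_pow_consistent[OF N])

lemma nat_pow: "x \<in> N \<Longrightarrow> \<pi> (x [^]\<^bsub>G\<^esub> (k::nat)) = \<pi> x [^]\<^bsub>Q\<^esub> k"
  using int_pow[of x "int k"] by (simp add: int_pow_int)

lemma subgroup_vimage:
  assumes "subgroup U Q" "subgroup X G" shows "subgroup {x \<in> X \<inter> N. \<pi> x \<in> U} G"
proof -
  interpret U: subgroup U Q by (rule assms)
  interpret X: subgroup X G by (rule assms)
  interpret N: subgroup N G by (rule N)
  show ?thesis
    by (rule G.subgroupI) (use one in \<open>auto simp: mult inv intro!: exI[of _ "\<one>\<^bsub>G\<^esub>"]\<close>)
qed

lemma subgroup_image:
  assumes "subgroup U G" "U \<subseteq> N" shows "subgroup (\<pi> ` U) Q"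
  using assms N by (intro h.subgroup_img_is_subgroup) (simp add: G.subgroup_incl)

text \<open>Families of subgroups of the image are pulled back into \<open>X \<inter> N\<close>,
  where the condition in \<open>G\<close> selects a member.\<close>

lemma max_mod_image:
  assumes X: "subgroup X G" and mx: "G.max_mod Y X"
  shows "Q.max_mod (\<pi> ` (Y \<inter> N)) (\<pi> ` (X \<inter> N))"
  unfolding Q.max_mod_def
proof (intro allI impI)
  fix \<U> assume U: "\<U> \<noteq> {}" "\<forall>U\<in>\<U>. subgroup U Q \<and> U \<subseteq> \<pi> ` (X \<inter> N)"
  define v where "v U = {x \<in> X \<inter> N. \<pi> x \<in> U}" for U
  have "v ` \<U> \<noteq> {}" using U(1) by simp
  then obtain W where W: "W \<in> v ` \<U>" "\<And>U' u'. U' \<in> v ` \<U> \<Longrightarrow> W \<subseteq> U' \<Longrightarrow> u' \<in> U' \<Longrightarrow> \<exists>u\<in>W. u' \<otimes>\<^bsub>G\<^esub> inv\<^bsub>G\<^esub> u \<in> Y"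
    by (rule G.max_modE[OF mx]) (use U(2) subgroup_vimage[OF _ X] in \<open>auto simp: v_def\<close>)
  then obtain U where UW: "U \<in> \<U>" "W = v U" by blast
  have "\<exists>u\<in>U. u' \<otimes>\<^bsub>Q\<^esub> inv\<^bsub>Q\<^esub> u \<in> \<pi> ` (Y \<inter> N)" if U': "U' \<in> \<U>" "U \<subseteq> U'" "u' \<in> U'" for U' u'
  proof -
    obtain x' where x': "x' \<in> X \<inter> N" "u' = \<pi> x'" using U(2) U' by blast
    have "\<exists>x\<in>W. x' \<otimes>\<^bsub>G\<^esub> inv\<^bsub>G\<^esub> x \<in> Y"
      by (rule W(2)[of "v U'"]) (use UW U' x' in \<open>auto simp: v_def\<close>)
    then obtain x where x: "x \<in> X \<inter> N" "\<pi> x \<in> U" "x' \<otimes>\<^bsub>G\<^esub> inv\<^bsub>G\<^esub> x \<in> Y" by (auto simp: UW v_def)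
    have "x' \<otimes>\<^bsub>G\<^esub> inv\<^bsub>G\<^esub> x \<in> N"
      using x x' N by (simp add: subgroup.m_closed subgroup.m_inv_closed)
    moreover have "\<pi> (x' \<otimes>\<^bsub>G\<^esub> inv\<^bsub>G\<^esub> x) = u' \<otimes>\<^bsub>Q\<^esub> inv\<^bsub>Q\<^esub> \<pi> x"
      using x x' subgroup.m_inv_closed[OF N] by (simp add: mult inv)
    ultimately show ?thesis using x(2,3) by (metis IntI imageI)
  qed
  then show "\<exists>U\<in>\<U>. \<forall>U'\<in>\<U>. U \<subseteq> U' \<longrightarrow> (\<forall>u'\<in>U'. \<exists>u\<in>U. u' \<otimes>\<^bsub>Q\<^esub> inv\<^bsub>Q\<^esub> u \<in> \<pi> ` (Y \<inter> N))"
    using UW(1) by blast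
qed

lemma min_mod_image:
  assumes X: "subgroup X G" and mn: "G.min_mod Y X"
  shows "Q.min_mod (\<pi> ` (Y \<inter> N)) (\<pi> ` (X \<inter> N))"
  unfolding Q.min_mod_def
proof (intro allI impI)
  fix \<U> assume U: "\<U> \<noteq> {}" "\<forall>U\<in>\<U>. subgroup U Q \<and> U \<subseteq> \<pi> ` (X \<inter> N)"
  define v where "v U = {x \<in> X \<inter> N. \<pi> x \<in> U}" for U
  have "v ` \<U> \<noteq> {}" using U(1) by simp
  then obtain W where W: "W \<in> v ` \<U>" "\<And>U' u. U' \<in> v ` \<U> \<Longrightarrow> U' \<subseteq> W \<Longrightarrow> u \<in> W \<Longrightarrow> \<exists>u'\<in>U'. u \<otimes>\<^bsub>G\<^esub> inv\<^bsub>G\<^esub> u' \<in> Y"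
    by (rule G.min_modE[OF mn]) (use U(2) subgroup_vimage[OF _ X] in \<open>auto simp: v_def\<close>)
  then obtain U where UW: "U \<in> \<U>" "W = v U" by blast
  have "\<exists>u'\<in>U'. u \<otimes>\<^bsub>Q\<^esub> inv\<^bsub>Q\<^esub> u' \<in> \<pi> ` (Y \<inter> N)" if U': "U' \<in> \<U>" "U' \<subseteq> U" "u \<in> U" for U' u
  proof -
    obtain x' where x': "x' \<in> X \<inter> N" "u = \<pi> x'" using U(2) U' UW(1) by blast
    have "\<exists>x\<in>v U'. x' \<otimes>\<^bsub>G\<^esub> inv\<^bsub>G\<^esub> x \<in> Y"
      by (rule W(2)) (use UW U' x' in \<open>auto simp: v_def\<close>)
    then obtain x where x: "x \<in> X \<inter> N" "\<pi> x \<in> U'" "x' \<otimes>\<^bsub>G\<^esub> inv\<^bsub>G\<^esub> x \<in> Y" by (auto simp: v_def)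
    have "x' \<otimes>\<^bsub>G\<^esub> inv\<^bsub>G\<^esub> x \<in> N"
      using x x' N by (simp add: subgroup.m_closed subgroup.m_inv_closed)
    moreover have "\<pi> (x' \<otimes>\<^bsub>G\<^esub> inv\<^bsub>G\<^esub> x) = u \<otimes>\<^bsub>Q\<^esub> inv\<^bsub>Q\<^esub> \<pi> x"
      using x x' subgroup.m_inv_closed[OF N] by (simp add: mult inv)
    ultimately show ?thesis using x(2,3) by (metis IntI imageI)
  qed
  then show "\<exists>U\<in>\<U>. \<forall>U'\<in>\<U>. U' \<subseteq> U \<longrightarrow> (\<forall>u\<in>U. \<exists>u'\<in>U'. u \<otimes>\<^bsub>Q\<^esub> inv\<^bsub>Q\<^esub> u' \<in> \<pi> ` (Y \<inter> N))"
    using UW(1) by blast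
qed

lemma mod_series_image:
  assumes "G.mod_series k S"
  shows "Q.mod_series k (\<lambda>i. \<pi> ` (S i \<inter> N))"
proof -
  have "S 0 \<inter> N = {\<one>\<^bsub>G\<^esub>}" using assms subgroup.one_closed[OF N] by (auto simp: G.mod_series_def)
  moreover have "\<pi> ` (S i \<inter> N) \<subseteq> \<pi> ` (S (Suc i) \<inter> N)" if "i < k" for i
    using assms that by (intro image_mono Int_mono) (auto simp: G.mod_series_def)
  ultimately show ?thesis
    using assms N one unfolding G.mod_series_def Q.mod_series_def
    by (simp add: subgroup_image G.subgroups_Inter_pair) (meson Suc_leI max_mod_image min_mod_image)
qed

text \<open>The conditions for a rank one section are about products, inverses and powers modulo the
  lower term, so they can be checked after applying \<open>\<pi>\<close>.\<close>

lemma rank1_vimage: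
  assumes r: "Q.rank1 X M"
  shows "G.rank1 {x \<in> N. \<pi> x \<in> X} {x \<in> N. \<pi> x \<in> M}"
proof -
  have sub: "subgroup {x \<in> N. \<pi> x \<in> U} G" if "subgroup U Q" for U
    using subgroup_vimage[OF that N] by simp
  interpret N: subgroup N G by (rule N)
  have pw: "x [^]\<^bsub>G\<^esub> (a::int) \<in> N" if "x \<in> N" for x a by (rule G.subgroup_int_pow_closed[OF N that])
  show ?thesis
    unfolding G.rank1_def
  proof (intro conjI ballI allI impI)
    show "subgroup {x \<in> N. \<pi> x \<in> X} G" "subgroup {x \<in> N. \<pi> x \<in> M} G" "{x \<in> N. \<pi> x \<in> M} \<subseteq> {x \<in> N. \<pi> x \<in> X}"
      using r sub by (auto simp: Q.rank1_def)
    show "G.commutators_in {x \<in> N. \<pi> x \<in> X} {x \<in> N. \<pi> x \<in> M}"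
      using r by (auto simp: Q.rank1_def G.commutators_in_def Q.commutators_in_def mult inv)
  next
    fix x and k :: nat
    assume "x \<in> {x \<in> N. \<pi> x \<in> X}" "0 < k" "x [^]\<^bsub>G\<^esub> k \<in> {x \<in> N. \<pi> x \<in> M}"
    then show "x \<in> {x \<in> N. \<pi> x \<in> M}" using r by (auto simp: Q.rank1_def nat_pow)
  next
    fix x y assume xy: "x \<in> {x \<in> N. \<pi> x \<in> X}" "y \<in> {x \<in> N. \<pi> x \<in> X}"
    then obtain a b :: int where ab: "a \<noteq> 0 \<or> b \<noteq> 0" "\<pi> x [^]\<^bsub>Q\<^esub> a \<otimes>\<^bsub>Q\<^esub> \<pi> y [^]\<^bsub>Q\<^esub> b \<in> M"
      using r unfolding Q.rank1_def by blast
    have "x [^]\<^bsub>G\<^esub> a \<otimes>\<^bsub>G\<^esub> y [^]\<^bsub>G\<^esub> b \<in> {x \<in> N. \<pi> x \<in> M}"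
      using xy ab(2) pw by (auto simp: mult int_pow)
    then show "\<exists>(a::int) (b::int). (a \<noteq> 0 \<or> b \<noteq> 0) \<and> x [^]\<^bsub>G\<^esub> a \<otimes>\<^bsub>G\<^esub> y [^]\<^bsub>G\<^esub> b \<in> {x \<in> N. \<pi> x \<in> M}"
      using ab(1) by blast
  qed
qed

lemma r1chain_vimage:
  "Q.r1chain K X \<Longrightarrow> G.r1chain {x \<in> N. \<pi> x \<in> K} {x \<in> N. \<pi> x \<in> X}"
proof (induction rule: Q.r1chain.induct)
  case base
  then show ?case using subgroup_vimage[OF _ N, of K] by (auto intro: G.r1chain.base)
next
  case (step M X)
  then show ?case using rank1_vimage by (blast intro: G.r1chain.step)
qed

end

section \<open>Torsion and isolated subgroups of abelian minimax groups\<close>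

context comm_group
begin

definition torsion :: "'a set" where
  "torsion = {x \<in> carrier G. \<exists>k>0. x [^] (k::nat) = \<one>}"

lemma torsion_subgroup: "subgroup torsion G"
proof (rule subgroupI)
  have "\<one> \<in> torsion" unfolding torsion_def by (auto intro!: exI[of _ 1])
  then show "torsion \<noteq> {}" by blast
next
  fix a assume "a \<in> torsion"
  then show "inv a \<in> torsion" by (auto simp: torsion_def nat_pow_inv)
next
  fix a b assume "a \<in> torsion" "b \<in> torsion"
  then obtain k l :: nat where a: "a \<in> carrier G" "k > 0" "a [^] k = \<one>" and b: "b \<in> carrier G" "l > 0" "b [^] l = \<one>"
    by (auto simp: torsion_def)
  have "(a \<otimes> b) [^] (k * l) = (a [^] k) [^] l \<otimes> (b [^] l) [^] k"
    using a(1) b(1) by (simp add: nat_pow_distrib nat_pow_pow mult.commute)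
  also have "\<dots> = \<one>" using a b by simp
  finally show "a \<otimes> b \<in> torsion" using a b unfolding torsion_def by (auto intro!: exI[of _ "k * l"])
qed (auto simp: torsion_def)

lemma finite_insert_torsion:
  assumes W: "subgroup W G" "finite W" and u: "u \<in> torsion"
  obtains W' where "subgroup W' G" "finite W'" "W \<subseteq> W'" "u \<in> W'"
    "\<And>U. subgroup U G \<Longrightarrow> W \<subseteq> U \<Longrightarrow> u \<in> U \<Longrightarrow> W' \<subseteq> U"
proof -
  interpret W: subgroup W G by (rule W)
  obtain k :: nat where k: "u \<in> carrier G" "k > 0" "u [^] k = \<one>" using u by (auto simp: torsion_def)
  define W' where "W' = {w \<otimes> u [^] (i::int) | w i. w \<in> W}"
  have "subgroup W' G"
  proof (rule subgroupI)
    show "W' \<subseteq> carrier G" using k(1) by (auto simp: W'_def)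
    show "W' \<noteq> {}" unfolding W'_def using W.one_closed by blast
  next
    fix a assume "a \<in> W'"
    then obtain w i where a: "a = w \<otimes> u [^] (i::int)" "w \<in> W" by (auto simp: W'_def)
    have "inv a = inv w \<otimes> u [^] (- i)" using a k(1) by (simp add: inv_mult int_pow_neg)
    then show "inv a \<in> W'" using a(2) unfolding W'_def by blast
  next
    fix a b assume "a \<in> W'" "b \<in> W'"
    then obtain w i v j where a: "a = w \<otimes> u [^] (i::int)" "w \<in> W" and b: "b = v \<otimes> u [^] (j::int)" "v \<in> W"
      by (auto simp: W'_def)
    have "a \<otimes> b = (w \<otimes> v) \<otimes> u [^] (i + j)" using a b k(1) by (simp add: int_pow_mult m_ac)
    then show "a \<otimes> b \<in> W'" using a(2) b(2) unfolding W'_def by blast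
  qed
  moreover have "W' \<subseteq> (\<lambda>(w, i). w \<otimes> u [^] i) ` (W \<times> {0..<int k})"
  proof
    fix a assume "a \<in> W'"
    then obtain w i where a: "a = w \<otimes> u [^] (i::int)" "w \<in> W" by (auto simp: W'_def)
    have "u [^] i = u [^] (int k * (i div int k) + i mod int k)" by simp
    also have "\<dots> = (u [^] int k) [^] (i div int k) \<otimes> u [^] (i mod int k)"
      using k(1) by (simp only: int_pow_mult int_pow_pow)
    also have "u [^] int k = \<one>" using k(3) by (simp add: int_pow_int)
    finally have "a = w \<otimes> u [^] (i mod int k)" using a k(1) by simp
    moreover have "i mod int k \<in> {0..<int k}" using k(2) by simp
    ultimately show "a \<in> (\<lambda>(w, i). w \<otimes> u [^] i) ` (W \<times> {0..<int k})" using a(2) by force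
  qed
  then have "finite W'" using W(2) finite_subset by blast
  moreover have "W \<subseteq> W'"
  proof
    fix w assume "w \<in> W"
    then have "w = w \<otimes> u [^] (0::int)" by simp
    then show "w \<in> W'" using \<open>w \<in> W\<close> unfolding W'_def by blast
  qed
  moreover have "u \<in> W'"
  proof -
    have "u = \<one> \<otimes> u [^] (1::int)" using k(1) by simp
    then show ?thesis using W.one_closed unfolding W'_def by blast
  qed
  moreover have "W' \<subseteq> U" if "subgroup U G" "W \<subseteq> U" "u \<in> U" for U
    using that subgroup_int_pow_closed[OF that(1,3)] subgroup.m_closed[OF that(1)] unfolding W'_def by blast
  ultimately show thesis by (rule that)
qed

text \<open>The family acts as a base of neighbourhoods of the identity with trivial intersection.
  Going up the series, the trace of the torsion on \<open>S i\<close> is made trivial by shrinking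
  \<open>V\<close>, separately for the two kinds of factor.\<close>

lemma residually_torsion_free:
  assumes S: "mod_series k S" "S k = carrier G"
    and ne: "\<V> \<noteq> {}" and sub: "\<And>V. V \<in> \<V> \<Longrightarrow> subgroup V G"
    and int: "\<And>V V'. V \<in> \<V> \<Longrightarrow> V' \<in> \<V> \<Longrightarrow> V \<inter> V' \<in> \<V>"
    and triv: "\<And>x. x \<in> carrier G \<Longrightarrow> (\<And>V. V \<in> \<V> \<Longrightarrow> x \<in> V) \<Longrightarrow> x = \<one>"
  obtains V where "V \<in> \<V>" "V \<inter> torsion = {\<one>}"
proof -
  have "\<exists>V\<in>\<V>. V \<inter> torsion \<inter> S i \<subseteq> {\<one>}" if "i \<le> k" for i
    using that
  proof (induction i)
    case 0
    then show ?case using S(1) ne by (auto simp: mod_series_def)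
  next
    case (Suc i)
    then obtain V where V: "V \<in> \<V>" "V \<inter> torsion \<inter> S i \<subseteq> {\<one>}" by auto
    have Ss: "subgroup (S (Suc i)) G" "max_mod (S i) (S (Suc i)) \<or> min_mod (S i) (S (Suc i))"
      using S(1) Suc.prems by (auto simp: mod_series_def)
    define u where "u V = V \<inter> torsion \<inter> S (Suc i)" for V
    have usub: "subgroup (u V) G" if "V \<in> \<V>" for V
      unfolding u_def using sub[OF that] torsion_subgroup Ss(1) by (intro subgroups_Inter_pair)
    \<comment> \<open>\<open>u V\<close> meets \<open>S i\<close> trivially and therefore embeds
      into the next factor: congruent elements are equal.\<close>
    have eqI: "x = y" if "x \<in> u V" "y \<in> u V" "x \<otimes> inv y \<in> S i" for x y
    proof -
      have c: "x \<in> carrier G" "y \<in> carrier G" using that subgroup.subset[OF usub[OF V(1)]] by auto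
      have "x \<otimes> inv y \<in> u V" using that usub[OF V(1)] by (simp add: subgroup.m_closed subgroup.m_inv_closed)
      then have "x \<otimes> inv y = \<one>" using V(2) that(3) by (auto simp: u_def)
      then have "x \<otimes> inv y \<otimes> y = y" using c by simp
      then show ?thesis using c by (simp add: m_assoc)
    qed
    show ?case
      using Ss(2)
    proof
      \<comment> \<open>A minimal trace coincides with the traces of all smaller members, hence lies
        in every member of the family and is trivial.\<close>
      assume "min_mod (S i) (S (Suc i))"
      moreover have "u ` {V' \<in> \<V>. V' \<subseteq> V} \<noteq> {}" using V(1) by blast
      ultimately obtain U where U: "U \<in> u ` {V' \<in> \<V>. V' \<subseteq> V}"
        "\<And>U' x. U' \<in> u ` {V' \<in> \<V>. V' \<subseteq> V} \<Longrightarrow> U' \<subseteq> U \<Longrightarrow> x \<in> U \<Longrightarrow> \<exists>u'\<in>U'. x \<otimes> inv u' \<in> S i"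
        by (rule min_modE) (use usub in \<open>auto simp: u_def\<close>)
      then obtain W where W: "W \<in> \<V>" "W \<subseteq> V" "U = u W" by blast
      have "x = \<one>" if x: "x \<in> u W" for x
      proof (rule triv)
        show "x \<in> carrier G" using x subgroup.subset[OF usub[OF W(1)]] by auto
        fix V' assume V': "V' \<in> \<V>"
        have "u (V' \<inter> W) \<in> u ` {V' \<in> \<V>. V' \<subseteq> V}" using int[OF V' W(1)] W(2) by blast
        moreover have "u (V' \<inter> W) \<subseteq> U" "x \<in> U" using W(3) x by (auto simp: u_def)
        ultimately have "\<exists>u'\<in>u (V' \<inter> W). x \<otimes> inv u' \<in> S i" by (rule U(2))
        then obtain u' where u': "u' \<in> u (V' \<inter> W)" "x \<otimes> inv u' \<in> S i" by blast
        have "x = u'" by (rule eqI) (use x u' W(2) in \<open>auto simp: u_def\<close>)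
        then show "x \<in> V'" using u'(1) by (auto simp: u_def)
      qed
      then show ?thesis using W(1) by (auto simp: u_def)
    next
      \<comment> \<open>A maximal finite subgroup of the torsion group \<open>u V\<close> is all of
        it. Finitely many nontrivial elements are then excluded by intersecting finitely many
        members.\<close>
      assume mx: "max_mod (S i) (S (Suc i))"
      let ?\<U> = "{W. subgroup W G \<and> finite W \<and> W \<subseteq> u V}"
      have "{\<one>} \<in> ?\<U>" using triv_subgroup subgroup.one_closed[OF usub[OF V(1)]] by simp
      then have "?\<U> \<noteq> {}" by blast
      with mx obtain W where W: "W \<in> ?\<U>"
        "\<And>U' x. U' \<in> ?\<U> \<Longrightarrow> W \<subseteq> U' \<Longrightarrow> x \<in> U' \<Longrightarrow> \<exists>u\<in>W. x \<otimes> inv u \<in> S i"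
        by (rule max_modE) (auto simp: u_def)
      have "u V \<subseteq> W"
      proof
        fix x assume x: "x \<in> u V"
        then have xt: "x \<in> torsion" by (simp add: u_def)
        obtain W' where W': "subgroup W' G" "finite W'" "W \<subseteq> W'" "x \<in> W'"
          "\<And>U. subgroup U G \<Longrightarrow> W \<subseteq> U \<Longrightarrow> x \<in> U \<Longrightarrow> W' \<subseteq> U"
          by (rule finite_insert_torsion[of W x]) (use W(1) xt in auto)
        have "W' \<subseteq> u V" using usub[OF V(1)] W(1) x by (intro W'(5)) auto
        then have "W' \<in> ?\<U>" using W'(1,2) by blast
        then have "\<exists>w\<in>W. x \<otimes> inv w \<in> S i" using W'(3,4) by (rule W(2))
        then obtain w where w: "w \<in> W" "x \<otimes> inv w \<in> S i" by blast
        have "x = w" by (rule eqI) (use x w W(1) in auto)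
        then show "x \<in> W" using w(1) by simp
      qed
      then have fin: "finite (u V)" using W(1) finite_subset by blast
      have "\<exists>V'\<in>\<V>. V' \<subseteq> V \<and> (\<forall>x\<in>F. x \<notin> V')" if "finite F" "F \<subseteq> u V - {\<one>}" for F
        using that
      proof (induction F rule: finite_induct)
        case empty
        then show ?case using V(1) by blast
      next
        case (insert x F)
        then obtain V1 where V1: "V1 \<in> \<V>" "V1 \<subseteq> V" "\<forall>x\<in>F. x \<notin> V1" by auto
        have "x \<in> carrier G" "x \<noteq> \<one>" using insert.prems subgroup.subset[OF usub[OF V(1)]] by auto
        then obtain V2 where "V2 \<in> \<V>" "x \<notin> V2" using triv by blast
        then show ?case using V1 int[OF V1(1)] by (intro bexI[of _ "V1 \<inter> V2"]) auto
      qed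
      from this[of "u V - {\<one>}"] fin obtain V' where "V' \<in> \<V>" "V' \<subseteq> V" "\<forall>x\<in>u V - {\<one>}. x \<notin> V'" by auto
      then show ?thesis by (intro bexI[of _ V']) (auto simp: u_def)
    qed
  qed
  then obtain V where V: "V \<in> \<V>" "V \<inter> torsion \<inter> S k \<subseteq> {\<one>}" by blast
  have "V \<inter> torsion = {\<one>}"
    using V S(2) subgroup.subset[OF sub[OF V(1)]] subgroup.one_closed[OF sub[OF V(1)]]
      subgroup.one_closed[OF torsion_subgroup] by auto
  then show thesis using V(1) that by blast
qed

text \<open>\<open>J'\<close> is the isolator in \<open>V\<close> of the group generated by
  \<open>J\<close> and \<open>y\<close>, that is, the elements with a nonzero power in that group.
  It has rank at most one over \<open>J\<close> because \<open>y\<close> can be eliminated from any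
  two of the defining relations.\<close>

lemma isolated_extension:
  assumes V: "subgroup V G" and J: "subgroup J G" "J \<subseteq> V"
    and iso: "\<And>x k. x \<in> V \<Longrightarrow> (k::int) \<noteq> 0 \<Longrightarrow> x [^] k \<in> J \<Longrightarrow> x \<in> J" and y: "y \<in> V"
  obtains J' where "subgroup J' G" "J' \<subseteq> V" "J \<subseteq> J'" "y \<in> J'" "rank1 J' J"
    "\<And>x k. x \<in> V \<Longrightarrow> (k::int) \<noteq> 0 \<Longrightarrow> x [^] k \<in> J' \<Longrightarrow> x \<in> J'"
proof -
  interpret V: subgroup V G by (rule V)
  interpret J: subgroup J G by (rule J)
  have Jp: "x [^] (k::int) \<in> J" if "x \<in> J" for x k by (rule subgroup_int_pow_closed[OF J(1) that])
  have Vp: "x [^] (k::int) \<in> V" if "x \<in> V" for x k by (rule subgroup_int_pow_closed[OF V that])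
  define J' where "J' = {x \<in> V. \<exists>(k::int) (a::int). k \<noteq> 0 \<and> x [^] k \<otimes> y [^] a \<in> J}"
  have J'I: "x \<in> J'" if "x \<in> V" "k \<noteq> 0" "x [^] k \<otimes> y [^] a \<in> J" for x and k a :: int
    unfolding J'_def using that by blast
  have sub: "subgroup J' G"
  proof (rule subgroupI)
    show "J' \<subseteq> carrier G" by (auto simp: J'_def)
    have "\<one> [^] (1::int) \<otimes> y [^] (0::int) \<in> J" by simp
    then have "\<one> \<in> J'" by (rule J'I[rotated 2]) simp_all
    then show "J' \<noteq> {}" by blast
  next
    fix x assume "x \<in> J'"
    then obtain k a where x: "x \<in> V" "(k::int) \<noteq> 0" "x [^] k \<otimes> y [^] (a::int) \<in> J" by (auto simp: J'_def)
    have "(inv x) [^] k \<otimes> y [^] (- a) = inv (x [^] k \<otimes> y [^] a)"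
      using x y by (simp add: inv_mult int_pow_neg int_pow_inv)
    then have "(inv x) [^] k \<otimes> y [^] (- a) \<in> J" using x(3) by simp
    then show "inv x \<in> J'" by (rule J'I[rotated 2]) (use x in simp_all)
  next
    fix x z assume "x \<in> J'" "z \<in> J'"
    then obtain k a l b where x: "x \<in> V" "(k::int) \<noteq> 0" "x [^] k \<otimes> y [^] (a::int) \<in> J"
      and z: "z \<in> V" "(l::int) \<noteq> 0" "z [^] l \<otimes> y [^] (b::int) \<in> J" by (auto simp: J'_def)
    have "(x \<otimes> z) [^] (k * l) \<otimes> y [^] (a * l + b * k)
        = (x [^] k \<otimes> y [^] a) [^] l \<otimes> (z [^] l \<otimes> y [^] b) [^] k"
      using x z y by (simp add: int_pow_distrib int_pow_pow int_pow_mult m_ac mult.commute)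
    then have "(x \<otimes> z) [^] (k * l) \<otimes> y [^] (a * l + b * k) \<in> J" using Jp x z by simp
    then show "x \<otimes> z \<in> J'" by (rule J'I[rotated 2]) (use x z in simp_all)
  qed
  have JJ': "J \<subseteq> J'"
  proof
    fix x assume x: "x \<in> J"
    then have "x [^] (1::int) \<otimes> y [^] (0::int) \<in> J" by simp
    then show "x \<in> J'" by (rule J'I[rotated 2]) (use x J(2) in auto)
  qed
  have yJ': "y \<in> J'"
  proof -
    have "y [^] (1::int) \<otimes> y [^] (-1::int) \<in> J" using y by (simp add: int_pow_neg)
    then show ?thesis by (rule J'I[rotated 2]) (use y in simp_all)
  qed
  have iso': "x \<in> J'" if x: "x \<in> V" "(m::int) \<noteq> 0" "x [^] m \<in> J'" for x m
  proof -
    obtain k a where k: "(k::int) \<noteq> 0" "(x [^] m) [^] k \<otimes> y [^] (a::int) \<in> J" using x(3) by (auto simp: J'_def)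
    then have "x [^] (m * k) \<otimes> y [^] a \<in> J" using x(1) by (simp add: int_pow_pow)
    then show ?thesis by (rule J'I[rotated 2]) (use x(1,2) k(1) in simp_all)
  qed
  have "rank1 J' J"
    unfolding rank1_def commutators_in_def
  proof (intro conjI sub J(1) JJ' ballI allI impI)
    fix x z assume "x \<in> J'" "z \<in> J'"
    then have c: "x \<in> carrier G" "z \<in> carrier G" by (auto simp: J'_def)
    then have "x \<otimes> z \<otimes> inv x \<otimes> inv z = \<one>" by (simp add: m_comm[of x z] m_assoc)
    then show "x \<otimes> z \<otimes> inv x \<otimes> inv z \<in> J" by simp
  next
    fix x and k :: nat assume "x \<in> J'" "0 < k" "x [^] k \<in> J"
    then show "x \<in> J" using iso[of x "int k"] by (simp add: J'_def int_pow_int)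
  next
    fix x z assume "x \<in> J'" "z \<in> J'"
    then obtain k a l b where x: "x \<in> V" "(k::int) \<noteq> 0" "x [^] k \<otimes> y [^] (a::int) \<in> J"
      and z: "z \<in> V" "(l::int) \<noteq> 0" "z [^] l \<otimes> y [^] (b::int) \<in> J" by (auto simp: J'_def)
    show "\<exists>(p::int) (q::int). (p \<noteq> 0 \<or> q \<noteq> 0) \<and> x [^] p \<otimes> z [^] q \<in> J"
    proof (cases "b = 0")
      case True
      then have "x [^] (0::int) \<otimes> z [^] l \<in> J" using z by simp
      then show ?thesis using z(2) by blast
    next
      case False
      have "(x [^] k \<otimes> y [^] a) [^] b \<otimes> (z [^] l \<otimes> y [^] b) [^] (- a)
          = x [^] (k * b) \<otimes> z [^] (l * - a) \<otimes> (y [^] (a * b) \<otimes> y [^] (b * - a))"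
        using x z y by (simp only: int_pow_distrib int_pow_pow int_pow_closed V.mem_carrier m_ac m_closed)
      also have "\<dots> = x [^] (k * b) \<otimes> z [^] (l * - a)"
        using x z y by (simp flip: int_pow_mult add: mult.commute)
      finally have "x [^] (k * b) \<otimes> z [^] (l * - a) \<in> J" using x z Jp by (metis J.m_closed)
      moreover have "k * b \<noteq> 0" using False x(2) by simp
      ultimately show ?thesis by blast
    qed
  qed
  then show thesis using that[OF sub _ JJ' yJ' _ iso'] by (auto simp: J'_def)
qed

text \<open>Isolated subgroups that carry a chain are enlarged until they contain the trace of
  \<open>V\<close> on each \<open>S i\<close>. A factor with the minimal condition brings nothing
  new to an isolated subgroup; for one with the maximal condition the enlargement stops.\<close>

lemma torsion_free_r1chain:
  assumes S: "mod_series k S" "S k = carrier G"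
    and V: "subgroup V G" "V \<inter> torsion = {\<one>}"
  shows "r1chain {\<one>} V"
proof -
  interpret V: subgroup V G by (rule V)
  define good where "good J \<longleftrightarrow> subgroup J G \<and> J \<subseteq> V \<and> r1chain {\<one>} J \<and>
    (\<forall>x\<in>V. \<forall>k. (k::int) \<noteq> 0 \<longrightarrow> x [^] k \<in> J \<longrightarrow> x \<in> J)" for J
  have triv: "good {\<one>}"
  proof -
    have "x = \<one>" if x: "x \<in> V" "(k::int) \<noteq> 0" "x [^] k = \<one>" for x k
    proof -
      have "x [^] nat \<bar>k\<bar> = \<one>"
      proof (cases "k > 0")
        case True
        then show ?thesis using x(3) int_pow_int[of G x "nat k"] by simp
      next
        case False
        then have "x [^] nat \<bar>k\<bar> = x [^] (- k)" using int_pow_int[of G x "nat (- k)"] by simp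
        then show ?thesis using x by (simp add: int_pow_neg)
      qed
      moreover have "nat \<bar>k\<bar> > 0" using x(2) by simp
      ultimately have "x \<in> torsion" unfolding torsion_def using V.mem_carrier[OF x(1)] by blast
      then show ?thesis using V(2) x(1) by blast
    qed
    then show ?thesis unfolding good_def using triv_subgroup by (auto intro: r1chain.base)
  qed
  have ext: "\<exists>J'. good J' \<and> J \<subseteq> J' \<and> y \<in> J'" if J: "good J" and y: "y \<in> V" for J y
  proof -
    obtain J' where "subgroup J' G" "J' \<subseteq> V" "J \<subseteq> J'" "y \<in> J'" "rank1 J' J"
      "\<And>x k. x \<in> V \<Longrightarrow> (k::int) \<noteq> 0 \<Longrightarrow> x [^] k \<in> J' \<Longrightarrow> x \<in> J'"
      by (rule isolated_extension[of V J y]) (use J y V(1) in \<open>auto simp: good_def\<close>)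
    then show ?thesis using J unfolding good_def by (blast intro: r1chain.step)
  qed
  have "\<exists>J. good J \<and> V \<inter> S i \<subseteq> J" if "i \<le> k" for i
    using that
  proof (induction i)
    case 0
    then show ?case using triv S(1) by (auto simp: mod_series_def)
  next
    case (Suc i)
    then obtain J where J: "good J" "V \<inter> S i \<subseteq> J" by auto
    have Ss: "subgroup (S (Suc i)) G" "max_mod (S i) (S (Suc i)) \<or> min_mod (S i) (S (Suc i))"
      using S(1) Suc.prems by (auto simp: mod_series_def)
    show ?case
      using Ss(2)
    proof
      assume mn: "min_mod (S i) (S (Suc i))"
      have "x \<in> J" if x: "x \<in> V" "x \<in> S (Suc i)" for x
      proof -
        have xc: "x \<in> carrier G" using x(1) by simp
        \<comment> \<open>The groups generated by the powers of \<open>x\<close> with exponent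
          \<open>2^n\<close> descend. Once they are stable modulo \<open>S i\<close>, some power of
          \<open>x\<close> with exponent \<open>2^n * (1 - 2 * k)\<close> lies in
          \<open>S i\<close>; the exponent is nonzero because its second factor is odd, and
          isolation gives \<open>x \<in> J\<close>.\<close>
        define p where "p n = (\<lambda>k::int. x [^] (2 ^ n * k)) ` UNIV" for n :: nat
        have ps: "subgroup (p n) G \<and> p n \<subseteq> S (Suc i)" for n
        proof
          show "subgroup (p n) G"
          proof (rule subgroupI)
            fix a b assume "a \<in> p n" "b \<in> p n"
            then obtain k l :: int where ab: "a = x [^] (2 ^ n * k)" "b = x [^] (2 ^ n * l)" by (auto simp: p_def)
            have "a \<otimes> b = x [^] (2 ^ n * (k + l))" using xc by (simp add: ab distrib_left int_pow_mult)
            then show "a \<otimes> b \<in> p n" by (auto simp: p_def)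
          next
            fix a assume "a \<in> p n"
            then obtain k :: int where "a = x [^] (2 ^ n * k)" by (auto simp: p_def)
            then have "inv a = x [^] (2 ^ n * (- k))" using xc by (simp add: int_pow_neg)
            then show "inv a \<in> p n" unfolding p_def by blast
          qed (use xc in \<open>auto simp: p_def\<close>)
          show "p n \<subseteq> S (Suc i)" using subgroup_int_pow_closed[OF Ss(1) x(2)] by (auto simp: p_def)
        qed
        obtain U where U: "U \<in> range p" "\<And>U' u. U' \<in> range p \<Longrightarrow> U' \<subseteq> U \<Longrightarrow> u \<in> U \<Longrightarrow> \<exists>u'\<in>U'. u \<otimes> inv u' \<in> S i"
          by (rule min_modE[OF mn, of "range p"]) (use ps in auto)
        then obtain n where n: "U = p n" by blast
        have "p (Suc n) \<subseteq> U"
        proof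
          fix a assume "a \<in> p (Suc n)"
          then obtain k :: int where "a = x [^] (2 ^ Suc n * k)" by (auto simp: p_def)
          then have "a = x [^] (2 ^ n * (2 * k))" by (simp add: mult.assoc mult.left_commute)
          then show "a \<in> U" unfolding n p_def by blast
        qed
        moreover have "x [^] (2 ^ n * 1 :: int) \<in> U" unfolding n p_def by blast
        ultimately obtain u' where u': "u' \<in> p (Suc n)" "x [^] (2 ^ n * 1 :: int) \<otimes> inv u' \<in> S i"
          using U(2)[of "p (Suc n)"] by blast
        then obtain k :: int where k: "u' = x [^] (2 ^ Suc n * k :: int)" by (auto simp: p_def)
        have "x [^] (2 ^ n * 1 - 2 ^ Suc n * k :: int) \<in> S i"
          using u'(2) xc unfolding k by (simp add: int_pow_diff)
        moreover have "x [^] (2 ^ n * 1 - 2 ^ Suc n * k :: int) \<in> V" by (rule subgroup_int_pow_closed[OF V(1) x(1)])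
        moreover have "(2 ^ n * 1 - 2 ^ Suc n * k :: int) \<noteq> 0"
        proof -
          have "(2 ^ n * 1 - 2 ^ Suc n * k :: int) = 2 ^ n * (1 - 2 * k)" by (simp add: algebra_simps)
          moreover have "1 - 2 * k \<noteq> 0" by presburger
          ultimately show ?thesis by simp
        qed
        ultimately show ?thesis using J x(1) unfolding good_def by blast
      qed
      then show ?thesis using J(1) by blast
    next
      assume mx: "max_mod (S i) (S (Suc i))"
      \<comment> \<open>Take a good subgroup whose trace on the next term is maximal modulo
        \<open>S i\<close>. Adjoining any \<open>x\<close> of the next term does not enlarge the
        trace modulo \<open>S i\<close>, so \<open>x\<close> was already present.\<close>
      let ?\<J> = "{J'. good J' \<and> J \<subseteq> J'}"
      let ?r = "\<lambda>J'. J' \<inter> S (Suc i)"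
      obtain U where U: "U \<in> ?r ` ?\<J>" "\<And>U' u'. U' \<in> ?r ` ?\<J> \<Longrightarrow> U \<subseteq> U' \<Longrightarrow> u' \<in> U' \<Longrightarrow> \<exists>u\<in>U. u' \<otimes> inv u \<in> S i"
      proof (rule max_modE[OF mx, of "?r ` ?\<J>"])
        show "?r ` ?\<J> \<noteq> {}" using J(1) by blast
        fix U assume "U \<in> ?r ` ?\<J>"
        then show "subgroup U G \<and> U \<subseteq> S (Suc i)" using Ss(1) by (auto simp: good_def intro: subgroups_Inter_pair)
      qed (use that in blast)
      then obtain J0 where J0: "good J0" "J \<subseteq> J0" "U = ?r J0" by blast
      have "x \<in> J0" if x: "x \<in> V" "x \<in> S (Suc i)" for x
      proof -
        obtain J1 where J1: "good J1" "J0 \<subseteq> J1" "x \<in> J1" using ext[OF J0(1) x(1)] by blast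
        have "\<exists>u\<in>U. x \<otimes> inv u \<in> S i"
          by (rule U(2)[of "?r J1"]) (use J1 J0 x in auto)
        then obtain u where u: "u \<in> J0" "x \<otimes> inv u \<in> S i" using J0(3) by blast
        have J0s: "subgroup J0 G" "J0 \<subseteq> V" using J0(1) by (auto simp: good_def)
        have uV: "u \<in> V" "x \<in> carrier G" "u \<in> carrier G" using u(1) x J0s by auto
        have "x \<otimes> inv u \<in> J0" using J(2) J0(2) u(2) x uV by auto
        then have "x \<otimes> inv u \<otimes> u \<in> J0" using u(1) J0s(1) by (simp add: subgroup.m_closed)
        then show ?thesis using uV by (simp add: m_assoc)
      qed
      then show ?thesis using J0(1) by blast
    qed
  qed
  then obtain J where "good J" "V \<inter> S k \<subseteq> J" by blast
  moreover have "V \<inter> S k = V" using S(2) V.subset by auto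
  ultimately show ?thesis unfolding good_def by (metis subset_antisym)
qed

end

section \<open>Closures of the derived subgroups\<close>

context group
begin

lemma carrier_finite_index_normal: "carrier G \<in> finite_index_normal G"
proof (rule finite_index_normalI[OF normal_self])
  show "fin_index (carrier G) (carrier G)"
    by (rule fin_index_colour[of "{()}" _ "\<lambda>_. ()"]) auto
qed

lemma Int_finite_index_normal:
  assumes V: "V \<in> finite_index_normal G" and W: "W \<in> finite_index_normal G"
  shows "V \<inter> W \<in> finite_index_normal G"
proof (rule finite_index_normalI)
  note VD = finite_index_normalD[OF V] and WD = finite_index_normalD[OF W]
  show "V \<inter> W \<lhd> G" using VD(1) WD(1) by (rule normal_subgroup_intersect)
  show "fin_index (V \<inter> W) (carrier G)"
    using VD(2) WD(2) order_refl VD(3) WD(3) by (rule fin_index_Int)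
qed

text \<open>Factors of the derived series need not be residually finite. Closed terms still have
  abelian factors, and these factors are separated by the finite index normal subgroups of
  \<open>G\<close>.\<close>

definition closure_of_derived :: "nat \<Rightarrow> 'a set" where
  "closure_of_derived n = \<Inter>{V \<in> finite_index_normal G. (derived G ^^ n) (carrier G) \<subseteq> V}"

lemma derived_normal: "(derived G ^^ n) (carrier G) \<lhd> G"
  by (induction n) (auto intro: normal_self derived_is_normal)

lemma closure_of_derived_le: "V \<in> finite_index_normal G \<Longrightarrow> (derived G ^^ n) (carrier G) \<subseteq> V \<Longrightarrow> closure_of_derived n \<subseteq> V"
  by (auto simp: closure_of_derived_def)

lemma closure_of_derived_subgroup: "subgroup (closure_of_derived n) G"
  unfolding closure_of_derived_def
proof (rule subgroups_Inter)
  show "{V \<in> finite_index_normal G. (derived G ^^ n) (carrier G) \<subseteq> V} \<noteq> {}"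
    using carrier_finite_index_normal subgroup.subset[OF normal_imp_subgroup[OF derived_normal[of n]]] by blast
qed (use finite_index_normalD(2) in blast)

lemma derived_Suc: "(derived G ^^ Suc n) (carrier G) = derived G ((derived G ^^ n) (carrier G))"
  by simp

lemma closure_of_derived_Suc: "closure_of_derived (Suc n) \<subseteq> closure_of_derived n"
proof -
  have "(derived G ^^ Suc n) (carrier G) \<subseteq> (derived G ^^ n) (carrier G)"
    unfolding derived_Suc using normal_imp_subgroup[OF derived_normal[of n]] by (intro derived_incl) auto
  then show ?thesis by (auto simp: closure_of_derived_def)
qed

text \<open>Modulo a finite index normal \<open>V\<close> a subgroup and its closure have the same
  image. Commutators of elements of the closure thus agree modulo \<open>V\<close> with commutators
  of elements of \<open>?D\<close>, which lie in \<open>V\<close>.\<close>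

lemma closure_of_derived_commutators:
  "commutators_in (closure_of_derived n) (closure_of_derived (Suc n))"
  unfolding commutators_in_def
proof (intro ballI)
  fix x y assume xy: "x \<in> closure_of_derived n" "y \<in> closure_of_derived n"
  let ?D = "(derived G ^^ n) (carrier G)"
  have Dn: "?D \<lhd> G" by (rule derived_normal)
  interpret D: normal ?D G by (rule Dn)
  have xyc: "x \<in> carrier G" "y \<in> carrier G"
    using xy subgroup.subset[OF closure_of_derived_subgroup] by auto
  show "x \<otimes> y \<otimes> inv x \<otimes> inv y \<in> closure_of_derived (Suc n)"
    unfolding closure_of_derived_def
  proof (intro InterI)
    fix V assume "V \<in> {V \<in> finite_index_normal G. (derived G ^^ Suc n) (carrier G) \<subseteq> V}"
    then have V: "V \<in> finite_index_normal G" "derived G ?D \<subseteq> V" by auto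
    note VD = finite_index_normalD[OF V(1)]
    interpret V: normal V G by (rule VD(1))
    \<comment> \<open>The product of \<open>V\<close> and \<open>?D\<close>: normal, of finite index
      and containing \<open>?D\<close>, so it contains the closure.\<close>
    define W where "W = {x \<in> carrier G. \<exists>d\<in>?D. x \<otimes> inv d \<in> V}"
    have W: "subgroup W G"
    proof (rule subgroupI)
      have "\<one> \<in> W" unfolding W_def by (auto intro!: bexI[of _ \<one>])
      then show "W \<noteq> {}" by blast
    next
      fix a assume "a \<in> W"
      then obtain d where a: "a \<in> carrier G" "d \<in> ?D" "a \<otimes> inv d \<in> V" by (auto simp: W_def)
      have "inv d \<otimes> inv (a \<otimes> inv d) \<otimes> d \<in> V" using a by (intro VD(6)) auto
      then have "inv a \<otimes> inv (inv d) \<in> V" using a by (simp add: inv_mult_group m_assoc)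
      then show "inv a \<in> W" using a unfolding W_def by blast
    next
      fix a b assume "a \<in> W" "b \<in> W"
      then obtain d e where a: "a \<in> carrier G" "d \<in> ?D" "a \<otimes> inv d \<in> V"
        and b: "b \<in> carrier G" "e \<in> ?D" "b \<otimes> inv e \<in> V" by (auto simp: W_def)
      have "(a \<otimes> inv d) \<otimes> (d \<otimes> (b \<otimes> inv e) \<otimes> inv d) \<in> V"
        by (rule V.m_closed) (use a b VD(5) in auto)
      also have "(a \<otimes> inv d) \<otimes> (d \<otimes> (b \<otimes> inv e) \<otimes> inv d) = (a \<otimes> b) \<otimes> inv (d \<otimes> e)"
        using a b by (simp add: inv_mult_group m_assoc)
      finally show "a \<otimes> b \<in> W" using a b unfolding W_def by blast
    qed (auto simp: W_def)
    have "W \<lhd> G"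
      unfolding normal_inv_iff
    proof (intro conjI ballI W)
      fix g a assume g: "g \<in> carrier G" and "a \<in> W"
      then obtain d where a: "a \<in> carrier G" "d \<in> ?D" "a \<otimes> inv d \<in> V" by (auto simp: W_def)
      have "g \<otimes> (a \<otimes> inv d) \<otimes> inv g \<in> V" using g a by (intro VD(5)) auto
      also have "g \<otimes> (a \<otimes> inv d) \<otimes> inv g = (g \<otimes> a \<otimes> inv g) \<otimes> inv (g \<otimes> d \<otimes> inv g)"
        using g a by (simp add: inv_mult_group m_assoc)
      finally have "(g \<otimes> a \<otimes> inv g) \<otimes> inv (g \<otimes> d \<otimes> inv g) \<in> V" .
      moreover have "g \<otimes> d \<otimes> inv g \<in> ?D" using g a(2) by (rule D.inv_op_closed2)
      ultimately show "g \<otimes> a \<otimes> inv g \<in> W" using g a unfolding W_def by blast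
    qed
    moreover have "V \<subseteq> W" unfolding W_def by (auto intro!: bexI[of _ \<one>])
    then have "fin_index W (carrier G)" by (rule fin_index_mono[OF VD(3)])
    ultimately have "W \<in> finite_index_normal G" by (rule finite_index_normalI)
    moreover have "d \<in> W" if "d \<in> ?D" for d
      unfolding W_def using that by (intro CollectI conjI bexI[of _ d]) simp_all
    then have "?D \<subseteq> W" by blast
    ultimately have "x \<in> W" "y \<in> W" using xy closure_of_derived_le by blast+
    then obtain d e where d: "d \<in> ?D" "x \<otimes> inv d \<in> V" and e: "e \<in> ?D" "y \<otimes> inv e \<in> V"
      by (auto simp: W_def)
    have Vc: "V \<subseteq> carrier G" by (rule VD(4))
    obtain Q :: "'a set monoid" and \<pi> where Q: "group Q" "\<pi> ` carrier G = carrier Q"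
      "\<And>x y. x \<in> carrier G \<Longrightarrow> y \<in> carrier G \<Longrightarrow> \<pi> (x \<otimes> y) = \<pi> x \<otimes>\<^bsub>Q\<^esub> \<pi> y"
      "\<And>x. x \<in> carrier G \<Longrightarrow> \<pi> (inv x) = inv\<^bsub>Q\<^esub> \<pi> x"
      "\<And>x k. x \<in> carrier G \<Longrightarrow> \<pi> (x [^] (k::int)) = \<pi> x [^]\<^bsub>Q\<^esub> k"
      "\<And>x. x \<in> carrier G \<Longrightarrow> \<pi> x = \<one>\<^bsub>Q\<^esub> \<longleftrightarrow> x \<in> V"
      "commutators_in (carrier G) V \<Longrightarrow> comm_group Q"
      using subgroup_quotient[OF subgroup_self VD(2) Vc VD(5)] by blast
    interpret Q: group Q by (rule Q(1))
    have \<pi>c: "\<pi> z \<in> carrier Q" if "z \<in> carrier G" for z using that Q(2) by auto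
    have eq: "\<pi> a = \<pi> b" if "a \<in> carrier G" "b \<in> carrier G" "a \<otimes> inv b \<in> V" for a b
    proof -
      have "\<pi> (a \<otimes> inv b) = \<one>\<^bsub>Q\<^esub>" using that Q(6)[of "a \<otimes> inv b"] by simp
      then have "\<pi> a \<otimes>\<^bsub>Q\<^esub> inv\<^bsub>Q\<^esub> \<pi> b = \<one>\<^bsub>Q\<^esub>" using that by (simp add: Q(3,4))
      then have "\<pi> a \<otimes>\<^bsub>Q\<^esub> inv\<^bsub>Q\<^esub> \<pi> b \<otimes>\<^bsub>Q\<^esub> \<pi> b = \<pi> b" using that \<pi>c by simp
      then show ?thesis using that \<pi>c by (simp add: Q.m_assoc)
    qed
    have de: "d \<in> carrier G" "e \<in> carrier G" using d e by auto
    have "d \<otimes> e \<otimes> inv d \<otimes> inv e \<in> derived G ?D"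
      unfolding derived_def[of G ?D] using d(1) e(1) by (intro generate.incl) blast
    then have "\<pi> (d \<otimes> e \<otimes> inv d \<otimes> inv e) = \<one>\<^bsub>Q\<^esub>" using V(2) Vc Q(6) by blast
    then have "\<pi> (x \<otimes> y \<otimes> inv x \<otimes> inv y) = \<one>\<^bsub>Q\<^esub>"
      using de xyc eq[OF xyc(1) de(1) d(2)] eq[OF xyc(2) de(2) e(2)] by (simp add: Q(3,4))
    then show "x \<otimes> y \<otimes> inv x \<otimes> inv y \<in> V" using Q(6)[of "x \<otimes> y \<otimes> inv x \<otimes> inv y"] xyc by simp
  qed
qed

text \<open>The abelian group \<open>N / C\<close> inherits a series from \<open>G\<close>, and the
  traces of the members of \<open>?F\<close> intersect trivially in it. One of them, given by
  \<open>V\<close>, is torsion-free. Cutting \<open>H\<close> with \<open>V\<close> yields a chain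
  from \<open>C\<close> to \<open>N\<close>, to which the chain above \<open>N\<close> is joined
  after intersecting it with \<open>V\<close>.\<close>

lemma r1chain_step_closure:
  assumes mm: "minimax G" and H: "subgroup H G" "fin_index H (carrier G)"
    and ch: "r1chain (closure_of_derived n \<inter> H) H"
  shows "\<exists>H. subgroup H G \<and> fin_index H (carrier G) \<and> r1chain (closure_of_derived (Suc n) \<inter> H) H"
proof -
  define N C where "N = closure_of_derived n" and "C = closure_of_derived (Suc n)"
  have N: "subgroup N G" and C: "subgroup C G" "C \<subseteq> N" and NC: "commutators_in N C"
    unfolding N_def C_def using closure_of_derived_subgroup closure_of_derived_Suc closure_of_derived_commutators by auto
  interpret C: subgroup C G by (rule C(1))
  obtain Q :: "'a set monoid" and \<pi> where Q: "group Q" "\<pi> ` N = carrier Q"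
    "\<And>x y. x \<in> N \<Longrightarrow> y \<in> N \<Longrightarrow> \<pi> (x \<otimes> y) = \<pi> x \<otimes>\<^bsub>Q\<^esub> \<pi> y"
    "\<And>x. x \<in> N \<Longrightarrow> \<pi> (inv x) = inv\<^bsub>Q\<^esub> \<pi> x"
    "\<And>x k. x \<in> N \<Longrightarrow> \<pi> (x [^] (k::int)) = \<pi> x [^]\<^bsub>Q\<^esub> k"
    "\<And>x. x \<in> N \<Longrightarrow> \<pi> x = \<one>\<^bsub>Q\<^esub> \<longleftrightarrow> x \<in> C"
    "commutators_in N C \<Longrightarrow> comm_group Q"
    using subgroup_quotient[OF N C commutators_conj[OF NC C subgroup.subset[OF N]]] by blast
  interpret Q: comm_group Q using Q(7)[OF NC] .
  interpret ph: partial_hom G Q N \<pi>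
    by (intro partial_hom.intro partial_hom_axioms.intro group_axioms Q.group_axioms) (use N Q(2,3) in auto)
  obtain k S where S: "mod_series k S" "S k = carrier G" using minimax_mod_series[OF mm] by blast
  have S': "Q.mod_series k (\<lambda>i. \<pi> ` (S i \<inter> N))" using S(1) by (rule ph.mod_series_image)
  have Sk: "\<pi> ` (S k \<inter> N) = carrier Q"
    using S(2) Q(2) subgroup.subset[OF N] by (simp add: Int_absorb1)
  let ?F = "{V \<in> finite_index_normal G. (derived G ^^ Suc n) (carrier G) \<subseteq> V}"
  have CV: "C \<subseteq> V" if "V \<in> ?F" for V using that by (auto simp: C_def closure_of_derived_def)
  have inV: "x \<in> V" if V: "V \<in> ?F" and x: "x \<in> N" "\<pi> x \<in> \<pi> ` (V \<inter> N)" for x V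
  proof -
    have Vs: "subgroup V G" using V finite_index_normalD(2) by blast
    obtain v where v: "v \<in> V" "v \<in> N" "\<pi> x = \<pi> v" using x(2) by blast
    have c: "x \<in> carrier G" "v \<in> carrier G" using x(1) v(2) subgroup.subset[OF N] by auto
    have mem: "x \<otimes> inv v \<in> N" using x(1) v(2) N by (simp add: subgroup.m_closed subgroup.m_inv_closed)
    have "\<pi> (x \<otimes> inv v) = \<one>\<^bsub>Q\<^esub>"
      using x(1) v subgroup.m_inv_closed[OF N] ph.closed by (simp add: Q(3,4))
    then have "x \<otimes> inv v \<in> V" using Q(6)[OF mem] CV[OF V] by blast
    then have "x \<otimes> inv v \<otimes> v \<in> V" using v(1) Vs by (simp add: subgroup.m_closed)
    then show ?thesis using c by (simp add: m_assoc)
  qed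
  have Vsub: "subgroup V G" if "V \<in> ?F" for V using that finite_index_normalD(2) by blast
  have carr: "carrier G \<in> ?F"
    using carrier_finite_index_normal subgroup.subset[OF normal_imp_subgroup[OF derived_normal[of "Suc n"]]] by blast
  obtain V' where V': "V' \<in> (\<lambda>V. \<pi> ` (V \<inter> N)) ` ?F" "V' \<inter> Q.torsion = {\<one>\<^bsub>Q\<^esub>}"
  proof (rule Q.residually_torsion_free[OF S' Sk, of "(\<lambda>V. \<pi> ` (V \<inter> N)) ` ?F"])
    show "(\<lambda>V. \<pi> ` (V \<inter> N)) ` ?F \<noteq> {}" using carr by blast
    show "subgroup U Q" if "U \<in> (\<lambda>V. \<pi> ` (V \<inter> N)) ` ?F" for U
      using that Vsub N by (auto intro!: ph.subgroup_image subgroups_Inter_pair)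
    show "U \<inter> U' \<in> (\<lambda>V. \<pi> ` (V \<inter> N)) ` ?F"
      if U: "U \<in> (\<lambda>V. \<pi> ` (V \<inter> N)) ` ?F" "U' \<in> (\<lambda>V. \<pi> ` (V \<inter> N)) ` ?F" for U U'
    proof -
      obtain V W where VW: "V \<in> ?F" "W \<in> ?F" "U = \<pi> ` (V \<inter> N)" "U' = \<pi> ` (W \<inter> N)" using U by blast
      have "V \<inter> W \<in> ?F" using VW Int_finite_index_normal by auto
      \<comment> \<open>\<open>V\<close> and \<open>W\<close> contain the kernel \<open>C\<close>,
        so taking images commutes with this intersection.\<close>
      moreover have "U \<inter> U' = \<pi> ` (V \<inter> W \<inter> N)" using VW inV by blast
      ultimately show ?thesis by blast
    qed
    show "x = \<one>\<^bsub>Q\<^esub>" if x: "x \<in> carrier Q" "\<And>U. U \<in> (\<lambda>V. \<pi> ` (V \<inter> N)) ` ?F \<Longrightarrow> x \<in> U" for x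
    proof -
      obtain y where y: "y \<in> N" "x = \<pi> y" using x(1) Q(2) by blast
      have "y \<in> V" if "V \<in> ?F" for V using inV[OF that y(1)] x(2) that y(2) by blast
      then have "y \<in> C" unfolding C_def closure_of_derived_def by blast
      then show ?thesis using Q(6) y by blast
    qed
  qed (use that in blast)
  then obtain V where V: "V \<in> ?F" "V' = \<pi> ` (V \<inter> N)" by blast
  have Vs: "subgroup V G" by (rule Vsub[OF V(1)])
  define H' where "H' = H \<inter> V"
  have H': "subgroup H' G" unfolding H'_def using H(1) Vs by (rule subgroups_Inter_pair)
  have fiH': "fin_index H' (carrier G)"
    unfolding H'_def using H(1) Vs order_refl H(2) by (rule fin_index_Int) (use V finite_index_normalD(3) in blast)
  define N' where "N' = N \<inter> H'"
  have N': "subgroup N' G" "N' \<subseteq> N" unfolding N'_def using N H' by (auto intro: subgroups_Inter_pair)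
  have "Q.r1chain {\<one>\<^bsub>Q\<^esub>} (\<pi> ` N')"
  proof (rule Q.torsion_free_r1chain[OF S' Sk])
    show sub: "subgroup (\<pi> ` N') Q" by (rule ph.subgroup_image[OF N'])
    have "\<pi> ` N' \<subseteq> V'" unfolding V(2) N'_def H'_def by blast
    then show "\<pi> ` N' \<inter> Q.torsion = {\<one>\<^bsub>Q\<^esub>}"
      using V'(2) subgroup.one_closed[OF sub] subgroup.one_closed[OF Q.torsion_subgroup] by blast
  qed
  moreover interpret ph': partial_hom G Q N' \<pi>
    by (intro partial_hom.intro partial_hom_axioms.intro group_axioms Q.group_axioms) (use N' ph.closed ph.mult in auto)
  have "r1chain {x \<in> N'. \<pi> x \<in> {\<one>\<^bsub>Q\<^esub>}} {x \<in> N'. \<pi> x \<in> \<pi> ` N'}"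
    using calculation by (rule ph'.r1chain_vimage)
  moreover have "{x \<in> N'. \<pi> x \<in> {\<one>\<^bsub>Q\<^esub>}} = C \<inter> H'" using Q(6) N'(2) C(2) by (auto simp: N'_def)
  moreover have "{x \<in> N'. \<pi> x \<in> \<pi> ` N'} = N \<inter> H'" by (auto simp: N'_def)
  ultimately have c1: "r1chain (C \<inter> H') (N \<inter> H')" by simp
  have "r1chain (N \<inter> H \<inter> V) (H \<inter> V)"
    using r1chain_Int[OF ch Vs] by (simp add: N_def)
  then have "r1chain (N \<inter> H') H'" by (simp add: H'_def Int_assoc)
  then have "r1chain (C \<inter> H') H'" using c1 by (rule r1chain_trans)
  then show ?thesis using H' fiH' unfolding C_def by blast
qed

text \<open>The chain is extended downwards along the closed derived series. Solubility makes a
  derived subgroup trivial, and residual finiteness makes its closure trivial as well.\<close>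

theorem residually_finite_minimax_r1chain:
  assumes "residually_finite G" "solvable G" "minimax G"
  obtains H where "subgroup H G" "fin_index H (carrier G)" "r1chain {\<one>} H"
proof -
  obtain d where d: "(derived G ^^ d) (carrier G) = {\<one>}"
    using assms(2) solvable_iff_trivial_derived_seq by blast
  have "\<exists>H. subgroup H G \<and> fin_index H (carrier G) \<and> r1chain (closure_of_derived n \<inter> H) H" for n
  proof (induction n)
    case 0
    have "closure_of_derived 0 = carrier G"
    proof
      show "carrier G \<subseteq> closure_of_derived 0" by (auto simp: closure_of_derived_def)
      show "closure_of_derived 0 \<subseteq> carrier G" using subgroup.subset[OF closure_of_derived_subgroup] .
    qed
    then show ?case
      using subgroup_self finite_index_normalD(3)[OF carrier_finite_index_normal]
      by (intro exI[of _ "carrier G"]) (simp add: r1chain.base)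
  next
    case (Suc n)
    then show ?case using r1chain_step_closure[OF assms(3)] by blast
  qed
  then obtain H where H: "subgroup H G" "fin_index H (carrier G)" "r1chain (closure_of_derived d \<inter> H) H" by blast
  have "closure_of_derived d = {\<one>}"
  proof
    show "closure_of_derived d \<subseteq> {\<one>}"
    proof
      fix x assume x: "x \<in> closure_of_derived d"
      have xc: "x \<in> carrier G" using x subgroup.subset[OF closure_of_derived_subgroup] by blast
      have "x \<in> V" if "V \<in> finite_index_normal G" for V
        using x that finite_index_normalD(2)[OF that] subgroup.one_closed
        unfolding closure_of_derived_def d by blast
      then show "x \<in> {\<one>}" using assms(1) xc unfolding residually_finite_def by blast
    qed
    show "{\<one>} \<subseteq> closure_of_derived d" using subgroup.one_closed[OF closure_of_derived_subgroup] by simp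
  qed
  then have "closure_of_derived d \<inter> H = {\<one>}" using subgroup.one_closed[OF H(1)] by auto
  then show thesis using H that by simp
qed

end

section \<open>Embedding finite modules into an additive type\<close>

text \<open>The quotient is the circle group R/Z. Coboundaries by \<open>cob\<close> need values in
  a type with addition, whereas coefficient modules are given by carriers; a finite abelian group
  has enough characters with values in R/Z to be embedded into functions on them.\<close>

definition same_frac :: "real \<Rightarrow> real \<Rightarrow> bool" where
  "same_frac x y \<longleftrightarrow> x - y \<in> \<int>"

quotient_type circ = real / same_frac
proof (rule equivpI)
  show "reflp same_frac" by (simp add: reflp_def same_frac_def)
  show "symp same_frac"
    by (rule sympI) (metis Ints_minus minus_diff_eq same_frac_def)
  show "transp same_frac"
    by (rule transpI) (metis Ints_add diff_add_cancel add_diff_eq same_frac_def)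
qed

instantiation circ :: ab_group_add
begin

lift_definition zero_circ :: circ is 0 .

lift_definition plus_circ :: "circ \<Rightarrow> circ \<Rightarrow> circ" is "(+)"
  unfolding same_frac_def by (metis Ints_add add_diff_add)

lift_definition uminus_circ :: "circ \<Rightarrow> circ" is uminus
  unfolding same_frac_def by (metis Ints_minus minus_diff_minus)

lift_definition minus_circ :: "circ \<Rightarrow> circ \<Rightarrow> circ" is "(-)"
proof -
  fix a b c d :: real assume "same_frac a b" "same_frac c d"
  then have "(a - b) - (c - d) \<in> \<int>" unfolding same_frac_def by (rule Ints_diff)
  then show "same_frac (a - c) (b - d)" by (simp add: same_frac_def algebra_simps)
qed

instance
  by standard (transfer; simp add: same_frac_def algebra_simps)+

end

text \<open>Integer multiples. Multiplication by a nonzero integer is onto, which extends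
  characters, and for an integer above one it has a nontrivial kernel, which separates
  points.\<close>

lift_definition imul :: "int \<Rightarrow> circ \<Rightarrow> circ" is "\<lambda>k x. of_int k * x"
  unfolding same_frac_def by (metis Ints_mult Ints_of_int right_diff_distrib)

lemma imul_add: "imul (k + l) z = imul k z + imul l z"
  by transfer (simp add: same_frac_def algebra_simps)

lemma imul_mult: "imul (k * l) z = imul k (imul l z)"
  by transfer (simp add: same_frac_def algebra_simps)

lemma imul_0 [simp]: "imul 0 z = 0"
  by transfer (simp add: same_frac_def)

lemma imul_1 [simp]: "imul 1 z = z"
  by transfer (simp add: same_frac_def)

lemma imul_surj:
  assumes "m \<noteq> 0" obtains z where "imul m z = y"
proof -
  obtain r where "y = abs_circ r" by (metis Quotient_circ Quotient_abs_rep)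
  then have "imul m (abs_circ (r / of_int m)) = y"
    using assms by (simp add: imul.abs_eq)
  then show thesis by (rule that)
qed

lemma imul_eq_0_nonzero:
  assumes "m > 1" obtains z where "imul m z = 0" "z \<noteq> 0"
proof -
  have "1 / real_of_int m \<notin> \<int>"
  proof
    assume "1 / real_of_int m \<in> \<int>"
    then obtain k :: int where "1 / real_of_int m = of_int k" by (auto simp: Ints_def)
    then have "real_of_int (k * m) = 1" using assms by (simp add: field_simps)
    then have "k * m = 1" by linarith
    then show False using assms by (metis dvd_triv_right zdvd_not_zless zero_less_one)
  qed
  moreover have "imul m (abs_circ (1 / real_of_int m)) = 0"
    using assms by (simp add: imul.abs_eq zero_circ_def circ.abs_eq_iff same_frac_def)
  ultimately show thesis
    using that[of "abs_circ (1 / real_of_int m)"] by (simp add: zero_circ_def circ.abs_eq_iff same_frac_def)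
qed

section \<open>Characters of finite abelian groups\<close>

context comm_group
begin

definition character_on :: "'a set \<Rightarrow> ('a \<Rightarrow> circ) \<Rightarrow> bool" where
  "character_on S \<chi> \<longleftrightarrow> (\<forall>a\<in>S. \<forall>b\<in>S. \<chi> (a \<otimes> b) = \<chi> a + \<chi> b)"

lemma character_int_pow:
  assumes S: "subgroup S G" and \<chi>: "character_on S \<chi>" and s: "s \<in> S"
  shows "\<chi> (s [^] (k::int)) = imul k (\<chi> s)"
proof -
  have sc: "s \<in> carrier G" using S s by (rule subgroup.mem_carrier)
  have pw: "s [^] (k::int) \<in> S" for k by (rule subgroup_int_pow_closed[OF S s])
  have "\<chi> \<one> = \<chi> \<one> + \<chi> \<one>"
    using \<chi> subgroup.one_closed[OF S] unfolding character_on_def by (metis l_one one_closed)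
  then have one: "\<chi> \<one> = 0" by simp
  have step: "\<chi> (s [^] (k + 1)) = \<chi> (s [^] k) + \<chi> s" for k :: int
    using \<chi> pw[of k] s sc unfolding character_on_def by (simp add: int_pow_mult)
  show ?thesis
  proof (induction k rule: int_induct[where k = 0])
    case base
    then show ?case using one by simp
  next
    case (step1 i)
    then show ?case using step[of i] by (simp add: imul_add)
  next
    case (step2 i)
    then show ?case using step[of "i - 1"] imul_add[of "i - 1" 1 "\<chi> s"] by simp
  qed
qed

text \<open>\<open>m\<close> is the order of \<open>b\<close> modulo \<open>S\<close>, so
  \<open>imul m z = \<chi> (b [^] m)\<close> is the one constraint on the value \<open>z\<close> at
  \<open>b\<close>. The value is prescribed because separating points needs a nonzero one.\<close>

lemma character_extend:
  assumes S: "subgroup S G" and \<chi>: "character_on S \<chi>" and b: "b \<in> carrier G"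
    and m: "m > 0" "b [^] (m::int) \<in> S" "\<And>k. 0 < k \<Longrightarrow> k < m \<Longrightarrow> b [^] (k::int) \<notin> S"
    and z: "imul m z = \<chi> (b [^] m)"
  obtains S' \<chi>' where "subgroup S' G" "S \<subseteq> S'" "b \<in> S'" "character_on S' \<chi>'"
    "\<And>s. s \<in> S \<Longrightarrow> \<chi>' s = \<chi> s" "\<chi>' b = z"
proof -
  interpret S: subgroup S G by (rule S)
  have pwS: "s [^] (k::int) \<in> S" if "s \<in> S" for s k by (rule subgroup_int_pow_closed[OF S that])
  have one: "\<chi> \<one> = 0"
    using \<chi> S.one_closed unfolding character_on_def by (metis l_one one_closed add_cancel_left_right)
  define S' where "S' = {s \<otimes> b [^] (k::int) | s k. s \<in> S}"
  \<comment> \<open>Independence of the representation: two exponents of \<open>b\<close> for the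
    same element differ by a multiple of \<open>m\<close>.\<close>
  have val: "\<chi> s + imul k z = \<chi> s' + imul k' z"
    if s: "s \<in> S" "s' \<in> S" and e: "s \<otimes> b [^] (k::int) = s' \<otimes> b [^] (k'::int)" for s s' k k'
  proof -
    define d where "d = k - k'"
    have "s' = s \<otimes> b [^] d"
    proof -
      have "s \<otimes> b [^] k \<otimes> b [^] (- k') = s' \<otimes> b [^] k' \<otimes> b [^] (- k')" using e by simp
      then have "s \<otimes> (b [^] k \<otimes> b [^] (- k')) = s' \<otimes> (b [^] k' \<otimes> b [^] (- k'))"
        using s b by (simp add: m_assoc)
      then show ?thesis using s b by (simp add: d_def flip: int_pow_mult)
    qed
    then have "inv s \<otimes> s' = b [^] d" using s b by simp
    then have bd: "b [^] d \<in> S" using s by (metis S.m_closed S.m_inv_closed)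
    have "b [^] (d mod m) = b [^] (d + m * (- (d div m)))" by (simp add: minus_mult_div_eq_mod)
    also have "\<dots> = b [^] d \<otimes> (b [^] m) [^] (- (d div m))" using b by (simp only: int_pow_mult int_pow_pow)
    finally have "b [^] (d mod m) \<in> S" using bd pwS[OF m(2)] by simp
    moreover have "d mod m \<ge> 0" "d mod m < m" using m(1) by simp_all
    ultimately have "d mod m = 0" using m(3)[of "d mod m"] by linarith
    then have dm: "d = (d div m) * m" by (metis add.right_neutral mult.commute mult_div_mod_eq)
    have "b [^] d = (b [^] m) [^] (d div m)"
      using b by (subst dm) (simp add: int_pow_pow mult.commute)
    then have "\<chi> (b [^] d) = imul (d div m) (\<chi> (b [^] m))"
      using character_int_pow[OF S \<chi> m(2)] by simp
    also have "\<dots> = imul d z" by (subst (2) dm) (simp add: imul_mult z)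
    finally have "\<chi> (b [^] d) = imul d z" .
    moreover have "\<chi> s' = \<chi> s + \<chi> (b [^] d)"
      using \<chi> s bd \<open>s' = s \<otimes> b [^] d\<close> unfolding character_on_def by blast
    moreover have "imul k z = imul d z + imul k' z" by (simp add: d_def flip: imul_add)
    ultimately show ?thesis by (simp add: algebra_simps)
  qed
  define \<chi>' where "\<chi>' x = (SOME v. \<exists>s\<in>S. \<exists>k::int. x = s \<otimes> b [^] k \<and> v = \<chi> s + imul k z)" for x
  have \<chi>': "\<chi>' (s \<otimes> b [^] (k::int)) = \<chi> s + imul k z" if "s \<in> S" for s k
    unfolding \<chi>'_def
  proof (rule some_equality)
    show "\<exists>s'\<in>S. \<exists>k'::int. s \<otimes> b [^] k = s' \<otimes> b [^] k' \<and> \<chi> s + imul k z = \<chi> s' + imul k' z"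
      using that by blast
    show "v = \<chi> s + imul k z"
      if "\<exists>s'\<in>S. \<exists>k'::int. s \<otimes> b [^] k = s' \<otimes> b [^] k' \<and> v = \<chi> s' + imul k' z" for v
      using that val \<open>s \<in> S\<close> by metis
  qed
  show thesis
  proof
    show "subgroup S' G"
    proof (rule subgroupI)
      show "S' \<subseteq> carrier G" using b by (auto simp: S'_def)
      show "S' \<noteq> {}" using S.one_closed unfolding S'_def by blast
    next
      fix x assume "x \<in> S'"
      then obtain s k where x: "x = s \<otimes> b [^] (k::int)" "s \<in> S" by (auto simp: S'_def)
      have "inv x = inv s \<otimes> b [^] (- k)" using x b by (simp add: inv_mult int_pow_neg)
      then show "inv x \<in> S'" using x(2) unfolding S'_def by blast
    next
      fix x y assume "x \<in> S'" "y \<in> S'"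
      then obtain s k t l where x: "x = s \<otimes> b [^] (k::int)" "s \<in> S" and y: "y = t \<otimes> b [^] (l::int)" "t \<in> S"
        by (auto simp: S'_def)
      have "x \<otimes> y = (s \<otimes> t) \<otimes> b [^] (k + l)" using x y b by (simp add: int_pow_mult m_ac)
      then show "x \<otimes> y \<in> S'" using x(2) y(2) unfolding S'_def by blast
    qed
    show "S \<subseteq> S'"
    proof
      fix s assume "s \<in> S"
      then have "s = s \<otimes> b [^] (0::int)" by simp
      then show "s \<in> S'" using \<open>s \<in> S\<close> unfolding S'_def by blast
    qed
    have b1: "b = \<one> \<otimes> b [^] (1::int)" using b by simp
    then show "b \<in> S'" using S.one_closed unfolding S'_def by blast
    show "\<chi>' b = z" using \<chi>'[OF S.one_closed, of 1] b one by simp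
    show "\<chi>' s = \<chi> s" if "s \<in> S" for s using \<chi>'[OF that, of 0] that by simp
    show "character_on S' \<chi>'"
      unfolding character_on_def
    proof (intro ballI)
      fix x y assume "x \<in> S'" "y \<in> S'"
      then obtain s k t l where x: "x = s \<otimes> b [^] (k::int)" "s \<in> S" and y: "y = t \<otimes> b [^] (l::int)" "t \<in> S"
        by (auto simp: S'_def)
      have "x \<otimes> y = (s \<otimes> t) \<otimes> b [^] (k + l)" using x y b by (simp add: int_pow_mult m_ac)
      then have "\<chi>' (x \<otimes> y) = \<chi> (s \<otimes> t) + imul (k + l) z" using \<chi>'[of "s \<otimes> t" "k + l"] x y by simp
      moreover have "\<chi> (s \<otimes> t) = \<chi> s + \<chi> t" using \<chi> x y unfolding character_on_def by blast
      ultimately show "\<chi>' (x \<otimes> y) = \<chi>' x + \<chi>' y" using \<chi>' x y by (simp add: imul_add algebra_simps)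
    qed
  qed
qed

lemma least_power_in:
  assumes fin: "finite (carrier G)" and S: "subgroup S G" and b: "b \<in> carrier G"
  obtains m :: int where "m > 0" "b [^] m \<in> S" "\<And>k::int. 0 < k \<Longrightarrow> k < m \<Longrightarrow> b [^] k \<notin> S"
proof -
  have "b [^] order G = \<one>" using b by (rule pow_order_eq_1)
  moreover have "order G > 0" using fin by (simp add: order_gt_0_iff_finite)
  ultimately have ex: "\<exists>n::nat. n > 0 \<and> b [^] n \<in> S" using subgroup.one_closed[OF S] by (metis)
  define n where "n = (LEAST n::nat. n > 0 \<and> b [^] n \<in> S)"
  have n: "n > 0" "b [^] n \<in> S" using LeastI_ex[OF ex] by (auto simp: n_def)
  have least: "b [^] k \<notin> S" if "0 < k" "k < n" for k :: nat
    using not_less_Least[of k "\<lambda>n::nat. n > 0 \<and> b [^] n \<in> S"] that by (auto simp: n_def)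
  show thesis
  proof (rule that[of "int n"])
    show "b [^] k \<notin> S" if "0 < k" "k < int n" for k :: int
      using least[of "nat k"] that int_pow_int[of G b "nat k"] by simp
  qed (use n in \<open>auto simp: int_pow_int\<close>)
qed

lemma character_extend_carrier:
  assumes fin: "finite (carrier G)" and S: "subgroup S G" and \<chi>: "character_on S \<chi>"
  obtains \<chi>' where "character_on (carrier G) \<chi>'" "\<And>s. s \<in> S \<Longrightarrow> \<chi>' s = \<chi> s"
proof -
  have "\<exists>\<chi>'. character_on (carrier G) \<chi>' \<and> (\<forall>s\<in>S. \<chi>' s = \<chi> s)"
    using S \<chi>
  proof (induction "card (carrier G - S)" arbitrary: S \<chi> rule: less_induct)
    case less
    show ?case
    proof (cases "S = carrier G")
      case True
      then show ?thesis using less.prems by blast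
    next
      case False
      then obtain b where b: "b \<in> carrier G" "b \<notin> S" using subgroup.subset[OF less.prems(1)] by blast
      obtain m :: int where m: "m > 0" "b [^] m \<in> S" "\<And>k::int. 0 < k \<Longrightarrow> k < m \<Longrightarrow> b [^] k \<notin> S"
        using least_power_in[OF fin less.prems(1) b(1)] by blast
      obtain z where z: "imul m z = \<chi> (b [^] m)" using imul_surj[of m "\<chi> (b [^] m)"] m(1) by auto
      obtain S' \<chi>' where S': "subgroup S' G" "S \<subseteq> S'" "b \<in> S'" "character_on S' \<chi>'"
        "\<And>s. s \<in> S \<Longrightarrow> \<chi>' s = \<chi> s"
        using character_extend[OF less.prems b(1) m z] by metis
      have "carrier G - S' \<subset> carrier G - S" using S'(2,3) b by blast
      then have "card (carrier G - S') < card (carrier G - S)" using fin by (intro psubset_card_mono) auto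
      from less.hyps[OF this S'(1,4)] show ?thesis using S'(2,5) by (metis subsetD)
    qed
  qed
  then show thesis using that by blast
qed

text \<open>On the cyclic group of \<open>a\<close> the generator is sent to a nonzero element of
  R/Z that is annihilated by the order of \<open>a\<close>; divisibility extends this to the whole
  group.\<close>

lemma characters_separate:
  assumes fin: "finite (carrier G)" and a: "a \<in> carrier G" "a \<noteq> \<one>"
  obtains \<chi> where "character_on (carrier G) \<chi>" "\<chi> a \<noteq> 0"
proof -
  have \<chi>0: "character_on {\<one>} (\<lambda>_. 0)" by (simp add: character_on_def)
  obtain m :: int where m: "m > 0" "a [^] m \<in> {\<one>}" "\<And>k::int. 0 < k \<Longrightarrow> k < m \<Longrightarrow> a [^] k \<notin> {\<one>}"
    using least_power_in[OF fin triv_subgroup a(1)] by blast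
  have "m \<noteq> 1" using m(2) a by auto
  then obtain z where z: "imul m z = 0" "z \<noteq> 0" using imul_eq_0_nonzero[of m] m(1) by auto
  obtain S' \<chi>' where S': "subgroup S' G" "a \<in> S'" "character_on S' \<chi>'" "\<chi>' a = z"
    using character_extend[OF triv_subgroup \<chi>0 a(1) m, of z] z(1) by metis
  obtain \<chi> where "character_on (carrier G) \<chi>" "\<And>s. s \<in> S' \<Longrightarrow> \<chi> s = \<chi>' s"
    using character_extend_carrier[OF fin S'(1,3)] by blast
  then show thesis using that[of \<chi>] S'(2,4) z(2) by simp
qed

end

text \<open>Evaluation embeds a finite abelian group into the functions on its characters.\<close>

lemma module_embedding:
  fixes A :: "'m monoid"
  assumes G: "group G" and A: "comm_group A" and fin: "finite (carrier A)"
    and \<phi>: "\<phi> \<in> hom G (AutoGroup A)"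
  obtains act :: "'a \<Rightarrow> (('m \<Rightarrow> circ) \<Rightarrow> circ) \<Rightarrow> ('m \<Rightarrow> circ) \<Rightarrow> circ" and \<iota> where
    "finite_gmodule G act (\<iota> ` carrier A)" "inj_on \<iota> (carrier A)"
    "\<And>a b. a \<in> carrier A \<Longrightarrow> b \<in> carrier A \<Longrightarrow> \<iota> (a \<otimes>\<^bsub>A\<^esub> b) = \<iota> a + \<iota> b"
    "\<And>g a. g \<in> carrier G \<Longrightarrow> a \<in> carrier A \<Longrightarrow> \<iota> (\<phi> g a) = act g (\<iota> a)"
proof -
  interpret G: group G by (rule G)
  interpret A: comm_group A by (rule A)
  \<comment> \<open>Completed by the identity outside the carrier, so that the action laws become
    equations between total functions.\<close>
  define \<psi> where "\<psi> g x = (if x \<in> carrier A then \<phi> g x else x)" for g x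
  have aut: "\<phi> g \<in> auto A" if "g \<in> carrier G" for g
    using \<phi> that by (auto simp: hom_def AutoGroup_def)
  have \<phi>h: "\<phi> g \<in> hom A A" "\<phi> g ` carrier A = carrier A" if "g \<in> carrier G" for g
    using aut[OF that] by (auto simp: auto_def Bij_def bij_betw_def)
  have \<phi>c: "\<phi> g a \<in> carrier A" if "g \<in> carrier G" "a \<in> carrier A" for g a
    using \<phi>h(2)[OF that(1)] that(2) by blast
  have \<phi>m: "\<phi> (g \<otimes>\<^bsub>G\<^esub> h) a = \<phi> g (\<phi> h a)" if "g \<in> carrier G" "h \<in> carrier G" "a \<in> carrier A" for g h a
  proof -
    have "\<phi> (g \<otimes>\<^bsub>G\<^esub> h) = \<phi> g \<otimes>\<^bsub>AutoGroup A\<^esub> \<phi> h" using \<phi> that by (simp add: hom_def)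
    then show ?thesis using that aut by (simp add: AutoGroup_def BijGroup_def auto_def compose_def)
  qed
  have \<phi>1: "\<phi> \<one>\<^bsub>G\<^esub> a = a" if a: "a \<in> carrier A" for a
  proof -
    obtain b where b: "b \<in> carrier A" "\<phi> \<one>\<^bsub>G\<^esub> b = a" using \<phi>h(2)[of "\<one>\<^bsub>G\<^esub>"] a by (metis G.one_closed imageE)
    then show ?thesis using \<phi>m[of "\<one>\<^bsub>G\<^esub>" "\<one>\<^bsub>G\<^esub>" b] by simp
  qed
  have \<psi>m: "\<psi> (g \<otimes>\<^bsub>G\<^esub> h) = \<psi> g \<circ> \<psi> h" if "g \<in> carrier G" "h \<in> carrier G" for g h
    using that by (auto simp: fun_eq_iff \<psi>_def \<phi>m \<phi>c)
  have \<psi>1: "\<psi> \<one>\<^bsub>G\<^esub> = id" by (auto simp: fun_eq_iff \<psi>_def \<phi>1)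
  \<comment> \<open>Composition with \<open>\<psi> g\<close> acts on characters from the right;
    evaluation turns this into a left action.\<close>
  define act :: "'a \<Rightarrow> (('m \<Rightarrow> circ) \<Rightarrow> circ) \<Rightarrow> ('m \<Rightarrow> circ) \<Rightarrow> circ" where "act g F \<chi> = F (\<chi> \<circ> \<psi> g)" for g F \<chi>
  \<comment> \<open>The argument ranges over all functions, and those that are not characters get
    the value 0. Additivity thus holds everywhere, and equivariance follows as
    \<open>\<psi> g\<close> preserves and reflects being a character.\<close>
  define \<iota> where "\<iota> a \<chi> = (if A.character_on (carrier A) \<chi> then \<chi> a else 0)" for a \<chi>
  have char: "A.character_on (carrier A) (\<chi> \<circ> \<psi> g)" if "g \<in> carrier G" "A.character_on (carrier A) \<chi>" for g \<chi>
    using that \<phi>h(1)[OF that(1)] \<phi>c[OF that(1)] by (auto simp: A.character_on_def \<psi>_def hom_def)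
  have char': "A.character_on (carrier A) \<chi>" if g: "g \<in> carrier G" and c: "A.character_on (carrier A) (\<chi> \<circ> \<psi> g)" for g \<chi>
  proof -
    have "A.character_on (carrier A) (\<chi> \<circ> \<psi> g \<circ> \<psi> (inv\<^bsub>G\<^esub> g))" by (rule char) (use g c in auto)
    moreover have "\<psi> g \<circ> \<psi> (inv\<^bsub>G\<^esub> g) = id" using \<psi>m[of g "inv\<^bsub>G\<^esub> g"] g \<psi>1 by simp
    ultimately show ?thesis by (simp add: comp_assoc)
  qed
  have add: "\<iota> (a \<otimes>\<^bsub>A\<^esub> b) = \<iota> a + \<iota> b" if "a \<in> carrier A" "b \<in> carrier A" for a b
    using that by (auto simp: \<iota>_def fun_eq_iff A.character_on_def)
  have equiv: "\<iota> (\<phi> g a) = act g (\<iota> a)" if "g \<in> carrier G" "a \<in> carrier A" for g a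
  proof
    fix \<chi>
    have "A.character_on (carrier A) (\<chi> \<circ> \<psi> g) \<longleftrightarrow> A.character_on (carrier A) \<chi>"
      using char char' that by blast
    then show "\<iota> (\<phi> g a) \<chi> = act g (\<iota> a) \<chi>" using that by (simp add: \<iota>_def act_def \<psi>_def)
  qed
  have z: "\<iota> \<one>\<^bsub>A\<^esub> = 0" using add[of "\<one>\<^bsub>A\<^esub>" "\<one>\<^bsub>A\<^esub>"] by simp
  have inj: "inj_on \<iota> (carrier A)"
  proof (rule inj_onI)
    fix a b assume ab: "a \<in> carrier A" "b \<in> carrier A" "\<iota> a = \<iota> b"
    have e: "a = (a \<otimes>\<^bsub>A\<^esub> inv\<^bsub>A\<^esub> b) \<otimes>\<^bsub>A\<^esub> b" using ab by (simp add: A.m_assoc)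
    then have "\<iota> a = \<iota> (a \<otimes>\<^bsub>A\<^esub> inv\<^bsub>A\<^esub> b) + \<iota> b" using add[of "a \<otimes>\<^bsub>A\<^esub> inv\<^bsub>A\<^esub> b" b] ab by simp
    then have \<iota>0: "\<iota> (a \<otimes>\<^bsub>A\<^esub> inv\<^bsub>A\<^esub> b) = 0" using ab(3) by simp
    have "a \<otimes>\<^bsub>A\<^esub> inv\<^bsub>A\<^esub> b = \<one>\<^bsub>A\<^esub>"
    proof (rule ccontr)
      assume "a \<otimes>\<^bsub>A\<^esub> inv\<^bsub>A\<^esub> b \<noteq> \<one>\<^bsub>A\<^esub>"
      then obtain \<chi> where "A.character_on (carrier A) \<chi>" "\<chi> (a \<otimes>\<^bsub>A\<^esub> inv\<^bsub>A\<^esub> b) \<noteq> 0"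
        using A.characters_separate[OF fin] ab by (metis A.inv_closed A.m_closed)
      then show False using fun_cong[OF \<iota>0, of \<chi>] by (simp add: \<iota>_def)
    qed
    then show "a = b" using e ab by simp
  qed
  have "finite_gmodule G act (\<iota> ` carrier A)"
  proof (intro finite_gmodule.intro finite_gmodule_axioms.intro G)
    show "act g (u + v) = act g u + act g v" for g u v by (simp add: act_def fun_eq_iff)
    show "act \<one>\<^bsub>G\<^esub> u = u" for u by (simp add: act_def fun_eq_iff \<psi>1)
    show "act (g \<otimes>\<^bsub>G\<^esub> h) u = act g (act h u)" if "g \<in> carrier G" "h \<in> carrier G" for g h u
      using that by (simp add: act_def fun_eq_iff \<psi>m comp_assoc)
    show "finite (\<iota> ` carrier A)" using fin by simp
    show "0 \<in> \<iota> ` carrier A" using z by (metis A.one_closed imageI)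
    show "act g u \<in> \<iota> ` carrier A" if "g \<in> carrier G" "u \<in> \<iota> ` carrier A" for g u
      using that equiv \<phi>c by (metis (no_types, lifting) imageE imageI)
    show "u - v \<in> \<iota> ` carrier A" if uv: "u \<in> \<iota> ` carrier A" "v \<in> \<iota> ` carrier A" for u v
    proof -
      obtain a b where ab: "a \<in> carrier A" "b \<in> carrier A" "u = \<iota> a" "v = \<iota> b" using uv by blast
      have "a = (a \<otimes>\<^bsub>A\<^esub> inv\<^bsub>A\<^esub> b) \<otimes>\<^bsub>A\<^esub> b" using ab by (simp add: A.m_assoc)
      then have "\<iota> a = \<iota> (a \<otimes>\<^bsub>A\<^esub> inv\<^bsub>A\<^esub> b) + \<iota> b" using add[of "a \<otimes>\<^bsub>A\<^esub> inv\<^bsub>A\<^esub> b" b] ab by simp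
      then have "u - v = \<iota> (a \<otimes>\<^bsub>A\<^esub> inv\<^bsub>A\<^esub> b)" using ab by simp
      then show ?thesis using ab by simp
    qed
  qed
  then show thesis using inj add equiv by (rule that)
qed

section \<open>Inhomogeneous cochains\<close>

definition signed :: "nat \<Rightarrow> 'v::ab_group_add \<Rightarrow> 'v" where
  "signed i v = (if even i then v else - v)"

lemma signed_0 [simp]: "signed 0 v = v"
  by (simp add: signed_def)

lemma signed_Suc: "signed (Suc i) v = - signed i v"
  by (simp add: signed_def)

text \<open>The explicit form is the one that can be matched term by term with
  \<open>coboundary\<close>.\<close>

lemma cob_sum:
  "cob f xs = (\<Sum>i<length xs. signed i (f (take i xs @ drop (Suc i) xs)))"
proof (induction xs arbitrary: f)
  case (Cons z zs)
  have "cob f (z # zs) = f zs - (\<Sum>i<length zs. signed i (f (z # take i zs @ drop (Suc i) zs)))"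
    using Cons[of "\<lambda>w. f (z # w)"] by simp
  also have "\<dots> = f zs + (\<Sum>i<length zs. signed (Suc i) (f (z # take i zs @ drop (Suc i) zs)))"
    by (simp add: signed_Suc sum_negf)
  also have "\<dots> = (\<Sum>i<length (z # zs). signed i (f (take i (z # zs) @ drop (Suc i) (z # zs))))"
    by (simp add: sum.lessThan_Suc_shift del: sum.lessThan_Suc)
  finally show ?case .
qed simp

lemma tuples_mem: "x \<in> tuples G n \<Longrightarrow> i < n \<Longrightarrow> x i \<in> carrier G"
  using PiE_mem[of x "{..<n}" "\<lambda>_. carrier G" i] by (simp add: tuples_def)

text \<open>Joins the multiplicative module \<open>A\<close> on a carrier to the additive module of
  its values under \<open>\<iota>\<close>. Identities between cochains with values in
  \<open>A\<close> are checked additively and pulled back by injectivity.\<close>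

locale coefficient_embedding =
  finite_gmodule G act "\<iota> ` carrier A"
  for G (structure) and act :: "'a \<Rightarrow> 'v::ab_group_add \<Rightarrow> 'v" and A :: "'m monoid" and \<iota> :: "'m \<Rightarrow> 'v" +
  fixes \<phi> :: "'a \<Rightarrow> 'm \<Rightarrow> 'm"
  assumes A: "comm_group A"
    and inj: "inj_on \<iota> (carrier A)"
    and add: "a \<in> carrier A \<Longrightarrow> b \<in> carrier A \<Longrightarrow> \<iota> (a \<otimes>\<^bsub>A\<^esub> b) = \<iota> a + \<iota> b"
    and equiv: "g \<in> carrier G \<Longrightarrow> a \<in> carrier A \<Longrightarrow> \<iota> (\<phi> g a) = act g (\<iota> a)"
    and closed: "g \<in> carrier G \<Longrightarrow> a \<in> carrier A \<Longrightarrow> \<phi> g a \<in> carrier A"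
begin

sublocale A: comm_group A by (rule A)

lemma eqI: "\<iota> a = \<iota> b \<Longrightarrow> a \<in> carrier A \<Longrightarrow> b \<in> carrier A \<Longrightarrow> a = b"
  using inj by (auto dest: inj_onD)

lemma emb_one [simp]: "\<iota> \<one>\<^bsub>A\<^esub> = 0"
  using add[of "\<one>\<^bsub>A\<^esub>" "\<one>\<^bsub>A\<^esub>"] by simp

lemma emb_inv: "a \<in> carrier A \<Longrightarrow> \<iota> (inv\<^bsub>A\<^esub> a) = - \<iota> a"
  using add[of a "inv\<^bsub>A\<^esub> a"] by (simp add: eq_neg_iff_add_eq_0 add.commute)

lemma emb_pow: "a \<in> carrier A \<Longrightarrow> \<iota> (a [^]\<^bsub>A\<^esub> ((- 1) ^ i :: int)) = signed i (\<iota> a)"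
  by (cases "even i") (simp_all add: signed_def A.int_pow_neg emb_inv)

lemma emb_finprod:
  assumes "finite I" "\<And>i. i \<in> I \<Longrightarrow> f i \<in> carrier A"
  shows "\<iota> (\<Otimes>\<^bsub>A\<^esub>i\<in>I. f i) = (\<Sum>i\<in>I. \<iota> (f i))"
  using assms
proof (induction I rule: finite_induct)
  case (insert i I)
  have "(\<Otimes>\<^bsub>A\<^esub>i\<in>insert i I. f i) = f i \<otimes>\<^bsub>A\<^esub> (\<Otimes>\<^bsub>A\<^esub>i\<in>I. f i)"
    using insert by (intro A.finprod_insert) auto
  moreover have "(\<Otimes>\<^bsub>A\<^esub>i\<in>I. f i) \<in> carrier A" using insert by (intro A.finprod_closed) auto
  ultimately show ?case using insert add by simp
qed simp

definition quot :: "nat \<Rightarrow> 'a list \<Rightarrow> nat \<Rightarrow> 'a" where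
  "quot n ys = (\<lambda>j\<in>{..<n}. inv (ys ! j) \<otimes> ys ! Suc j)"

text \<open>The classical passage to homogeneous cochains,
  \<open>F(y0, ..., yn) = y0 f(y0^-1 y1, y1^-1 y2, ...)\<close>; the number of variables goes up by
  one.\<close>

definition hom_cochain :: "nat \<Rightarrow> ((nat \<Rightarrow> 'a) \<Rightarrow> 'm) \<Rightarrow> 'a list \<Rightarrow> 'v" where
  "hom_cochain n f ys = act (hd ys) (\<iota> (f (quot n ys)))"

lemma cochains_eq: "cochains G A n = (tuples G n \<rightarrow>\<^sub>E carrier A)"
  by (simp add: cochains_def cochain_group_def product_group_def)

lemma nth_lists: "ys \<in> lists_n n \<Longrightarrow> i < n \<Longrightarrow> ys ! i \<in> carrier G"
  by (auto simp: lists_n_def)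

lemma quot_tuples: "ys \<in> lists_n (Suc n) \<Longrightarrow> quot n ys \<in> tuples G n"
  using nth_lists by (auto simp: tuples_def quot_def)

lemma hom_cochain_cochain:
  assumes f: "f \<in> cochains G A n"
  shows "hom_cochain n f \<in> cochain (carrier G) (Suc n)"
  unfolding cochain_def
proof (intro CollectI conjI ballI)
  fix ys assume ys: "ys \<in> lists_n (Suc n)"
  have c: "f (quot n ys) \<in> carrier A" using f quot_tuples[OF ys] by (auto simp: cochains_eq)
  have h: "hd ys \<in> carrier G" using hd_lists(1)[OF ys] .
  show "hom_cochain n f ys \<in> \<iota> ` carrier A"
    unfolding hom_cochain_def using c h by (intro act_B) auto
  fix g assume g: "g \<in> carrier G"
  have "quot n (lmul g ys) = quot n ys"
    unfolding quot_def
  proof (rule restrict_ext)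
    fix j assume "j \<in> {..<n}"
    then have j: "j < length ys" "Suc j < length ys" using ys by (auto simp: lists_n_def)
    then have "ys ! j \<in> carrier G" "ys ! Suc j \<in> carrier G" using ys by (auto simp: lists_n_def)
    then show "inv (lmul g ys ! j) \<otimes> lmul g ys ! Suc j = inv (ys ! j) \<otimes> ys ! Suc j"
      using j g by (simp add: inv_mult_group m_assoc)
  qed
  then show "hom_cochain n f (lmul g ys) = act g (hom_cochain n f ys)"
    unfolding hom_cochain_def using hd_lists(2)[OF ys] g h by (simp add: act_mult)
qed

lemma merge_tuples: "x \<in> tuples G (Suc n) \<Longrightarrow> i < n \<Longrightarrow> merge_entries G n i x \<in> tuples G n"
  using tuples_mem[of x G "Suc n"] unfolding tuples_def merge_entries_def restrict_PiE_iff by simp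

lemma shift_tuples: "x \<in> tuples G (Suc n) \<Longrightarrow> (\<lambda>j\<in>{..<n}. x (Suc j)) \<in> tuples G n"
  using tuples_mem[of x G "Suc n"] unfolding tuples_def restrict_PiE_iff by simp

lemma restrict_tuples: "x \<in> tuples G (Suc n) \<Longrightarrow> restrict x {..<n} \<in> tuples G n"
  using tuples_mem[of x G "Suc n"] unfolding tuples_def restrict_PiE_iff by simp

lemma emb_coboundary:
  assumes f: "f \<in> cochains G A n" and x: "x \<in> tuples G (Suc n)"
  shows "coboundary G A \<phi> n f x \<in> carrier A"
    and "\<iota> (coboundary G A \<phi> n f x) =
      act (x 0) (\<iota> (f (\<lambda>j\<in>{..<n}. x (Suc j)))) +
      (\<Sum>i<n. signed (Suc i) (\<iota> (f (merge_entries G n i x)))) +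
      signed (Suc n) (\<iota> (f (restrict x {..<n})))"
proof -
  have fc: "f y \<in> carrier A" if "y \<in> tuples G n" for y using f that by (auto simp: cochains_eq)
  have x0: "x 0 \<in> carrier G" using x by (auto simp: tuples_def)
  define a where "a = \<phi> (x 0) (f (\<lambda>j\<in>{..<n}. x (Suc j)))"
  define b where "b i = f (merge_entries G n i x) [^]\<^bsub>A\<^esub> ((-1) ^ (i + 1) :: int)" for i
  define c where "c = f (restrict x {..<n}) [^]\<^bsub>A\<^esub> ((-1) ^ (n + 1) :: int)"
  have ac: "a \<in> carrier A" unfolding a_def using x0 fc[OF shift_tuples[OF x]] by (rule closed)
  have bc: "b i \<in> carrier A" if "i < n" for i unfolding b_def using fc[OF merge_tuples[OF x that]] by simp
  have cc: "c \<in> carrier A" unfolding c_def using fc[OF restrict_tuples[OF x]] by simp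
  have pc: "(\<Otimes>\<^bsub>A\<^esub>i\<in>{..<n}. b i) \<in> carrier A" using bc by (intro A.finprod_closed) auto
  have e: "coboundary G A \<phi> n f x = a \<otimes>\<^bsub>A\<^esub> (\<Otimes>\<^bsub>A\<^esub>i\<in>{..<n}. b i) \<otimes>\<^bsub>A\<^esub> c"
    unfolding coboundary_def a_def b_def c_def using x by simp
  show "coboundary G A \<phi> n f x \<in> carrier A" unfolding e using ac pc cc by simp
  have "\<iota> (coboundary G A \<phi> n f x) = \<iota> a + (\<Sum>i<n. \<iota> (b i)) + \<iota> c"
    unfolding e using ac pc cc emb_finprod[of "{..<n}" b] bc by (simp add: add)
  also have "\<iota> a = act (x 0) (\<iota> (f (\<lambda>j\<in>{..<n}. x (Suc j))))"
    unfolding a_def using x0 fc[OF shift_tuples[OF x]] by (rule equiv)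
  also have "(\<Sum>i<n. \<iota> (b i)) = (\<Sum>i<n. signed (Suc i) (\<iota> (f (merge_entries G n i x))))"
    unfolding b_def by (intro sum.cong refl, subst emb_pow) (use fc[OF merge_tuples[OF x]] in auto)
  also have "\<iota> c = signed (Suc n) (\<iota> (f (restrict x {..<n})))"
    unfolding c_def by (subst emb_pow) (use fc[OF restrict_tuples[OF x]] in auto)
  finally show "\<iota> (coboundary G A \<phi> n f x) =
      act (x 0) (\<iota> (f (\<lambda>j\<in>{..<n}. x (Suc j)))) +
      (\<Sum>i<n. signed (Suc i) (\<iota> (f (merge_entries G n i x)))) +
      signed (Suc n) (\<iota> (f (restrict x {..<n})))" .
qed

lemma coboundary_cochains: "f \<in> cochains G A n \<Longrightarrow> coboundary G A \<phi> n f \<in> cochains G A (Suc n)"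
  using emb_coboundary(1) by (auto simp: cochains_eq coboundary_def)

lemma nth_del: "i < length ys \<Longrightarrow> j < length ys - 1 \<Longrightarrow> (take i ys @ drop (Suc i) ys) ! j = (if j < i then ys ! j else ys ! Suc j)"
  by (auto simp: nth_append min_def)

text \<open>Deleting the first entry gives the term with the action, deleting entry
  \<open>Suc i\<close> for \<open>i < n\<close> merges the quotients \<open>i\<close> and
  \<open>Suc i\<close>, and deleting the last entry drops the last quotient. The position of the
  deletion accounts for the sign.\<close>

lemma cob_hom_cochain:
  assumes f: "f \<in> cochains G A n" and ys: "ys \<in> lists_n (Suc (Suc n))"
  shows "cob (hom_cochain n f) ys = hom_cochain (Suc n) (coboundary G A \<phi> n f) ys"
proof -
  define x where "x = quot (Suc n) ys"
  have x: "x \<in> tuples G (Suc n)" unfolding x_def using ys by (rule quot_tuples)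
  have len: "length ys = Suc (Suc n)" using ys by (simp add: lists_n_def)
  have yc: "ys ! i \<in> carrier G" if "i < Suc (Suc n)" for i using nth_lists[OF ys that] .
  have hd: "hd ys = ys ! 0" using len by (cases ys) auto
  let ?d = "\<lambda>i. take i ys @ drop (Suc i) ys"
  have d0: "hom_cochain n f (?d 0) = act (ys ! 0) (act (x 0) (\<iota> (f (\<lambda>j\<in>{..<n}. x (Suc j)))))"
  proof -
    have "hd (?d 0) = ys ! Suc 0" using len by (simp add: hd_drop_conv_nth)
    also have "\<dots> = ys ! 0 \<otimes> x 0" using yc[of 0] yc[of 1] by (simp add: x_def quot_def)
    finally have h: "hd (?d 0) = ys ! 0 \<otimes> x 0" .
    have "quot n (?d 0) = (\<lambda>j\<in>{..<n}. x (Suc j))"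
      unfolding quot_def using len by (intro restrict_ext) (auto simp: x_def quot_def)
    then show ?thesis
      unfolding hom_cochain_def h using yc[of 0] x by (simp add: act_mult tuples_def PiE_iff)
  qed
  have dm: "hom_cochain n f (?d (Suc i)) = act (ys ! 0) (\<iota> (f (merge_entries G n i x)))" if i: "i < n" for i
  proof -
    have h: "hd (?d (Suc i)) = ys ! 0" using len by (cases ys) auto
    have "quot n (?d (Suc i)) = merge_entries G n i x"
      unfolding quot_def merge_entries_def
    proof (rule restrict_ext)
      fix j assume j: "j \<in> {..<n}"
      have c: "ys ! j \<in> carrier G" "ys ! Suc j \<in> carrier G" "ys ! Suc (Suc j) \<in> carrier G"
        using j yc by auto
      show "inv (?d (Suc i) ! j) \<otimes> ?d (Suc i) ! Suc j =
          (if j < i then x j else if j = i then x i \<otimes> x (Suc i) else x (Suc j))"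
        using i j len c by (auto simp: nth_del x_def quot_def m_assoc)
    qed
    then show ?thesis unfolding hom_cochain_def h by simp
  qed
  have dl: "hom_cochain n f (?d (Suc n)) = act (ys ! 0) (\<iota> (f (restrict x {..<n})))"
  proof -
    have h: "hd (?d (Suc n)) = ys ! 0" using len by (cases ys) auto
    have "quot n (?d (Suc n)) = restrict x {..<n}"
      unfolding quot_def by (rule restrict_ext) (use len in \<open>auto simp: nth_del x_def quot_def\<close>)
    then show ?thesis unfolding hom_cochain_def h by simp
  qed
  let ?T = "act (ys ! 0)"
  have sg: "?T (signed i v) = signed i (?T v)" for i v by (simp add: signed_def act_minus)
  have sm: "?T (\<Sum>i<k. w i) = (\<Sum>i<k. ?T (w i))" for w and k :: nat
    by (induction k) (auto simp: act_add)
  have "cob (hom_cochain n f) ys = (\<Sum>i<Suc (Suc n). signed i (hom_cochain n f (?d i)))"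
    by (simp only: cob_sum len)
  also have "\<dots> = hom_cochain n f (?d 0) + (\<Sum>i<n. signed (Suc i) (hom_cochain n f (?d (Suc i)))) +
      signed (Suc n) (hom_cochain n f (?d (Suc n)))"
    by (subst sum.lessThan_Suc_shift, subst sum.lessThan_Suc) (simp add: signed_def add.assoc)
  also have "\<dots> = ?T (\<iota> (coboundary G A \<phi> n f x))"
    unfolding emb_coboundary(2)[OF f x] d0 dl act_add sm sg using dm by simp
  finally show ?thesis unfolding hom_cochain_def hd x_def .
qed

fun partial_prod :: "(nat \<Rightarrow> 'a) \<Rightarrow> nat \<Rightarrow> 'a" where
  "partial_prod x 0 = \<one>"
| "partial_prod x (Suc i) = partial_prod x i \<otimes> x i"

text \<open>The list \<open>1, x0, x0 x1, ...\<close>, the section of \<open>quot\<close> with head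
  \<open>\<one>\<close>.\<close>

definition prods :: "nat \<Rightarrow> (nat \<Rightarrow> 'a) \<Rightarrow> 'a list" where
  "prods n x = map (partial_prod x) [0..<Suc n]"

lemma partial_prod_closed: "x \<in> tuples G n \<Longrightarrow> i \<le> n \<Longrightarrow> partial_prod x i \<in> carrier G"
  by (induction i) (simp_all add: tuples_mem[of x G n])

lemma prods_lists: "x \<in> tuples G n \<Longrightarrow> prods n x \<in> lists_n (Suc n)"
  using partial_prod_closed[of x n] by (auto simp: prods_def lists_n_def)

lemma nth_prods: "i \<le> n \<Longrightarrow> prods n x ! i = partial_prod x i"
  unfolding prods_def by (subst nth_map) (auto simp del: upt_Suc)

lemma hd_prods [simp]: "hd (prods n x) = \<one>"
  by (simp add: prods_def hd_map del: upt_Suc)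

lemma quot_prods:
  assumes x: "x \<in> tuples G n" shows "quot n (prods n x) = x"
proof
  fix j show "quot n (prods n x) j = x j"
  proof (cases "j < n")
    case True
    then show ?thesis
      using partial_prod_closed[OF x, of j] tuples_mem[OF x] by (simp add: quot_def nth_prods)
  next
    case False
    then show ?thesis using x by (auto simp: quot_def tuples_def PiE_iff extensional_def)
  qed
qed

lemma prods_quot:
  assumes ys: "ys \<in> lists_n (Suc n)"
  shows "lmul (hd ys) (prods n (quot n ys)) = ys"
proof (rule nth_equalityI)
  have len: "length ys = Suc n" using ys by (simp add: lists_n_def)
  show "length (lmul (hd ys) (prods n (quot n ys))) = length ys" by (simp add: prods_def len)
  have hd: "hd ys = ys ! 0" using len by (cases ys) auto
  have p: "ys ! 0 \<otimes> partial_prod (quot n ys) i = ys ! i" if "i \<le> n" for i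
    using that
  proof (induction i)
    case 0
    then show ?case using nth_lists[OF ys, of 0] by simp
  next
    case (Suc i)
    have c: "ys ! i \<in> carrier G" "ys ! Suc i \<in> carrier G" "ys ! 0 \<in> carrier G"
      using nth_lists[OF ys] Suc.prems by auto
    have "ys ! 0 \<otimes> partial_prod (quot n ys) (Suc i) = (ys ! 0 \<otimes> partial_prod (quot n ys) i) \<otimes> (inv (ys ! i) \<otimes> ys ! Suc i)"
      using Suc.prems c partial_prod_closed[OF quot_tuples[OF ys], of i] by (simp add: quot_def m_assoc)
    also have "\<dots> = ys ! i \<otimes> (inv (ys ! i) \<otimes> ys ! Suc i)" using Suc by simp
    finally show ?case using c by simp
  qed
  fix i assume "i < length (lmul (hd ys) (prods n (quot n ys)))"
  then have i: "i \<le> n" "i < length (prods n (quot n ys))" by (auto simp: prods_def)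
  then show "lmul (hd ys) (prods n (quot n ys)) ! i = ys ! i" using p by (simp add: nth_prods hd)
qed

lemma hom_cochain_prods: "x \<in> tuples G n \<Longrightarrow> hom_cochain n f (prods n x) = \<iota> (f x)"
  by (simp add: hom_cochain_def quot_prods)

lemma hom_cochain_inj:
  assumes "f \<in> cochains G A n" "g \<in> cochains G A n" "\<And>ys. ys \<in> lists_n (Suc n) \<Longrightarrow> hom_cochain n f ys = hom_cochain n g ys"
  shows "f = g"
proof
  fix x show "f x = g x"
  proof (cases "x \<in> tuples G n")
    case True
    then have "\<iota> (f x) = \<iota> (g x)" using assms(3)[OF prods_lists[OF True]] by (simp add: hom_cochain_prods)
    then show ?thesis using assms(1,2) True by (intro eqI) (auto simp: cochains_eq)
  next
    case False
    then show ?thesis using assms(1,2) by (auto simp: cochains_eq PiE_iff extensional_def)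
  qed
qed

text \<open>Equivariance determines \<open>F\<close> by its values on lists with head
  \<open>\<one>\<close>, and these are exactly the lists of partial products.\<close>

lemma hom_cochain_surj:
  assumes F: "F \<in> cochain (carrier G) (Suc n)"
  obtains f where "f \<in> cochains G A n" "\<And>ys. ys \<in> lists_n (Suc n) \<Longrightarrow> hom_cochain n f ys = F ys"
proof
  define f where "f = (\<lambda>x\<in>tuples G n. inv_into (carrier A) \<iota> (F (prods n x)))"
  have B: "F (prods n x) \<in> \<iota> ` carrier A" if "x \<in> tuples G n" for x
    using cochain_B[OF F prods_lists[OF that]] .
  show "f \<in> cochains G A n" unfolding cochains_eq f_def using B by (auto intro: inv_into_into)
  fix ys assume ys: "ys \<in> lists_n (Suc n)"
  have q: "quot n ys \<in> tuples G n" by (rule quot_tuples[OF ys])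
  have "hom_cochain n f ys = act (hd ys) (F (prods n (quot n ys)))"
    unfolding hom_cochain_def f_def using q B[OF q] by (simp add: f_inv_into_f)
  also have "\<dots> = F (lmul (hd ys) (prods n (quot n ys)))"
    using hd_lists(1)[OF ys] prods_lists[OF q] by (intro cochain_act[OF F, symmetric])
  finally show "hom_cochain n f ys = F ys" using prods_quot[OF ys] by simp
qed

sublocale C: comm_group "cochain_group G A n" for n
  unfolding cochain_group_def
proof (rule group.group_comm_groupI)
  show "group (product_group (tuples G n) (\<lambda>_. A))" by (rule product_group) simp
  show "x \<otimes>\<^bsub>product_group (tuples G n) (\<lambda>_. A)\<^esub> y = y \<otimes>\<^bsub>product_group (tuples G n) (\<lambda>_. A)\<^esub> x"
    if "x \<in> carrier (product_group (tuples G n) (\<lambda>_. A))" "y \<in> carrier (product_group (tuples G n) (\<lambda>_. A))" for x y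
    using that by (auto intro!: restrict_ext A.m_comm)
qed

lemma cochain_group_simps:
  "carrier (cochain_group G A n) = cochains G A n"
  "\<one>\<^bsub>cochain_group G A n\<^esub> = (\<lambda>x\<in>tuples G n. \<one>\<^bsub>A\<^esub>)"
  "f \<otimes>\<^bsub>cochain_group G A n\<^esub> g = (\<lambda>x\<in>tuples G n. f x \<otimes>\<^bsub>A\<^esub> g x)"
  by (simp_all add: cochains_def cochain_group_def product_group_def)

lemma hom_cochain_mult:
  assumes "f \<in> cochains G A n" "g \<in> cochains G A n" "ys \<in> lists_n (Suc n)"
  shows "hom_cochain n (f \<otimes>\<^bsub>cochain_group G A n\<^esub> g) ys = hom_cochain n f ys + hom_cochain n g ys"
proof -
  have q: "quot n ys \<in> tuples G n" by (rule quot_tuples[OF assms(3)])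
  then have "f (quot n ys) \<in> carrier A" "g (quot n ys) \<in> carrier A" using assms by (auto simp: cochains_eq)
  then show ?thesis using q by (simp add: hom_cochain_def cochain_group_simps add act_add)
qed

lemma hom_cochain_one:
  "ys \<in> lists_n (Suc n) \<Longrightarrow> hom_cochain n \<one>\<^bsub>cochain_group G A n\<^esub> ys = 0"
  using quot_tuples[of ys n] by (simp add: hom_cochain_def cochain_group_simps)

lemma hom_cochain_inv:
  assumes "f \<in> cochains G A n" "ys \<in> lists_n (Suc n)"
  shows "hom_cochain n (inv\<^bsub>cochain_group G A n\<^esub> f) ys = - hom_cochain n f ys"
proof -
  have f: "f \<in> carrier (cochain_group G A n)" using assms by (simp add: cochain_group_simps)
  have "hom_cochain n (f \<otimes>\<^bsub>cochain_group G A n\<^esub> inv\<^bsub>cochain_group G A n\<^esub> f) ys = 0"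
    using f assms(2) by (simp add: hom_cochain_one)
  moreover have "inv\<^bsub>cochain_group G A n\<^esub> f \<in> cochains G A n"
    using C.inv_closed[OF f] by (simp add: cochain_group_simps)
  ultimately show ?thesis
    using hom_cochain_mult[OF assms(1) _ assms(2)] by (simp add: eq_neg_iff_add_eq_0 add.commute)
qed

text \<open>Additivity is read off from \<open>cob_add\<close> after passing to homogeneous
  cochains, which avoids rearranging the product in \<open>coboundary\<close>.\<close>

lemma coboundary_mult:
  assumes f: "f \<in> cochains G A n" and g: "g \<in> cochains G A n"
  shows "coboundary G A \<phi> n (f \<otimes>\<^bsub>cochain_group G A n\<^esub> g) =
    coboundary G A \<phi> n f \<otimes>\<^bsub>cochain_group G A (Suc n)\<^esub> coboundary G A \<phi> n g"
proof (rule hom_cochain_inj)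
  have fg: "f \<otimes>\<^bsub>cochain_group G A n\<^esub> g \<in> cochains G A n"
    using C.m_closed[of f n g] f g by (simp only: cochain_group_simps(1))
  show "coboundary G A \<phi> n (f \<otimes>\<^bsub>cochain_group G A n\<^esub> g) \<in> cochains G A (Suc n)"
    by (rule coboundary_cochains[OF fg])
  note cf = coboundary_cochains[OF f] and cg = coboundary_cochains[OF g]
  show "coboundary G A \<phi> n f \<otimes>\<^bsub>cochain_group G A (Suc n)\<^esub> coboundary G A \<phi> n g \<in> cochains G A (Suc n)"
    using C.m_closed[of _ "Suc n"] cf cg by (simp only: cochain_group_simps(1))
  fix ys assume ys: "ys \<in> lists_n (Suc (Suc n))"
  have "hom_cochain (Suc n) (coboundary G A \<phi> n (f \<otimes>\<^bsub>cochain_group G A n\<^esub> g)) ys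
      = cob (hom_cochain n (f \<otimes>\<^bsub>cochain_group G A n\<^esub> g)) ys"
    by (rule cob_hom_cochain[OF fg ys, symmetric])
  also have "\<dots> = cob (\<lambda>ys. hom_cochain n f ys + hom_cochain n g ys) ys"
    using ys by (rule cob_cong[rotated]) (rule hom_cochain_mult[OF f g])
  also have "\<dots> = hom_cochain (Suc n) (coboundary G A \<phi> n f) ys + hom_cochain (Suc n) (coboundary G A \<phi> n g) ys"
    by (simp add: cob_add cob_hom_cochain[OF f ys] cob_hom_cochain[OF g ys])
  also have "\<dots> = hom_cochain (Suc n) (coboundary G A \<phi> n f \<otimes>\<^bsub>cochain_group G A (Suc n)\<^esub> coboundary G A \<phi> n g) ys"
    by (rule hom_cochain_mult[OF cf cg ys, symmetric])
  finally show "hom_cochain (Suc n) (coboundary G A \<phi> n (f \<otimes>\<^bsub>cochain_group G A n\<^esub> g)) ys =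
      hom_cochain (Suc n) (coboundary G A \<phi> n f \<otimes>\<^bsub>cochain_group G A (Suc n)\<^esub> coboundary G A \<phi> n g) ys" .
qed

lemma coboundary_hom: "coboundary G A \<phi> n \<in> hom (cochain_group G A n) (cochain_group G A (Suc n))"
  by (rule homI) (simp_all add: cochain_group_simps(1) coboundary_cochains coboundary_mult)

lemma coboundary_group_hom: "group_hom (cochain_group G A n) (cochain_group G A (Suc n)) (coboundary G A \<phi> n)"
  using coboundary_hom by (simp add: group_hom_def group_hom_axioms_def)

lemma coboundary_coboundary:
  assumes f: "f \<in> cochains G A n"
  shows "coboundary G A \<phi> (Suc n) (coboundary G A \<phi> n f) = \<one>\<^bsub>cochain_group G A (Suc (Suc n))\<^esub>"
proof (rule hom_cochain_inj)
  note cf = coboundary_cochains[OF f]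
  show "coboundary G A \<phi> (Suc n) (coboundary G A \<phi> n f) \<in> cochains G A (Suc (Suc n))"
    by (rule coboundary_cochains[OF cf])
  show "\<one>\<^bsub>cochain_group G A (Suc (Suc n))\<^esub> \<in> cochains G A (Suc (Suc n))"
    using C.one_closed[of "Suc (Suc n)"] by (simp only: cochain_group_simps(1))
  fix ys assume ys: "ys \<in> lists_n (Suc (Suc (Suc n)))"
  have "hom_cochain (Suc (Suc n)) (coboundary G A \<phi> (Suc n) (coboundary G A \<phi> n f)) ys
      = cob (hom_cochain (Suc n) (coboundary G A \<phi> n f)) ys"
    by (rule cob_hom_cochain[OF cf ys, symmetric])
  also have "\<dots> = cob (cob (hom_cochain n f)) ys"
    using ys by (rule cob_cong[rotated]) (rule cob_hom_cochain[OF f, symmetric])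
  finally show "hom_cochain (Suc (Suc n)) (coboundary G A \<phi> (Suc n) (coboundary G A \<phi> n f)) ys =
      hom_cochain (Suc (Suc n)) \<one>\<^bsub>cochain_group G A (Suc (Suc n))\<^esub> ys"
    using ys by (simp add: hom_cochain_one)
qed

end

section \<open>Cochains of finite level\<close>

context finite_gmodule
begin

lemma trivial_action_subgroup:
  obtains T where "T \<in> finite_index_normal G" "\<And>t u. t \<in> T \<Longrightarrow> u \<in> B \<Longrightarrow> act t u = u"
proof -
  define P where "P = {g \<in> carrier G. \<forall>u\<in>B. act g u = u}"
  have P: "subgroup P G"
  proof (rule subgroupI)
    have "\<one> \<in> P" by (simp add: P_def)
    then show "P \<noteq> {}" by blast
  next
    fix a assume a: "a \<in> P"
    have "act (inv a) u = u" if "u \<in> B" for u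
    proof -
      have "a \<in> carrier G" "act a u = u" using a that by (auto simp: P_def)
      then show ?thesis using act_inv_cancel(2)[of a u] by metis
    qed
    then show "inv a \<in> P" using a by (simp add: P_def)
  next
    fix a b assume "a \<in> P" "b \<in> P"
    then show "a \<otimes> b \<in> P" by (simp add: P_def act_mult)
  qed (auto simp: P_def)
  moreover have "fin_index P (carrier G)"
  proof (rule fin_index_colour[where C = "B \<rightarrow>\<^sub>E B" and c = "\<lambda>g. restrict (act g) B"])
    show "finite (B \<rightarrow>\<^sub>E B)" using finite_B by (simp add: finite_PiE)
    show "restrict (act x) B \<in> B \<rightarrow>\<^sub>E B" if "x \<in> carrier G" for x using that act_B by auto
    fix x y assume xy: "x \<in> carrier G" "y \<in> carrier G" "restrict (act x) B = restrict (act y) B"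
    have "act (inv x \<otimes> y) u = u" if u: "u \<in> B" for u
    proof -
      have "act y u = act x u" using xy(3) u by (metis restrict_apply')
      then show ?thesis using xy by (simp add: act_mult)
    qed
    then show "inv x \<otimes> y \<in> P" using xy by (simp add: P_def)
  qed
  ultimately obtain T where "T \<in> finite_index_normal G" "T \<subseteq> P" by (rule finite_index_normal_core)
  then show thesis using that unfolding P_def by blast
qed

end

context coefficient_embedding
begin

definition level :: "'a set \<Rightarrow> nat \<Rightarrow> ((nat \<Rightarrow> 'a) \<Rightarrow> 'm) \<Rightarrow> bool" where
  "level N n f \<longleftrightarrow> (\<forall>x\<in>tuples G n. \<forall>y\<in>tuples G n. (\<forall>i<n. inv (x i) \<otimes> y i \<in> N) \<longrightarrow> f x = f y)"

lemma level_mono: "level N n f \<Longrightarrow> N' \<subseteq> N \<Longrightarrow> level N' n f"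
  unfolding level_def by blast

text \<open>The factor \<open>act (hd ys)\<close> sees \<open>hd ys\<close> itself, so
  \<open>N\<close> has to act trivially; the quotients of neighbouring entries are controlled by
  normality of \<open>N\<close>.\<close>

lemma level_hom_cochain:
  assumes N: "N \<in> finite_index_normal G" and triv: "\<And>t u. t \<in> N \<Longrightarrow> u \<in> \<iota> ` carrier A \<Longrightarrow> act t u = u"
    and f: "f \<in> cochains G A n" "level N n f"
    and ys: "ys \<in> lists_n (Suc n)" "ys' \<in> lists_n (Suc n)" "lev N ys ys'"
  shows "hom_cochain n f ys = hom_cochain n f ys'"
proof -
  note ND = finite_index_normalD[OF N]
  interpret N: subgroup N G by (rule ND(2))
  have h: "hd ys \<in> carrier G" "hd ys' \<in> carrier G" using hd_lists(1) ys by auto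
  define w where "w = inv (hd ys) \<otimes> hd ys'"
  have w: "w \<in> N" unfolding w_def using lev_hd[OF ys(3,1)] .
  have h': "hd ys' = hd ys \<otimes> w" unfolding w_def using h by simp
  have "inv (quot n ys i) \<otimes> quot n ys' i \<in> N" if i: "i < n" for i
  proof -
    have c: "ys ! j \<in> carrier G" "ys' ! j \<in> carrier G" if "j < Suc n" for j
      using nth_lists[OF ys(1) that] nth_lists[OF ys(2) that] .
    have q: "inv (ys ! j) \<otimes> ys' ! j \<in> N" if "j < Suc n" for j
      using ys that unfolding lev_def list_all2_conv_all_nth by (auto simp: lists_n_def)
    let ?a = "inv (ys ! i) \<otimes> ys ! Suc i"
    have "(inv ?a \<otimes> inv (inv (ys ! i) \<otimes> ys' ! i) \<otimes> ?a) \<otimes> (inv (ys ! Suc i) \<otimes> ys' ! Suc i) \<in> N"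
      by (rule N.m_closed[OF ND(6)[OF _ N.m_inv_closed[OF q]] q]) (use c i in auto)
    also have "(inv ?a \<otimes> inv (inv (ys ! i) \<otimes> ys' ! i) \<otimes> ?a) \<otimes> (inv (ys ! Suc i) \<otimes> ys' ! Suc i)
        = inv ?a \<otimes> (inv (ys' ! i) \<otimes> ys' ! Suc i)"
      using c[of i] c[of "Suc i"] i by (simp add: inv_mult_group m_assoc)
    finally show ?thesis using i by (simp add: quot_def)
  qed
  then have e: "f (quot n ys) = f (quot n ys')"
    using f(2) quot_tuples[OF ys(1)] quot_tuples[OF ys(2)] unfolding level_def by blast
  have "\<iota> (f (quot n ys')) \<in> \<iota> ` carrier A"
    using f(1) quot_tuples[OF ys(2)] by (auto simp: cochains_eq)
  then show ?thesis
    unfolding hom_cochain_def e h' using h w triv[OF w] by (simp add: act_mult)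
qed

text \<open>Partial products of congruent tuples are congruent, since \<open>N\<close> is normal. As
  these lists start with \<open>\<one>\<close>, the action disappears.\<close>

lemma hom_cochain_level:
  assumes N: "N \<in> finite_index_normal G" and f: "f \<in> cochains G A n"
    and l: "\<And>ys ys'. ys \<in> lists_n (Suc n) \<Longrightarrow> ys' \<in> lists_n (Suc n) \<Longrightarrow> lev N ys ys' \<Longrightarrow>
      hom_cochain n f ys = hom_cochain n f ys'"
  shows "level N n f"
  unfolding level_def
proof (intro ballI impI)
  note ND = finite_index_normalD[OF N]
  interpret N: subgroup N G by (rule ND(2))
  fix x y assume x: "x \<in> tuples G n" and y: "y \<in> tuples G n" and xy: "\<forall>i<n. inv (x i) \<otimes> y i \<in> N"
  have pp: "inv (partial_prod x i) \<otimes> partial_prod y i \<in> N" if "i \<le> n" for i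
    using that
  proof (induction i)
    case (Suc i)
    then have i: "i < n" by simp
    have c: "partial_prod x i \<in> carrier G" "partial_prod y i \<in> carrier G" "x i \<in> carrier G" "y i \<in> carrier G"
      using partial_prod_closed[OF x, of i] partial_prod_closed[OF y, of i] tuples_mem[OF x i] tuples_mem[OF y i] i by auto
    have "(inv (x i) \<otimes> (inv (partial_prod x i) \<otimes> partial_prod y i) \<otimes> x i) \<otimes> (inv (x i) \<otimes> y i) \<in> N"
      by (rule N.m_closed[OF ND(6)[OF c(3)]]) (use Suc i xy in auto)
    then show ?case using c by (simp add: inv_mult_group m_assoc)
  qed simp
  have len: "length (prods n x) = Suc n" "length (prods n y) = Suc n" by (simp_all add: prods_def)
  have "lev N (prods n x) (prods n y)"
    unfolding lev_def list_all2_conv_all_nth using len pp by (auto simp: nth_prods less_Suc_eq_le)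
  then have "\<iota> (f x) = \<iota> (f y)"
    using l[OF prods_lists[OF x] prods_lists[OF y]] by (simp add: hom_cochain_prods x y)
  then show "f x = f y" using f x y by (intro eqI) (auto simp: cochains_eq)
qed

lemma coboundaries_subset:
  "coboundaries G A \<phi> (cochains G A) n \<subseteq> cochains G A n"
  using C.one_closed[of 0] coboundary_cochains
  by (auto simp: coboundaries_def cochain_group_simps(1) split: nat.splits)

lemma coboundary_of_coboundaries:
  "b \<in> coboundaries G A \<phi> (cochains G A) n \<Longrightarrow> coboundary G A \<phi> n b = \<one>\<^bsub>cochain_group G A (Suc n)\<^esub>"
  using group_hom.hom_one[OF coboundary_group_hom, of 0] coboundary_coboundary
  by (auto simp: coboundaries_def split: nat.splits)

text \<open>Intersecting \<open>V\<close> with the kernel \<open>T\<close> of the action makes the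
  two notions of level comparable. Degree zero is apart: the homogeneous complex would offer a
  primitive from the augmentation, but there is only one empty tuple, so every cochain has every
  level. The subgroup \<open>V'\<close> is found before \<open>f\<close>.\<close>

lemma level_approximation:
  assumes unif: "\<And>V n. V \<in> finite_index_normal G \<Longrightarrow>
      \<exists>V'\<in>finite_index_normal G. V' \<subseteq> V \<and> cocycle V (Suc n) \<subseteq> cobound V' n"
    and V: "V \<in> finite_index_normal G"
  obtains V' where "V' \<in> finite_index_normal G"
    "\<And>f. f \<in> cochains G A k \<Longrightarrow> level V (Suc k) (coboundary G A \<phi> k f) \<Longrightarrow>
      \<exists>b\<in>coboundaries G A \<phi> (cochains G A) k. level V' k (f \<otimes>\<^bsub>cochain_group G A k\<^esub> inv\<^bsub>cochain_group G A k\<^esub> b)"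
proof (cases k)
  case 0
  show thesis
  proof (rule that[OF V])
    fix f assume "f \<in> cochains G A k"
    have "\<one>\<^bsub>cochain_group G A k\<^esub> \<in> coboundaries G A \<phi> (cochains G A) k" using 0 by (simp add: coboundaries_def)
    moreover have "level V k g" for g using 0 by (auto simp: level_def tuples_def)
    ultimately show "\<exists>b\<in>coboundaries G A \<phi> (cochains G A) k. level V k (f \<otimes>\<^bsub>cochain_group G A k\<^esub> inv\<^bsub>cochain_group G A k\<^esub> b)"
      by blast
  qed
next
  case (Suc m)
  obtain T where T: "T \<in> finite_index_normal G" "\<And>t u. t \<in> T \<Longrightarrow> u \<in> \<iota> ` carrier A \<Longrightarrow> act t u = u"
    using trivial_action_subgroup by blast
  have VT: "V \<inter> T \<in> finite_index_normal G" using V T(1) by (rule Int_finite_index_normal)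
  obtain V' where V': "V' \<in> finite_index_normal G"
    "\<forall>F\<in>cochain (carrier G) (Suc k).
      (\<forall>ys\<in>lists_n (Suc (Suc k)). \<forall>ys'\<in>lists_n (Suc (Suc k)). lev (V \<inter> T) ys ys' \<longrightarrow> cob F ys = cob F ys') \<longrightarrow>
      (\<exists>h\<in>cochain (carrier G) k. \<forall>ys\<in>lists_n (Suc k). \<forall>ys'\<in>lists_n (Suc k). lev V' ys ys' \<longrightarrow>
         F ys - cob h ys = F ys' - cob h ys')"
    using finite_level_approximation[OF unif VT, of k] by blast
  show thesis
  proof (rule that[OF V'(1)])
    fix f assume f: "f \<in> cochains G A k" "level V (Suc k) (coboundary G A \<phi> k f)"
    have "\<exists>h\<in>cochain (carrier G) k. \<forall>ys\<in>lists_n (Suc k). \<forall>ys'\<in>lists_n (Suc k). lev V' ys ys' \<longrightarrow>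
         hom_cochain k f ys - cob h ys = hom_cochain k f ys' - cob h ys'"
    proof (intro V'(2)[rule_format, OF hom_cochain_cochain[OF f(1)]])
      fix ys ys' assume ys: "ys \<in> lists_n (Suc (Suc k))" "ys' \<in> lists_n (Suc (Suc k))" "lev (V \<inter> T) ys ys'"
      have "hom_cochain (Suc k) (coboundary G A \<phi> k f) ys = hom_cochain (Suc k) (coboundary G A \<phi> k f) ys'"
        by (rule level_hom_cochain[OF VT _ coboundary_cochains[OF f(1)] level_mono[OF f(2)] ys]) (use T(2) in auto)
      then show "cob (hom_cochain k f) ys = cob (hom_cochain k f) ys'"
        using cob_hom_cochain[OF f(1) ys(1)] cob_hom_cochain[OF f(1) ys(2)] by simp
    qed
    then obtain h where h: "h \<in> cochain (carrier G) (Suc m)"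
      "\<And>ys ys'. ys \<in> lists_n (Suc k) \<Longrightarrow> ys' \<in> lists_n (Suc k) \<Longrightarrow> lev V' ys ys' \<Longrightarrow>
         hom_cochain k f ys - cob h ys = hom_cochain k f ys' - cob h ys'"
      using Suc by blast
    obtain h' where h': "h' \<in> cochains G A m" "\<And>ys. ys \<in> lists_n (Suc m) \<Longrightarrow> hom_cochain m h' ys = h ys"
      using hom_cochain_surj[OF h(1)] by blast
    define b where "b = coboundary G A \<phi> m h'"
    have b: "b \<in> coboundaries G A \<phi> (cochains G A) k" using h'(1) Suc by (auto simp: b_def coboundaries_def)
    have bc: "b \<in> cochains G A k" using b coboundaries_subset by blast
    have ibc: "inv\<^bsub>cochain_group G A k\<^esub> b \<in> cochains G A k"
      using C.inv_closed[of b k] bc by (simp only: cochain_group_simps(1))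
    have d: "hom_cochain k (f \<otimes>\<^bsub>cochain_group G A k\<^esub> inv\<^bsub>cochain_group G A k\<^esub> b) ys = hom_cochain k f ys - cob h ys"
      if ys: "ys \<in> lists_n (Suc k)" for ys
    proof -
      have "hom_cochain k b ys = cob (hom_cochain m h') ys"
        unfolding b_def Suc using cob_hom_cochain[OF h'(1)] ys Suc by simp
      also have "\<dots> = cob h ys" using ys Suc h'(2) by (intro cob_cong[of "Suc m"]) auto
      finally have "hom_cochain k b ys = cob h ys" .
      then show ?thesis
        using hom_cochain_mult[OF f(1) ibc ys] hom_cochain_inv[OF bc ys] by simp
    qed
    have fc: "f \<otimes>\<^bsub>cochain_group G A k\<^esub> inv\<^bsub>cochain_group G A k\<^esub> b \<in> cochains G A k"
      using C.m_closed[of f k] f(1) ibc by (simp only: cochain_group_simps(1))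
    have "level V' k (f \<otimes>\<^bsub>cochain_group G A k\<^esub> inv\<^bsub>cochain_group G A k\<^esub> b)"
      by (rule hom_cochain_level[OF V'(1) fc]) (use d h(2) in metis)
    then show "\<exists>b\<in>coboundaries G A \<phi> (cochains G A) k. level V' k (f \<otimes>\<^bsub>cochain_group G A k\<^esub> inv\<^bsub>cochain_group G A k\<^esub> b)"
      using b by blast
  qed
qed

text \<open>A cochain of level \<open>V\<close> is determined by its values on one tuple for each
  pattern of coset colours, and there are finitely many patterns and values.\<close>

lemma finite_level_cochains:
  assumes V: "V \<in> finite_index_normal G"
  shows "finite {f \<in> cochains G A n. level V n f}"
proof -
  have fA: "finite (carrier A)" using finite_imageD[OF finite_B inj] .
  obtain C :: "'a set" and c where c: "finite C" "\<And>x. x \<in> carrier G \<Longrightarrow> c x \<in> C"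
    "\<And>x y. x \<in> carrier G \<Longrightarrow> y \<in> carrier G \<Longrightarrow> c x = c y \<Longrightarrow> inv x \<otimes> y \<in> V"
    using fin_index_colouring[OF finite_index_normalD(2)[OF V] order_refl finite_index_normalD(3)[OF V]] by blast
  define col where "col x = (\<lambda>i\<in>{..<n}. c (x i))" for x
  define rep where "rep u = (SOME x. x \<in> tuples G n \<and> col x = u)" for u
  have rep: "rep (col x) \<in> tuples G n \<and> col (rep (col x)) = col x" if "x \<in> tuples G n" for x
    unfolding rep_def by (rule someI[of _ x]) (use that in simp)
  have eq: "f x = f (rep (col x))" if f: "level V n f" and x: "x \<in> tuples G n" for f x
  proof -
    have "inv (x i) \<otimes> rep (col x) i \<in> V" if i: "i < n" for i
    proof (rule c(3))
      have "col (rep (col x)) i = col x i" using rep[OF x] by simp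
      then show "c (x i) = c (rep (col x) i)" using i by (simp add: col_def)
    qed (use rep[OF x] x i tuples_mem in auto)
    then show ?thesis using f x rep[OF x] unfolding level_def by blast
  qed
  define r where "r f = restrict (\<lambda>u. f (rep u)) (col ` tuples G n)" for f :: "(nat \<Rightarrow> 'a) \<Rightarrow> 'm"
  have colC: "col ` tuples G n \<subseteq> ({..<n} \<rightarrow>\<^sub>E C)"
  proof
    fix u assume "u \<in> col ` tuples G n"
    then obtain x where x: "x \<in> tuples G n" "u = col x" by blast
    show "u \<in> ({..<n} \<rightarrow>\<^sub>E C)" unfolding x(2) col_def restrict_PiE_iff using c(2) tuples_mem[OF x(1)] by simp
  qed
  have fin: "finite (col ` tuples G n)" using finite_subset[OF colC] c(1) by (simp add: finite_PiE)
  have "inj_on r {f \<in> cochains G A n. level V n f}"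
  proof (rule inj_onI)
    fix f g assume f: "f \<in> {f \<in> cochains G A n. level V n f}" and g: "g \<in> {f \<in> cochains G A n. level V n f}" and e: "r f = r g"
    show "f = g"
    proof
      fix x show "f x = g x"
      proof (cases "x \<in> tuples G n")
        case True
        then have "f (rep (col x)) = g (rep (col x))"
          using fun_cong[OF e, of "col x"] by (simp add: r_def)
        then show ?thesis using eq[OF _ True] f g by (metis (mono_tags, lifting) mem_Collect_eq)
      next
        case False
        then show ?thesis using f g by (auto simp: cochains_eq PiE_iff extensional_def)
      qed
    qed
  qed
  moreover have "r ` {f \<in> cochains G A n. level V n f} \<subseteq> (col ` tuples G n \<rightarrow>\<^sub>E carrier A)"
  proof
    fix w assume "w \<in> r ` {f \<in> cochains G A n. level V n f}"
    then obtain f where f: "f \<in> cochains G A n" "w = r f" by blast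
    show "w \<in> (col ` tuples G n \<rightarrow>\<^sub>E carrier A)"
      unfolding f(2) r_def restrict_PiE_iff using f(1) rep by (auto simp: cochains_eq)
  qed
  ultimately show ?thesis
    using fin fA by (meson finite_PiE finite_imageD finite_subset)
qed

end

section \<open>The profinite completion\<close>

text \<open>Every subset of a product of two discrete spaces is clopen, and so is its
  preimage.\<close>

lemma clopen_discrete_pair:
  assumes "continuous_map X (discrete_topology U) u" "continuous_map X (discrete_topology V) v"
  shows "openin X {z \<in> topspace X. P (u z) (v z)}" "closedin X {z \<in> topspace X. P (u z) (v z)}"
proof -
  have o: "openin X {z \<in> topspace X. Q (u z) (v z)}" for Q
  proof -
    have "continuous_map X (prod_topology (discrete_topology U) (discrete_topology V)) (\<lambda>z. (u z, v z))"
      using assms unfolding continuous_map_pairwise comp_def by simp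
    then have "continuous_map X (discrete_topology (U \<times> V)) (\<lambda>z. (u z, v z))"
      by (simp only: prod_topology_discrete_topology)
    then have "openin X {z \<in> topspace X. (u z, v z) \<in> {p \<in> U \<times> V. Q (fst p) (snd p)}}"
      by (rule openin_continuous_map_preimage) auto
    moreover have "{z \<in> topspace X. (u z, v z) \<in> {p \<in> U \<times> V. Q (fst p) (snd p)}} = {z \<in> topspace X. Q (u z) (v z)}"
      using continuous_map_image_subset_topspace[OF assms(1)] continuous_map_image_subset_topspace[OF assms(2)] by auto
    ultimately show ?thesis by simp
  qed
  show "openin X {z \<in> topspace X. P (u z) (v z)}" by (rule o)
  have "topspace X - {z \<in> topspace X. P (u z) (v z)} = {z \<in> topspace X. \<not> P (u z) (v z)}" by auto
  then show "closedin X {z \<in> topspace X. P (u z) (v z)}"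
    using o[of "\<lambda>a b. \<not> P a b"] by (simp add: closedin_def)
qed

context group
begin

lemma completion_carrier:
  "x \<in> carrier (profinite_completion G) \<longleftrightarrow>
    x \<in> (\<Pi>\<^sub>E N\<in>finite_index_normal G. carrier (G Mod N)) \<and>
    (\<forall>N\<in>finite_index_normal G. \<forall>M\<in>finite_index_normal G. N \<subseteq> M \<longrightarrow> x M = M <#> x N)"
  by (simp add: profinite_completion_def Let_def)

lemma completion_PiE:
  "x \<in> carrier (profinite_completion G) \<Longrightarrow> x \<in> (\<Pi>\<^sub>E N\<in>finite_index_normal G. carrier (G Mod N))"
  by (rule conjunct1[OF iffD1[OF completion_carrier]])

lemma completion_mult: "N \<in> finite_index_normal G \<Longrightarrow> (x \<otimes>\<^bsub>profinite_completion G\<^esub> y) N = x N <#> y N"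
  by (simp add: profinite_completion_def Let_def)

text \<open>Elements of \<open>G Mod N\<close> are right cosets, whereas levels are defined by left
  ones; normality identifies the two conditions.\<close>

lemma coset_eq_iff:
  assumes N: "N \<in> finite_index_normal G" and gh: "g \<in> carrier G" "h \<in> carrier G"
  shows "N #> g = N #> h \<longleftrightarrow> inv g \<otimes> h \<in> N"
proof -
  note ND = finite_index_normalD[OF N]
  interpret N: subgroup N G by (rule ND(2))
  have "N #> g = N #> h \<longleftrightarrow> h \<otimes> inv g \<in> N"
  proof
    assume "N #> g = N #> h"
    then have "h \<in> N #> g" using rcos_self[OF gh(2) ND(2)] by simp
    then show "h \<otimes> inv g \<in> N" using N.rcos_module_imp[OF group_axioms gh(1)] by simp
  next
    assume "h \<otimes> inv g \<in> N"
    then have "h \<in> N #> g" using N.rcos_module_rev[OF group_axioms gh] by simp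
    then show "N #> g = N #> h" using repr_independence[OF _ gh(1) ND(2)] by simp
  qed
  also have "\<dots> \<longleftrightarrow> inv g \<otimes> h \<in> N"
  proof
    assume "h \<otimes> inv g \<in> N"
    then have "inv g \<otimes> (h \<otimes> inv g) \<otimes> g \<in> N" by (rule ND(6)[OF gh(1)])
    then show "inv g \<otimes> h \<in> N" using gh by (simp add: m_assoc)
  next
    assume "inv g \<otimes> h \<in> N"
    then have "g \<otimes> (inv g \<otimes> h) \<otimes> inv g \<in> N" by (rule ND(5)[OF gh(1)])
    then show "h \<otimes> inv g \<in> N" using gh by simp
  qed
  finally show ?thesis .
qed

lemma coset_mult:
  assumes "N \<in> finite_index_normal G" "g \<in> carrier G" "h \<in> carrier G"
  shows "(N #> g) <#> (N #> h) = N #> (g \<otimes> h)"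
  using normal.rcos_sum[OF finite_index_normalD(1)[OF assms(1)] assms(2,3)] .

lemma coset_project:
  assumes N: "N \<in> finite_index_normal G" and M: "M \<in> finite_index_normal G" and NM: "N \<subseteq> M" and g: "g \<in> carrier G"
  shows "M <#> (N #> g) = M #> g"
proof -
  note ND = finite_index_normalD[OF N] and MD = finite_index_normalD[OF M]
  have "M <#> N = M"
  proof
    show "M <#> N \<subseteq> M" unfolding set_mult_def using NM subgroup.m_closed[OF MD(2)] by blast
    show "M \<subseteq> M <#> N"
    proof
      fix m assume m: "m \<in> M"
      then have "m = m \<otimes> \<one>" using MD(4) by auto
      then show "m \<in> M <#> N" unfolding set_mult_def using m subgroup.one_closed[OF ND(2)] by blast
    qed
  qed
  then show ?thesis using setmult_rcos_assoc[OF MD(4) ND(4) g] by simp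
qed

lemma completion_rep:
  assumes "x \<in> carrier (profinite_completion G)" "N \<in> finite_index_normal G"
  obtains g where "g \<in> carrier G" "x N = N #> g"
proof -
  have "x \<in> (\<Pi>\<^sub>E N\<in>finite_index_normal G. carrier (G Mod N))"
    using assms(1) by (rule completion_PiE)
  then have "x N \<in> carrier (G Mod N)" using assms(2) by (rule PiE_mem)
  then have "x N \<in> (\<lambda>g. N #> g) ` carrier G" by (simp only: carrier_FactGroup)
  then show thesis by (rule imageE) (rule that)
qed

lemma completion_project:
  assumes "x \<in> carrier (profinite_completion G)" "N \<in> finite_index_normal G" "M \<in> finite_index_normal G" "N \<subseteq> M"
  shows "x M = M <#> x N"
  using conjunct2[OF iffD1[OF completion_carrier assms(1)]] assms(2-4) by blast

lemma completion_eq_mono: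
  assumes "x \<in> carrier (profinite_completion G)" "y \<in> carrier (profinite_completion G)"
    "N \<in> finite_index_normal G" "M \<in> finite_index_normal G" "N \<subseteq> M" "x N = y N"
  shows "x M = y M"
  using completion_project[OF assms(1,3-5)] completion_project[OF assms(2,3-5)] assms(6) by simp

text \<open>A common representative for two comparable levels yields compatibility, and the case of
  equal levels yields membership in the product.\<close>

lemma completionI:
  assumes "x \<in> extensional (finite_index_normal G)"
    and "\<And>N M. N \<in> finite_index_normal G \<Longrightarrow> M \<in> finite_index_normal G \<Longrightarrow> N \<subseteq> M \<Longrightarrow>
      \<exists>g\<in>carrier G. x N = N #> g \<and> x M = M #> g"
  shows "x \<in> carrier (profinite_completion G)"
  unfolding completion_carrier
proof (intro conjI ballI impI)
  show "x \<in> (\<Pi>\<^sub>E N\<in>finite_index_normal G. carrier (G Mod N))"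
  proof (rule PiE_I)
    fix N assume "N \<in> finite_index_normal G"
    then have "\<exists>g\<in>carrier G. x N = N #> g \<and> x N = N #> g" by (intro assms(2)) auto
    then show "x N \<in> carrier (G Mod N)" unfolding carrier_FactGroup by auto
  qed (use assms(1) in \<open>auto simp: extensional_def\<close>)
  fix N M assume NM: "N \<in> finite_index_normal G" "M \<in> finite_index_normal G" "N \<subseteq> M"
  obtain g where "g \<in> carrier G" "x N = N #> g" "x M = M #> g" using bexE[OF assms(2)[OF NM]] by metis
  then show "x M = M <#> x N" using coset_project[OF NM] by simp
qed

lemma completion_map_app: "N \<in> finite_index_normal G \<Longrightarrow> completion_map G g N = N #> g"
  by (simp add: completion_map_def)

lemma completion_map_closed: "g \<in> carrier G \<Longrightarrow> completion_map G g \<in> carrier (profinite_completion G)"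
  by (rule completionI) (auto simp: completion_map_def)

lemma completion_mult_ext: "x \<otimes>\<^bsub>profinite_completion G\<^esub> y \<in> extensional (finite_index_normal G)"
  by (simp add: profinite_completion_def Let_def)

lemma completion_map_mult:
  assumes "g \<in> carrier G" "h \<in> carrier G"
  shows "completion_map G (g \<otimes> h) = completion_map G g \<otimes>\<^bsub>profinite_completion G\<^esub> completion_map G h"
proof (rule extensionalityI[of _ "finite_index_normal G"])
  show "completion_map G (g \<otimes> h) \<in> extensional (finite_index_normal G)" by (simp add: completion_map_def)
  show "completion_map G (g \<otimes> h) N = (completion_map G g \<otimes>\<^bsub>profinite_completion G\<^esub> completion_map G h) N"
    if "N \<in> finite_index_normal G" for N
    using that assms coset_mult[OF that assms] by (simp add: completion_mult completion_map_app)
qed (rule completion_mult_ext)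

lemma completion_group: "group (profinite_completion G)"
proof -
  let ?P = "product_group (finite_index_normal G) (\<lambda>N. G Mod N)"
  let ?C = "carrier (profinite_completion G)"
  have fg: "group (G Mod N)" if "N \<in> finite_index_normal G" for N
    using normal.factorgroup_is_group[OF finite_index_normalD(1)[OF that]] .
  interpret P: group ?P by (rule product_group) (rule fg)
  have "subgroup ?C ?P"
  proof (rule P.subgroupI)
    show "?C \<subseteq> carrier ?P" using completion_PiE by simp blast
    show "?C \<noteq> {}" using completion_map_closed[OF one_closed] by blast
  next
    fix x assume x: "x \<in> ?C"
    have xP: "x \<in> carrier ?P"
      using completion_PiE[OF x] by simp
    have e: "inv\<^bsub>?P\<^esub> x = (\<lambda>N\<in>finite_index_normal G. inv\<^bsub>G Mod N\<^esub> x N)"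
      using xP by (subst inv_product_group) (auto intro: fg)
    show "inv\<^bsub>?P\<^esub> x \<in> ?C"
    proof (rule completionI)
      show "inv\<^bsub>?P\<^esub> x \<in> extensional (finite_index_normal G)" unfolding e by simp
      fix N M assume NM: "N \<in> finite_index_normal G" "M \<in> finite_index_normal G" "N \<subseteq> M"
      obtain g where g: "g \<in> carrier G" "x N = N #> g" using completion_rep[OF x NM(1)] by blast
      have xM: "x M = M #> g" using completion_project[OF x NM] g coset_project[OF NM g(1)] by simp
      have i: "inv\<^bsub>G Mod L\<^esub> (L #> g) = L #> inv g" if "L \<in> finite_index_normal G" for L
      proof -
        have "L #> g \<in> carrier (G Mod L)" using g(1) unfolding carrier_FactGroup by blast
        then show ?thesis
          using normal.inv_FactGroup[OF finite_index_normalD(1)[OF that]] normal.rcos_inv[OF finite_index_normalD(1)[OF that] g(1)] by simp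
      qed
      show "\<exists>g\<in>carrier G. (inv\<^bsub>?P\<^esub> x) N = N #> g \<and> (inv\<^bsub>?P\<^esub> x) M = M #> g"
        using g xM i[OF NM(1)] i[OF NM(2)] NM by (intro bexI[of _ "inv g"]) (simp_all add: e)
    qed
  next
    fix x y assume x: "x \<in> ?C" and y: "y \<in> ?C"
    show "x \<otimes>\<^bsub>?P\<^esub> y \<in> ?C"
    proof (rule completionI)
      fix N M assume NM: "N \<in> finite_index_normal G" "M \<in> finite_index_normal G" "N \<subseteq> M"
      obtain g where g: "g \<in> carrier G" "x N = N #> g" using completion_rep[OF x NM(1)] by blast
      obtain h where h: "h \<in> carrier G" "y N = N #> h" using completion_rep[OF y NM(1)] by blast
      have "x M = M #> g" "y M = M #> h"
        using completion_project[OF x NM] completion_project[OF y NM] g h coset_project[OF NM] by simp_all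
      then show "\<exists>k\<in>carrier G. (x \<otimes>\<^bsub>?P\<^esub> y) N = N #> k \<and> (x \<otimes>\<^bsub>?P\<^esub> y) M = M #> k"
        using g h coset_mult[OF NM(1) g(1) h(1)] coset_mult[OF NM(2) g(1) h(1)] NM
        by (intro bexI[of _ "g \<otimes> h"]) simp_all
    qed simp
  qed
  then have "group (?P\<lparr>carrier := ?C\<rparr>)" by (rule subgroup.subgroup_is_group) (rule P.group_axioms)
  moreover have "profinite_completion G = ?P\<lparr>carrier := ?C\<rparr>"
    by (simp add: profinite_completion_def Let_def)
  ultimately show ?thesis by simp
qed

lemma topspace_profinite: "topspace (profinite_topology G) = carrier (profinite_completion G)"
  using completion_PiE by (simp add: profinite_topology_def Int_absorb1 subset_iff del: PiE_iff)

lemma compact_profinite: "compact_space (profinite_topology G)"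
proof -
  let ?X = "product_topology (\<lambda>N. discrete_topology (carrier (G Mod N))) (finite_index_normal G)"
  have "compact_space ?X"
  proof (rule compact_space_product_discrete)
    show "finite (carrier (G Mod N))" if "N \<in> finite_index_normal G" for N
      using that by (simp add: finite_index_normal_def FactGroup_def)
  qed
  moreover have "closedin ?X (carrier (profinite_completion G))"
  proof (rule closedin_product_discrete)
    fix x assume "x \<in> (\<Pi>\<^sub>E N\<in>finite_index_normal G. carrier (G Mod N))" "x \<notin> carrier (profinite_completion G)"
    then obtain N M where NM: "N \<in> finite_index_normal G" "M \<in> finite_index_normal G" "N \<subseteq> M" "x M \<noteq> M <#> x N"
      unfolding completion_carrier by blast
    have "y \<notin> carrier (profinite_completion G)" if "\<forall>i\<in>{N, M}. y i = x i" for y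
      using completion_project[of y N M] NM that by auto
    then show "\<exists>S. finite S \<and> S \<subseteq> finite_index_normal G \<and>
        (\<forall>y\<in>\<Pi>\<^sub>E N\<in>finite_index_normal G. carrier (G Mod N). (\<forall>i\<in>S. y i = x i) \<longrightarrow> y \<notin> carrier (profinite_completion G))"
      using NM(1,2) by (intro exI[of _ "{N, M}"]) blast
  qed (use completion_PiE in blast)
  ultimately have "compactin ?X (carrier (profinite_completion G))"
    by (rule closedin_compact_space)
  then show ?thesis
    unfolding profinite_topology_def by (rule compact_space_subtopology)
qed

lemma continuous_projection:
  assumes "N \<in> finite_index_normal G"
  shows "continuous_map (profinite_topology G) (discrete_topology (carrier (G Mod N))) (\<lambda>x. x N)"
  unfolding profinite_topology_def
  by (rule continuous_map_from_subtopology) (rule continuous_map_product_projection[OF assms])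

lemma continuous_entry:
  assumes N: "N \<in> finite_index_normal G" and i: "i < n"
  shows "continuous_map (product_topology (\<lambda>_. profinite_topology G) {..<n}) (discrete_topology (carrier (G Mod N))) (\<lambda>x. x i N)"
proof -
  have "continuous_map (product_topology (\<lambda>_. profinite_topology G) {..<n}) (profinite_topology G) (\<lambda>x. x i)"
    by (rule continuous_map_product_projection[where X = "\<lambda>_. profinite_topology G"]) (use i in simp)
  from continuous_map_compose[OF this continuous_projection[OF N]] show ?thesis by (simp add: comp_def)
qed

text \<open>The counterpart of \<open>level\<close> on the completion: equality of the coordinates
  at \<open>N\<close> replaces equality of cosets.\<close>

definition completion_level :: "'a set \<Rightarrow> nat \<Rightarrow> ((nat \<Rightarrow> 'a set \<Rightarrow> 'a set) \<Rightarrow> 'm) \<Rightarrow> bool" where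
  "completion_level N n f \<longleftrightarrow> (\<forall>x\<in>tuples (profinite_completion G) n. \<forall>y\<in>tuples (profinite_completion G) n.
     (\<forall>i<n. x i N = y i N) \<longrightarrow> f x = f y)"

lemma Inter_finite_index_normal:
  assumes "finite \<F>" "\<F> \<subseteq> finite_index_normal G"
  obtains N where "N \<in> finite_index_normal G" "\<And>M. M \<in> \<F> \<Longrightarrow> N \<subseteq> M"
proof -
  have "\<exists>N\<in>finite_index_normal G. \<forall>M\<in>\<F>. N \<subseteq> M"
    using assms
  proof (induction \<F> rule: finite_induct)
    case empty
    then show ?case using carrier_finite_index_normal by blast
  next
    case (insert M \<F>)
    then obtain N where "N \<in> finite_index_normal G" "\<forall>M\<in>\<F>. N \<subseteq> M" by blast
    then show ?case using insert.prems Int_finite_index_normal[of N M] by (intro bexI[of _ "N \<inter> M"]) auto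
  qed
  then show thesis using that by blast
qed

lemma topspace_tuples:
  "topspace (product_topology (\<lambda>_. profinite_topology G) {..<n}) = tuples (profinite_completion G) n"
  by (simp add: topspace_profinite tuples_def)

text \<open>Pairs that agree at \<open>N\<close> but have different values form a closed set which
  shrinks with \<open>N\<close>. If none of these sets were empty, compactness would give a pair
  that agrees at every \<open>N\<close>, that is, equal tuples with different values.\<close>

lemma continuous_completion_level:
  assumes f: "continuous_map (product_topology (\<lambda>_. profinite_topology G) {..<n}) (discrete_topology U) f"
  shows "\<exists>N\<in>finite_index_normal G. completion_level N n f"
proof (rule ccontr)
  assume neg: "\<not> (\<exists>N\<in>finite_index_normal G. completion_level N n f)"
  let ?X = "product_topology (\<lambda>_. profinite_topology G) {..<n}"
  let ?XX = "prod_topology ?X ?X"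
  let ?T = "tuples (profinite_completion G) n"
  have comp: "compact_space ?XX"
    by (simp add: compact_space_prod_topology compact_space_product_topology compact_profinite)
  have top: "topspace ?XX = ?T \<times> ?T" using topspace_tuples by simp
  define D where "D N = {z \<in> ?T \<times> ?T. (\<forall>i<n. fst z i N = snd z i N) \<and> f (fst z) \<noteq> f (snd z)}" for N
  have closed: "closedin ?XX (D N)" if N: "N \<in> finite_index_normal G" for N
  proof -
    have DN: "D N = (\<Inter>i\<in>{..<n}. {z \<in> topspace ?XX. fst z i N = snd z i N}) \<inter> {z \<in> topspace ?XX. f (fst z) \<noteq> f (snd z)}"
      unfolding D_def top by auto
    have c1: "closedin ?XX {z \<in> topspace ?XX. f (fst z) \<noteq> f (snd z)}"
      using f continuous_map_compose[OF continuous_map_fst f] continuous_map_compose[OF continuous_map_snd f]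
      by (intro clopen_discrete_pair(2)[where P = "(\<noteq>)"]) (auto simp: comp_def)
    have c2: "closedin ?XX {z \<in> topspace ?XX. fst z i N = snd z i N}" if i: "i < n" for i
    proof -
      note p = continuous_entry[OF N i]
      show ?thesis
        using continuous_map_compose[OF continuous_map_fst p] continuous_map_compose[OF continuous_map_snd p]
        by (intro clopen_discrete_pair(2)[where P = "(=)"]) (auto simp: comp_def)
    qed
    show ?thesis
    \<comment> \<open>For \<open>n = 0\<close> the intersection over the coordinates has an empty
      index set.\<close>
    proof (cases "n = 0")
      case True
      then show ?thesis using c1 DN by simp
    next
      case False
      then show ?thesis
        unfolding DN using c2 c1 by (intro closedin_Int closedin_INT) auto
    qed
  qed
  have mono: "D N \<subseteq> D M" if NM: "N \<in> finite_index_normal G" "M \<in> finite_index_normal G" "N \<subseteq> M" for N M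
  proof
    fix z assume z: "z \<in> D N"
    have "fst z i M = snd z i M" if "i < n" for i
    proof (rule completion_eq_mono[OF _ _ NM])
      show "fst z i \<in> carrier (profinite_completion G)" "snd z i \<in> carrier (profinite_completion G)"
        using z that tuples_mem by (auto simp: D_def mem_Times_iff)
      show "fst z i N = snd z i N" using z that by (simp add: D_def)
    qed
    then show "z \<in> D M" using z unfolding D_def by simp
  qed
  have ne: "D N \<noteq> {}" if "N \<in> finite_index_normal G" for N
  proof -
    have "\<not> completion_level N n f" using neg that by blast
    then obtain x y where "x \<in> ?T" "y \<in> ?T" "\<forall>i<n. x i N = y i N" "f x \<noteq> f y"
      unfolding completion_level_def by blast
    then have "(x, y) \<in> D N" by (simp add: D_def)
    then show ?thesis by blast
  qed
  have "\<Inter>(D ` finite_index_normal G) \<noteq> {}"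
  proof (rule comp[unfolded compact_space_fip, rule_format], intro conjI allI impI ballI)
    show "closedin ?XX E" if "E \<in> D ` finite_index_normal G" for E using that closed by blast
    fix \<E> assume "finite \<E> \<and> \<E> \<subseteq> D ` finite_index_normal G"
    then obtain \<F> where F: "finite \<F>" "\<F> \<subseteq> finite_index_normal G" "\<E> = D ` \<F>" by (meson finite_subset_image)
    obtain N where N: "N \<in> finite_index_normal G" "\<And>M. M \<in> \<F> \<Longrightarrow> N \<subseteq> M"
      using Inter_finite_index_normal[OF F(1,2)] by blast
    have "D N \<subseteq> \<Inter>\<E>" using F mono[OF N(1) _ N(2)] by blast
    then show "\<Inter>\<E> \<noteq> {}" using ne[OF N(1)] by blast
  qed
  then obtain z where z: "\<And>N. N \<in> finite_index_normal G \<Longrightarrow> z \<in> D N" by blast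
  have zT: "fst z \<in> ?T" "snd z \<in> ?T" using z[OF carrier_finite_index_normal] by (auto simp: D_def)
  have "fst z i = snd z i" if i: "i < n" for i
  proof (rule extensionalityI[of _ "finite_index_normal G"])
    have "fst z i \<in> carrier (profinite_completion G)" "snd z i \<in> carrier (profinite_completion G)"
      using zT i unfolding tuples_def by (auto simp: PiE_iff)
    then show "fst z i \<in> extensional (finite_index_normal G)" "snd z i \<in> extensional (finite_index_normal G)"
      by (auto dest!: completion_PiE simp: PiE_iff)+
    show "fst z i N = snd z i N" if "N \<in> finite_index_normal G" for N
      using z[OF that] i by (simp add: D_def)
  qed
  then have "fst z = snd z"
    using zT unfolding tuples_def by (intro extensionalityI[of _ "{..<n}"]) (auto simp: PiE_iff)
  then show False using z[OF carrier_finite_index_normal] by (simp add: D_def)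
qed

lemma completion_level_continuous:
  assumes N: "N \<in> finite_index_normal G" and f: "completion_level N n f"
    and fU: "\<And>x. x \<in> tuples (profinite_completion G) n \<Longrightarrow> f x \<in> U"
  shows "continuous_map (product_topology (\<lambda>_. profinite_topology G) {..<n}) (discrete_topology U) f"
proof -
  let ?X = "product_topology (\<lambda>_. profinite_topology G) {..<n}"
  let ?T = "tuples (profinite_completion G) n"
  note p = continuous_entry[OF N]
  have nb: "openin ?X {y \<in> ?T. \<forall>i<n. y i N = x i N}" for x
  proof (cases "n = 0")
    case True
    then show ?thesis using openin_topspace[of ?X] unfolding topspace_tuples by simp
  next
    case False
    have "openin ?X {y \<in> topspace ?X. y i N = x i N}" if "i < n" for i
      using clopen_discrete_pair(1)[OF p[OF that] p[OF that], of "\<lambda>a b. a = x i N"] .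
    then have "openin ?X (\<Inter>i\<in>{..<n}. {y \<in> topspace ?X. y i N = x i N})"
      using False by (intro openin_INT2) auto
    moreover have "(\<Inter>i\<in>{..<n}. {y \<in> topspace ?X. y i N = x i N}) = {y \<in> ?T. \<forall>i<n. y i N = x i N}"
      using False unfolding topspace_tuples by auto
    ultimately show ?thesis by simp
  qed
  show ?thesis
    unfolding continuous_map_def
  proof (intro conjI allI impI)
    show "f \<in> topspace ?X \<rightarrow> topspace (discrete_topology U)" using fU unfolding topspace_tuples by simp
    fix W
    show "openin ?X {x \<in> topspace ?X. f x \<in> W}"
    proof (subst openin_subopen, intro ballI)
      fix x assume x: "x \<in> {x \<in> topspace ?X. f x \<in> W}"
      then have xT: "x \<in> ?T" unfolding topspace_tuples by simp
      have "{y \<in> ?T. \<forall>i<n. y i N = x i N} \<subseteq> {x \<in> topspace ?X. f x \<in> W}"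
        using x xT f unfolding topspace_tuples completion_level_def by fastforce
      then show "\<exists>Y. openin ?X Y \<and> x \<in> Y \<and> Y \<subseteq> {x \<in> topspace ?X. f x \<in> W}"
        using nb[of x] xT by blast
    qed
  qed
qed

text \<open>For fixed \<open>a\<close> the orbit map is a continuous function of a tuple of length
  one and so has a level; as the module is finite, one level serves all \<open>a\<close>.\<close>

lemma discrete_module_level:
  fixes A :: "'m monoid"
  assumes dm: "discrete_module (profinite_topology G) (profinite_completion G) A \<phi>" and fin: "finite (carrier A)"
  obtains N where "N \<in> finite_index_normal G"
    "\<And>x y a. x \<in> carrier (profinite_completion G) \<Longrightarrow> y \<in> carrier (profinite_completion G) \<Longrightarrow> x N = y N \<Longrightarrow>
       a \<in> carrier A \<Longrightarrow> \<phi> x a = \<phi> y a"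
proof -
  let ?X = "product_topology (\<lambda>_. profinite_topology G) {..<1::nat}"
  let ?T = "profinite_topology G"
  have "\<exists>N\<in>finite_index_normal G. \<forall>x\<in>carrier (profinite_completion G). \<forall>y\<in>carrier (profinite_completion G).
      x N = y N \<longrightarrow> \<phi> x a = \<phi> y a" if a: "a \<in> carrier A" for a
  proof -
    have c: "continuous_map (prod_topology ?T (discrete_topology (carrier A))) (discrete_topology (carrier A)) (\<lambda>(g, a). \<phi> g a)"
      using dm by (simp add: discrete_module_def)
    have "continuous_map ?X ?T (\<lambda>x. x 0)" by (rule continuous_map_product_projection) simp
    moreover have "continuous_map ?X (discrete_topology (carrier A)) (\<lambda>_. a)" using a by simp
    ultimately have "continuous_map ?X (prod_topology ?T (discrete_topology (carrier A))) (\<lambda>x. (x 0, a))"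
      by (simp add: continuous_map_pairwise comp_def)
    from continuous_map_compose[OF this c]
    have "continuous_map ?X (discrete_topology (carrier A)) (\<lambda>x. \<phi> (x 0) a)" by (simp add: comp_def)
    then obtain N where N: "N \<in> finite_index_normal G" "completion_level N 1 (\<lambda>x. \<phi> (x 0) a)"
      using continuous_completion_level by blast
    have "\<phi> x a = \<phi> y a" if "x \<in> carrier (profinite_completion G)" "y \<in> carrier (profinite_completion G)" "x N = y N" for x y
    proof -
      have t: "(\<lambda>i\<in>{..<1::nat}. w) \<in> tuples (profinite_completion G) 1" if "w \<in> carrier (profinite_completion G)" for w
        using that by (auto simp: tuples_def)
      show ?thesis
        using N(2)[unfolded completion_level_def, rule_format, OF t[OF that(1)] t[OF that(2)]] that(3) by simp
    qed
    then show ?thesis using N(1) by blast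
  qed
  then obtain \<nu> where \<nu>: "\<And>a. a \<in> carrier A \<Longrightarrow> \<nu> a \<in> finite_index_normal G"
    "\<And>a x y. a \<in> carrier A \<Longrightarrow> x \<in> carrier (profinite_completion G) \<Longrightarrow> y \<in> carrier (profinite_completion G) \<Longrightarrow>
      x (\<nu> a) = y (\<nu> a) \<Longrightarrow> \<phi> x a = \<phi> y a" by metis
  obtain N where N: "N \<in> finite_index_normal G" "\<And>M. M \<in> \<nu> ` carrier A \<Longrightarrow> N \<subseteq> M"
    using Inter_finite_index_normal[of "\<nu> ` carrier A"] fin \<nu>(1) by blast
  show thesis
  proof (rule that[OF N(1)])
    fix x y a assume xy: "x \<in> carrier (profinite_completion G)" "y \<in> carrier (profinite_completion G)" "x N = y N"
      and a: "a \<in> carrier A"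
    have "x (\<nu> a) = y (\<nu> a)" using completion_eq_mono[OF xy(1,2) N(1) \<nu>(1)[OF a] N(2) xy(3)] a by blast
    then show "\<phi> x a = \<phi> y a" using \<nu>(2) a xy by blast
  qed
qed

end

section \<open>The comparison map\<close>

text \<open>\<open>B\<close> is the full preimage of \<open>B'\<close> in \<open>Z\<close>, hence
  the kernel of the induced map, and \<open>surj\<close> makes it onto. The map is written with
  \<open>the_elem\<close> so as to match \<open>cohomology_pullback\<close>.\<close>

lemma quotient_hom_iso:
  assumes C: "comm_group C" and D: "comm_group D" and p: "p \<in> hom C D"
    and Z: "subgroup Z C" and B: "subgroup B C" "B \<subseteq> Z" and Z': "subgroup Z' D" and B': "subgroup B' D" "B' \<subseteq> Z'"
    and pZ: "\<And>z. z \<in> Z \<Longrightarrow> p z \<in> Z'" and pB: "\<And>z. z \<in> Z \<Longrightarrow> p z \<in> B' \<longleftrightarrow> z \<in> B"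
    and surj: "\<And>w. w \<in> Z' \<Longrightarrow> \<exists>z\<in>Z. w \<otimes>\<^bsub>D\<^esub> inv\<^bsub>D\<^esub> (p z) \<in> B'"
  shows "(\<lambda>X. the_elem ((\<lambda>z. B' #>\<^bsub>D\<^esub> p z) ` X)) \<in> iso (C\<lparr>carrier := Z\<rparr> Mod B) (D\<lparr>carrier := Z'\<rparr> Mod B')"
proof -
  interpret C: comm_group C by (rule C)
  interpret D: comm_group D by (rule D)
  let ?C = "C\<lparr>carrier := Z\<rparr>" and ?D = "D\<lparr>carrier := Z'\<rparr>"
  let ?h = "\<lambda>z. B' #>\<^bsub>D\<^esub> p z"
  have cC: "comm_group ?C" 
    using subgroup.mem_carrier[OF Z] C.m_comm
    by (intro group.group_comm_groupI[OF subgroup.subgroup_is_group[OF Z C.group_axioms]]) simp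
  have cD: "comm_group ?D" 
    using subgroup.mem_carrier[OF Z'] D.m_comm
    by (intro group.group_comm_groupI[OF subgroup.subgroup_is_group[OF Z' D.group_axioms]]) simp
  have "subgroup B' ?D" using D.subgroup_incl[OF B'(1) Z' B'(2)] .
  then have n: "B' \<lhd> ?D" by (rule comm_group.subgroup_imp_normal[OF cD])
  have r: "B' #>\<^bsub>?D\<^esub> x = B' #>\<^bsub>D\<^esub> x" for x by (simp add: r_coset_def)
  have ZD: "z \<in> carrier D" if "z \<in> Z'" for z using that subgroup.mem_carrier[OF Z'] by blast
  have hom: "?h \<in> hom ?C (?D Mod B')"
  proof (rule homI)
    fix x y assume "x \<in> carrier ?C" "y \<in> carrier ?C"
    then have xy: "x \<in> Z" "y \<in> Z" by simp_all
    then show "?h x \<in> carrier (?D Mod B')" using pZ by (auto simp: carrier_FactGroup r)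
    have "p (x \<otimes>\<^bsub>C\<^esub> y) = p x \<otimes>\<^bsub>D\<^esub> p y"
      using hom_mult[OF p] xy subgroup.mem_carrier[OF Z] by blast
    then show "?h (x \<otimes>\<^bsub>?C\<^esub> y) = ?h x \<otimes>\<^bsub>?D Mod B'\<^esub> ?h y"
      using normal.rcos_sum[OF n, of "p x" "p y"] pZ xy by (simp add: r set_mult_def)
  qed
  have g: "group (?D Mod B')" using normal.factorgroup_is_group[OF n] .
  have gh: "group_hom ?C (?D Mod B') ?h"
    using cC g hom by (simp add: group_hom_def group_hom_axioms_def comm_group_def)
  have coset: "B' #>\<^bsub>D\<^esub> x = B' #>\<^bsub>D\<^esub> y \<longleftrightarrow> x \<otimes>\<^bsub>D\<^esub> inv\<^bsub>D\<^esub> y \<in> B'" if "x \<in> carrier D" "y \<in> carrier D" for x y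
  proof
    assume "B' #>\<^bsub>D\<^esub> x = B' #>\<^bsub>D\<^esub> y"
    then have "x \<in> B' #>\<^bsub>D\<^esub> y" using D.rcos_self[OF that(1) B'(1)] by simp
    then show "x \<otimes>\<^bsub>D\<^esub> inv\<^bsub>D\<^esub> y \<in> B'" using subgroup.rcos_module_imp[OF B'(1) D.group_axioms that(2)] by simp
  next
    assume "x \<otimes>\<^bsub>D\<^esub> inv\<^bsub>D\<^esub> y \<in> B'"
    then have "x \<in> B' #>\<^bsub>D\<^esub> y" using subgroup.rcos_module_rev[OF B'(1) D.group_axioms that(2,1)] by simp
    then show "B' #>\<^bsub>D\<^esub> x = B' #>\<^bsub>D\<^esub> y" using D.repr_independence[OF _ that(2) B'(1)] by simp
  qed
  have im: "?h ` carrier ?C = carrier (?D Mod B')"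
  proof
    show "?h ` carrier ?C \<subseteq> carrier (?D Mod B')" using hom by (auto simp: hom_def)
    show "carrier (?D Mod B') \<subseteq> ?h ` carrier ?C"
    proof
      fix X assume "X \<in> carrier (?D Mod B')"
      then obtain w where w: "w \<in> Z'" "X = B' #>\<^bsub>D\<^esub> w" by (auto simp: carrier_FactGroup r)
      obtain z where z: "z \<in> Z" "w \<otimes>\<^bsub>D\<^esub> inv\<^bsub>D\<^esub> (p z) \<in> B'" using surj[OF w(1)] by blast
      have "X = ?h z" using coset[of w "p z"] ZD w z pZ by simp
      then show "X \<in> ?h ` carrier ?C" using z(1) by simp
    qed
  qed
  have "kernel ?C (?D Mod B') ?h = B"
  proof -
    have "B' #>\<^bsub>D\<^esub> p z = B' \<longleftrightarrow> p z \<in> B'" if "z \<in> Z" for z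
      using D.coset_join1[OF _ _ B'(1), of "p z"] D.coset_join2[OF _ B'(1), of "p z"] subgroup.subset[OF B'(1)] ZD pZ that by blast
    then show ?thesis using pB B(2) by (auto simp: kernel_def)
  qed
  then show ?thesis using group_hom.FactGroup_iso_set[OF gh im] by simp
qed

section \<open>Cocycles and coboundaries of a subcomplex\<close>

context coefficient_embedding
begin

context
  fixes K
  assumes K: "\<And>n. subgroup (K n) (cochain_group G A n)"
    and KS: "\<And>n f. f \<in> K n \<Longrightarrow> coboundary G A \<phi> n f \<in> K (Suc n)"
begin

lemma subcomplex_cochains: "f \<in> K n \<Longrightarrow> f \<in> cochains G A n"
  using subgroup.mem_carrier[OF K] by (simp only: cochain_group_simps(1))

lemma subgroup_cocycles: "subgroup (cocycles G A \<phi> K n) (cochain_group G A n)"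
proof -
  interpret h: group_hom "cochain_group G A n" "cochain_group G A (Suc n)" "coboundary G A \<phi> n"
    by (rule coboundary_group_hom)
  have "cocycles G A \<phi> K n = K n \<inter> kernel (cochain_group G A n) (cochain_group G A (Suc n)) (coboundary G A \<phi> n)"
    using subcomplex_cochains by (auto simp: cocycles_def kernel_def cochain_group_simps(1))
  then show ?thesis using C.subgroups_Inter_pair[OF K h.subgroup_kernel] by simp
qed

lemma subgroup_coboundaries: "subgroup (coboundaries G A \<phi> K n) (cochain_group G A n)"
proof (cases n)
  case 0
  then show ?thesis using C.triv_subgroup[of 0] by (simp add: coboundaries_def)
next
  case (Suc m)
  then show ?thesis
    using group_hom.subgroup_img_is_subgroup[OF coboundary_group_hom K] by (simp add: coboundaries_def)
qed

lemma coboundaries_cocycles: "coboundaries G A \<phi> K n \<subseteq> cocycles G A \<phi> K n"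
proof (cases n)
  case 0
  have "\<one>\<^bsub>cochain_group G A 0\<^esub> \<in> cocycles G A \<phi> K 0"
    by (rule subgroup.one_closed[OF subgroup_cocycles])
  then show ?thesis using 0 by (simp add: coboundaries_def)
next
  case (Suc m)
  then show ?thesis
    using KS coboundary_coboundary subcomplex_cochains by (auto simp: coboundaries_def cocycles_def)
qed

end

lemma subgroup_cochains: "subgroup (cochains G A n) (cochain_group G A n)"
  using C.subgroup_self[of n] by (simp only: cochain_group_simps(1))

end

text \<open>The same \<open>A\<close> is embedded twice, equivariantly for \<open>G\<close> and for
  its completion. The two embeddings are unrelated, since cochains are compared with values in
  \<open>A\<close>; vanishing of classes is assumed over \<open>G\<close> alone.\<close>

locale completion_module =
  G: coefficient_embedding G act A \<iota> "\<phi> \<circ> completion_map G" +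
  H: coefficient_embedding "profinite_completion G" act' A \<iota>' \<phi>
  for G :: "('a, 'b) monoid_scheme" and act :: "'a \<Rightarrow> 'v::ab_group_add \<Rightarrow> 'v" and A :: "'m monoid" and \<iota> :: "'m \<Rightarrow> 'v"
    and act' :: "('a set \<Rightarrow> 'a set) \<Rightarrow> 'w::ab_group_add \<Rightarrow> 'w" and \<iota>' :: "'m \<Rightarrow> 'w" and \<phi> +
  assumes dm: "discrete_module (profinite_topology G) (profinite_completion G) A \<phi>"
    and unif: "\<And>V n. V \<in> finite_index_normal G \<Longrightarrow>
      \<exists>V'\<in>finite_index_normal G. V' \<subseteq> V \<and> G.cocycle V (Suc n) \<subseteq> G.cobound V' n"
begin

abbreviation "\<Gamma> \<equiv> profinite_completion G"
abbreviation "c \<equiv> completion_map G"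
abbreviation "p \<equiv> cochain_pullback G c"
abbreviation "\<theta> \<equiv> \<phi> \<circ> c"
abbreviation "CC \<equiv> continuous_cochains (profinite_topology G) \<Gamma> A"

lemma pullback_app: "x \<in> tuples G n \<Longrightarrow> p n f x = f (\<lambda>j\<in>{..<n}. c (x j))"
  by (simp add: cochain_pullback_def)

lemma pullback_tuples: "x \<in> tuples G n \<Longrightarrow> (\<lambda>j\<in>{..<n}. c (x j)) \<in> tuples \<Gamma> n"
  using tuples_mem[of x G n] G.completion_map_closed unfolding tuples_def restrict_PiE_iff by simp

lemma cochains_app:
  "f \<in> cochains K A n \<Longrightarrow> x \<in> tuples K n \<Longrightarrow> f x \<in> carrier A"
  by (auto simp: cochains_def cochain_group_def)

lemma pullback_cochains: "f \<in> cochains \<Gamma> A n \<Longrightarrow> p n f \<in> cochains G A n"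
  unfolding G.cochains_eq cochain_pullback_def restrict_PiE_iff using cochains_app pullback_tuples by blast

lemma pullback_mult:
  "p n (f \<otimes>\<^bsub>cochain_group \<Gamma> A n\<^esub> g) = p n f \<otimes>\<^bsub>cochain_group G A n\<^esub> p n g"
  unfolding G.cochain_group_simps H.cochain_group_simps cochain_pullback_def
  using pullback_tuples by (intro restrict_ext) simp

lemma pullback_hom: "p n \<in> hom (cochain_group \<Gamma> A n) (cochain_group G A n)"
  by (rule homI) (simp_all only: G.cochain_group_simps(1) H.cochain_group_simps(1) pullback_cochains pullback_mult)

lemma pullback_coboundary:
  assumes f: "f \<in> cochains \<Gamma> A n"
  shows "p (Suc n) (coboundary \<Gamma> A \<phi> n f) = coboundary G A \<theta> n (p n f)"
  unfolding cochain_pullback_def[of G c "Suc n"] coboundary_def[of G A]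
proof (rule restrict_ext)
  fix x assume x: "x \<in> tuples G (Suc n)"
  let ?x = "\<lambda>j\<in>{..<Suc n}. c (x j)"
  have xT: "?x \<in> tuples \<Gamma> (Suc n)" by (rule pullback_tuples[OF x])
  have shift: "(\<lambda>j\<in>{..<n}. ?x (Suc j)) = (\<lambda>j\<in>{..<n}. c ((\<lambda>j\<in>{..<n}. x (Suc j)) j))" by auto
  have last: "restrict ?x {..<n} = (\<lambda>j\<in>{..<n}. c (restrict x {..<n} j))" by auto
  have merge: "merge_entries \<Gamma> n i ?x = (\<lambda>j\<in>{..<n}. c (merge_entries G n i x j))" if i: "i < n" for i
    unfolding merge_entries_def
    using i G.completion_map_mult tuples_mem[OF x] by (intro restrict_ext) (simp add: less_Suc_eq_le)
  have fm: "f (merge_entries \<Gamma> n i ?x) = p n f (merge_entries G n i x)" if i: "i < n" for i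
    unfolding merge[OF i] pullback_app[OF G.merge_tuples[OF x i]] ..
  have fin: "(\<Otimes>\<^bsub>A\<^esub>i\<in>{..<n}. f (merge_entries \<Gamma> n i ?x) [^]\<^bsub>A\<^esub> ((-1) ^ (i + 1) :: int)) =
      (\<Otimes>\<^bsub>A\<^esub>i\<in>{..<n}. p n f (merge_entries G n i x) [^]\<^bsub>A\<^esub> ((-1) ^ (i + 1) :: int))"
    using fm cochains_app[OF pullback_cochains[OF f] G.merge_tuples[OF x]]
    by (intro G.A.finprod_cong') auto
  show "coboundary \<Gamma> A \<phi> n f ?x = \<theta> (x 0) (p n f (\<lambda>j\<in>{..<n}. x (Suc j))) \<otimes>\<^bsub>A\<^esub>
      (\<Otimes>\<^bsub>A\<^esub>i\<in>{..<n}. p n f (merge_entries G n i x) [^]\<^bsub>A\<^esub> ((-1) ^ (i + 1) :: int)) \<otimes>\<^bsub>A\<^esub>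
      p n f (restrict x {..<n}) [^]\<^bsub>A\<^esub> ((-1) ^ (n + 1) :: int)"
    unfolding pullback_app[OF G.shift_tuples[OF x]] pullback_app[OF G.restrict_tuples[OF x]] shift[symmetric] last[symmetric] fin[symmetric]
    using xT by (simp add: coboundary_def)
qed

lemma continuous_iff:
  "f \<in> CC n \<longleftrightarrow> f \<in> cochains \<Gamma> A n \<and> (\<exists>N\<in>finite_index_normal G. G.completion_level N n f)"
proof
  assume "f \<in> CC n"
  then show "f \<in> cochains \<Gamma> A n \<and> (\<exists>N\<in>finite_index_normal G. G.completion_level N n f)"
    unfolding continuous_cochains_def using G.continuous_completion_level by blast
next
  assume "f \<in> cochains \<Gamma> A n \<and> (\<exists>N\<in>finite_index_normal G. G.completion_level N n f)"
  then obtain N where f: "f \<in> cochains \<Gamma> A n" and N: "N \<in> finite_index_normal G" "G.completion_level N n f"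
    by blast
  show "f \<in> CC n"
    unfolding continuous_cochains_def
    using f G.completion_level_continuous[OF N cochains_app[OF f]] by blast
qed

lemma completion_level_mono:
  assumes "G.completion_level M n f" "N \<in> finite_index_normal G" "M \<in> finite_index_normal G" "N \<subseteq> M"
  shows "G.completion_level N n f"
  unfolding G.completion_level_def
proof (intro ballI impI)
  fix x y assume xy: "x \<in> tuples \<Gamma> n" "y \<in> tuples \<Gamma> n" "\<forall>i<n. x i N = y i N"
  have "x i M = y i M" if "i < n" for i
    using G.completion_eq_mono[OF tuples_mem[OF xy(1) that] tuples_mem[OF xy(2) that] assms(2-4)] xy(3) that by blast
  then show "f x = f y" using assms(1) xy unfolding G.completion_level_def by blast
qed

lemma common_level:
  assumes "f \<in> CC n" "g \<in> CC m"
  obtains N where "N \<in> finite_index_normal G" "G.completion_level N n f" "G.completion_level N m g"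
proof -
  obtain N M where NM: "N \<in> finite_index_normal G" "M \<in> finite_index_normal G"
    "G.completion_level N n f" "G.completion_level M m g"
    using assms unfolding continuous_iff by blast
  have I: "N \<inter> M \<in> finite_index_normal G" using NM(1,2) by (rule G.Int_finite_index_normal)
  show thesis
    using that[OF I completion_level_mono[OF NM(3) I NM(1)] completion_level_mono[OF NM(4) I NM(2)]] by simp
qed

lemma subgroup_continuous: "subgroup (CC n) (cochain_group \<Gamma> A n)"
proof (rule H.C.subgroupI)
  show "CC n \<subseteq> carrier (cochain_group \<Gamma> A n)" using continuous_iff by (auto simp: H.cochain_group_simps(1))
  have "\<one>\<^bsub>cochain_group \<Gamma> A n\<^esub> \<in> CC n"
    unfolding continuous_iff
  proof
    show "\<one>\<^bsub>cochain_group \<Gamma> A n\<^esub> \<in> cochains \<Gamma> A n" using H.C.one_closed[of n] by (simp only: H.cochain_group_simps(1))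
    have "G.completion_level N n \<one>\<^bsub>cochain_group \<Gamma> A n\<^esub>" for N
      unfolding G.completion_level_def H.cochain_group_simps by simp
    then show "\<exists>N\<in>finite_index_normal G. G.completion_level N n \<one>\<^bsub>cochain_group \<Gamma> A n\<^esub>"
      using G.carrier_finite_index_normal by blast
  qed
  then show "CC n \<noteq> {}" by blast
next
  fix f assume f: "f \<in> CC n"
  then obtain N where N: "f \<in> cochains \<Gamma> A n" "N \<in> finite_index_normal G" "G.completion_level N n f"
    unfolding continuous_iff by blast
  have fc: "f \<in> carrier (cochain_group \<Gamma> A n)" using N(1) by (simp only: H.cochain_group_simps(1))
  have e: "inv\<^bsub>cochain_group \<Gamma> A n\<^esub> f = (\<lambda>x\<in>tuples \<Gamma> n. inv\<^bsub>A\<^esub> f x)"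
    using fc unfolding cochain_group_def by (intro inv_product_group) auto
  have "inv\<^bsub>cochain_group \<Gamma> A n\<^esub> f \<in> cochains \<Gamma> A n"
    using H.C.inv_closed[OF fc] by (simp only: H.cochain_group_simps(1))
  moreover have "G.completion_level N n (inv\<^bsub>cochain_group \<Gamma> A n\<^esub> f)"
    unfolding G.completion_level_def
  proof (intro ballI impI)
    fix x y assume xy: "x \<in> tuples \<Gamma> n" "y \<in> tuples \<Gamma> n" "\<forall>i<n. x i N = y i N"
    then have "f x = f y" using N(3) unfolding G.completion_level_def by blast
    then show "(inv\<^bsub>cochain_group \<Gamma> A n\<^esub> f) x = (inv\<^bsub>cochain_group \<Gamma> A n\<^esub> f) y" using xy by (simp add: e)
  qed
  ultimately show "inv\<^bsub>cochain_group \<Gamma> A n\<^esub> f \<in> CC n" unfolding continuous_iff using N(2) by blast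
next
  fix f g assume fg: "f \<in> CC n" "g \<in> CC n"
  then have fgc: "f \<in> cochains \<Gamma> A n" "g \<in> cochains \<Gamma> A n" unfolding continuous_iff by blast+
  obtain N where N: "N \<in> finite_index_normal G" "G.completion_level N n f" "G.completion_level N n g"
    using common_level[OF fg] by blast
  have "f \<otimes>\<^bsub>cochain_group \<Gamma> A n\<^esub> g \<in> cochains \<Gamma> A n"
    using H.C.m_closed[of f n g] fgc by (simp only: H.cochain_group_simps(1))
  moreover have "G.completion_level N n (f \<otimes>\<^bsub>cochain_group \<Gamma> A n\<^esub> g)"
    unfolding G.completion_level_def
  proof (intro ballI impI)
    fix x y assume xy: "x \<in> tuples \<Gamma> n" "y \<in> tuples \<Gamma> n" "\<forall>i<n. x i N = y i N"
    then have "f x = f y" "g x = g y" using N(2,3) unfolding G.completion_level_def by blast+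
    then show "(f \<otimes>\<^bsub>cochain_group \<Gamma> A n\<^esub> g) x = (f \<otimes>\<^bsub>cochain_group \<Gamma> A n\<^esub> g) y"
      using xy by (simp add: H.cochain_group_simps)
  qed
  ultimately show "f \<otimes>\<^bsub>cochain_group \<Gamma> A n\<^esub> g \<in> CC n" unfolding continuous_iff using N(1) by blast
qed

text \<open>A level of \<open>f\<close> is intersected with a level of the action. Multiplication in
  the completion is coordinatewise, so the coordinates at \<open>N\<close> determine those of merged
  entries.\<close>

lemma coboundary_continuous:
  assumes f: "f \<in> CC n"
  shows "coboundary \<Gamma> A \<phi> n f \<in> CC (Suc n)"
proof -
  obtain M where M: "f \<in> cochains \<Gamma> A n" "M \<in> finite_index_normal G" "G.completion_level M n f"
    using f unfolding continuous_iff by blast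
  have fA: "finite (carrier A)" using finite_imageD[OF G.finite_B G.inj] .
  obtain L where L: "L \<in> finite_index_normal G"
    "\<And>x y a. x \<in> carrier \<Gamma> \<Longrightarrow> y \<in> carrier \<Gamma> \<Longrightarrow> x L = y L \<Longrightarrow> a \<in> carrier A \<Longrightarrow> \<phi> x a = \<phi> y a"
    using G.discrete_module_level[OF dm fA] by blast
  define N where "N = M \<inter> L"
  have N: "N \<in> finite_index_normal G" unfolding N_def using M(2) L(1) by (rule G.Int_finite_index_normal)
  have fN: "G.completion_level N n f" by (rule completion_level_mono[OF M(3) N M(2)]) (simp add: N_def)
  have "G.completion_level N (Suc n) (coboundary \<Gamma> A \<phi> n f)"
    unfolding G.completion_level_def
  proof (intro ballI impI)
    fix x y assume x: "x \<in> tuples \<Gamma> (Suc n)" and y: "y \<in> tuples \<Gamma> (Suc n)" and xy: "\<forall>i<Suc n. x i N = y i N"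
    have f_eq: "f u = f v" if "u \<in> tuples \<Gamma> n" "v \<in> tuples \<Gamma> n" "\<And>i. i < n \<Longrightarrow> u i N = v i N" for u v
      using fN that unfolding G.completion_level_def by blast
    have s: "f (\<lambda>j\<in>{..<n}. x (Suc j)) = f (\<lambda>j\<in>{..<n}. y (Suc j))"
      by (rule f_eq[OF H.shift_tuples[OF x] H.shift_tuples[OF y]]) (use xy in simp)
    have r: "f (restrict x {..<n}) = f (restrict y {..<n})"
      by (rule f_eq[OF H.restrict_tuples[OF x] H.restrict_tuples[OF y]]) (use xy in simp)
    have m: "f (merge_entries \<Gamma> n i x) = f (merge_entries \<Gamma> n i y)" if i: "i < n" for i
      by (rule f_eq[OF H.merge_tuples[OF x i] H.merge_tuples[OF y i]])
        (use xy i N in \<open>simp add: merge_entries_def G.completion_mult\<close>)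
    have "x 0 L = y 0 L"
      by (rule G.completion_eq_mono[OF tuples_mem[OF x] tuples_mem[OF y] N L(1)]) (use xy in \<open>simp_all add: N_def\<close>)
    then have h: "\<phi> (x 0) a = \<phi> (y 0) a" if "a \<in> carrier A" for a
      by (intro L(2) tuples_mem[OF x] tuples_mem[OF y] that) simp_all
    have fin: "(\<Otimes>\<^bsub>A\<^esub>i\<in>{..<n}. f (merge_entries \<Gamma> n i x) [^]\<^bsub>A\<^esub> ((-1) ^ (i + 1) :: int)) =
        (\<Otimes>\<^bsub>A\<^esub>i\<in>{..<n}. f (merge_entries \<Gamma> n i y) [^]\<^bsub>A\<^esub> ((-1) ^ (i + 1) :: int))"
      using m cochains_app[OF M(1) H.merge_tuples[OF y]] by (intro G.A.finprod_cong') auto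
    show "coboundary \<Gamma> A \<phi> n f x = coboundary \<Gamma> A \<phi> n f y"
      using x y h[OF cochains_app[OF M(1) H.shift_tuples[OF y]]]
      by (simp only: coboundary_def restrict_apply if_True s r fin)
  qed
  then show ?thesis unfolding continuous_iff using N H.coboundary_cochains[OF M(1)] by blast
qed

text \<open>Density of \<open>G\<close>: at a common level of \<open>f\<close> and \<open>g\<close>
  a tuple of the completion is indistinguishable from the image of a tuple of
  \<open>G\<close>.\<close>

lemma pullback_inj:
  assumes f: "f \<in> CC n" and g: "g \<in> CC n" and e: "p n f = p n g"
  shows "f = g"
proof (rule extensionalityI[of _ "tuples \<Gamma> n"])
  show "f \<in> extensional (tuples \<Gamma> n)" "g \<in> extensional (tuples \<Gamma> n)"
    using f g unfolding continuous_iff H.cochains_eq PiE_iff by blast+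
  fix x assume x: "x \<in> tuples \<Gamma> n"
  obtain N where N: "N \<in> finite_index_normal G" "G.completion_level N n f" "G.completion_level N n g"
    using common_level[OF f g] by blast
  have "\<exists>y\<in>carrier G. x i N = N #>\<^bsub>G\<^esub> y" if "i < n" for i
    using G.completion_rep[OF tuples_mem[OF x that] N(1)] by metis
  then obtain y where y: "\<And>i. i < n \<Longrightarrow> y i \<in> carrier G" "\<And>i. i < n \<Longrightarrow> x i N = N #>\<^bsub>G\<^esub> y i" by metis
  define y' where "y' = restrict y {..<n}"
  have y': "y' \<in> tuples G n" unfolding y'_def tuples_def restrict_PiE_iff using y(1) by simp
  have l: "h x = p n h y'" if "G.completion_level N n h" for h :: "_ \<Rightarrow> 'm"
  proof -
    have "\<forall>i<n. x i N = (\<lambda>j\<in>{..<n}. c (y' j)) i N" using y N(1) by (simp add: y'_def G.completion_map_app)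
    then show ?thesis
      using that x pullback_tuples[OF y'] unfolding G.completion_level_def pullback_app[OF y'] by blast
  qed
  show "f x = g x" using l[OF N(2)] l[OF N(3)] e by simp
qed

text \<open>The extension evaluates \<open>g\<close> at representatives of the coordinates at
  \<open>V\<close>; over \<open>G\<close> the level of \<open>g\<close> makes the choice
  immaterial.\<close>

lemma pullback_level_surj:
  assumes g: "g \<in> cochains G A n" and V: "V \<in> finite_index_normal G" and l: "G.level V n g"
  obtains f where "f \<in> CC n" "p n f = g"
proof
  define r where "r X = (SOME y. y \<in> carrier G \<and> X = V #>\<^bsub>G\<^esub> y)" for X
  define f where "f = (\<lambda>x\<in>tuples \<Gamma> n. g (\<lambda>i\<in>{..<n}. r (x i V)))"
  have r: "r (u V) \<in> carrier G \<and> u V = V #>\<^bsub>G\<^esub> r (u V)" if "u \<in> carrier \<Gamma>" for u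
    unfolding r_def using G.completion_rep[OF that V] by (metis (mono_tags, lifting) someI_ex)
  have rT: "(\<lambda>i\<in>{..<n}. r (x i V)) \<in> tuples G n" if "x \<in> tuples \<Gamma> n" for x
    unfolding tuples_def restrict_PiE_iff using r tuples_mem[OF that] by simp
  have "f \<in> cochains \<Gamma> A n"
    unfolding H.cochains_eq f_def restrict_PiE_iff using cochains_app[OF g rT] by blast
  moreover have "G.completion_level V n f"
    unfolding G.completion_level_def
  proof (intro ballI impI)
    fix x y assume xy: "x \<in> tuples \<Gamma> n" "y \<in> tuples \<Gamma> n" "\<forall>i<n. x i V = y i V"
    then have "(\<lambda>i\<in>{..<n}. r (x i V)) = (\<lambda>i\<in>{..<n}. r (y i V))" by (intro restrict_ext) simp
    then show "f x = f y" using xy by (simp add: f_def)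
  qed
  ultimately show "f \<in> CC n" unfolding continuous_iff using V by blast
  show "p n f = g"
  proof (rule extensionalityI[of _ "tuples G n"])
    show "p n f \<in> extensional (tuples G n)" by (simp add: cochain_pullback_def)
    show "g \<in> extensional (tuples G n)" using g unfolding G.cochains_eq PiE_iff by blast
    fix x assume x: "x \<in> tuples G n"
    let ?y = "\<lambda>i\<in>{..<n}. r ((\<lambda>j\<in>{..<n}. c (x j)) i V)"
    have "p n f x = g ?y" using x pullback_tuples[OF x] by (simp add: pullback_app f_def)
    also have "\<dots> = g x"
    proof -
      have "inv\<^bsub>G\<^esub> (?y i) \<otimes>\<^bsub>G\<^esub> x i \<in> V" if i: "i < n" for i
      proof -
        have xi: "x i \<in> carrier G" by (rule tuples_mem[OF x i])
        have "r (c (x i) V) \<in> carrier G" "V #>\<^bsub>G\<^esub> r (c (x i) V) = V #>\<^bsub>G\<^esub> x i"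
          using r[OF G.completion_map_closed[OF xi]] G.completion_map_app[OF V, of "x i"] by simp_all
        then show ?thesis using G.coset_eq_iff[OF V _ xi] i by simp
      qed
      then show ?thesis using l rT[OF pullback_tuples[OF x]] x unfolding G.level_def by blast
    qed
    finally show "p n f x = g x" .
  qed
qed

lemma pullback_level:
  assumes N: "N \<in> finite_index_normal G" and f: "G.completion_level N n f"
  shows "G.level N n (p n f)"
  unfolding G.level_def
proof (intro ballI impI)
  fix x y assume x: "x \<in> tuples G n" and y: "y \<in> tuples G n" and xy: "\<forall>i<n. inv\<^bsub>G\<^esub> (x i) \<otimes>\<^bsub>G\<^esub> y i \<in> N"
  have "(\<lambda>j\<in>{..<n}. c (x j)) i N = (\<lambda>j\<in>{..<n}. c (y j)) i N" if i: "i < n" for i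
    using G.coset_eq_iff[OF N tuples_mem[OF x i] tuples_mem[OF y i]] xy i N by (simp add: G.completion_map_app)
  then show "p n f x = p n f y"
    using f pullback_tuples[OF x] pullback_tuples[OF y] unfolding G.completion_level_def pullback_app[OF x] pullback_app[OF y] by blast
qed

end

section \<open>Finiteness and the comparison isomorphism\<close>

context completion_module
begin

abbreviation "CG n \<equiv> cochain_group G A n"
abbreviation "ZG \<equiv> cocycles G A \<theta> (cochains G A)"
abbreviation "BG \<equiv> coboundaries G A \<theta> (cochains G A)"
abbreviation "Z\<Gamma> \<equiv> cocycles \<Gamma> A \<phi> CC"
abbreviation "B\<Gamma> \<equiv> coboundaries \<Gamma> A \<phi> CC"

lemma subgroup_ZG: "subgroup (ZG n) (CG n)"
  by (rule G.subgroup_cocycles[OF G.subgroup_cochains G.coboundary_cochains])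

lemma subgroup_BG: "subgroup (BG n) (CG n)"
  by (rule G.subgroup_coboundaries[OF G.subgroup_cochains G.coboundary_cochains])

lemma BG_ZG: "BG n \<subseteq> ZG n"
  by (rule G.coboundaries_cocycles[OF G.subgroup_cochains G.coboundary_cochains])

lemma cochain_div:
  "f \<in> cochains G A n \<Longrightarrow> b \<in> BG n \<Longrightarrow> f \<otimes>\<^bsub>CG n\<^esub> inv\<^bsub>CG n\<^esub> b \<in> cochains G A n"
  using subgroup.mem_carrier[OF subgroup_BG, of b n] G.C.m_closed[of f n] G.C.inv_closed[of b n]
  by (simp only: G.cochain_group_simps(1))

lemma coboundary_div:
  assumes f: "f \<in> cochains G A n" and b: "b \<in> BG n"
  shows "coboundary G A \<theta> n (f \<otimes>\<^bsub>CG n\<^esub> inv\<^bsub>CG n\<^esub> b) = coboundary G A \<theta> n f"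
proof -
  interpret h: group_hom "CG n" "CG (Suc n)" "coboundary G A \<theta> n" by (rule G.coboundary_group_hom)
  have "f \<in> carrier (CG n)" "b \<in> carrier (CG n)"
    using f subgroup.mem_carrier[OF subgroup_BG b] by (simp_all only: G.cochain_group_simps(1))
  then show ?thesis using G.coboundary_of_coboundaries[OF b] by simp
qed

text \<open>Approximation brings \<open>f\<close> to finite level modulo a coboundary, and cochains
  of finite level come from the completion.\<close>

lemma extend_cochain:
  assumes f: "f \<in> cochains G A n" and V: "V \<in> finite_index_normal G"
    and l: "G.level V (Suc n) (coboundary G A \<theta> n f)"
  obtains e b where "e \<in> CC n" "b \<in> BG n" "p n e = f \<otimes>\<^bsub>CG n\<^esub> inv\<^bsub>CG n\<^esub> b"
proof -
  obtain V' where V': "V' \<in> finite_index_normal G" "\<And>f. f \<in> cochains G A n \<Longrightarrow>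
      G.level V (Suc n) (coboundary G A \<theta> n f) \<Longrightarrow> \<exists>b\<in>BG n. G.level V' n (f \<otimes>\<^bsub>CG n\<^esub> inv\<^bsub>CG n\<^esub> b)"
    by (rule G.level_approximation[OF unif V]) blast+
  obtain b where b: "b \<in> BG n" "G.level V' n (f \<otimes>\<^bsub>CG n\<^esub> inv\<^bsub>CG n\<^esub> b)" using V'(2)[OF f l] by blast
  obtain e where "e \<in> CC n" "p n e = f \<otimes>\<^bsub>CG n\<^esub> inv\<^bsub>CG n\<^esub> b"
    by (rule pullback_level_surj[OF cochain_div[OF f b(1)] V'(1) b(2)])
  then show thesis using that b(1) by blast
qed

lemma cocycle_level: "z \<in> ZG n \<Longrightarrow> G.level (carrier G) (Suc n) (coboundary G A \<theta> n z)"
  by (simp add: cocycles_def G.level_def G.cochain_group_simps)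

text \<open>The coboundary of a cocycle is constant, so the whole group is a level of it. One
  \<open>V'\<close> then serves all cocycles, and every class has a representative of level
  \<open>V'\<close>.\<close>

lemma finite_cohomology: "finite (carrier (group_cohomology G A \<theta> n))"
proof -
  obtain V' where V': "V' \<in> finite_index_normal G" "\<And>f. f \<in> cochains G A n \<Longrightarrow>
      G.level (carrier G) (Suc n) (coboundary G A \<theta> n f) \<Longrightarrow> \<exists>b\<in>BG n. G.level V' n (f \<otimes>\<^bsub>CG n\<^esub> inv\<^bsub>CG n\<^esub> b)"
    by (rule G.level_approximation[OF unif G.carrier_finite_index_normal]) blast+
  let ?L = "{f \<in> cochains G A n. G.level V' n f}"
  have "carrier (group_cohomology G A \<theta> n) \<subseteq> (\<lambda>z. BG n #>\<^bsub>CG n\<^esub> z) ` ?L"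
  proof
    fix X assume "X \<in> carrier (group_cohomology G A \<theta> n)"
    then obtain z where z: "z \<in> ZG n" "X = BG n #>\<^bsub>CG n\<^esub> z"
      by (auto simp: group_cohomology_def cohomology_of_def carrier_FactGroup r_coset_def)
    have zc: "z \<in> cochains G A n" using z(1) by (simp add: cocycles_def)
    obtain b where b: "b \<in> BG n" "G.level V' n (z \<otimes>\<^bsub>CG n\<^esub> inv\<^bsub>CG n\<^esub> b)"
      using V'(2)[OF zc cocycle_level[OF z(1)]] by blast
    have c: "z \<in> carrier (CG n)" "b \<in> carrier (CG n)"
      using zc subgroup.mem_carrier[OF subgroup_BG b(1)] by (simp_all only: G.cochain_group_simps(1))
    have "z \<otimes>\<^bsub>CG n\<^esub> inv\<^bsub>CG n\<^esub> b \<in> BG n #>\<^bsub>CG n\<^esub> z"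
      using subgroup.m_inv_closed[OF subgroup_BG b(1)] c G.C.m_comm[of z n "inv\<^bsub>CG n\<^esub> b"]
      by (auto simp: r_coset_def)
    then have "X = BG n #>\<^bsub>CG n\<^esub> (z \<otimes>\<^bsub>CG n\<^esub> inv\<^bsub>CG n\<^esub> b)"
      unfolding z(2) by (rule G.C.repr_independence[OF _ c(1) subgroup_BG])
    then show "X \<in> (\<lambda>z. BG n #>\<^bsub>CG n\<^esub> z) ` ?L" using cochain_div[OF zc b(1)] b(2) by blast
  qed
  then show ?thesis using G.finite_level_cochains[OF V'(1), of n] by (rule finite_subset[OF _ finite_imageI])
qed

text \<open>The coboundary of a continuous cochain is continuous, and the pullback is injective on
  such cochains, so vanishing over \<open>G\<close> is reflected.\<close>

lemma pullback_cocycle: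
  assumes f: "f \<in> CC n"
  shows "p n f \<in> ZG n \<longleftrightarrow> f \<in> Z\<Gamma> n"
proof -
  have fc: "f \<in> cochains \<Gamma> A n" using f continuous_iff by blast
  have one: "p (Suc n) \<one>\<^bsub>cochain_group \<Gamma> A (Suc n)\<^esub> = \<one>\<^bsub>CG (Suc n)\<^esub>"
    by (rule hom_one[OF pullback_hom H.C.is_group G.C.is_group])
  have "p n f \<in> ZG n \<longleftrightarrow> p (Suc n) (coboundary \<Gamma> A \<phi> n f) = p (Suc n) \<one>\<^bsub>cochain_group \<Gamma> A (Suc n)\<^esub>"
    using pullback_cochains[OF fc] pullback_coboundary[OF fc] one by (simp add: cocycles_def)
  also have "\<dots> \<longleftrightarrow> coboundary \<Gamma> A \<phi> n f = \<one>\<^bsub>cochain_group \<Gamma> A (Suc n)\<^esub>"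
    using pullback_inj[OF coboundary_continuous[OF f] subgroup.one_closed[OF subgroup_continuous]] by metis
  finally show ?thesis using f by (simp add: cocycles_def)
qed

text \<open>A primitive \<open>h\<close> over \<open>G\<close> need not extend, but its coboundary
  has finite level. Changing \<open>h\<close> by a coboundary makes it extend to some
  \<open>e\<close>, and injectivity of the pullback identifies the coboundary of \<open>e\<close>
  with \<open>z\<close>.\<close>

lemma pullback_coboundaries:
  assumes z: "z \<in> CC n"
  shows "p n z \<in> BG n \<longleftrightarrow> z \<in> B\<Gamma> n"
proof (cases n)
  case 0
  have one: "p 0 \<one>\<^bsub>cochain_group \<Gamma> A 0\<^esub> = \<one>\<^bsub>CG 0\<^esub>"
    by (rule hom_one[OF pullback_hom H.C.is_group G.C.is_group])
  show ?thesis
    using pullback_inj[OF z[unfolded 0] subgroup.one_closed[OF subgroup_continuous]] one 0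
    by (auto simp: coboundaries_def)
next
  case (Suc m)
  show ?thesis
  proof
    assume "z \<in> B\<Gamma> n"
    then obtain h where h: "h \<in> CC m" "z = coboundary \<Gamma> A \<phi> m h" using Suc by (auto simp: coboundaries_def)
    have hc: "h \<in> cochains \<Gamma> A m" using h(1) continuous_iff by blast
    have "p n z = coboundary G A \<theta> m (p m h)" unfolding h(2) Suc by (rule pullback_coboundary[OF hc])
    then show "p n z \<in> BG n" using Suc pullback_cochains[OF hc] by (simp add: coboundaries_def)
  next
    assume "p n z \<in> BG n"
    then obtain h where h: "h \<in> cochains G A m" "p n z = coboundary G A \<theta> m h"
      using Suc by (auto simp: coboundaries_def)
    obtain N where N: "N \<in> finite_index_normal G" "G.completion_level N n z" using z continuous_iff by blast
    have "G.level N (Suc m) (coboundary G A \<theta> m h)" using pullback_level[OF N] h(2) Suc by simp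
    then obtain e b where e: "e \<in> CC m" "b \<in> BG m" "p m e = h \<otimes>\<^bsub>CG m\<^esub> inv\<^bsub>CG m\<^esub> b"
      using extend_cochain[OF h(1) N(1)] by blast
    have ec: "e \<in> cochains \<Gamma> A m" using e(1) continuous_iff by blast
    have "p (Suc m) (coboundary \<Gamma> A \<phi> m e) = p (Suc m) z"
      using pullback_coboundary[OF ec] e(3) coboundary_div[OF h(1) e(2)] h(2) Suc by simp
    then have "coboundary \<Gamma> A \<phi> m e = z"
      by (rule pullback_inj[OF coboundary_continuous[OF e(1)] z[unfolded Suc]])
    then show "z \<in> B\<Gamma> n" using e(1) Suc by (auto simp: coboundaries_def)
  qed
qed

lemma comparison_iso:
  "cohomology_pullback G A \<phi> c n
    \<in> iso (continuous_cohomology (profinite_topology G) \<Gamma> A \<phi> n) (group_cohomology G A \<theta> n)"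
proof -
  have ZC: "z \<in> CC n" if "z \<in> Z\<Gamma> n" for z using that by (simp add: cocycles_def)
  have "(\<lambda>X. the_elem ((\<lambda>z. BG n #>\<^bsub>CG n\<^esub> p n z) ` X))
    \<in> iso ((cochain_group \<Gamma> A n)\<lparr>carrier := Z\<Gamma> n\<rparr> Mod B\<Gamma> n) ((CG n)\<lparr>carrier := ZG n\<rparr> Mod BG n)"
  proof (rule quotient_hom_iso[OF H.C.comm_group_axioms G.C.comm_group_axioms pullback_hom _ _ _
        subgroup_ZG subgroup_BG BG_ZG])
    show "subgroup (Z\<Gamma> n) (cochain_group \<Gamma> A n)"
      by (rule H.subgroup_cocycles[OF subgroup_continuous coboundary_continuous])
    show "subgroup (B\<Gamma> n) (cochain_group \<Gamma> A n)"
      by (rule H.subgroup_coboundaries[OF subgroup_continuous coboundary_continuous])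
    show "B\<Gamma> n \<subseteq> Z\<Gamma> n"
      by (rule H.coboundaries_cocycles[OF subgroup_continuous coboundary_continuous])
    show "p n z \<in> ZG n" "p n z \<in> BG n \<longleftrightarrow> z \<in> B\<Gamma> n" if "z \<in> Z\<Gamma> n" for z
      using pullback_cocycle[OF ZC[OF that]] pullback_coboundaries[OF ZC[OF that]] that by blast+
    fix w assume w: "w \<in> ZG n"
    have wc: "w \<in> cochains G A n" using w by (simp add: cocycles_def)
    obtain e b where e: "e \<in> CC n" "b \<in> BG n" "p n e = w \<otimes>\<^bsub>CG n\<^esub> inv\<^bsub>CG n\<^esub> b"
      by (rule extend_cochain[OF wc G.carrier_finite_index_normal cocycle_level[OF w]])
    have c: "w \<in> carrier (CG n)" "b \<in> carrier (CG n)"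
      using wc subgroup.mem_carrier[OF subgroup_BG e(2)] by (simp_all only: G.cochain_group_simps(1))
    have "p n e \<in> ZG n"
      unfolding e(3) using subgroup.m_closed[OF subgroup_ZG w subgroup.m_inv_closed[OF subgroup_ZG]] e(2) BG_ZG by blast
    then have "e \<in> Z\<Gamma> n" using pullback_cocycle[OF e(1)] by simp
    moreover have "w \<otimes>\<^bsub>CG n\<^esub> inv\<^bsub>CG n\<^esub> (p n e) = b"
      unfolding e(3) using c by (simp add: G.C.inv_mult)
    ultimately show "\<exists>z\<in>Z\<Gamma> n. w \<otimes>\<^bsub>CG n\<^esub> inv\<^bsub>CG n\<^esub> (p n z) \<in> BG n" using e(2) by metis
  qed
  moreover have "cohomology_pullback G A \<phi> c n = (\<lambda>X. the_elem ((\<lambda>z. BG n #>\<^bsub>CG n\<^esub> p n z) ` X))"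
    by (rule ext) (simp add: cohomology_pullback_def)
  ultimately show ?thesis
    by (simp only: continuous_cohomology_def group_cohomology_def cohomology_of_def)
qed

end

theorem theorem3p9:
  fixes G :: "('a, 'b) monoid_scheme"
  assumes "group G"
    and "residually_finite G"
    and "solvable G"
    and "minimax G"
  shows "class_G TYPE('m) G"
  unfolding class_G_def
proof (intro conjI allI impI)
  show "group G" by fact
  fix n :: nat and A :: "'m monoid" and \<phi>
  assume a: "finite (carrier A) \<and> discrete_module (profinite_topology G) (profinite_completion G) A \<phi>"
  interpret G: group G by fact
  have A: "comm_group A" and \<phi>: "\<phi> \<in> hom (profinite_completion G) (AutoGroup A)"
    using a by (simp_all add: discrete_module_def group_module_def)
  have c: "completion_map G \<in> hom G (profinite_completion G)"
    by (rule homI) (simp_all add: G.completion_map_closed G.completion_map_mult)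
  have \<phi>c: "\<phi> \<circ> completion_map G \<in> hom G (AutoGroup A)" using c \<phi> by (rule hom_compose)
  have cl: "\<phi> g a \<in> carrier A" if "g \<in> carrier (profinite_completion G)" "a \<in> carrier A" for g a
    using hom_in_carrier[OF \<phi> that(1)] that(2) by (auto simp: AutoGroup_def BijGroup_def auto_def Bij_def dest: bij_betwE)
  obtain act :: "'a \<Rightarrow> (('m \<Rightarrow> circ) \<Rightarrow> circ) \<Rightarrow> ('m \<Rightarrow> circ) \<Rightarrow> circ" and \<iota> where
    i: "finite_gmodule G act (\<iota> ` carrier A)" "inj_on \<iota> (carrier A)"
    "\<And>a b. a \<in> carrier A \<Longrightarrow> b \<in> carrier A \<Longrightarrow> \<iota> (a \<otimes>\<^bsub>A\<^esub> b) = \<iota> a + \<iota> b"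
    "\<And>g a. g \<in> carrier G \<Longrightarrow> a \<in> carrier A \<Longrightarrow> \<iota> ((\<phi> \<circ> completion_map G) g a) = act g (\<iota> a)"
    using module_embedding[OF \<open>group G\<close> A _ \<phi>c] a by metis
  obtain act' :: "('a set \<Rightarrow> 'a set) \<Rightarrow> (('m \<Rightarrow> circ) \<Rightarrow> circ) \<Rightarrow> ('m \<Rightarrow> circ) \<Rightarrow> circ" and \<iota>' where
    i': "finite_gmodule (profinite_completion G) act' (\<iota>' ` carrier A)" "inj_on \<iota>' (carrier A)"
    "\<And>a b. a \<in> carrier A \<Longrightarrow> b \<in> carrier A \<Longrightarrow> \<iota>' (a \<otimes>\<^bsub>A\<^esub> b) = \<iota>' a + \<iota>' b"
    "\<And>g a. g \<in> carrier (profinite_completion G) \<Longrightarrow> a \<in> carrier A \<Longrightarrow> \<iota>' (\<phi> g a) = act' g (\<iota>' a)"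
    using module_embedding[OF G.completion_group A _ \<phi>] a by metis
  interpret M: finite_gmodule G act "\<iota> ` carrier A" by (rule i(1))
  \<comment> \<open>Residual finiteness, solubility and the minimax condition enter through this
    \<open>H\<close> and its chain alone.\<close>
  obtain H where H: "G.fin_index H (carrier G)" "G.r1chain {\<one>\<^bsub>G\<^esub>} H"
    using G.residually_finite_minimax_r1chain assms by metis
  interpret completion_module G act A \<iota> act' \<iota>' \<phi>
  proof (intro completion_module.intro coefficient_embedding.intro coefficient_embedding_axioms.intro
      completion_module_axioms.intro)
    show "\<exists>V'\<in>finite_index_normal G. V' \<subseteq> V \<and> M.cocycle V (Suc n) \<subseteq> M.cobound V' n"
      if "V \<in> finite_index_normal G" for V n
      using M.uniform_kill[OF H(2,1) that] by metis
    show "(\<phi> \<circ> completion_map G) g b \<in> carrier A" if "g \<in> carrier G" "b \<in> carrier A" for g b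
      using cl[OF G.completion_map_closed] that by simp
  qed (use A a i i' cl in simp_all)
  show "finite (carrier (group_cohomology G A (\<phi> \<circ> completion_map G) n))" by (rule finite_cohomology)
  show "cohomology_pullback G A \<phi> (completion_map G) n
      \<in> iso (continuous_cohomology (profinite_topology G) (profinite_completion G) A \<phi> n)
          (group_cohomology G A (\<phi> \<circ> completion_map G) n)"
    by (rule comparison_iso)
qed

end
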